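(* Let $K$ be an algebraically closed field of characteristic zero. Let $S\le\mathfrak I_n$ be an inverse subsemigroup with $E(S)=E(\mathfrak I_n)$. Let $X\subseteq[n]$ with $|X|=r$ and let $G_X$ be the maximal subgroup of $S$ with identity $1_X$. Let $\chi$ be an irreducible character of $G_X$ over $K$ and let $p\ge1$. Then the multiplicity of $\chi^*$ in the $p$-th tensor power $\theta^p$ of the rook matrix representation of $S$ is \[(\chi,\theta^p)_S=\frac{1}{|G_X|}\deg(\chi)\,r!\,S(p,r).\] In particular, if $S=\mathfrak I_n$, $X=[r]$ and $\chi^{\lambda}$ is the irreducible character of $\mathfrak S_r$ corresponding to a partition $\lambda$ of $r$, then the multiplicity of $(\chi^\lambda)^*$ in $\theta^p$ is $f_\lambda S(p,r)$, where $f_\lambda$ is the number of standard Young tableaux of shape $\lambda$.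
   Context: $[n]=\{1,\dots,n\}$; $\mathfrak I_n$ is the monoid of all partial permutations of $[n]$ (bijections between subsets, including the empty one), acting on the right; $\mathfrak S_r$ is the symmetric group on $[r]$, identified with the maximal subgroup of $\mathfrak I_n$ at $1_{[r]}$. An inverse subsemigroup is a subsemigroup closed under inverses. Write $\mathrm{dom}(s)=ss^{-1}$, $\mathrm{ran}(s)=s^{-1}s$. $E(S)$ is the set of idempotents of $S$, which are partial identities $1_Z$, ordered by $1_Z\le 1_{Z'}\iff Z\subseteq Z'$; $\mu$ is the M\"obius function of $E(S)$. For $e\in E(S)$, $G_e=\{s\in S:\mathrm{dom}(s)=e=\mathrm{ran}(s)\}$ is the maximal subgroup at $e$. The rook matrix representation of $S$ sends $\sigma$ to the $n\times n$ matrix with $(i,j)$ entry $1$ if $i\sigma=j$ and $0$ otherwise; $\theta^p$ denotes also the character of its $p$-th tensor power. For $e\in E(S)$, $\chi$ an irreducible character of $G_e$, and $\theta$ a character of $S$, \[(\chi,\theta)_S=\sum_{f\in E(S),\,f\le e}\Big(\frac1{|G_e|}\sum_{g\in G_e}\chi(g^{-1})\theta(fg)\Big)\mu(f,e).\] Induced irreducible character $\chi^*$: let $\varphi$ be an irreducible representation of $G_e$ with character $\chi$. Let $D$ be the set of idempotents $f$ for which there is $s\in S$ with $\mathrm{dom}(s)=e$, $\mathrm{ran}(s)=f$, and for each $f\in D$ fix such an element $p_f$. Then $\varphi^*$ is the irreducible representation of $S$ by $D\times D$ block matrices whose $(f,f')$ block at $s$ is $\varphi(p_f s p_{f'}^{-1})$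 if $f\le ss^{-1}$ and $s^{-1}fs=f'$, and $0$ otherwise; $\chi^*$ is its character. $S(p,r)=\frac1{r!}\sum_{k=0}^r(-1)^{r-k}\binom rk k^p$ is the Stirling number of the second kind. *)

theory Defs
  imports
    "Jordan_Normal_Form.VS_Connect"
    "HOL-Library.Function_Algebras"
    "HOL-Combinatorics.Permutations"
    "HOL-Combinatorics.Stirling"
begin

section \<open>Partial permutations\<close>

text \<open>
  A partial permutation of \<open>[n] = {1..n}\<close> is represented by its graph. Relational composition
  \<open>r O s\<close> applies \<open>r\<close> first, so it is the product of partial maps acting on the right; the inverse
  is the converse relation, the partial identity \<open>1\<^sub>Z\<close> is \<open>Id_on Z\<close>, and
  \<open>1\<^sub>Z \<le> 1\<^sub>W\<close> is inclusion of relations.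
\<close>

definition pperms :: "nat \<Rightarrow> nat rel set" where
  "pperms n = {s. s \<subseteq> {1..n} \<times> {1..n} \<and> single_valued s \<and> single_valued (s\<inverse>)}"

definition inverse_subsemigroup :: "nat \<Rightarrow> nat rel set \<Rightarrow> bool" where
  "inverse_subsemigroup n S \<longleftrightarrow>
     S \<subseteq> pperms n \<and> (\<forall>s\<in>S. \<forall>t\<in>S. s O t \<in> S) \<and> (\<forall>s\<in>S. s\<inverse> \<in> S)"

definition idems :: "nat rel set \<Rightarrow> nat rel set" where
  "idems S = {e \<in> S. e O e = e}"

definition idem_dom :: "nat rel \<Rightarrow> nat rel" where
  "idem_dom s = s O s\<inverse>"

definition idem_ran :: "nat rel \<Rightarrow> nat rel" where
  "idem_ran s = s\<inverse> O s"

definition max_subgroup :: "nat rel set \<Rightarrow> nat rel \<Rightarrow> nat rel set" where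
  "max_subgroup S e = {s \<in> S. idem_dom s = e \<and> idem_ran s = e}"

definition rel_monoid :: "nat rel set \<Rightarrow> nat rel \<Rightarrow> nat rel monoid" where
  "rel_monoid S e = \<lparr>carrier = S, monoid.mult = (O), one = e\<rparr>"


section \<open>Matrix representations of monoids\<close>

definition mat_rep :: "('a, 'b) monoid_scheme \<Rightarrow> nat \<Rightarrow> ('a \<Rightarrow> 'k::field mat) \<Rightarrow> bool" where
  "mat_rep G d \<rho> \<longleftrightarrow> \<rho> \<in> hom G (ring_mat TYPE('k) d ()) \<and> \<rho> \<one>\<^bsub>G\<^esub> = 1\<^sub>m d"

definition irreducible_rep :: "('a, 'b) monoid_scheme \<Rightarrow> nat \<Rightarrow> ('a \<Rightarrow> 'k::field mat) \<Rightarrow> bool" where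
  "irreducible_rep G d \<rho> \<longleftrightarrow> mat_rep G d \<rho> \<and> d > 0 \<and>
     (\<forall>W. VectorSpace.subspace class_ring W (module_vec TYPE('k) d) \<and>
          (\<forall>s\<in>carrier G. \<forall>w\<in>W. \<rho> s *\<^sub>v w \<in> W)
        \<longrightarrow> W = {0\<^sub>v d} \<or> W = carrier_vec d)"

definition rep_equiv ::
  "('a, 'b) monoid_scheme \<Rightarrow> nat \<Rightarrow> ('a \<Rightarrow> 'k::field mat) \<Rightarrow> nat \<Rightarrow> ('a \<Rightarrow> 'k mat) \<Rightarrow> bool" where
  "rep_equiv G d \<rho> d' \<rho>' \<longleftrightarrow> d = d' \<and>
     (\<exists>P\<in>carrier_mat d d. invertible_mat P \<and> (\<forall>s\<in>carrier G. P * \<rho> s = \<rho>' s * P))"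

definition mat_trace :: "'k::field mat \<Rightarrow> 'k" where
  "mat_trace A = (\<Sum>i<dim_row A. A $$ (i, i))"

definition character :: "('a \<Rightarrow> 'k::field mat) \<Rightarrow> 'a \<Rightarrow> 'k" where
  "character \<rho> s = mat_trace (\<rho> s)"

definition direct_sum :: "(nat \<times> ('a \<Rightarrow> 'k::field mat)) list \<Rightarrow> 'a \<Rightarrow> 'k mat" where
  "direct_sum Rs s = diag_block_mat (map (\<lambda>(d, \<rho>). \<rho> s) Rs)"

definition irreducible_decomposition ::
  "('a, 'b) monoid_scheme \<Rightarrow> nat \<Rightarrow> ('a \<Rightarrow> 'k::field mat) \<Rightarrow> (nat \<times> ('a \<Rightarrow> 'k mat)) list \<Rightarrow> bool" where
  "irreducible_decomposition G N \<rho> Rs \<longleftrightarrow>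
     (\<forall>(d, \<sigma>)\<in>set Rs. irreducible_rep G d \<sigma>) \<and>
     rep_equiv G N \<rho> (sum_list (map fst Rs)) (direct_sum Rs)"

text \<open>
  \<open>has_multiplicity G d \<psi> N \<rho> m\<close>: the representation \<open>\<rho>\<close> of degree \<open>N\<close> is a direct sum of
  irreducible representations, and every such decomposition of \<open>\<rho>\<close> has exactly \<open>m\<close> summands
  equivalent to the representation \<open>\<psi>\<close> of degree \<open>d\<close>.
\<close>

definition has_multiplicity ::
  "('a, 'b) monoid_scheme \<Rightarrow> nat \<Rightarrow> ('a \<Rightarrow> 'k::field mat) \<Rightarrow> nat \<Rightarrow> ('a \<Rightarrow> 'k mat) \<Rightarrow> nat \<Rightarrow> bool" where
  "has_multiplicity G d \<psi> N \<rho> m \<longleftrightarrow>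
     (\<exists>Rs. irreducible_decomposition G N \<rho> Rs) \<and>
     (\<forall>Rs. irreducible_decomposition G N \<rho> Rs \<longrightarrow>
        length (filter (\<lambda>(d', \<sigma>). rep_equiv G d' \<sigma> d \<psi>) Rs) = m)"

definition kronecker :: "'k::field mat \<Rightarrow> 'k mat \<Rightarrow> 'k mat" where
  "kronecker A B = mat (dim_row A * dim_row B) (dim_col A * dim_col B)
     (\<lambda>(i, j). A $$ (i div dim_row B, j div dim_col B) * B $$ (i mod dim_row B, j mod dim_col B))"

primrec kronecker_power :: "nat \<Rightarrow> 'k::field mat \<Rightarrow> 'k mat" where
  "kronecker_power 0 A = 1\<^sub>m 1"
| "kronecker_power (Suc p) A = kronecker A (kronecker_power p A)"

definition tensor_power :: "nat \<Rightarrow> ('a \<Rightarrow> 'k::field mat) \<Rightarrow> 'a \<Rightarrow> 'k mat" where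
  "tensor_power p \<rho> s = kronecker_power p (\<rho> s)"


section \<open>Rook matrices, the pairing and induced representations\<close>

text \<open>Matrix indices start at \<open>0\<close>, points of \<open>[n]\<close> at \<open>1\<close>.\<close>

definition rook_rep :: "nat \<Rightarrow> nat rel \<Rightarrow> 'k::field mat" where
  "rook_rep n s = mat n n (\<lambda>(i, j). if (Suc i, Suc j) \<in> s then 1 else 0)"

text \<open>The Moebius function of a finite subset \<open>P\<close> of an ordered type.\<close>

function moebius :: "'a::order set \<Rightarrow> 'a \<Rightarrow> 'a \<Rightarrow> int" where
  "moebius P x y =
     (if x = y then 1
      else if finite P \<and> x < y then - (\<Sum>z\<in>{z \<in> P. x \<le> z \<and> z < y}. moebius P x z)
      else 0)"
  by pat_completeness auto
termination
proof (relation "measure (\<lambda>(P, x, y). card {z \<in> P. z < y})", goal_cases)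
  case (2 P x y z)
  then have "{w \<in> P. w < z} \<subset> {w \<in> P. w < y}"
    by (auto intro: less_trans)
  with 2 show ?case
    by (auto intro!: psubset_card_mono)
qed simp

declare moebius.simps [simp del]

definition pairing :: "nat rel set \<Rightarrow> nat rel \<Rightarrow> (nat rel \<Rightarrow> 'k::field) \<Rightarrow> (nat rel \<Rightarrow> 'k) \<Rightarrow> 'k" where
  "pairing S e \<chi> \<theta> =
     (\<Sum>f\<in>{f \<in> idems S. f \<subseteq> e}.
        (1 / of_nat (card (max_subgroup S e)) *
           (\<Sum>g\<in>max_subgroup S e. \<chi> (g\<inverse>) * \<theta> (f O g))) *
        of_int (moebius (idems S) f e))"

definition d_class_idems :: "nat rel set \<Rightarrow> nat rel \<Rightarrow> nat rel set" where
  "d_class_idems S e = {f \<in> idems S. \<exists>s\<in>S. idem_dom s = e \<and> idem_ran s = f}"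

text \<open>
  The data fixed for an induced representation: an enumeration \<open>fs\<close> of the index set \<open>D\<close> of the
  blocks, and for each \<open>f \<in> D\<close> an element \<open>pf f\<close> with domain \<open>e\<close> and range \<open>f\<close>.
\<close>

definition transversal :: "nat rel set \<Rightarrow> nat rel \<Rightarrow> nat rel list \<Rightarrow> (nat rel \<Rightarrow> nat rel) \<Rightarrow> bool" where
  "transversal S e fs pf \<longleftrightarrow> distinct fs \<and> set fs = d_class_idems S e \<and>
     (\<forall>f\<in>d_class_idems S e. pf f \<in> S \<and> idem_dom (pf f) = e \<and> idem_ran (pf f) = f)"

text \<open>
  Row \<open>a\<close> of the block matrix is row \<open>a mod d\<close> inside the block row with index \<open>fs ! (a div d)\<close>;
  likewise for columns. The degree is \<open>length fs * d\<close>.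
\<close>

definition induced_rep ::
  "nat \<Rightarrow> (nat rel \<Rightarrow> 'k::field mat) \<Rightarrow> nat rel list \<Rightarrow> (nat rel \<Rightarrow> nat rel) \<Rightarrow> nat rel \<Rightarrow> 'k mat" where
  "induced_rep d \<phi> fs pf s = mat (length fs * d) (length fs * d)
     (\<lambda>(a, b). let f = fs ! (a div d); f' = fs ! (b div d) in
        if f \<subseteq> s O s\<inverse> \<and> s\<inverse> O f O s = f'
        then \<phi> (pf f O s O (pf f')\<inverse>) $$ (a mod d, b mod d) else 0)"


section \<open>Irreducible characters of symmetric groups\<close>

definition partition_of :: "nat \<Rightarrow> nat list \<Rightarrow> bool" where
  "partition_of r shp \<longleftrightarrow> sorted_wrt (\<ge>) shp \<and> 0 \<notin> set shp \<and> sum_list shp = r"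

definition cells :: "nat list \<Rightarrow> (nat \<times> nat) set" where
  "cells shp = {(i, j). i < length shp \<and> j < shp ! i}"

definition tableaux :: "nat list \<Rightarrow> (nat \<times> nat \<Rightarrow> nat) set" where
  "tableaux shp = {t \<in> extensional (cells shp). bij_betw t (cells shp) {1..sum_list shp}}"

definition standard_tableaux :: "nat list \<Rightarrow> (nat \<times> nat \<Rightarrow> nat) set" where
  "standard_tableaux shp = {t \<in> tableaux shp.
     (\<forall>i j j'. (i, j) \<in> cells shp \<and> (i, j') \<in> cells shp \<and> j < j' \<longrightarrow> t (i, j) < t (i, j')) \<and>
     (\<forall>i i' j. (i, j) \<in> cells shp \<and> (i', j) \<in> cells shp \<and> i < i' \<longrightarrow> t (i, j) < t (i', j))}"

text \<open>
  A tabloid (row equivalence class of tableaux) is given by its sequence of row sets. The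
  permutation module on tabloids is realised inside the space of all functions from
  \<open>nat \<Rightarrow> nat set\<close> to the field, a tabloid \<open>T\<close> being the indicator function of \<open>T\<close>; the
  character of shape \<open>shp\<close> is the character of the Specht module spanned by the polytabloids
  of that shape.
\<close>

definition tabloid :: "nat list \<Rightarrow> (nat \<times> nat \<Rightarrow> nat) \<Rightarrow> nat \<Rightarrow> nat set" where
  "tabloid shp t = (\<lambda>i. t ` {c \<in> cells shp. fst c = i})"

definition column_group :: "nat list \<Rightarrow> (nat \<times> nat \<Rightarrow> nat) \<Rightarrow> (nat \<Rightarrow> nat) set" where
  "column_group shp t = {\<pi>. \<pi> permutes {1..sum_list shp} \<and>
     (\<forall>j. \<pi> ` t ` {c \<in> cells shp. snd c = j} = t ` {c \<in> cells shp. snd c = j})}"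

definition polytabloid :: "nat list \<Rightarrow> (nat \<times> nat \<Rightarrow> nat) \<Rightarrow> (nat \<Rightarrow> nat set) \<Rightarrow> 'k::field" where
  "polytabloid shp t T =
     (\<Sum>\<pi>\<in>column_group shp t. if tabloid shp (\<pi> \<circ> t) = T then of_int (sign \<pi>) else 0)"

definition fun_scale :: "'k::field \<Rightarrow> ('x \<Rightarrow> 'k) \<Rightarrow> 'x \<Rightarrow> 'k" where
  "fun_scale c v = (\<lambda>x. c * v x)"

global_interpretation fun_space: vector_space fun_scale
  by standard (auto simp: fun_scale_def fun_eq_iff algebra_simps)

definition specht :: "nat list \<Rightarrow> ((nat \<Rightarrow> nat set) \<Rightarrow> 'k::field) set" where
  "specht shp = fun_space.span (polytabloid shp ` tableaux shp)"

text \<open>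
  A permutation sends a tabloid with rows \<open>T i\<close> to the one with rows \<open>\<pi> ` T i\<close>; on functions of
  tabloids this is precomposition with the inverse, and \<open>\<pi> -` T i\<close> is the image of \<open>T i\<close> under the
  inverse of \<open>\<pi>\<close>.
\<close>

definition perm_action :: "(nat \<Rightarrow> nat) \<Rightarrow> ((nat \<Rightarrow> nat set) \<Rightarrow> 'k) \<Rightarrow> (nat \<Rightarrow> nat set) \<Rightarrow> 'k" where
  "perm_action \<pi> v = (\<lambda>T. v (\<lambda>i. \<pi> -` T i))"

text \<open>
  The trace of a linear operator on an invariant subspace \<open>W\<close> of finite dimension. It does not
  depend on the basis chosen.
\<close>

definition trace_on :: "('x \<Rightarrow> 'k::field) set \<Rightarrow> (('x \<Rightarrow> 'k) \<Rightarrow> 'x \<Rightarrow> 'k) \<Rightarrow> 'k" where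
  "trace_on W L = (let B = (SOME B. fun_space.independent B \<and> fun_space.span B = W) in
     \<Sum>b\<in>B. fun_space.representation B (L b) b)"

definition specht_character :: "nat list \<Rightarrow> (nat \<Rightarrow> nat) \<Rightarrow> 'k::field" where
  "specht_character shp \<pi> = trace_on (specht shp) (perm_action \<pi>)"

text \<open>
  The identification of the symmetric group on \<open>[r]\<close> with the maximal subgroup at \<open>1\<^sub>[\<^sub>r\<^sub>]\<close>. It turns
  products into products in the opposite order, because of the right action; characters of
  symmetric groups do not see the difference, a permutation being conjugate to its inverse.
\<close>

definition perm_graph :: "nat \<Rightarrow> (nat \<Rightarrow> nat) \<Rightarrow> nat rel" where
  "perm_graph r \<pi> = {(i, \<pi> i) | i. i \<in> {1..r}}"


section \<open>Stirling numbers of the second kind\<close>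

text \<open>The library numbers \<open>Stirling p r\<close>, defined by recursion, satisfy the explicit formula.\<close>

lemma Stirling_explicit_fact:
  "of_nat (fact r * Stirling p r) =
     (\<Sum>k\<le>r. (-1) ^ (r - k) * of_nat (r choose k) * of_nat k ^ p :: 'a::comm_ring_1)"
proof (induction p arbitrary: r)
  case 0
  have "(\<Sum>k\<le>r. (-1) ^ (r - k) * of_nat (r choose k) :: 'a) = (1 + (-1)) ^ r"
    unfolding binomial_ring by (simp add: mult.commute)
  then show ?case by (cases r) auto
next
  case (Suc p)
  show ?case
  proof (cases r)
    case 0
    then show ?thesis by simp
  next
    case (Suc q)
    have k: "of_nat (Suc k) * of_nat (Suc q choose Suc k) = (of_nat (Suc q) * of_nat (q choose k) :: 'a)" for k
      by (metis Suc_times_binomial of_nat_mult)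
    have "(\<Sum>k\<le>Suc q. (-1) ^ (Suc q - k) * of_nat (Suc q choose k) * of_nat k ^ Suc p :: 'a)
        = (\<Sum>k\<le>q. (-1) ^ (q - k) * (of_nat (Suc k) * of_nat (Suc q choose Suc k)) * of_nat (Suc k) ^ p)"
      by (subst sum.atMost_Suc_shift) (simp add: mult_ac del: of_nat_Suc binomial_Suc_Suc)
    also have "\<dots> = of_nat (Suc q) * (\<Sum>k\<le>q. (-1) ^ (q - k) * of_nat (q choose k) * of_nat (Suc k) ^ p)"
      unfolding k sum_distrib_left by (simp only: mult_ac)
    also have "(\<Sum>k\<le>q. (-1) ^ (q - k) * of_nat (q choose k) * of_nat (Suc k) ^ p)
        = of_nat (fact (Suc q) * Stirling p (Suc q)) + (of_nat (fact q * Stirling p q) :: 'a)"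
    proof -
      have "of_nat (fact (Suc q) * Stirling p (Suc q)) =
          (-1) ^ Suc q * of_nat 0 ^ p +
          (\<Sum>k\<le>q. (-1) ^ (q - k) * of_nat (Suc q choose Suc k) * of_nat (Suc k) ^ p :: 'a)"
        unfolding Suc.IH by (subst sum.atMost_Suc_shift) simp
      also have "(\<Sum>k\<le>q. (-1) ^ (q - k) * of_nat (Suc q choose Suc k) * of_nat (Suc k) ^ p :: 'a) =
          (\<Sum>k\<le>q. (-1) ^ (q - k) * of_nat (q choose k) * of_nat (Suc k) ^ p) +
          (\<Sum>k\<le>q. (-1) ^ (q - k) * of_nat (q choose Suc k) * of_nat (Suc k) ^ p)"
        unfolding sum.distrib[symmetric]
        by (simp only: binomial_Suc_Suc of_nat_add ring_distribs)
      finally have A: "of_nat (fact (Suc q) * Stirling p (Suc q)) =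
          (-1) ^ Suc q * of_nat 0 ^ p +
          ((\<Sum>k\<le>q. (-1) ^ (q - k) * of_nat (q choose k) * of_nat (Suc k) ^ p) +
          (\<Sum>k\<le>q. (-1) ^ (q - k) * of_nat (q choose Suc k) * of_nat (Suc k) ^ p :: 'a))" .
      have "(of_nat (fact q * Stirling p q) :: 'a) =
          (\<Sum>k\<le>Suc q. (-1) ^ (q - k) * of_nat (q choose k) * of_nat k ^ p)"
        unfolding Suc.IH by (simp add: binomial_eq_0)
      also have "\<dots> = (-1) ^ q * of_nat 0 ^ p +
          (\<Sum>k\<le>q. (-1) ^ (q - Suc k) * of_nat (q choose Suc k) * of_nat (Suc k) ^ p)"
        by (subst sum.atMost_Suc_shift) simp
      also have "(\<Sum>k\<le>q. (-1) ^ (q - Suc k) * of_nat (q choose Suc k) * of_nat (Suc k) ^ p :: 'a) =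
          - (\<Sum>k\<le>q. (-1) ^ (q - k) * of_nat (q choose Suc k) * of_nat (Suc k) ^ p)"
        unfolding sum_negf[symmetric]
      proof (rule sum.cong[OF refl])
        fix k assume "k \<in> {..q}"
        then consider "k = q" | "k < q" by fastforce
        then show "(-1) ^ (q - Suc k) * of_nat (q choose Suc k) * of_nat (Suc k) ^ p =
            - ((-1) ^ (q - k) * of_nat (q choose Suc k) * of_nat (Suc k) ^ p :: 'a)"
        proof cases
          case 2
          then have "q - k = Suc (q - Suc k)" by simp
          then show ?thesis by simp
        qed (simp add: binomial_eq_0)
      qed
      finally show ?thesis unfolding A by simp
    qed
    finally show ?thesis
      by (simp only: \<open>r = Suc q\<close> Stirling.simps fact_Suc of_nat_mult of_nat_add of_nat_id
        ring_distribs mult_ac)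
  qed
qed

lemma Stirling_explicit:
  "of_nat (Stirling p r) =
     (1 / fact r * (\<Sum>k\<le>r. (-1) ^ (r - k) * of_nat (r choose k) * of_nat k ^ p) :: 'a::field_char_0)"
  using Stirling_explicit_fact[of r p, where 'a = 'a] by (simp add: field_simps)

end

theory Submission
  imports Defs "Jordan_Normal_Form.Char_Poly" "HOL-Algebra.Sym_Groups"
begin

text \<open>
  The multiplicity of \<open>\<phi>\<^sup>*\<close> in any representation is computed by the pairing, and for tensor powers of
  the rook matrices the pairing can be evaluated by counting surjections.

  In a representation \<open>\<sigma>\<close> of \<open>S\<close>, Moebius inversion over the restrictions of \<open>s\<close> turns \<open>\<sigma> s\<close>
  into a matrix \<open>bracket d \<sigma> s\<close>. These matrices multiply like the arrows of a groupoid: a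
  product is again such a matrix when domain and range match, and zero otherwise. This has two
  consequences. Averaging a projection over all arrows, as in Maschke's theorem for groups, shows
  that representations of \<open>S\<close> are completely reducible (\<open>monoid_semisimple\<close>). And the pairing of the
  character \<open>\<chi>\<close> of \<open>\<phi>\<close> with that of \<open>\<sigma>\<close> is the average of \<open>\<chi> (g\<inverse>)\<close> times the trace of the matrix of the
  arrow \<open>g\<close>, over \<open>g\<close> in the maximal subgroup. For irreducible \<open>\<sigma>\<close> it is \<open>1\<close> when \<open>\<sigma>\<close> is equivalent to
  \<open>\<phi>\<^sup>*\<close>, because then the traces are the values of \<open>\<chi>\<close>; and it is \<open>0\<close> otherwise, because a nonzero
  average over the subgroup would extend to an intertwiner between \<open>\<phi>\<^sup>*\<close> and \<open>\<sigma>\<close>, which are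
  irreducible (\<open>pairing_irreducible\<close>). The pairing is additive, so it counts the summands equivalent to \<open>\<phi>\<^sup>*\<close>
  in every decomposition into irreducible representations (\<open>has_multiplicity_pairing\<close>).

  The character of the tensor power at \<open>s\<close> is the \<open>p\<close>-th power of the number of fixed points of \<open>s\<close>. The
  alternating sum over the restrictions of \<open>g\<close> counts the maps from a set with \<open>p\<close> elements onto \<open>X\<close>
  if \<open>g\<close> is the identity and vanishes otherwise, which gives the formula (\<open>pairing_tensor_power\<close>).

  The second part is the case \<open>S = pperms n\<close>, once \<open>\<phi>\<close> is known to be irreducible of degree \<open>f\<^sub>\<lambda>\<close>.
  The hypothesis only speaks of its character, so irreducibility is derived from the norm of
  the character. An operator that commutes with the symmetric group maps a polytabloid to a
  multiple of itself, since the column antisymmetriser maps all tabloids to multiples of the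
  polytabloid (\<open>antisym_tabloid\<close>). Hence the commutant of the Specht module consists of scalars and
  its character has norm \<open>1\<close> (\<open>specht_orthogonality\<close>). The degree is the dimension of the Specht
  module, for which the standard polytabloids form a basis: they are independent because a standard
  tabloid is the extreme term of its polytabloid (\<open>standard_independent\<close>), and they span by the Garnir
  relations (\<open>garnir\<close>).
\<close>

section \<open>Sums and traces of matrices\<close>

lemma mat_assoc:
  fixes A B C :: "'k::field mat"
  assumes "dim_col A = dim_row B" "dim_col B = dim_row C"
  shows "A * B * C = A * (B * C)"
  by (rule assoc_mult_mat[of A "dim_row A" "dim_row B" B "dim_row C" C "dim_col C"]) (use assms in auto)

lemma mat_vec_assoc:
  fixes A B :: "'k::field mat"
  assumes "dim_col A = dim_row B" "dim_col B = dim_vec v"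
  shows "A * B *\<^sub>v v = A *\<^sub>v (B *\<^sub>v v)"
  by (rule assoc_mult_mat_vec[of A "dim_row A" "dim_row B" B "dim_col B" v])
    (simp_all only: assms(1) carrier_matI carrier_vecI assms(2)[symmetric])

lemma mat_eqI_vec:
  fixes A B :: "'k::field mat"
  assumes "A \<in> carrier_mat n m" "B \<in> carrier_mat n m"
    and "\<And>v. v \<in> carrier_vec m \<Longrightarrow> A *\<^sub>v v = B *\<^sub>v v"
  shows "A = B"
proof (rule eq_matI)
  fix i j assume ij: "i < dim_row B" "j < dim_col B"
  have "(A *\<^sub>v unit_vec m j) $ i = (B *\<^sub>v unit_vec m j) $ i"
    using assms(3)[of "unit_vec m j"] by simp
  then show "A $$ (i, j) = B $$ (i, j)"
    using ij assms(1,2) by (simp add: scalar_prod_right_unit)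
qed (use assms in auto)

text \<open>
  Matrices of all dimensions together form no additive monoid, so a sum over a set has to
  name the dimensions of its value.
\<close>

definition msum :: "nat \<Rightarrow> nat \<Rightarrow> ('i \<Rightarrow> 'k::field mat) \<Rightarrow> 'i set \<Rightarrow> 'k mat" where
  "msum n m f I = mat n m (\<lambda>(a, b). \<Sum>i\<in>I. f i $$ (a, b))"

lemma msum_carrier [simp]: "msum n m f I \<in> carrier_mat n m"
  and dim_msum [simp]: "dim_row (msum n m f I) = n" "dim_col (msum n m f I) = m"
  and index_msum [simp]: "a < n \<Longrightarrow> b < m \<Longrightarrow> msum n m f I $$ (a, b) = (\<Sum>i\<in>I. f i $$ (a, b))"
  by (auto simp: msum_def)

lemma msum_cong: "(\<And>i. i \<in> I \<Longrightarrow> f i = g i) \<Longrightarrow> msum n m f I = msum n m g I"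
  by (auto simp: msum_def intro!: eq_matI sum.cong)

lemma msum_empty [simp]: "msum n m f {} = 0\<^sub>m n m"
  by (auto intro!: eq_matI)

lemma msum_insert:
  "finite I \<Longrightarrow> x \<notin> I \<Longrightarrow> f x \<in> carrier_mat n m \<Longrightarrow> msum n m f (insert x I) = f x + msum n m f I"
  by (auto intro!: eq_matI)

lemma msum_reindex: "bij_betw h I J \<Longrightarrow> msum n m f J = msum n m (\<lambda>i. f (h i)) I"
  by (auto intro!: eq_matI sum.reindex_bij_betw[symmetric])

lemma msum_zero: "(\<And>i. i \<in> I \<Longrightarrow> f i = 0\<^sub>m n m) \<Longrightarrow> msum n m f I = 0\<^sub>m n m"
  by (auto intro!: eq_matI)

lemma msum_mono_neutral:
  "finite J \<Longrightarrow> I \<subseteq> J \<Longrightarrow> (\<And>i. i \<in> J - I \<Longrightarrow> f i = 0\<^sub>m n m) \<Longrightarrow> msum n m f I = msum n m f J"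
  by (auto intro!: eq_matI sum.mono_neutral_left)

lemma msum_smult: 
  assumes "\<And>i. i \<in> I \<Longrightarrow> f i \<in> carrier_mat n m"
  shows "c \<cdot>\<^sub>m msum n m f I = msum n m (\<lambda>i. c \<cdot>\<^sub>m f i) I"
proof (rule eq_matI)
  fix a b assume "a < dim_row (msum n m (\<lambda>i. c \<cdot>\<^sub>m f i) I)" "b < dim_col (msum n m (\<lambda>i. c \<cdot>\<^sub>m f i) I)"
  then have ab: "a < n" "b < m" by auto
  have "(\<Sum>i\<in>I. (c \<cdot>\<^sub>m f i) $$ (a, b)) = (\<Sum>i\<in>I. c * f i $$ (a, b))"
    using assms ab by (intro sum.cong) (auto dest!: assms)
  then show "(c \<cdot>\<^sub>m msum n m f I) $$ (a, b) = msum n m (\<lambda>i. c \<cdot>\<^sub>m f i) I $$ (a, b)"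
    using ab by (simp add: sum_distrib_left)
qed auto

lemma mult_msum:
  assumes A: "A \<in> carrier_mat l n" and f: "\<And>i. i \<in> I \<Longrightarrow> f i \<in> carrier_mat n m"
  shows "A * msum n m f I = msum l m (\<lambda>i. A * f i) I"
proof (rule eq_matI)
  fix a b assume "a < dim_row (msum l m (\<lambda>i. A * f i) I)" "b < dim_col (msum l m (\<lambda>i. A * f i) I)"
  then have ab: "a < l" "b < m" by auto
  have "(A * msum n m f I) $$ (a, b) = (\<Sum>k<n. \<Sum>i\<in>I. A $$ (a, k) * f i $$ (k, b))"
    using ab A by (simp add: scalar_prod_def sum_distrib_left atLeast0LessThan)
  also have "\<dots> = (\<Sum>i\<in>I. \<Sum>k<n. A $$ (a, k) * f i $$ (k, b))" by (rule sum.swap)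
  also have "\<dots> = (\<Sum>i\<in>I. (A * f i) $$ (a, b))"
    using ab A f by (intro sum.cong) (auto simp: scalar_prod_def atLeast0LessThan dest!: f)
  finally show "(A * msum n m f I) $$ (a, b) = msum l m (\<lambda>i. A * f i) I $$ (a, b)"
    using ab by simp
qed (use A in auto)

lemma msum_mult:
  assumes B: "B \<in> carrier_mat m l" and f: "\<And>i. i \<in> I \<Longrightarrow> f i \<in> carrier_mat n m"
  shows "msum n m f I * B = msum n l (\<lambda>i. f i * B) I"
proof (rule eq_matI)
  fix a b assume "a < dim_row (msum n l (\<lambda>i. f i * B) I)" "b < dim_col (msum n l (\<lambda>i. f i * B) I)"
  then have ab: "a < n" "b < l" by auto
  have "(msum n m f I * B) $$ (a, b) = (\<Sum>k<m. \<Sum>i\<in>I. f i $$ (a, k) * B $$ (k, b))"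
    using ab B by (simp add: scalar_prod_def sum_distrib_right atLeast0LessThan)
  also have "\<dots> = (\<Sum>i\<in>I. \<Sum>k<m. f i $$ (a, k) * B $$ (k, b))" by (rule sum.swap)
  also have "\<dots> = (\<Sum>i\<in>I. (f i * B) $$ (a, b))"
    using ab B f by (intro sum.cong) (auto simp: scalar_prod_def atLeast0LessThan dest!: f)
  finally show "(msum n m f I * B) $$ (a, b) = msum n l (\<lambda>i. f i * B) I $$ (a, b)"
    using ab by simp
qed (use B in auto)

definition subspace_vec :: "nat \<Rightarrow> 'k::field vec set \<Rightarrow> bool" where
  "subspace_vec d W \<longleftrightarrow> W \<subseteq> carrier_vec d \<and> 0\<^sub>v d \<in> W \<and>
     (\<forall>x\<in>W. \<forall>y\<in>W. x + y \<in> W) \<and> (\<forall>c. \<forall>x\<in>W. c \<cdot>\<^sub>v x \<in> W)"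

lemma subspace_vec_iff:
  "VectorSpace.subspace class_ring W (module_vec TYPE('k::field) d) \<longleftrightarrow> subspace_vec d W"
proof -
  interpret vec_space "TYPE('k)" d .
  show ?thesis
    unfolding VectorSpace.subspace_def submodule_def subspace_vec_def
    by (auto simp: module_vec_simps vec_vs vec_module)
qed

lemma subspace_vec_diff:
  "subspace_vec d W \<Longrightarrow> x \<in> W \<Longrightarrow> y \<in> W \<Longrightarrow> x - y \<in> W"
proof -
  assume W: "subspace_vec d W" and x: "x \<in> W" and y: "y \<in> W"
  have "x - y = x + (-1) \<cdot>\<^sub>v y" using W x y
    by (intro eq_vecI) (auto simp: subspace_vec_def)
  then show "x - y \<in> W" using W x y by (auto simp: subspace_vec_def)
qed

lemma msum_mult_vec_mem:
  assumes "subspace_vec n W" "finite I" "\<And>i. i \<in> I \<Longrightarrow> f i \<in> carrier_mat n m"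
    and "v \<in> carrier_vec m" "\<And>i. i \<in> I \<Longrightarrow> f i *\<^sub>v v \<in> W"
  shows "msum n m f I *\<^sub>v v \<in> W"
  using assms(2,3,5)
proof (induction I)
  case empty
  have "0\<^sub>m n m *\<^sub>v v = 0\<^sub>v n" using assms(4) by (intro eq_vecI) auto
  then show ?case using assms(1) by (simp add: subspace_vec_def)
next
  case (insert x I)
  then have "msum n m f (insert x I) *\<^sub>v v = f x *\<^sub>v v + msum n m f I *\<^sub>v v"
    using assms(4) by (simp add: msum_insert add_mult_distrib_mat_vec[of _ n m])
  then show ?case using insert assms(1) by (auto simp: subspace_vec_def)
qed

lemma mat_trace_msum:
  assumes "\<And>i. i \<in> I \<Longrightarrow> f i \<in> carrier_mat n n"
  shows "mat_trace (msum n n f I) = (\<Sum>i\<in>I. mat_trace (f i))"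
proof -
  have "mat_trace (msum n n f I) = (\<Sum>a<n. \<Sum>i\<in>I. f i $$ (a, a))"
    by (simp add: mat_trace_def)
  also have "\<dots> = (\<Sum>i\<in>I. \<Sum>a<n. f i $$ (a, a))" by (rule sum.swap)
  also have "\<dots> = (\<Sum>i\<in>I. mat_trace (f i))"
    unfolding mat_trace_def using assms by (intro sum.cong) auto
  finally show ?thesis .
qed

lemma mat_trace_comm:
  assumes "A \<in> carrier_mat n m" "B \<in> carrier_mat m n"
  shows "mat_trace (A * B) = mat_trace (B * A)"
proof -
  have "mat_trace (A * B) = (\<Sum>a<n. \<Sum>b<m. A $$ (a, b) * B $$ (b, a))"
    using assms by (simp add: mat_trace_def scalar_prod_def atLeast0LessThan)
  also have "\<dots> = (\<Sum>b<m. \<Sum>a<n. A $$ (a, b) * B $$ (b, a))" by (rule sum.swap)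
  also have "\<dots> = mat_trace (B * A)"
    using assms by (simp add: mat_trace_def scalar_prod_def atLeast0LessThan mult.commute)
  finally show ?thesis .
qed

lemma mat_trace_one [simp]: "mat_trace (1\<^sub>m n :: 'k::field mat) = of_nat n"
  by (simp add: mat_trace_def)

lemma mat_trace_smult [simp]: "mat_trace (c \<cdot>\<^sub>m A) = c * mat_trace A" if "A \<in> carrier_mat n n"
  using that by (simp add: mat_trace_def sum_distrib_left)

text \<open>
  The traces of \<open>A * B\<close> and \<open>B * A\<close> agree; in characteristic zero they determine the dimensions.
\<close>

lemma mutually_inverse_dims:
  fixes A :: "'k::field_char_0 mat"
  assumes "A \<in> carrier_mat n m" "B \<in> carrier_mat m n" "A * B = 1\<^sub>m n" "B * A = 1\<^sub>m m"
  shows "n = m"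
proof -
  have "(of_nat n :: 'k) = of_nat m"
    using mat_trace_comm[OF assms(1,2)] assms(3,4) by simp
  then show ?thesis by simp
qed

text \<open>
  If \<open>n < m\<close>, padding both matrices with zeros to square matrices would give an invertible
  matrix with a zero row.
\<close>

lemma left_inverse_dim_le:
  fixes A :: "'k::field mat"
  assumes A: "A \<in> carrier_mat n m" and B: "B \<in> carrier_mat m n" and BA: "B * A = 1\<^sub>m m"
  shows "m \<le> n"
proof (rule ccontr)
  assume nm: "\<not> m \<le> n"
  define A' where "A' = mat m m (\<lambda>(i, j). if i < n then A $$ (i, j) else 0)"
  define B' where "B' = mat m m (\<lambda>(i, j). if j < n then B $$ (i, j) else 0)"
  have "B' * A' = B * A"
  proof (rule eq_matI)
    fix i j assume "i < dim_row (B * A)" "j < dim_col (B * A)"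
    then have ij: "i < m" "j < m" using A B by auto
    have "(B' * A') $$ (i, j) = (\<Sum>k<m. B' $$ (i, k) * A' $$ (k, j))"
      using ij by (simp add: A'_def B'_def scalar_prod_def atLeast0LessThan)
    also have "\<dots> = (\<Sum>k<n. B $$ (i, k) * A $$ (k, j))"
      using ij nm by (intro sum.mono_neutral_cong_right) (auto simp: A'_def B'_def)
    also have "\<dots> = (B * A) $$ (i, j)"
      using ij A B by (simp add: scalar_prod_def atLeast0LessThan)
    finally show "(B' * A') $$ (i, j) = (B * A) $$ (i, j)" .
  qed (use A B in \<open>auto simp: A'_def B'_def\<close>)
  then have "det B' * det A' = 1"
    using BA det_mult[of B' m A'] by (simp add: A'_def B'_def)
  moreover have "A'\<^sup>T *\<^sub>v unit_vec m n = 0\<^sub>v m"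
    using nm by (intro eq_vecI) (auto simp: A'_def scalar_prod_right_unit)
  then have "det A'\<^sup>T = 0"
    using nm det_0_iff_vec_prod_zero_field[of "A'\<^sup>T" m]
    by (auto simp: A'_def intro!: exI[of _ "unit_vec m n"])
  then have "det A' = 0" using det_transpose[of A' m] by (simp add: A'_def)
  ultimately show False by simp
qed

section \<open>Representations and Schur's lemma\<close>

lemma mat_rep_iff:
  "mat_rep G d (\<rho> :: 'a \<Rightarrow> 'k::field mat) \<longleftrightarrow>
     (\<forall>s\<in>carrier G. \<rho> s \<in> carrier_mat d d) \<and>
     (\<forall>s\<in>carrier G. \<forall>t\<in>carrier G. \<rho> (s \<otimes>\<^bsub>G\<^esub> t) = \<rho> s * \<rho> t) \<and> \<rho> \<one>\<^bsub>G\<^esub> = 1\<^sub>m d"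
  by (auto simp: mat_rep_def hom_def ring_mat_def)

definition invariant :: "('a, 'b) monoid_scheme \<Rightarrow> ('a \<Rightarrow> 'k::field mat) \<Rightarrow> 'k vec set \<Rightarrow> bool" where
  "invariant G \<rho> W \<longleftrightarrow> (\<forall>s\<in>carrier G. \<forall>w\<in>W. \<rho> s *\<^sub>v w \<in> W)"

lemma irreducible_rep_iff:
  "irreducible_rep G d \<rho> \<longleftrightarrow> mat_rep G d \<rho> \<and> d > 0 \<and>
     (\<forall>W. subspace_vec d W \<and> invariant G \<rho> W \<longrightarrow> W = {0\<^sub>v d} \<or> W = carrier_vec d)"
  by (simp add: irreducible_rep_def subspace_vec_iff invariant_def)

lemma irreducible_repD:
  assumes "irreducible_rep G d \<rho>"
  shows "mat_rep G d \<rho>" "d > 0"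
    and "subspace_vec d W \<Longrightarrow> invariant G \<rho> W \<Longrightarrow> W = {0\<^sub>v d} \<or> W = carrier_vec d"
  using assms by (auto simp: irreducible_rep_iff)

lemma rep_equivI:
  fixes P :: "'k::field_char_0 mat"
  assumes "P \<in> carrier_mat d' d" "Q \<in> carrier_mat d d'" "P * Q = 1\<^sub>m d'" "Q * P = 1\<^sub>m d"
    and "\<And>s. s \<in> carrier G \<Longrightarrow> P * \<rho> s = \<rho>' s * P"
  shows "rep_equiv G d \<rho> d' \<rho>'"
proof -
  have dd: "d' = d" by (rule mutually_inverse_dims[OF assms(1-4)])
  have "invertible_mat P"
    using assms dd by (auto simp: invertible_mat_def inverts_mat_def square_mat.simps)
  then show ?thesis using assms dd by (auto simp: rep_equiv_def)
qed

lemma rep_equivE: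
  assumes "rep_equiv G d \<rho> d' (\<rho>' :: 'a \<Rightarrow> 'k::field mat)"
  obtains P Q where "d' = d" "P \<in> carrier_mat d d" "Q \<in> carrier_mat d d" "P * Q = 1\<^sub>m d" "Q * P = 1\<^sub>m d"
    "\<And>s. s \<in> carrier G \<Longrightarrow> P * \<rho> s = \<rho>' s * P"
proof -
  from assms obtain P where P: "d = d'" "P \<in> carrier_mat d d" "invertible_mat P"
    "\<And>s. s \<in> carrier G \<Longrightarrow> P * \<rho> s = \<rho>' s * P" by (auto simp: rep_equiv_def)
  from P(3) obtain Q where Q: "P * Q = 1\<^sub>m (dim_row P)" "Q * P = 1\<^sub>m (dim_row Q)"
    by (auto simp: invertible_mat_def inverts_mat_def)
  have "dim_col Q = d" using arg_cong[OF Q(1), of dim_col] P(2) by simp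
  moreover have "dim_row Q = d" using arg_cong[OF Q(2), of dim_col] P(2) by simp
  ultimately show thesis using that[of P Q] P Q by auto
qed

lemma rep_equiv_refl:
  fixes \<rho> :: "'a \<Rightarrow> 'k::field_char_0 mat"
  shows "mat_rep G d \<rho> \<Longrightarrow> rep_equiv G d \<rho> d \<rho>"
  by (rule rep_equivI[of "1\<^sub>m d" _ _ "1\<^sub>m d"]) (auto simp: mat_rep_iff)

lemma conj_of_intertwine:
  fixes P Q A B :: "'k::field mat"
  assumes "P \<in> carrier_mat d d" "Q \<in> carrier_mat d d" "A \<in> carrier_mat d d" "B \<in> carrier_mat d d"
    and "Q * P = 1\<^sub>m d" "P * A = B * P"
  shows "A = Q * B * P"
proof -
  have "A = Q * P * A" using assms by simp
  also have "\<dots> = Q * (P * A)" by (rule mat_assoc) (use assms in auto)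
  also have "\<dots> = Q * (B * P)" using assms by simp
  also have "\<dots> = Q * B * P" using assms by (simp add: mat_assoc)
  finally show ?thesis .
qed

lemma character_rep_equiv:
  assumes "rep_equiv G d \<rho> d' (\<rho>' :: 'a \<Rightarrow> 'k::field mat)" "mat_rep G d \<rho>" "mat_rep G d' \<rho>'" "s \<in> carrier G"
  shows "character \<rho> s = character \<rho>' s"
proof -
  from assms(1) obtain P Q where P: "d' = d" "P \<in> carrier_mat d d" "Q \<in> carrier_mat d d"
    "P * Q = 1\<^sub>m d" "Q * P = 1\<^sub>m d" "\<And>s. s \<in> carrier G \<Longrightarrow> P * \<rho> s = \<rho>' s * P"
    by (rule rep_equivE) (rule that; blast)
  have c: "\<rho> s \<in> carrier_mat d d" "\<rho>' s \<in> carrier_mat d d" using assms P(1) by (auto simp: mat_rep_iff)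
  have "\<rho> s = Q * (\<rho>' s * P)"
    using conj_of_intertwine[OF P(2,3) c P(5) P(6)[OF assms(4)]] c P by (simp add: mat_assoc)
  then have "mat_trace (\<rho> s) = mat_trace (\<rho>' s * P * Q)"
    using mat_trace_comm[of Q d d "\<rho>' s * P"] c P by simp
  also have "\<rho>' s * P * Q = \<rho>' s" using c P by (simp add: mat_assoc)
  finally show ?thesis by (simp add: character_def)
qed

lemma irreducible_rep_equiv:
  assumes "rep_equiv G d \<rho> d' (\<rho>' :: 'a \<Rightarrow> 'k::field mat)" "mat_rep G d \<rho>" "irreducible_rep G d' \<rho>'"
  shows "irreducible_rep G d \<rho>"
  unfolding irreducible_rep_iff
proof (intro conjI allI impI)
  from assms(1) obtain P Q where P: "d' = d" "P \<in> carrier_mat d d" "Q \<in> carrier_mat d d"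
    "P * Q = 1\<^sub>m d" "Q * P = 1\<^sub>m d" "\<And>s. s \<in> carrier G \<Longrightarrow> P * \<rho> s = \<rho>' s * P"
    by (rule rep_equivE) (rule that; blast)
  note irr = irreducible_repD[OF assms(3)]
  show "d > 0" using irr P by simp
  fix W assume W: "subspace_vec d W \<and> invariant G \<rho> W"
  then have Wc: "W \<subseteq> carrier_vec d" by (auto simp: subspace_vec_def)
  define U where "U = (\<lambda>w. P *\<^sub>v w) ` W"
  have QPw: "Q *\<^sub>v (P *\<^sub>v w) = w" if "w \<in> carrier_vec d" for w
    using that P mat_vec_assoc[of Q P w] by simp
  have PQw: "P *\<^sub>v (Q *\<^sub>v w) = w" if "w \<in> carrier_vec d" for w
    using that P mat_vec_assoc[of P Q w] by simp
  have "subspace_vec d U"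
    unfolding subspace_vec_def
  proof (intro conjI ballI allI)
    show "U \<subseteq> carrier_vec d" using P Wc by (auto simp: U_def)
    have "P *\<^sub>v 0\<^sub>v d = 0\<^sub>v d" using P by (intro eq_vecI) auto
    then show "0\<^sub>v d \<in> U" using W by (auto simp: U_def subspace_vec_def intro!: image_eqI[of _ _ "0\<^sub>v d"])
  next
    fix x y assume "x \<in> U" "y \<in> U"
    then obtain v w where vw: "v \<in> W" "w \<in> W" "x = P *\<^sub>v v" "y = P *\<^sub>v w" by (auto simp: U_def)
    then have "x + y = P *\<^sub>v (v + w)" using mult_add_distrib_mat_vec[OF P(2) subsetD[OF Wc vw(1)] subsetD[OF Wc vw(2)]] by simp
    then show "x + y \<in> U" using vw W by (auto simp: U_def subspace_vec_def)
  next
    fix c x assume "x \<in> U"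
    then obtain v where vw: "v \<in> W" "x = P *\<^sub>v v" by (auto simp: U_def)
    then have "c \<cdot>\<^sub>v x = P *\<^sub>v (c \<cdot>\<^sub>v v)" using mult_mat_vec[OF P(2) subsetD[OF Wc vw(1)]] by simp
    then show "c \<cdot>\<^sub>v x \<in> U" using vw W by (auto simp: U_def subspace_vec_def)
  qed
  moreover have "invariant G \<rho>' U"
    unfolding invariant_def
  proof (intro ballI)
    fix s u assume s: "s \<in> carrier G" and "u \<in> U"
    then obtain w where w: "w \<in> W" "u = P *\<^sub>v w" by (auto simp: U_def)
    have c: "\<rho> s \<in> carrier_mat d d" "\<rho>' s \<in> carrier_mat d d"
      using assms(2) irr(1) P(1) s by (auto simp: mat_rep_iff)
    have "\<rho>' s *\<^sub>v u = P *\<^sub>v (\<rho> s *\<^sub>v w)"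
      using w Wc P c P(6)[OF s] mat_vec_assoc[of P "\<rho> s" w] mat_vec_assoc[of "\<rho>' s" P w] by auto
    then show "\<rho>' s *\<^sub>v u \<in> U" using W w s by (auto simp: U_def invariant_def)
  qed
  ultimately have "U = {0\<^sub>v d} \<or> U = carrier_vec d" using irr(3)[of U] P(1) by simp
  moreover have WU: "W = (\<lambda>u. Q *\<^sub>v u) ` U" 
  proof -
    have "(\<lambda>u. Q *\<^sub>v u) ` U = (\<lambda>w. w) ` W"
      unfolding U_def image_image by (rule image_cong[OF refl]) (use QPw Wc in blast)
    then show ?thesis by simp
  qed
  moreover have "Q *\<^sub>v 0\<^sub>v d = 0\<^sub>v d" using P by (intro eq_vecI) auto
  moreover have "W = carrier_vec d" if "U = carrier_vec d"
  proof
    show "carrier_vec d \<subseteq> W"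
    proof
      fix v :: "'k vec" assume v: "v \<in> carrier_vec d"
      then have "P *\<^sub>v v \<in> U" using that P by auto
      then show "v \<in> W" unfolding WU using QPw[OF v] by (metis imageI)
    qed
  qed (rule Wc)
  ultimately show "W = {0\<^sub>v d} \<or> W = carrier_vec d" by auto
qed (rule assms(2))

text \<open>
  The kernel and the image of an intertwiner are invariant, so irreducibility leaves only a
  bijection.
\<close>

lemma schur_inverse:
  fixes T :: "'k::field_char_0 mat"
  assumes \<sigma>: "irreducible_rep G n \<sigma>" and \<psi>: "irreducible_rep G m \<psi>"
    and T: "T \<in> carrier_mat n m" "T \<noteq> 0\<^sub>m n m"
    and int: "\<And>s. s \<in> carrier G \<Longrightarrow> \<sigma> s * T = T * \<psi> s"
  obtains T' where "T' \<in> carrier_mat m n" "T * T' = 1\<^sub>m n" "T' * T = 1\<^sub>m m"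
proof -
  have c: "\<sigma> s \<in> carrier_mat n n" "\<psi> s \<in> carrier_mat m m" if "s \<in> carrier G" for s
    using irreducible_repD(1)[OF \<sigma>] irreducible_repD(1)[OF \<psi>] that by (auto simp: mat_rep_iff)
  have int_vec: "\<sigma> s *\<^sub>v (T *\<^sub>v v) = T *\<^sub>v (\<psi> s *\<^sub>v v)" if "s \<in> carrier G" "v \<in> carrier_vec m" for s v
    using c[OF that(1)] int[OF that(1)] that(2) T(1)
      mat_vec_assoc[of "\<sigma> s" T v] mat_vec_assoc[of T "\<psi> s" v] by auto
  have T0: "T *\<^sub>v 0\<^sub>v m = 0\<^sub>v n" using T by (intro eq_vecI) auto
  have not_all: "\<not> (\<forall>v\<in>carrier_vec m. T *\<^sub>v v = 0\<^sub>v n)"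
  proof
    assume "\<forall>v\<in>carrier_vec m. T *\<^sub>v v = 0\<^sub>v n"
    then have "T *\<^sub>v v = 0\<^sub>m n m *\<^sub>v v" if "v \<in> carrier_vec m" for v
      using that by (auto intro!: eq_vecI)
    then show False using mat_eqI_vec[of T n m "0\<^sub>m n m"] T by auto
  qed
  define K where "K = {v \<in> carrier_vec m. T *\<^sub>v v = 0\<^sub>v n}"
  have "subspace_vec m K" unfolding subspace_vec_def K_def
    using T T0 by (auto simp: mult_add_distrib_mat_vec[of _ n m] mult_mat_vec[of _ n m])
  moreover have "invariant G \<psi> K"
    unfolding invariant_def
  proof (intro ballI)
    fix s v assume s: "s \<in> carrier G" and v: "v \<in> K"
    have "\<sigma> s *\<^sub>v 0\<^sub>v n = 0\<^sub>v n" using c[OF s] by (intro eq_vecI) auto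
    then show "\<psi> s *\<^sub>v v \<in> K" using c[OF s] int_vec[OF s, of v] v by (auto simp: K_def)
  qed
  ultimately have K: "K = {0\<^sub>v m}"
    using irreducible_repD(3)[OF \<psi>, of K] not_all by (auto simp: K_def)
  define U where "U = (\<lambda>v. T *\<^sub>v v) ` carrier_vec m"
  have "subspace_vec n U" unfolding subspace_vec_def
  proof (intro conjI ballI allI)
    show "U \<subseteq> carrier_vec n" "0\<^sub>v n \<in> U" using T T0 by (auto simp: U_def intro!: image_eqI[of _ _ "0\<^sub>v m"])
  next
    fix x y assume "x \<in> U" "y \<in> U"
    then show "x + y \<in> U" using T
      by (auto simp: U_def mult_add_distrib_mat_vec[of _ n m, symmetric])
  next
    fix a x assume "x \<in> U"
    then show "a \<cdot>\<^sub>v x \<in> U" using T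
      by (auto simp: U_def mult_mat_vec[of _ n m, symmetric])
  qed
  moreover have "invariant G \<sigma> U"
    unfolding invariant_def U_def using int_vec c by (auto intro!: imageI mult_mat_vec_carrier)
  ultimately have U: "U = carrier_vec n"
    using irreducible_repD(3)[OF \<sigma>, of U] not_all by (auto simp: U_def)
  have "\<exists>v\<in>carrier_vec m. T *\<^sub>v v = unit_vec n i" for i
    using U unfolding U_def by (metis (no_types, lifting) image_iff unit_vec_carrier)
  then obtain v where v: "\<And>i. v i \<in> carrier_vec m" "\<And>i. T *\<^sub>v v i = unit_vec n i" by metis
  define T' where "T' = mat m n (\<lambda>(a, i). v i $ a)"
  have T': "T' \<in> carrier_mat m n" by (simp add: T'_def)
  have "col T' i = v i" if "i < n" for i
    using v(1)[of i] that by (intro eq_vecI) (auto simp: T'_def)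
  then have TT': "T * T' = 1\<^sub>m n"
  proof (intro eq_matI)
    fix a i assume "a < dim_row (1\<^sub>m n :: 'k mat)" "i < dim_col (1\<^sub>m n :: 'k mat)"
    then have ai: "a < n" "i < n" by auto
    have "(T * T') $$ (a, i) = (T *\<^sub>v col T' i) $ a" using ai T T' by simp
    also have "\<dots> = unit_vec n i $ a" using \<open>\<And>i. i < n \<Longrightarrow> col T' i = v i\<close> ai v(2) by simp
    finally show "(T * T') $$ (a, i) = 1\<^sub>m n $$ (a, i)" using ai by simp
  qed (use T T' in auto)
  have "T' * T = 1\<^sub>m m"
  proof (rule mat_eqI_vec[of _ m m])
    fix w :: "'k vec" assume w: "w \<in> carrier_vec m"
    let ?x = "T' *\<^sub>v (T *\<^sub>v w)"
    have x: "?x \<in> carrier_vec m" using T' T w by auto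
    have "T *\<^sub>v ?x = T *\<^sub>v w"
      using mat_vec_assoc[of T T' "T *\<^sub>v w"] T T' TT' w by auto
    then have "?x - w \<in> K" using T x w
      by (auto simp: K_def mult_minus_distrib_mat_vec[of _ n m])
    then have eq0: "?x - w = 0\<^sub>v m" using K by auto
    have "?x = w"
    proof (rule eq_vecI)
      fix i assume "i < dim_vec w"
      then have "(?x - w) $ i = 0" using w by (subst eq0) auto
      then show "?x $ i = w $ i" using x w \<open>i < dim_vec w\<close> by auto
    qed (use T' w in auto)
    then show "T' * T *\<^sub>v w = 1\<^sub>m m *\<^sub>v w" using mat_vec_assoc[of T' T w] T T' w by auto
  qed (use T T' in auto)
  then show thesis using that T' TT' by blast
qed

lemma schur_equiv:
  fixes T :: "'k::field_char_0 mat"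
  assumes "irreducible_rep G n \<sigma>" "irreducible_rep G m \<psi>"
    and "T \<in> carrier_mat n m" "T \<noteq> 0\<^sub>m n m"
    and "\<And>s. s \<in> carrier G \<Longrightarrow> \<sigma> s * T = T * \<psi> s"
  shows "rep_equiv G n \<sigma> m \<psi>"
proof -
  obtain T' where T': "T' \<in> carrier_mat m n" "T * T' = 1\<^sub>m n" "T' * T = 1\<^sub>m m"
    by (rule schur_inverse[OF assms])
  have c: "\<sigma> s \<in> carrier_mat n n" "\<psi> s \<in> carrier_mat m m" if "s \<in> carrier G" for s
    using assms(1,2) that by (auto simp: mat_rep_iff irreducible_rep_iff)
  show ?thesis
  proof (rule rep_equivI[OF T'(1) assms(3) T'(3,2)])
    fix s assume s: "s \<in> carrier G"
    have "T' * \<sigma> s = T' * \<sigma> s * (T * T')" using T' c[OF s] by simp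
    also have "\<dots> = T' * (\<sigma> s * T) * T'" using T' c[OF s] assms(3) by (simp add: mat_assoc)
    also have "\<dots> = T' * (T * \<psi> s) * T'" by (simp only: assms(5)[OF s])
    also have "T' * (T * \<psi> s) = T' * T * \<psi> s" by (rule mat_assoc[symmetric]) (use T' c[OF s] assms(3) in auto)
    also have "T' * T * \<psi> s * T' = \<psi> s * T'" using T' c[OF s] by simp
    finally show "T' * \<sigma> s = \<psi> s * T'" .
  qed
qed

text \<open>
  An eigenspace of \<open>T\<close> is a nonzero invariant subspace, hence the whole space.
\<close>

lemma schur_scalar:
  fixes T :: "'k::{alg_closed_field, field_char_0} mat"
  assumes \<sigma>: "irreducible_rep G n \<sigma>" and T: "T \<in> carrier_mat n n"
    and int: "\<And>s. s \<in> carrier G \<Longrightarrow> \<sigma> s * T = T * \<sigma> s"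
  obtains c where "T = c \<cdot>\<^sub>m 1\<^sub>m n"
proof -
  have c: "\<sigma> s \<in> carrier_mat n n" if "s \<in> carrier G" for s
    using irreducible_repD(1)[OF \<sigma>] that by (auto simp: mat_rep_iff)
  have "degree (char_poly T) > 0" using degree_monic_char_poly[OF T] irreducible_repD(2)[OF \<sigma>] by simp
  then obtain x where "poly (char_poly T) x = 0" using alg_closed_imp_poly_has_root by blast
  then have "eigenvalue T x" using eigenvalue_root_char_poly[OF T] by simp
  then obtain v where v: "v \<in> carrier_vec n" "v \<noteq> 0\<^sub>v n" "T *\<^sub>v v = x \<cdot>\<^sub>v v"
    using T by (auto simp: eigenvalue_def eigenvector_def)
  define W where "W = {v \<in> carrier_vec n. T *\<^sub>v v = x \<cdot>\<^sub>v v}"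
  have "T *\<^sub>v 0\<^sub>v n = 0\<^sub>v n" using T by (intro eq_vecI) auto
  then have "subspace_vec n W" unfolding subspace_vec_def W_def
    using T by (auto simp: mult_add_distrib_mat_vec[of _ n n] mult_mat_vec[of _ n n] smult_add_distrib_vec
        smult_smult_assoc mult.commute)
  moreover have "invariant G \<sigma> W"
    unfolding invariant_def
  proof (intro ballI)
    fix s w assume s: "s \<in> carrier G" and w: "w \<in> W"
    have "T *\<^sub>v (\<sigma> s *\<^sub>v w) = \<sigma> s *\<^sub>v (T *\<^sub>v w)"
      using mat_vec_assoc[of T "\<sigma> s" w] mat_vec_assoc[of "\<sigma> s" T w] c[OF s] int[OF s] w T by (auto simp: W_def)
    then show "\<sigma> s *\<^sub>v w \<in> W" using w c[OF s] by (auto simp: W_def mult_mat_vec[of _ n n])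
  qed
  ultimately have "W = carrier_vec n"
    using irreducible_repD(3)[OF \<sigma>, of W] v by (auto simp: W_def)
  then have W: "T *\<^sub>v v = x \<cdot>\<^sub>v v" if "v \<in> carrier_vec n" for v using that by (auto simp: W_def)
  have "T = x \<cdot>\<^sub>m 1\<^sub>m n"
  proof (rule mat_eqI_vec[OF T])
    fix v :: "'k vec" assume v: "v \<in> carrier_vec n"
    have "(x \<cdot>\<^sub>m 1\<^sub>m n) *\<^sub>v v = x \<cdot>\<^sub>v v" using v
      by (intro eq_vecI) auto
    then show "T *\<^sub>v v = (x \<cdot>\<^sub>m 1\<^sub>m n) *\<^sub>v v" using W[OF v] by simp
  qed simp
  then show thesis by (rule that)
qed

section \<open>Splitting a representation at an invariant subspace\<close>

lemma index_mult_mat_sum: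
  "i < dim_row A \<Longrightarrow> j < dim_col B \<Longrightarrow> dim_col A = dim_row B \<Longrightarrow>
   (A * B) $$ (i, j) = (\<Sum>k<dim_row B. A $$ (i, k) * B $$ (k, j))"
  by (simp add: scalar_prod_def atLeast0LessThan)

lemma index_mult_vec_sum:
  "i < dim_row A \<Longrightarrow> dim_col A = dim_vec v \<Longrightarrow> (A *\<^sub>v v) $ i = (\<Sum>k<dim_vec v. A $$ (i, k) * v $ k)"
  by (simp add: scalar_prod_def atLeast0LessThan)

text \<open>
  If the columns of \<open>A\<close> do not span \<open>W\<close>, then \<open>u = w - A (B w)\<close> is a nonzero vector of \<open>W\<close>
  that is annihilated by \<open>B\<close>, and it serves as a new column.
\<close>

lemma subspace_factor_extend:
  fixes A B :: "'k::field mat"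
  assumes W: "subspace_vec n W" and A: "A \<in> carrier_mat n k" and B: "B \<in> carrier_mat k n"
    and BA: "B * A = 1\<^sub>m k" and AW: "\<And>v. v \<in> carrier_vec k \<Longrightarrow> A *\<^sub>v v \<in> W"
    and w: "w \<in> W" "A *\<^sub>v (B *\<^sub>v w) \<noteq> w"
  shows "\<exists>A' B'. A' \<in> carrier_mat n (Suc k) \<and> B' \<in> carrier_mat (Suc k) n \<and> B' * A' = 1\<^sub>m (Suc k) \<and>
    (\<forall>v\<in>carrier_vec (Suc k). A' *\<^sub>v v \<in> W)"
proof -
  have wc: "w \<in> carrier_vec n" using W w by (auto simp: subspace_vec_def)
  define u where "u = w - A *\<^sub>v (B *\<^sub>v w)"
  have uc: "u \<in> carrier_vec n" using wc A B by (auto simp: u_def)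
  have uW: "u \<in> W" unfolding u_def using W w wc AW B by (intro subspace_vec_diff) auto
  have "\<exists>i<n. u $ i \<noteq> 0"
  proof (rule ccontr)
    assume "\<not> (\<exists>i<n. u $ i \<noteq> 0)"
    then have "A *\<^sub>v (B *\<^sub>v w) = w" using wc A B by (intro eq_vecI) (auto simp: u_def)
    then show False using w by simp
  qed
  then obtain i where i: "i < n" "u $ i \<noteq> 0" by blast
  have Bu: "B *\<^sub>v u = 0\<^sub>v k"
  proof -
    have "B *\<^sub>v u = B *\<^sub>v w - B *\<^sub>v (A *\<^sub>v (B *\<^sub>v w))"
      unfolding u_def using wc A B by (intro mult_minus_distrib_mat_vec) auto
    also have "B *\<^sub>v (A *\<^sub>v (B *\<^sub>v w)) = B *\<^sub>v w"
      using mat_vec_assoc[of B A "B *\<^sub>v w"] A B BA wc by auto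
    finally show ?thesis using B by auto
  qed
  define A' where "A' = mat n (Suc k) (\<lambda>(a, b). if b < k then A $$ (a, b) else u $ a)"
  \<comment> \<open>The new row of the left inverse: a coordinate functional, corrected to vanish on the
    columns of \<open>A\<close> and scaled to take the value \<open>1\<close> at \<open>u\<close>.\<close>
  define r where "r c = ((if c = i then 1 else 0) - (A * B) $$ (i, c)) / u $ i" for c
  define B' where "B' = mat (Suc k) n (\<lambda>(a, b). if a < k then B $$ (a, b) else r b)"
  have r_sum: "(\<Sum>c<n. r c * f c) = (f i - (\<Sum>c<n. (A * B) $$ (i, c) * f c)) / u $ i" for f
  proof -
    have "(\<Sum>c<n. r c * f c) = (\<Sum>c<n. (if c = i then f c else 0) - (A * B) $$ (i, c) * f c) / u $ i"
      unfolding sum_divide_distrib by (intro sum.cong) (auto simp: r_def field_simps)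
    then show ?thesis using i by (simp add: sum_subtractf)
  qed
  have "B' * A' = 1\<^sub>m (Suc k)"
  proof (rule eq_matI)
    fix a b assume "a < dim_row (1\<^sub>m (Suc k) :: 'k mat)" "b < dim_col (1\<^sub>m (Suc k) :: 'k mat)"
    then have ab: "a < Suc k" "b < Suc k" by auto
    have *: "(B' * A') $$ (a, b) = (\<Sum>c<n. B' $$ (a, c) * A' $$ (c, b))"
      using ab by (subst index_mult_mat_sum) (auto simp: A'_def B'_def)
    consider "a < k" "b < k" | "a < k" "b = k" | "a = k" "b < k" | "a = k" "b = k" using ab by linarith
    then show "(B' * A') $$ (a, b) = 1\<^sub>m (Suc k) $$ (a, b)"
    proof cases
      case 1
      have "(B * A) $$ (a, b) = (\<Sum>c<n. B $$ (a, c) * A $$ (c, b))"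
        using 1 A B by (subst index_mult_mat_sum) auto
      then show ?thesis using * 1 BA by (simp add: A'_def B'_def)
    next
      case 2
      have "(B *\<^sub>v u) $ a = (\<Sum>c<n. B $$ (a, c) * u $ c)"
        using 2 uc B by (subst index_mult_vec_sum) auto
      then show ?thesis using * 2 Bu by (simp add: A'_def B'_def)
    next
      case 3
      have "(A * B * A) $$ (i, b) = (\<Sum>c<n. (A * B) $$ (i, c) * A $$ (c, b))"
        using 3 A B i by (subst index_mult_mat_sum) auto
      moreover have "A * B * A = A" using A B BA by (simp add: mat_assoc)
      ultimately show ?thesis using * 3 r_sum[of "\<lambda>c. A $$ (c, b)"] by (simp add: A'_def B'_def)
    next
      case 4
      have "(A * B *\<^sub>v u) $ i = (\<Sum>c<n. (A * B) $$ (i, c) * u $ c)"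
        using uc A B i by (subst index_mult_vec_sum) auto
      moreover have "A * B *\<^sub>v u = 0\<^sub>v n" using A B Bu uc mat_vec_assoc[of A B u] by auto
      ultimately show ?thesis using * 4 r_sum[of "\<lambda>c. u $ c"] i by (simp add: A'_def B'_def)
    qed
  qed (auto simp: A'_def B'_def)
  moreover have "A' *\<^sub>v v \<in> W" if v: "v \<in> carrier_vec (Suc k)" for v
  proof -
    let ?v = "vec k (\<lambda>c. v $ c)"
    have "A' *\<^sub>v v = A *\<^sub>v ?v + v $ k \<cdot>\<^sub>v u"
    proof (rule eq_vecI)
      fix a assume "a < dim_vec (A *\<^sub>v ?v + v $ k \<cdot>\<^sub>v u)"
      then have a: "a < n" using A uc by simp
      have "(A' *\<^sub>v v) $ a = (\<Sum>c<Suc k. A' $$ (a, c) * v $ c)"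
        using a v by (subst index_mult_vec_sum) (auto simp: A'_def)
      also have "\<dots> = (\<Sum>c<k. A $$ (a, c) * v $ c) + u $ a * v $ k" using a by (simp add: A'_def)
      also have "(\<Sum>c<k. A $$ (a, c) * v $ c) = (A *\<^sub>v ?v) $ a"
        using a A by (subst index_mult_vec_sum) auto
      finally show "(A' *\<^sub>v v) $ a = (A *\<^sub>v ?v + v $ k \<cdot>\<^sub>v u) $ a" using a A uc by simp
    qed (use A uc in \<open>auto simp: A'_def\<close>)
    then show ?thesis using AW[of ?v] uW W by (auto simp: subspace_vec_def)
  qed
  ultimately show ?thesis by (intro exI[of _ A'] exI[of _ B']) (auto simp: A'_def B'_def)
qed

text \<open>
  The columns of \<open>A\<close> act as a basis of \<open>W\<close> and the rows of \<open>B\<close> as its coordinate functionals; in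
  particular \<open>A * B\<close> is a projection onto \<open>W\<close>. A largest left invertible matrix with columns in \<open>W\<close> works.
\<close>

lemma subspace_factor:
  fixes W :: "'k::field vec set"
  assumes W: "subspace_vec n W"
  obtains k A B where "A \<in> carrier_mat n k" "B \<in> carrier_mat k n" "B * A = 1\<^sub>m k"
    "\<And>v. v \<in> carrier_vec k \<Longrightarrow> A *\<^sub>v v \<in> W" "\<And>w. w \<in> W \<Longrightarrow> A *\<^sub>v (B *\<^sub>v w) = w"
proof -
  define Q where "Q k \<longleftrightarrow> (\<exists>A B. A \<in> carrier_mat n k \<and> B \<in> carrier_mat k n \<and> B * A = 1\<^sub>m k \<and>
    (\<forall>v\<in>carrier_vec k. A *\<^sub>v v \<in> W))" for k
  have "0\<^sub>m n 0 *\<^sub>v v = 0\<^sub>v n" if "v \<in> carrier_vec 0" for v :: "'k vec"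
    using that by (intro eq_vecI) (auto simp: scalar_prod_def)
  then have Q0: "Q 0" using W unfolding Q_def subspace_vec_def
    by (intro exI[of _ "0\<^sub>m n 0"] exI[of _ "0\<^sub>m 0 n"]) (auto intro!: eq_matI)
  have bound: "k \<le> n" if "Q k" for k using that left_inverse_dim_le unfolding Q_def by blast
  define k where "k = Greatest Q"
  have "Q k" unfolding k_def using Q0 bound by (rule GreatestI_nat)
  have max: "\<not> Q (Suc k)"
    using Greatest_le_nat[of Q "Suc k" n] bound by (auto simp: k_def)
  from \<open>Q k\<close> obtain A B where AB: "A \<in> carrier_mat n k" "B \<in> carrier_mat k n" "B * A = 1\<^sub>m k"
    "\<And>v. v \<in> carrier_vec k \<Longrightarrow> A *\<^sub>v v \<in> W" by (auto simp: Q_def)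
  have "A *\<^sub>v (B *\<^sub>v w) = w" if "w \<in> W" for w
    using subspace_factor_extend[OF W AB that] max unfolding Q_def by blast
  with AB show thesis by (rule that)
qed

text \<open>
  Complete reducibility in the form in which averaging provides it: every invariant subspace is
  the image of a projection that commutes with the representation.
\<close>

definition semisimple_reps :: "('a, 'b) monoid_scheme \<Rightarrow> 'k::field itself \<Rightarrow> bool" where
  "semisimple_reps G K \<longleftrightarrow> (\<forall>n (\<rho> :: 'a \<Rightarrow> 'k mat) W. mat_rep G n \<rho> \<and> subspace_vec n W \<and> invariant G \<rho> W \<longrightarrow>
     (\<exists>E\<in>carrier_mat n n. (\<forall>s\<in>carrier G. E * \<rho> s = \<rho> s * E) \<and>
        (\<forall>v\<in>carrier_vec n. E *\<^sub>v v \<in> W) \<and> (\<forall>w\<in>W. E *\<^sub>v w = w)))"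

lemma four_block_diag_mult:
  fixes A B C D :: "'k::field mat"
  assumes "A \<in> carrier_mat a b" "B \<in> carrier_mat c d" "C \<in> carrier_mat b a'" "D \<in> carrier_mat d c'"
  shows "four_block_mat A (0\<^sub>m a d) (0\<^sub>m c b) B * four_block_mat C (0\<^sub>m b c') (0\<^sub>m d a') D =
    four_block_mat (A * C) (0\<^sub>m a c') (0\<^sub>m c a') (B * D)"
  using assms by (subst mult_four_block_mat[of _ a b _ d _ c _ _ a' _ c']) auto

lemma four_block_one: "four_block_mat (1\<^sub>m a) (0\<^sub>m a b) (0\<^sub>m b a) (1\<^sub>m b) = 1\<^sub>m (a + b)"
  by (intro eq_matI) auto

lemma mat_trace_four_block:
  assumes "A \<in> carrier_mat a a" "D \<in> carrier_mat d d"
  shows "mat_trace (four_block_mat A B C D) = mat_trace A + mat_trace (D :: 'k::field mat)"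
proof -
  have "mat_trace (four_block_mat A B C D) = (\<Sum>i<a + d. if i < a then A $$ (i, i) else D $$ (i - a, i - a))"
    using assms unfolding mat_trace_def by (intro sum.cong) auto
  also have "\<dots> = (\<Sum>i<a. A $$ (i, i)) + (\<Sum>i<d. D $$ (i, i))"
    by (simp add: sum.nat_group[symmetric] lessThan_atLeast0 sum.atLeastLessThan_concat[of 0 a "a+d", symmetric]
        sum.shift_bounds_nat_ivl[of _ 0 a d, simplified add.commute[of d a], simplified])
  finally show ?thesis using assms by (simp add: mat_trace_def)
qed

text \<open>
  The images of \<open>E\<close> and \<open>1 - E\<close> are complementary invariant subspaces, and factorisations of
  these two projections assemble into the base change.
\<close>

lemma split_rep:
  fixes \<rho> :: "'a \<Rightarrow> 'k::field_char_0 mat"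
  assumes \<rho>: "mat_rep G n \<rho>" and W: "subspace_vec n W" "W \<noteq> {0\<^sub>v n}" "W \<noteq> carrier_vec n"
    and E: "E \<in> carrier_mat n n" "\<And>s. s \<in> carrier G \<Longrightarrow> E * \<rho> s = \<rho> s * E"
      "\<And>v. v \<in> carrier_vec n \<Longrightarrow> E *\<^sub>v v \<in> W" "\<And>w. w \<in> W \<Longrightarrow> E *\<^sub>v w = w"
  obtains k l \<rho>1 \<rho>2 where "k < n" "l < n" "mat_rep G k \<rho>1" "mat_rep G l \<rho>2"
    "rep_equiv G n \<rho> (k + l) (\<lambda>s. four_block_mat (\<rho>1 s) (0\<^sub>m k l) (0\<^sub>m l k) (\<rho>2 s))"
proof -
  have c: "\<rho> s \<in> carrier_mat n n" if "s \<in> carrier G" for s using \<rho> that by (auto simp: mat_rep_iff)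
  have Wc: "W \<subseteq> carrier_vec n" using W by (auto simp: subspace_vec_def)
  define F where "F = 1\<^sub>m n - E"
  have F: "F \<in> carrier_mat n n" using E by (auto simp: F_def)
  have EE: "E * E = E"
    by (rule mat_eqI_vec[of _ n n]) (use E mat_vec_assoc[of E E] in auto)
  have EF: "E * F = 0\<^sub>m n n"
    unfolding F_def by (subst mult_minus_distrib_mat[of _ n n]) (use E(1) EE in auto)
  have FE: "F * E = 0\<^sub>m n n"
    unfolding F_def by (subst minus_mult_distrib_mat[of _ n n]) (use E(1) EE in auto)
  have E_add_F: "E + F = 1\<^sub>m n" using E by (auto simp: F_def intro!: eq_matI)
  have \<rho>F: "F * \<rho> s = \<rho> s * F" if "s \<in> carrier G" for s
  proof -
    have "F * \<rho> s = 1\<^sub>m n * \<rho> s - E * \<rho> s"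
      unfolding F_def by (rule minus_mult_distrib_mat) (use E(1) c[OF that] in auto)
    also have "\<dots> = \<rho> s * 1\<^sub>m n - \<rho> s * E" using E(2)[OF that] c[OF that] by simp
    also have "\<dots> = \<rho> s * F"
      unfolding F_def by (rule mult_minus_distrib_mat[symmetric]) (use E(1) c[OF that] in auto)
    finally show ?thesis .
  qed
  define U where "U = {v \<in> carrier_vec n. E *\<^sub>v v = 0\<^sub>v n}"
  have E0: "E *\<^sub>v 0\<^sub>v n = 0\<^sub>v n" using E by (intro eq_vecI) auto
  have U: "subspace_vec n U" unfolding subspace_vec_def U_def
    using E(1) E0 by (auto simp: mult_add_distrib_mat_vec[of _ n n] mult_mat_vec[of _ n n])
  have FU: "F *\<^sub>v v \<in> U" if "v \<in> carrier_vec n" for v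
  proof -
    have "E *\<^sub>v (F *\<^sub>v v) = 0\<^sub>m n n *\<^sub>v v" using mat_vec_assoc[of E F v] E(1) F EF that by simp
    also have "\<dots> = 0\<^sub>v n" using that by (intro eq_vecI) auto
    finally show ?thesis using F that by (simp add: U_def)
  qed
  have UF: "F *\<^sub>v v = v" if "v \<in> U" for v
    using that E(1) unfolding F_def by (subst minus_mult_distrib_mat_vec[of _ n n]) (auto simp: U_def)
  obtain k A1 B1 where 1: "A1 \<in> carrier_mat n k" "B1 \<in> carrier_mat k n" "B1 * A1 = 1\<^sub>m k"
    "\<And>v. v \<in> carrier_vec k \<Longrightarrow> A1 *\<^sub>v v \<in> W" "\<And>w. w \<in> W \<Longrightarrow> A1 *\<^sub>v (B1 *\<^sub>v w) = w"
    by (rule subspace_factor[OF W(1)]) (rule that; blast)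
  obtain l A2 B2 where 2: "A2 \<in> carrier_mat n l" "B2 \<in> carrier_mat l n" "B2 * A2 = 1\<^sub>m l"
    "\<And>v. v \<in> carrier_vec l \<Longrightarrow> A2 *\<^sub>v v \<in> U" "\<And>w. w \<in> U \<Longrightarrow> A2 *\<^sub>v (B2 *\<^sub>v w) = w"
    by (rule subspace_factor[OF U]) (rule that; blast)
  have EA1: "E * A1 = A1"
    by (rule mat_eqI_vec[of _ n k]) (use E 1 mat_vec_assoc[of E A1] in auto)
  have FA2: "F * A2 = A2"
    by (rule mat_eqI_vec[of _ n l]) (use F UF 2 mat_vec_assoc[of F A2] in auto)
  define C1 where "C1 = B1 * E"
  define C2 where "C2 = B2 * F"
  have C: "C1 \<in> carrier_mat k n" "C2 \<in> carrier_mat l n" using 1 2 E F by (auto simp: C1_def C2_def)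
  have dims [simp]: "dim_row A1 = n" "dim_col A1 = k" "dim_row A2 = n" "dim_col A2 = l"
    "dim_row C1 = k" "dim_col C1 = n" "dim_row C2 = l" "dim_col C2 = n" "dim_row E = n" "dim_col E = n"
    "dim_row F = n" "dim_col F = n" "dim_row B1 = k" "dim_col B1 = n" "dim_row B2 = l" "dim_col B2 = n"
    using 1 2 C E F by auto
  have C1A1: "C1 * A1 = 1\<^sub>m k" using 1 by (simp add: C1_def mat_assoc EA1)
  have C2A2: "C2 * A2 = 1\<^sub>m l" using 2 by (simp add: C2_def mat_assoc FA2)
  have "C1 * A2 = B1 * (E * F) * A2" by (simp add: C1_def mat_assoc FA2)
  then have C1A2: "C1 * A2 = 0\<^sub>m k l" using 1 2 by (simp add: EF)
  have "C2 * A1 = B2 * (F * E) * A1" by (simp add: C2_def mat_assoc EA1)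
  then have C2A1: "C2 * A1 = 0\<^sub>m l k" using 1 2 by (simp add: FE)
  have A1C1: "A1 * C1 = E"
  proof (rule mat_eqI_vec[of _ n n])
    fix v :: "'k vec" assume v: "v \<in> carrier_vec n"
    have "A1 * C1 *\<^sub>v v = A1 *\<^sub>v (C1 *\<^sub>v v)" using v by (intro mat_vec_assoc) auto
    also have "C1 *\<^sub>v v = B1 *\<^sub>v (E *\<^sub>v v)" unfolding C1_def using v by (intro mat_vec_assoc) auto
    also have "A1 *\<^sub>v \<dots> = E *\<^sub>v v" using v E(1) E(3) by (intro 1(5)) auto
    finally show "A1 * C1 *\<^sub>v v = E *\<^sub>v v" .
  qed (use 1 C E(1) E(3) in auto)
  have A2C2: "A2 * C2 = F"
  proof (rule mat_eqI_vec[of _ n n])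
    fix v :: "'k vec" assume v: "v \<in> carrier_vec n"
    have "A2 * C2 *\<^sub>v v = A2 *\<^sub>v (C2 *\<^sub>v v)" using v by (intro mat_vec_assoc) auto
    also have "C2 *\<^sub>v v = B2 *\<^sub>v (F *\<^sub>v v)" unfolding C2_def using v by (intro mat_vec_assoc) auto
    also have "A2 *\<^sub>v \<dots> = F *\<^sub>v v" using v F FU by (intro 2(5)) auto
    finally show "A2 * C2 *\<^sub>v v = F *\<^sub>v v" .
  qed (use 2 C F FU in auto)
  define P where "P = four_block_mat C1 (0\<^sub>m k 0) C2 (0\<^sub>m l 0)"
  define Q where "Q = four_block_mat A1 A2 (0\<^sub>m 0 k) (0\<^sub>m 0 l)"
  have P: "P \<in> carrier_mat (k + l) n" unfolding P_def by (intro carrier_matI) simp_all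
  have Q: "Q \<in> carrier_mat n (k + l)" unfolding Q_def by (intro carrier_matI) simp_all
  have PQ: "P * Q = 1\<^sub>m (k + l)"
  proof -
    have "P * Q = four_block_mat (C1 * A1 + 0\<^sub>m k 0 * 0\<^sub>m 0 k) (C1 * A2 + 0\<^sub>m k 0 * 0\<^sub>m 0 l)
        (C2 * A1 + 0\<^sub>m l 0 * 0\<^sub>m 0 k) (C2 * A2 + 0\<^sub>m l 0 * 0\<^sub>m 0 l)"
      unfolding P_def Q_def
      by (rule mult_four_block_mat[OF C(1) zero_carrier_mat C(2) zero_carrier_mat
            1(1) 2(1) zero_carrier_mat zero_carrier_mat])
    also have "\<dots> = 1\<^sub>m (k + l)"
      by (simp add: C1A1 C1A2 C2A1 C2A2 four_block_one)
    finally show ?thesis .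
  qed
  have block_trivial: "four_block_mat X (0\<^sub>m n 0) (0\<^sub>m 0 n) (0\<^sub>m 0 0) = X" if "X \<in> carrier_mat n n" for X :: "'k mat"
    using that by (intro eq_matI) auto
  have QP: "Q * P = 1\<^sub>m n"
  proof -
    have "Q * P = four_block_mat (A1 * C1 + A2 * C2) (A1 * 0\<^sub>m k 0 + A2 * 0\<^sub>m l 0)
        (0\<^sub>m 0 k * C1 + 0\<^sub>m 0 l * C2) (0\<^sub>m 0 k * 0\<^sub>m k 0 + 0\<^sub>m 0 l * 0\<^sub>m l 0)"
      unfolding P_def Q_def
      by (rule mult_four_block_mat[OF 1(1) 2(1) zero_carrier_mat zero_carrier_mat
            C(1) zero_carrier_mat C(2) zero_carrier_mat])
    also have "\<dots> = 1\<^sub>m n"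
      using 1(1) 2(1) C by (simp add: A1C1 A2C2 E_add_F block_trivial)
    finally show ?thesis .
  qed
  have n: "n = k + l" using mutually_inverse_dims[OF Q P QP PQ] .
  define \<rho>1 where "\<rho>1 s = C1 * \<rho> s * A1" for s
  define \<rho>2 where "\<rho>2 s = C2 * \<rho> s * A2" for s
  have \<rho>1c: "\<rho>1 s \<in> carrier_mat k k" and \<rho>2c: "\<rho>2 s \<in> carrier_mat l l" if "s \<in> carrier G" for s
    using c[OF that] C 1 2 by (auto simp: \<rho>1_def \<rho>2_def)
  have \<rho>A1: "\<rho> s * A1 = A1 * \<rho>1 s" if s: "s \<in> carrier G" for s
  proof -
    have "A1 * \<rho>1 s = (A1 * C1) * (\<rho> s * A1)" using c[OF s] by (simp add: \<rho>1_def mat_assoc)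
    also have "\<dots> = (E * \<rho> s) * A1" using c[OF s] by (simp add: A1C1 mat_assoc)
    also have "\<dots> = \<rho> s * A1" using c[OF s] by (simp add: E(2)[OF s] mat_assoc EA1)
    finally show ?thesis ..
  qed
  have \<rho>A2: "\<rho> s * A2 = A2 * \<rho>2 s" if s: "s \<in> carrier G" for s
  proof -
    have "A2 * \<rho>2 s = (A2 * C2) * (\<rho> s * A2)" using c[OF s] by (simp add: \<rho>2_def mat_assoc)
    also have "\<dots> = (F * \<rho> s) * A2" using c[OF s] by (simp add: A2C2 mat_assoc)
    also have "\<dots> = \<rho> s * A2" using c[OF s] by (simp add: \<rho>F[OF s] mat_assoc FA2)
    finally show ?thesis ..
  qed
  have "mat_rep G k \<rho>1"
    unfolding mat_rep_iff
  proof (intro conjI ballI)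
    fix s t assume s: "s \<in> carrier G" and t: "t \<in> carrier G"
    have "\<rho> (s \<otimes>\<^bsub>G\<^esub> t) = \<rho> s * \<rho> t" using \<rho> s t by (simp add: mat_rep_iff)
    then have "\<rho>1 (s \<otimes>\<^bsub>G\<^esub> t) = C1 * \<rho> s * (\<rho> t * A1)"
      using c[OF s] c[OF t] by (simp add: \<rho>1_def mat_assoc)
    also have "\<dots> = \<rho>1 s * \<rho>1 t"
      using c[OF s] c[OF t] \<rho>1c[OF t] by (simp add: \<rho>A1[OF t]) (simp add: \<rho>1_def[of s] mat_assoc)
    finally show "\<rho>1 (s \<otimes>\<^bsub>G\<^esub> t) = \<rho>1 s * \<rho>1 t" .
  next
    show "\<rho>1 \<one>\<^bsub>G\<^esub> = 1\<^sub>m k" using \<rho> C C1A1 by (simp add: \<rho>1_def mat_rep_iff)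
  qed (rule \<rho>1c)
  moreover have "mat_rep G l \<rho>2"
    unfolding mat_rep_iff
  proof (intro conjI ballI)
    fix s t assume s: "s \<in> carrier G" and t: "t \<in> carrier G"
    have "\<rho> (s \<otimes>\<^bsub>G\<^esub> t) = \<rho> s * \<rho> t" using \<rho> s t by (simp add: mat_rep_iff)
    then have "\<rho>2 (s \<otimes>\<^bsub>G\<^esub> t) = C2 * \<rho> s * (\<rho> t * A2)"
      using c[OF s] c[OF t] by (simp add: \<rho>2_def mat_assoc)
    also have "\<dots> = \<rho>2 s * \<rho>2 t"
      using c[OF s] c[OF t] \<rho>2c[OF t] by (simp add: \<rho>A2[OF t]) (simp add: \<rho>2_def[of s] mat_assoc)
    finally show "\<rho>2 (s \<otimes>\<^bsub>G\<^esub> t) = \<rho>2 s * \<rho>2 t" .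
  next
    show "\<rho>2 \<one>\<^bsub>G\<^esub> = 1\<^sub>m l" using \<rho> C C2A2 by (simp add: \<rho>2_def mat_rep_iff)
  qed (rule \<rho>2c)
  moreover have "rep_equiv G n \<rho> (k + l) (\<lambda>s. four_block_mat (\<rho>1 s) (0\<^sub>m k l) (0\<^sub>m l k) (\<rho>2 s))"
  proof (rule rep_equivI[OF P Q PQ QP])
    fix s assume s: "s \<in> carrier G"
    let ?D = "four_block_mat (\<rho>1 s) (0\<^sub>m k l) (0\<^sub>m l k) (\<rho>2 s)"
    have "\<rho> s * Q = Q * ?D"
    proof -
      have "\<rho> s * Q = four_block_mat (\<rho> s) (0\<^sub>m n 0) (0\<^sub>m 0 n) (0\<^sub>m 0 0) * Q"
        using block_trivial[OF c[OF s]] by simp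
      also have "\<dots> = four_block_mat (\<rho> s * A1) (\<rho> s * A2) (0\<^sub>m 0 k) (0\<^sub>m 0 l)"
        unfolding Q_def using c[OF s] 1(1) 2(1)
        by (subst mult_four_block_mat[of _ n n _ 0 _ 0 _ _ k _ l]) simp_all
      also have "\<dots> = Q * ?D"
        unfolding Q_def using c[OF s] 1(1) 2(1) \<rho>1c[OF s] \<rho>2c[OF s]
        by (subst mult_four_block_mat[of _ n k _ l _ 0 _ _ k _ l]) (simp_all add: \<rho>A1[OF s] \<rho>A2[OF s])
      finally show ?thesis .
    qed
    then have "P * (\<rho> s * Q) * P = P * (Q * ?D) * P" by simp
    then have "P * \<rho> s * (Q * P) = (P * Q) * ?D * P"
      using P Q c[OF s] \<rho>1c[OF s] \<rho>2c[OF s] by (simp add: mat_assoc)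
    then show "P * \<rho> s = ?D * P"
      using P Q c[OF s] \<rho>1c[OF s] \<rho>2c[OF s] by (simp add: PQ QP)
  qed
  moreover have "k \<noteq> 0"
  proof
    assume k: "k = 0"
    have "w = 0\<^sub>v n" if "w \<in> W" for w
    proof -
      have "A1 *\<^sub>v (B1 *\<^sub>v w) = 0\<^sub>v n" using k 1(1,2) subsetD[OF Wc that]
        by (intro eq_vecI) (auto simp: index_mult_vec_sum simp del: index_mult_mat_vec)
      then show ?thesis using 1(5)[OF that] by simp
    qed
    then show False using W by (auto simp: subspace_vec_def)
  qed
  moreover have "l \<noteq> 0"
  proof
    assume l: "l = 0"
    have "v \<in> W" if v: "v \<in> carrier_vec n" for v
    proof -
      have "F *\<^sub>v v = A2 *\<^sub>v (C2 *\<^sub>v v)" using A2C2 mat_vec_assoc[of A2 C2 v] v by auto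
      also have "\<dots> = 0\<^sub>v n" using l v
        by (intro eq_vecI) (auto simp: index_mult_vec_sum simp del: index_mult_mat_vec)
      finally have F0: "F *\<^sub>v v = 0\<^sub>v n" .
      have "v = (E + F) *\<^sub>v v" using v by (simp add: E_add_F)
      also have "\<dots> = E *\<^sub>v v" using v E(1) F F0 by (simp add: add_mult_distrib_mat_vec[of _ n n])
      finally show ?thesis using E(3)[OF v] by simp
    qed
    then show False using W Wc by blast
  qed
  ultimately show thesis using that[of k l \<rho>1 \<rho>2] n by simp
qed

section \<open>Complete reducibility by averaging\<close>

lemma direct_sum_carrier:
  assumes "\<And>d \<sigma>. (d, \<sigma>) \<in> set Rs \<Longrightarrow> \<sigma> s \<in> carrier_mat d d"
  shows "direct_sum Rs s \<in> carrier_mat (sum_list (map fst Rs)) (sum_list (map fst Rs))"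
  using assms
proof (induction Rs)
  case (Cons R Rs)
  obtain d \<sigma> where R: "R = (d, \<sigma>)" by (cases R)
  have "direct_sum Rs s \<in> carrier_mat (sum_list (map fst Rs)) (sum_list (map fst Rs))"
    by (rule Cons.IH) (use Cons.prems in auto)
  moreover have "\<sigma> s \<in> carrier_mat d d" using Cons.prems R by auto
  ultimately show ?case by (auto simp: direct_sum_def R Let_def intro!: carrier_matI)
qed (simp add: direct_sum_def)

lemma direct_sum_append:
  assumes "direct_sum Rs s \<in> carrier_mat k k" "direct_sum Ts s \<in> carrier_mat l l"
  shows "direct_sum (Rs @ Ts) s =
    four_block_mat (direct_sum Rs s) (0\<^sub>m k l) (0\<^sub>m l k) (direct_sum Ts s)"
  using assms unfolding direct_sum_def map_append diag_block_mat_append Let_def by auto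

lemma mat_trace_direct_sum:
  assumes "\<And>d \<sigma>. (d, \<sigma>) \<in> set Rs \<Longrightarrow> \<sigma> s \<in> carrier_mat d d"
  shows "mat_trace (direct_sum Rs s) = (\<Sum>(d, \<sigma>)\<leftarrow>Rs. mat_trace (\<sigma> s))"
  using assms
proof (induction Rs)
  case Nil
  then show ?case by (simp add: direct_sum_def mat_trace_def)
next
  case (Cons R Rs)
  obtain d \<sigma> where R: "R = (d, \<sigma>)" by (cases R)
  have 1: "\<sigma> s \<in> carrier_mat d d" using Cons.prems R by auto
  have 2: "direct_sum Rs s \<in> carrier_mat (sum_list (map fst Rs)) (sum_list (map fst Rs))"
    by (rule direct_sum_carrier) (use Cons.prems in auto)
  have "direct_sum (R # Rs) s = four_block_mat (\<sigma> s) (0\<^sub>m (dim_row (\<sigma> s)) (dim_col (direct_sum Rs s)))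
     (0\<^sub>m (dim_row (direct_sum Rs s)) (dim_col (\<sigma> s))) (direct_sum Rs s)"
    by (simp add: direct_sum_def R Let_def)
  then have "mat_trace (direct_sum (R # Rs) s) = mat_trace (\<sigma> s) + mat_trace (direct_sum Rs s)"
    using mat_trace_four_block[OF 1 2] by simp
  then show ?case using Cons by (simp add: R)
qed

text \<open>
  A base change preserves traces, and traces are additive on diagonal blocks.
\<close>

lemma character_decomposition:
  assumes \<rho>: "mat_rep G n \<rho>" and Rs: "irreducible_decomposition G n \<rho> Rs" and s: "s \<in> carrier G"
  shows "character \<rho> s = (\<Sum>(d, \<sigma>)\<leftarrow>Rs. character \<sigma> s)"
proof -
  let ?N = "sum_list (map fst Rs)"
  have c: "\<sigma> t \<in> carrier_mat d d" if "(d, \<sigma>) \<in> set Rs" "t \<in> carrier G" for d \<sigma> t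
    using Rs that by (auto simp: irreducible_decomposition_def irreducible_rep_def mat_rep_iff)
  have eq: "rep_equiv G n \<rho> ?N (direct_sum Rs)" using Rs by (simp add: irreducible_decomposition_def)
  then obtain P Q where P: "?N = n" "P \<in> carrier_mat n n" "Q \<in> carrier_mat n n"
    "P * Q = 1\<^sub>m n" "Q * P = 1\<^sub>m n" "\<And>s. s \<in> carrier G \<Longrightarrow> P * \<rho> s = direct_sum Rs s * P"
    by (rule rep_equivE) (rule that; blast)
  have cd: "\<rho> s \<in> carrier_mat n n" "direct_sum Rs s \<in> carrier_mat n n"
    using \<rho> s direct_sum_carrier[of Rs s] c P(1) by (auto simp: mat_rep_iff)
  have "\<rho> s = Q * direct_sum Rs s * P" by (rule conj_of_intertwine[OF P(2,3) cd P(5) P(6)[OF s]])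
  then have "mat_trace (\<rho> s) = mat_trace (Q * (direct_sum Rs s * P))" using cd P(2,3) by (simp add: mat_assoc)
  also have "\<dots> = mat_trace (direct_sum Rs s * P * Q)" by (rule mat_trace_comm[of _ n n]) (use cd P(2,3) in auto)
  also have "direct_sum Rs s * P * Q = direct_sum Rs s" using cd P(2,3,4) by (simp add: mat_assoc)
  finally show ?thesis using mat_trace_direct_sum[of Rs s] c[OF _ s] by (simp add: character_def)
qed

lemma rep_equiv_trans:
  fixes \<rho> :: "'a \<Rightarrow> 'k::field_char_0 mat"
  assumes "rep_equiv G d \<rho> d' \<rho>'" "rep_equiv G d' \<rho>' d'' \<rho>''"
    and c: "\<And>s. s \<in> carrier G \<Longrightarrow> \<rho> s \<in> carrier_mat d d" "\<And>s. s \<in> carrier G \<Longrightarrow> \<rho>' s \<in> carrier_mat d' d'"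
      "\<And>s. s \<in> carrier G \<Longrightarrow> \<rho>'' s \<in> carrier_mat d'' d''"
  shows "rep_equiv G d \<rho> d'' \<rho>''"
proof -
  from assms(1) obtain P Q where P: "d' = d" "P \<in> carrier_mat d d" "Q \<in> carrier_mat d d"
    "P * Q = 1\<^sub>m d" "Q * P = 1\<^sub>m d" "\<And>s. s \<in> carrier G \<Longrightarrow> P * \<rho> s = \<rho>' s * P"
    by (rule rep_equivE) (rule that; blast)
  from assms(2) obtain P' Q' where P': "d'' = d'" "P' \<in> carrier_mat d' d'" "Q' \<in> carrier_mat d' d'"
    "P' * Q' = 1\<^sub>m d'" "Q' * P' = 1\<^sub>m d'" "\<And>s. s \<in> carrier G \<Longrightarrow> P' * \<rho>' s = \<rho>'' s * P'"
    by (rule rep_equivE) (rule that; blast)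
  note d = P(1) P'(1)
  have dims [simp]: "dim_row P = d" "dim_col P = d" "dim_row Q = d" "dim_col Q = d"
    "dim_row P' = d" "dim_col P' = d" "dim_row Q' = d" "dim_col Q' = d"
    using P(2,3) P'(2,3) d by auto
  show ?thesis unfolding d
  proof (rule rep_equivI[of "P' * P" d d "Q * Q'"])
    show "P' * P \<in> carrier_mat d d" "Q * Q' \<in> carrier_mat d d" by (intro carrier_matI; simp)+
    have "P' * P * (Q * Q') = P' * (P * Q) * Q'" by (simp add: mat_assoc)
    then show "P' * P * (Q * Q') = 1\<^sub>m d" using P(4) P'(2,4) d by simp
    have "Q * Q' * (P' * P) = Q * (Q' * P') * P" by (simp add: mat_assoc)
    then show "Q * Q' * (P' * P) = 1\<^sub>m d" using P(3,5) P'(5) d by simp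
  next
    fix s assume s: "s \<in> carrier G"
    note cs = c(1)[OF s] c(2)[OF s, unfolded d] c(3)[OF s, unfolded d]
    have "P' * P * \<rho> s = P' * (P * \<rho> s)" using cs by (simp add: mat_assoc)
    also have "\<dots> = (P' * \<rho>' s) * P" using cs by (simp add: P(6)[OF s] mat_assoc)
    also have "\<dots> = \<rho>'' s * (P' * P)" using cs by (simp add: P'(6)[OF s] mat_assoc)
    finally show "P' * P * \<rho> s = \<rho>'' s * (P' * P)" .
  qed
qed

lemma rep_equiv_block:
  fixes \<rho> :: "'a \<Rightarrow> 'k::field_char_0 mat"
  assumes "rep_equiv G k \<rho> k' \<rho>'" "rep_equiv G l \<sigma> l' \<sigma>'"
    and c: "\<And>s. s \<in> carrier G \<Longrightarrow> \<rho> s \<in> carrier_mat k k" "\<And>s. s \<in> carrier G \<Longrightarrow> \<rho>' s \<in> carrier_mat k' k'"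
      "\<And>s. s \<in> carrier G \<Longrightarrow> \<sigma> s \<in> carrier_mat l l" "\<And>s. s \<in> carrier G \<Longrightarrow> \<sigma>' s \<in> carrier_mat l' l'"
  shows "rep_equiv G (k + l) (\<lambda>s. four_block_mat (\<rho> s) (0\<^sub>m k l) (0\<^sub>m l k) (\<sigma> s))
    (k' + l') (\<lambda>s. four_block_mat (\<rho>' s) (0\<^sub>m k' l') (0\<^sub>m l' k') (\<sigma>' s))"
proof -
  from assms(1) obtain P Q where P: "k' = k" "P \<in> carrier_mat k k" "Q \<in> carrier_mat k k"
    "P * Q = 1\<^sub>m k" "Q * P = 1\<^sub>m k" "\<And>s. s \<in> carrier G \<Longrightarrow> P * \<rho> s = \<rho>' s * P"
    by (rule rep_equivE) (rule that; blast)
  from assms(2) obtain P' Q' where P': "l' = l" "P' \<in> carrier_mat l l" "Q' \<in> carrier_mat l l"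
    "P' * Q' = 1\<^sub>m l" "Q' * P' = 1\<^sub>m l" "\<And>s. s \<in> carrier G \<Longrightarrow> P' * \<sigma> s = \<sigma>' s * P'"
    by (rule rep_equivE) (rule that; blast)
  show ?thesis unfolding P(1) P'(1)
  proof (rule rep_equivI[of "four_block_mat P (0\<^sub>m k l) (0\<^sub>m l k) P'" _ _ "four_block_mat Q (0\<^sub>m k l) (0\<^sub>m l k) Q'"])
    fix s assume s: "s \<in> carrier G"
    note cs = c[OF s, unfolded P(1) P'(1)]
    show "four_block_mat P (0\<^sub>m k l) (0\<^sub>m l k) P' * four_block_mat (\<rho> s) (0\<^sub>m k l) (0\<^sub>m l k) (\<sigma> s) =
      four_block_mat (\<rho>' s) (0\<^sub>m k l) (0\<^sub>m l k) (\<sigma>' s) * four_block_mat P (0\<^sub>m k l) (0\<^sub>m l k) P'"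
      by (simp only: four_block_diag_mult[OF P(2) P'(2) cs(1,3)] four_block_diag_mult[OF cs(2,4) P(2) P'(2)]
        P(6)[OF s] P'(6)[OF s])
  qed (simp_all only: four_block_diag_mult[OF P(2) P'(2) P(3) P'(3)] four_block_diag_mult[OF P(3) P'(3) P(2) P'(2)]
     P(4,5) P'(4,5) four_block_one four_block_carrier_mat[OF P(2) P'(2)] four_block_carrier_mat[OF P(3) P'(3)])
qed

lemma rep_equiv_cong:
  "(\<And>s. s \<in> carrier G \<Longrightarrow> \<sigma> s = \<sigma>' s) \<Longrightarrow> rep_equiv G d \<rho> d' \<sigma>' \<Longrightarrow> rep_equiv G d \<rho> d' \<sigma>"
  by (auto simp: rep_equiv_def)

text \<open>
  Invariant subspaces are split off until none are left, by induction on the degree.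
\<close>

lemma irreducible_decomposition_exists:
  fixes \<rho> :: "'a \<Rightarrow> 'k::field_char_0 mat"
  assumes ss: "semisimple_reps G TYPE('k)" and "mat_rep G n \<rho>"
  shows "\<exists>Rs. irreducible_decomposition G n \<rho> Rs"
  using assms(2)
proof (induction n arbitrary: \<rho> rule: less_induct)
  case (less n)
  have c: "\<rho> s \<in> carrier_mat n n" if "s \<in> carrier G" for s using less.prems that by (auto simp: mat_rep_iff)
  consider "n = 0" | "irreducible_rep G n \<rho>" | "n > 0" "\<not> irreducible_rep G n \<rho>" by blast
  then show ?case
  proof cases
    case 1
    have "rep_equiv G n \<rho> 0 (direct_sum [])"
    proof (rule rep_equivI[of "1\<^sub>m 0" 0 n "1\<^sub>m 0"])
      fix s assume "s \<in> carrier G"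
      then show "1\<^sub>m 0 * \<rho> s = direct_sum [] s * 1\<^sub>m 0"
        using 1 c[of s] by (intro eq_matI) (auto simp: direct_sum_def)
    qed (use 1 in auto)
    then show ?thesis by (intro exI[of _ "[]"]) (simp add: irreducible_decomposition_def)
  next
    case 2
    have "rep_equiv G n \<rho> n \<rho>" by (rule rep_equiv_refl[OF less.prems])
    moreover have "direct_sum [(n, \<rho>)] = \<rho>" by (rule ext) (simp add: direct_sum_def del: diag_block_mat.simps)
    ultimately show ?thesis using 2 by (intro exI[of _ "[(n, \<rho>)]"]) (simp add: irreducible_decomposition_def)
  next
    case 3
    then obtain W where W: "subspace_vec n W" "invariant G \<rho> W" "W \<noteq> {0\<^sub>v n}" "W \<noteq> carrier_vec n"
      using less.prems by (auto simp: irreducible_rep_iff)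
    then obtain E where E: "E \<in> carrier_mat n n" "\<And>s. s \<in> carrier G \<Longrightarrow> E * \<rho> s = \<rho> s * E"
      "\<And>v. v \<in> carrier_vec n \<Longrightarrow> E *\<^sub>v v \<in> W" "\<And>w. w \<in> W \<Longrightarrow> E *\<^sub>v w = w"
      using ss[unfolded semisimple_reps_def, rule_format, OF conjI[OF less.prems conjI[OF W(1,2)]]] by auto
    obtain k l \<rho>1 \<rho>2 where split: "k < n" "l < n" "mat_rep G k \<rho>1" "mat_rep G l \<rho>2"
      "rep_equiv G n \<rho> (k + l) (\<lambda>s. four_block_mat (\<rho>1 s) (0\<^sub>m k l) (0\<^sub>m l k) (\<rho>2 s))"
      by (rule split_rep[OF less.prems W(1,3,4) E]) (assumption | (rule that; assumption))+
    obtain Rs where Rs: "irreducible_decomposition G k \<rho>1 Rs" using less.IH[OF split(1,3)] by blast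
    obtain Ts where Ts: "irreducible_decomposition G l \<rho>2 Ts" using less.IH[OF split(2,4)] by blast
    let ?R = "sum_list (map fst Rs)" and ?T = "sum_list (map fst Ts)"
    have cR: "direct_sum Rs s \<in> carrier_mat ?R ?R" if "s \<in> carrier G" for s
      by (rule direct_sum_carrier)
        (use Rs that in \<open>auto simp: irreducible_decomposition_def irreducible_rep_def mat_rep_iff\<close>)
    have cT: "direct_sum Ts s \<in> carrier_mat ?T ?T" if "s \<in> carrier G" for s
      by (rule direct_sum_carrier)
        (use Ts that in \<open>auto simp: irreducible_decomposition_def irreducible_rep_def mat_rep_iff\<close>)
    have c12: "\<rho>1 s \<in> carrier_mat k k" "\<rho>2 s \<in> carrier_mat l l" if "s \<in> carrier G" for s
      using split(3,4) that by (auto simp: mat_rep_iff)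
    have cd: "direct_sum (Rs @ Ts) s = four_block_mat (direct_sum Rs s) (0\<^sub>m ?R ?T) (0\<^sub>m ?T ?R) (direct_sum Ts s)"
      if "s \<in> carrier G" for s by (rule direct_sum_append[OF cR[OF that] cT[OF that]])
    have "rep_equiv G (k + l) (\<lambda>s. four_block_mat (\<rho>1 s) (0\<^sub>m k l) (0\<^sub>m l k) (\<rho>2 s))
      (?R + ?T) (\<lambda>s. four_block_mat (direct_sum Rs s) (0\<^sub>m ?R ?T) (0\<^sub>m ?T ?R) (direct_sum Ts s))"
      by (rule rep_equiv_block) (use Rs Ts c12 cR cT in \<open>auto simp: irreducible_decomposition_def\<close>)
    from rep_equiv_trans[OF split(5) this]
    have "rep_equiv G n \<rho> (?R + ?T) (\<lambda>s. four_block_mat (direct_sum Rs s) (0\<^sub>m ?R ?T) (0\<^sub>m ?T ?R) (direct_sum Ts s))"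
      using c c12 cR cT by auto
    then have "rep_equiv G n \<rho> (sum_list (map fst (Rs @ Ts))) (direct_sum (Rs @ Ts))"
      using rep_equiv_cong[of G "direct_sum (Rs @ Ts)", OF cd] by simp
    then show ?thesis using Rs Ts
      by (intro exI[of _ "Rs @ Ts"]) (auto simp: irreducible_decomposition_def)
  qed
qed

lemma msum_mult_vec_cong:
  assumes "\<And>i. i \<in> I \<Longrightarrow> f i \<in> carrier_mat n m" "\<And>i. i \<in> I \<Longrightarrow> g i \<in> carrier_mat n m"
    and "v \<in> carrier_vec m" "\<And>i. i \<in> I \<Longrightarrow> f i *\<^sub>v v = g i *\<^sub>v v"
  shows "msum n m f I *\<^sub>v v = msum n m g I *\<^sub>v v"
proof -
  have *: "(msum n m h I *\<^sub>v v) $ a = (\<Sum>i\<in>I. (h i *\<^sub>v v) $ a)"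
    if "a < n" and h: "\<And>i. i \<in> I \<Longrightarrow> h i \<in> carrier_mat n m" for a h
  proof -
    have "(msum n m h I *\<^sub>v v) $ a = (\<Sum>b<m. \<Sum>i\<in>I. h i $$ (a, b) * v $ b)"
      using that(1) assms(3) by (subst index_mult_vec_sum) (simp_all add: sum_distrib_right)
    also have "\<dots> = (\<Sum>i\<in>I. \<Sum>b<m. h i $$ (a, b) * v $ b)" by (rule sum.swap)
    also have "\<dots> = (\<Sum>i\<in>I. (h i *\<^sub>v v) $ a)"
    proof (rule sum.cong[OF refl])
      fix i assume "i \<in> I"
      then show "(\<Sum>b<m. h i $$ (a, b) * v $ b) = (h i *\<^sub>v v) $ a"
        using that(1) assms(3) h[of i] by (subst index_mult_vec_sum) auto
    qed
    finally show ?thesis .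
  qed
  show ?thesis
    by (intro eq_vecI) (auto simp del: index_mult_mat_vec simp add: * assms)
qed

text \<open>
  If \<open>P\<close> is a projection onto an invariant subspace that all \<open>a i\<close> and \<open>b i\<close> preserve, and the
  products \<open>a i * b i\<close> sum to \<open>1\<close>, then the sum of the \<open>a i * P * b i\<close> is again a projection onto that subspace.
  Both groups and inverse monoids admit averages of this kind that commute with the representation.
\<close>

lemma semisimple_by_averaging:
  assumes "\<And>n (\<rho> :: 'a \<Rightarrow> 'k::field mat). mat_rep G n \<rho> \<Longrightarrow>
    \<exists>(I :: 'a set) a b. finite I \<and> (\<forall>i\<in>I. a i \<in> carrier_mat n n \<and> b i \<in> carrier_mat n n) \<and>
      (\<forall>W. subspace_vec n W \<and> invariant G \<rho> W \<longrightarrow> (\<forall>i\<in>I. \<forall>w\<in>W. a i *\<^sub>v w \<in> W \<and> b i *\<^sub>v w \<in> W)) \<and>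
      msum n n (\<lambda>i. a i * b i) I = 1\<^sub>m n \<and>
      (\<forall>P\<in>carrier_mat n n. \<forall>s\<in>carrier G.
         msum n n (\<lambda>i. a i * P * b i) I * \<rho> s = \<rho> s * msum n n (\<lambda>i. a i * P * b i) I)"
  shows "semisimple_reps G TYPE('k)"
  unfolding semisimple_reps_def
proof (intro allI impI)
  fix n and \<rho> :: "'a \<Rightarrow> 'k mat" and W
  assume asm: "mat_rep G n \<rho> \<and> subspace_vec n W \<and> invariant G \<rho> W"
  then have W: "subspace_vec n W" "invariant G \<rho> W" by auto
  from assms[OF conjunct1[OF asm]] obtain I :: "'a set" and a b where I: "finite I"
    and ab': "\<forall>i\<in>I. a i \<in> carrier_mat n n \<and> b i \<in> carrier_mat n n"
    and inv': "\<forall>W. subspace_vec n W \<and> invariant G \<rho> W \<longrightarrow> (\<forall>i\<in>I. \<forall>w\<in>W. a i *\<^sub>v w \<in> W \<and> b i *\<^sub>v w \<in> W)"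
    and one: "msum n n (\<lambda>i. a i * b i) I = 1\<^sub>m n"
    and comm: "\<forall>P\<in>carrier_mat n n. \<forall>s\<in>carrier G.
         msum n n (\<lambda>i. a i * P * b i) I * \<rho> s = \<rho> s * msum n n (\<lambda>i. a i * P * b i) I"
    by (elim exE conjE) (rule that; assumption)
  have ab: "a i \<in> carrier_mat n n" "b i \<in> carrier_mat n n" if "i \<in> I" for i using ab' that by auto
  have inv: "a i *\<^sub>v w \<in> W" "b i *\<^sub>v w \<in> W" if "i \<in> I" "w \<in> W" for i w using inv' W that by blast+
  have Wc: "W \<subseteq> carrier_vec n" using W by (auto simp: subspace_vec_def)
  obtain k A B where AB: "A \<in> carrier_mat n k" "B \<in> carrier_mat k n" "B * A = 1\<^sub>m k"
    "\<And>v. v \<in> carrier_vec k \<Longrightarrow> A *\<^sub>v v \<in> W" "\<And>w. w \<in> W \<Longrightarrow> A *\<^sub>v (B *\<^sub>v w) = w"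
    by (rule subspace_factor[OF W(1)]) (rule that; blast)
  define P where "P = A * B"
  have P: "P \<in> carrier_mat n n" using AB(1,2) by (simp add: P_def)
  have Pv: "P *\<^sub>v v = A *\<^sub>v (B *\<^sub>v v)" if "v \<in> carrier_vec n" for v
    unfolding P_def by (rule mat_vec_assoc) (use AB(1,2) that in auto)
  have PW: "P *\<^sub>v v \<in> W" if "v \<in> carrier_vec n" for v
    unfolding Pv[OF that] by (rule AB(4)) (use AB(2) that in auto)
  have aPb: "(a i * P * b i) *\<^sub>v v = a i *\<^sub>v (P *\<^sub>v (b i *\<^sub>v v))" if "i \<in> I" "v \<in> carrier_vec n" for i v
  proof -
    have "(a i * P * b i) *\<^sub>v v = (a i * P) *\<^sub>v (b i *\<^sub>v v)"
      by (rule mat_vec_assoc) (use ab[OF that(1)] P that(2) in auto)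
    also have "\<dots> = a i *\<^sub>v (P *\<^sub>v (b i *\<^sub>v v))"
      by (rule mat_vec_assoc) (use ab[OF that(1)] P that(2) in auto)
    finally show ?thesis .
  qed
  have aPbc: "a i * P * b i \<in> carrier_mat n n" "a i * b i \<in> carrier_mat n n" if "i \<in> I" for i
    using ab[OF that] P by auto
  show "\<exists>E\<in>carrier_mat n n. (\<forall>s\<in>carrier G. E * \<rho> s = \<rho> s * E) \<and>
        (\<forall>v\<in>carrier_vec n. E *\<^sub>v v \<in> W) \<and> (\<forall>w\<in>W. E *\<^sub>v w = w)"
  proof (intro bexI conjI ballI)
    show "msum n n (\<lambda>i. a i * P * b i) I * \<rho> s = \<rho> s * msum n n (\<lambda>i. a i * P * b i) I"
      if "s \<in> carrier G" for s using comm P that by blast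
  next
    fix v :: "'k vec" assume v: "v \<in> carrier_vec n"
    show "msum n n (\<lambda>i. a i * P * b i) I *\<^sub>v v \<in> W"
    proof (rule msum_mult_vec_mem[OF W(1) I _ v])
      fix i assume i: "i \<in> I"
      show "a i * P * b i \<in> carrier_mat n n" using aPbc[OF i] by simp
      have "b i *\<^sub>v v \<in> carrier_vec n" using ab[OF i] v by simp
      then show "a i * P * b i *\<^sub>v v \<in> W" unfolding aPb[OF i v] by (intro inv(1)[OF i] PW)
    qed
  next
    fix w assume w: "w \<in> W"
    then have wc: "w \<in> carrier_vec n" using Wc by auto
    have "msum n n (\<lambda>i. a i * P * b i) I *\<^sub>v w = msum n n (\<lambda>i. a i * b i) I *\<^sub>v w"
    proof (rule msum_mult_vec_cong[OF aPbc wc])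
      fix i assume i: "i \<in> I"
      have bw: "b i *\<^sub>v w \<in> W" by (rule inv(2)[OF i w])
      then have "P *\<^sub>v (b i *\<^sub>v w) = b i *\<^sub>v w" using Pv AB(5) Wc by auto
      then show "a i * P * b i *\<^sub>v w = a i * b i *\<^sub>v w"
        unfolding aPb[OF i wc] using mat_vec_assoc[of "a i" "b i" w] ab[OF i] wc by auto
    qed
    then show "msum n n (\<lambda>i. a i * P * b i) I *\<^sub>v w = w" using one wc by simp
  qed simp
qed

lemma mult3_carrier:
  "A \<in> carrier_mat n k \<Longrightarrow> B \<in> carrier_mat k l \<Longrightarrow> C \<in> carrier_mat l m \<Longrightarrow> A * B * C \<in> carrier_mat n m"
  by (intro carrier_matI) auto

lemma group_bij_mult_left:
  fixes G :: "('a, 'b) monoid_scheme" (structure)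
  assumes "group G" "h \<in> carrier G"
  shows "bij_betw (\<lambda>g. h \<otimes>\<^bsub>G\<^esub> g) (carrier G) (carrier G)"
proof -
  interpret group G by fact
  show ?thesis by (rule bij_betwI[of _ _ _ "\<lambda>g. inv h \<otimes> g"]) (use assms in \<open>auto simp: m_assoc[symmetric]\<close>)
qed

text \<open>
  Left translation by \<open>h\<close> permutes the terms.
\<close>

lemma group_average_commutes:
  fixes G :: "('a, 'b) monoid_scheme" (structure) and \<sigma> :: "'a \<Rightarrow> 'k::field mat"
  assumes "group G" and \<sigma>: "mat_rep G n \<sigma>" and \<psi>: "mat_rep G m \<psi>" and T: "T \<in> carrier_mat n m"
    and h: "h \<in> carrier G"
  shows "msum n m (\<lambda>g. \<sigma> g * T * \<psi> (inv\<^bsub>G\<^esub> g)) (carrier G) * \<psi> h =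
    \<sigma> h * msum n m (\<lambda>g. \<sigma> g * T * \<psi> (inv\<^bsub>G\<^esub> g)) (carrier G)"
proof -
  interpret group G by fact
  have c: "\<sigma> g \<in> carrier_mat n n" "\<psi> g \<in> carrier_mat m m" if "g \<in> carrier G" for g
    using \<sigma> \<psi> that by (auto simp: mat_rep_iff)
  have hom: "\<sigma> (g \<otimes> g') = \<sigma> g * \<sigma> g'" "\<psi> (g \<otimes> g') = \<psi> g * \<psi> g'" if "g \<in> carrier G" "g' \<in> carrier G" for g g'
    using \<sigma> \<psi> that by (auto simp: mat_rep_iff)
  have "msum n m (\<lambda>g. \<sigma> g * T * \<psi> (inv g)) (carrier G) * \<psi> h =
    msum n m (\<lambda>g. \<sigma> g * T * \<psi> (inv g) * \<psi> h) (carrier G)"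
    by (rule msum_mult) (use c h mult3_carrier[OF c(1) T c(2)] in auto)
  also have "\<dots> = msum n m (\<lambda>g. \<sigma> (h \<otimes> g) * T * \<psi> (inv (h \<otimes> g)) * \<psi> h) (carrier G)"
    by (rule msum_reindex[OF group_bij_mult_left[OF assms(1) h]])
  also have "\<dots> = msum n m (\<lambda>g. \<sigma> h * (\<sigma> g * T * \<psi> (inv g))) (carrier G)"
  proof (rule msum_cong)
    fix g assume g: "g \<in> carrier G"
    have "\<psi> (inv (h \<otimes> g)) * \<psi> h = \<psi> (inv g)"
      using g h by (simp add: hom[symmetric] inv_mult_group m_assoc)
    moreover have "\<sigma> (h \<otimes> g) * T * \<psi> (inv (h \<otimes> g)) * \<psi> h = \<sigma> (h \<otimes> g) * T * (\<psi> (inv (h \<otimes> g)) * \<psi> h)"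
      using c[of "h \<otimes> g"] c[of "inv (h \<otimes> g)"] c[OF h] g h T by (simp add: mat_assoc)
    moreover have "\<sigma> (h \<otimes> g) * T * \<psi> (inv g) = \<sigma> h * (\<sigma> g * T * \<psi> (inv g))"
      using c[of g] c[of "inv g"] c[OF h] g h T by (simp add: hom mat_assoc)
    ultimately show "\<sigma> (h \<otimes> g) * T * \<psi> (inv (h \<otimes> g)) * \<psi> h = \<sigma> h * (\<sigma> g * T * \<psi> (inv g))" by simp
  qed
  also have "\<dots> = \<sigma> h * msum n m (\<lambda>g. \<sigma> g * T * \<psi> (inv g)) (carrier G)"
    by (rule mult_msum[symmetric]) (use c h mult3_carrier[OF c(1) T c(2)] in auto)
  finally show ?thesis .
qed

text \<open>
  Maschke's theorem, with \<open>a g\<close> the matrix of \<open>g\<close> divided by the order of the group and \<open>b g\<close> the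
  matrix of the inverse of \<open>g\<close>.
\<close>

lemma group_semisimple:
  fixes G :: "('a, 'b) monoid_scheme" (structure)
  assumes "group G" "finite (carrier G)"
  shows "semisimple_reps G TYPE('k::field_char_0)"
proof (rule semisimple_by_averaging)
  interpret group G by fact
  fix n and \<rho> :: "'a \<Rightarrow> 'k mat" assume \<rho>: "mat_rep G n \<rho>"
  then have c: "\<rho> g \<in> carrier_mat n n" if "g \<in> carrier G" for g using that by (auto simp: mat_rep_iff)
  define N where "N = (of_nat (card (carrier G)) :: 'k)"
  have N: "N \<noteq> 0" using assms(2) carrier_not_empty by (simp add: N_def)
  let ?a = "\<lambda>g. (1 / N) \<cdot>\<^sub>m \<rho> g" and ?b = "\<lambda>g. \<rho> (inv g)"
  have aPb: "msum n n (\<lambda>g. ?a g * P * ?b g) (carrier G) = (1 / N) \<cdot>\<^sub>m msum n n (\<lambda>g. \<rho> g * P * ?b g) (carrier G)"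
    if "P \<in> carrier_mat n n" for P
  proof -
    have "(1 / N) \<cdot>\<^sub>m msum n n (\<lambda>g. \<rho> g * P * ?b g) (carrier G) = msum n n (\<lambda>g. (1 / N) \<cdot>\<^sub>m (\<rho> g * P * ?b g)) (carrier G)"
      by (rule msum_smult) (use mult3_carrier[OF c that c] in auto)
    also have "\<dots> = msum n n (\<lambda>g. ?a g * P * ?b g) (carrier G)"
    proof (rule msum_cong)
      fix g assume "g \<in> carrier G"
      then show "(1 / N) \<cdot>\<^sub>m (\<rho> g * P * ?b g) = ?a g * P * ?b g"
        using c[of g] c[of "inv g"] that by (simp add: mult_smult_assoc_mat[of _ n n _ n])
    qed
    finally show ?thesis ..
  qed
  have "msum n n (\<lambda>g. ?a g * ?b g) (carrier G) = msum n n (\<lambda>g. (1 / N) \<cdot>\<^sub>m 1\<^sub>m n) (carrier G)"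
  proof (rule msum_cong)
    fix g assume g: "g \<in> carrier G"
    have "\<rho> g * \<rho> (inv g) = \<rho> (g \<otimes> inv g)" using \<rho> g inv_closed[OF g] unfolding mat_rep_iff by metis
    then have "\<rho> g * \<rho> (inv g) = 1\<^sub>m n" using \<rho> g by (simp add: mat_rep_iff)
    then show "?a g * ?b g = (1 / N) \<cdot>\<^sub>m 1\<^sub>m n"
      using c[of g] c[of "inv g"] g by (simp add: mult_smult_assoc_mat[of _ n n _ n])
  qed
  also have "\<dots> = 1\<^sub>m n" using N by (intro eq_matI) (auto simp: N_def)
  finally have one: "msum n n (\<lambda>g. ?a g * ?b g) (carrier G) = 1\<^sub>m n" .
  show "\<exists>(I :: 'a set) a b. finite I \<and> (\<forall>i\<in>I. a i \<in> carrier_mat n n \<and> b i \<in> carrier_mat n n) \<and>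
      (\<forall>W. subspace_vec n W \<and> invariant G \<rho> W \<longrightarrow> (\<forall>i\<in>I. \<forall>w\<in>W. a i *\<^sub>v w \<in> W \<and> b i *\<^sub>v w \<in> W)) \<and>
      msum n n (\<lambda>i. a i * b i) I = 1\<^sub>m n \<and>
      (\<forall>P\<in>carrier_mat n n. \<forall>s\<in>carrier G.
         msum n n (\<lambda>i. a i * P * b i) I * \<rho> s = \<rho> s * msum n n (\<lambda>i. a i * P * b i) I)"
  proof (rule exI[of _ "carrier G"], rule exI[of _ ?a], rule exI[of _ ?b], intro conjI ballI allI impI)
    show "?a g \<in> carrier_mat n n" "?b g \<in> carrier_mat n n" if "g \<in> carrier G" for g
      using c that by auto
  next
    fix W g w assume W: "subspace_vec n W \<and> invariant G \<rho> W" and g: "g \<in> carrier G" and w: "w \<in> W"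
    have "w \<in> carrier_vec n" using W w by (auto simp: subspace_vec_def)
    then have "?a g *\<^sub>v w = (1 / N) \<cdot>\<^sub>v (\<rho> g *\<^sub>v w)" using c[OF g] by (intro eq_vecI) auto
    then show "?a g *\<^sub>v w \<in> W" using W g w by (auto simp: subspace_vec_def invariant_def)
    show "?b g *\<^sub>v w \<in> W" using W g w by (auto simp: invariant_def)
  next
    fix P :: "'k mat" and h assume P: "P \<in> carrier_mat n n" and h: "h \<in> carrier G"
    let ?M = "msum n n (\<lambda>g. \<rho> g * P * ?b g) (carrier G)"
    have "(1 / N) \<cdot>\<^sub>m ?M * \<rho> h = (1 / N) \<cdot>\<^sub>m (?M * \<rho> h)" by (rule mult_smult_assoc_mat) (use c[OF h] in auto)
    also have "\<dots> = (1 / N) \<cdot>\<^sub>m (\<rho> h * ?M)" by (simp only: group_average_commutes[OF assms(1) \<rho> \<rho> P h])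
    also have "\<dots> = \<rho> h * ((1 / N) \<cdot>\<^sub>m ?M)" by (rule mult_smult_distrib[symmetric]) (use c[OF h] in auto)
    finally show "msum n n (\<lambda>g. ?a g * P * ?b g) (carrier G) * \<rho> h = \<rho> h * msum n n (\<lambda>g. ?a g * P * ?b g) (carrier G)"
      unfolding aPb[OF P] .
  qed (use assms(2) one in auto)
qed

section \<open>Orthogonality of characters\<close>

definition elem_mat :: "nat \<Rightarrow> nat \<Rightarrow> nat \<Rightarrow> nat \<Rightarrow> 'k::field mat" where
  "elem_mat n m i j = mat n m (\<lambda>(a, b). if a = i \<and> b = j then 1 else 0)"

lemma elem_mat_carrier [simp]: "elem_mat n m i j \<in> carrier_mat n m"
  by (simp add: elem_mat_def)

lemma mult_elem_mat_mult:
  fixes A B :: "'k::field mat"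
  assumes "A \<in> carrier_mat n' n" "B \<in> carrier_mat m m'" "i < n" "j < m" "x < n'" "y < m'"
  shows "(A * elem_mat n m i j * B) $$ (x, y) = A $$ (x, i) * B $$ (j, y)"
proof -
  have 1: "(A * elem_mat n m i j) $$ (x, b) = (if b = j then A $$ (x, i) else 0)" if "b < m" for b
  proof -
    have "(A * elem_mat n m i j) $$ (x, b) = (\<Sum>a<n. A $$ (x, a) * elem_mat n m i j $$ (a, b))"
      using assms that by (subst index_mult_mat_sum) (auto simp: elem_mat_def)
    also have "\<dots> = (\<Sum>a<n. if a = i then (if b = j then A $$ (x, i) else 0) else 0)"
      using that by (intro sum.cong) (auto simp: elem_mat_def)
    finally show ?thesis using assms(3) by simp
  qed
  have "(A * elem_mat n m i j * B) $$ (x, y) = (\<Sum>b<m. (A * elem_mat n m i j) $$ (x, b) * B $$ (b, y))"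
    using assms by (subst index_mult_mat_sum) (auto simp: elem_mat_def)
  also have "\<dots> = (\<Sum>b<m. if b = j then A $$ (x, i) * B $$ (j, y) else 0)"
    using 1 by (intro sum.cong) auto
  finally show ?thesis using assms(4) by simp
qed

text \<open>
  Averages of elementary matrices contain all products of matrix coefficients, so that
  knowing all averages yields the sums of products of traces.
\<close>

lemma sum_mult_mat_trace:
  fixes a b :: "'i \<Rightarrow> 'k::field mat"
  assumes "\<And>g. g \<in> I \<Longrightarrow> a g \<in> carrier_mat n n" "\<And>g. g \<in> I \<Longrightarrow> b g \<in> carrier_mat m m"
  shows "(\<Sum>g\<in>I. mat_trace (a g) * mat_trace (b g)) =
    (\<Sum>i<n. \<Sum>j<m. msum n m (\<lambda>g. a g * elem_mat n m i j * b g) I $$ (i, j))"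
proof -
  have "(\<Sum>g\<in>I. mat_trace (a g) * mat_trace (b g)) = (\<Sum>g\<in>I. \<Sum>i<n. \<Sum>j<m. a g $$ (i, i) * b g $$ (j, j))"
  proof (rule sum.cong[OF refl])
    fix g assume "g \<in> I"
    then have "dim_row (a g) = n" "dim_row (b g) = m" using assms[of g] by auto
    then show "mat_trace (a g) * mat_trace (b g) = (\<Sum>i<n. \<Sum>j<m. a g $$ (i, i) * b g $$ (j, j))"
      by (simp add: mat_trace_def sum_product)
  qed
  also have "\<dots> = (\<Sum>i<n. \<Sum>g\<in>I. \<Sum>j<m. a g $$ (i, i) * b g $$ (j, j))" by (rule sum.swap)
  also have "\<dots> = (\<Sum>i<n. \<Sum>j<m. \<Sum>g\<in>I. a g $$ (i, i) * b g $$ (j, j))"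
    by (intro sum.cong refl, rule sum.swap)
  also have "\<dots> = (\<Sum>i<n. \<Sum>j<m. msum n m (\<lambda>g. a g * elem_mat n m i j * b g) I $$ (i, j))"
    by (intro sum.cong refl) (auto simp: assms mult_elem_mat_mult[of _ n n _ m m])
  finally show ?thesis .
qed

text \<open>
  Every average is an intertwiner, which vanishes by Schur's lemma.
\<close>

lemma schur_orthogonality_inequivalent:
  fixes G :: "('a, 'b) monoid_scheme" (structure) and \<sigma> :: "'a \<Rightarrow> 'k::field_char_0 mat"
  assumes G: "group G" and \<sigma>: "irreducible_rep G n \<sigma>" and \<psi>: "irreducible_rep G m \<psi>"
    and ne: "\<not> rep_equiv G n \<sigma> m \<psi>"
  shows "(\<Sum>g\<in>carrier G. character \<sigma> g * character \<psi> (inv g)) = 0"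
proof -
  interpret group G by (rule G)
  have rep: "mat_rep G n \<sigma>" "mat_rep G m \<psi>" using \<sigma> \<psi> by (auto simp: irreducible_rep_iff)
  then have c: "\<sigma> g \<in> carrier_mat n n" "\<psi> (inv g) \<in> carrier_mat m m" if "g \<in> carrier G" for g
    using that by (auto simp: mat_rep_iff)
  have "msum n m (\<lambda>g. \<sigma> g * T * \<psi> (inv g)) (carrier G) = 0\<^sub>m n m" if "T \<in> carrier_mat n m" for T
    using schur_equiv[OF \<sigma> \<psi> msum_carrier _ group_average_commutes[OF G rep that, symmetric]] ne by blast
  then show ?thesis unfolding character_def by (subst sum_mult_mat_trace[OF c]) auto
qed

text \<open>
  The hypothesis on the commutant takes the place of irreducibility, since for Specht modules it is
  the commutant that can be computed. An average of an elementary matrix is a scalar matrix, and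
  its trace determines the scalar.
\<close>

lemma schur_orthogonality_scalar_commutant:
  fixes G :: "('a, 'b) monoid_scheme" (structure) and \<rho> :: "'a \<Rightarrow> 'k::field_char_0 mat"
  assumes G: "group G" and \<rho>: "mat_rep G d \<rho>" and d: "d > 0"
    and scalar: "\<And>T. T \<in> carrier_mat d d \<Longrightarrow> (\<And>g. g \<in> carrier G \<Longrightarrow> \<rho> g * T = T * \<rho> g) \<Longrightarrow> \<exists>c. T = c \<cdot>\<^sub>m 1\<^sub>m d"
  shows "(\<Sum>g\<in>carrier G. character \<rho> g * character \<rho> (inv g)) = of_nat (card (carrier G))"
proof -
  interpret group G by (rule G)
  have c: "\<rho> g \<in> carrier_mat d d" "\<rho> (inv g) \<in> carrier_mat d d" if "g \<in> carrier G" for g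
    using \<rho> that by (auto simp: mat_rep_iff)
  let ?M = "\<lambda>i j. msum d d (\<lambda>g. \<rho> g * elem_mat d d i j * \<rho> (inv g)) (carrier G)"
  have M: "?M i j $$ (i, j) = (if i = j then of_nat (card (carrier G)) / of_nat d else 0)"
    if ij: "i < d" "j < d" for i j
  proof -
    have "\<rho> g * ?M i j = ?M i j * \<rho> g" if "g \<in> carrier G" for g
      by (rule group_average_commutes[OF G \<rho> \<rho> _ that, symmetric]) simp
    then obtain x where x: "?M i j = x \<cdot>\<^sub>m 1\<^sub>m d" using scalar[OF msum_carrier] by blast
    have "x * of_nat d = mat_trace (?M i j)" unfolding x by (subst mat_trace_smult[of _ d]) simp_all
    also have "\<dots> = (\<Sum>g\<in>carrier G. mat_trace (\<rho> g * elem_mat d d i j * \<rho> (inv g)))"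
      by (rule mat_trace_msum) (use mult3_carrier[OF c(1) elem_mat_carrier c(2)] in auto)
    also have "\<dots> = (\<Sum>g\<in>carrier G. mat_trace (elem_mat d d i j :: 'k mat))"
    proof (rule sum.cong[OF refl])
      fix g assume g: "g \<in> carrier G"
      have "\<rho> (inv g) * \<rho> g = \<rho> (inv g \<otimes> g)" using \<rho> g inv_closed[OF g] unfolding mat_rep_iff by metis
      then have one: "\<rho> (inv g) * \<rho> g = 1\<^sub>m d" using \<rho> g by (simp add: mat_rep_iff)
      let ?E = "elem_mat d d i j"
      have "\<rho> g * ?E * \<rho> (inv g) = \<rho> g * (?E * \<rho> (inv g))" using c[OF g] by (simp add: mat_assoc elem_mat_def)
      then have "mat_trace (\<rho> g * ?E * \<rho> (inv g)) = mat_trace (?E * \<rho> (inv g) * \<rho> g)"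
        using mat_trace_comm[OF c(1)[OF g] mult_carrier_mat[OF elem_mat_carrier c(2)[OF g]]] by simp
      also have "?E * \<rho> (inv g) * \<rho> g = ?E * (\<rho> (inv g) * \<rho> g)" using c[OF g] by (simp add: mat_assoc elem_mat_def)
      finally show "mat_trace (\<rho> g * ?E * \<rho> (inv g)) = mat_trace ?E"
        by (simp add: one right_mult_one_mat[OF elem_mat_carrier])
    qed
    also have "mat_trace (elem_mat d d i j :: 'k mat) = (\<Sum>a<d. if a = i then (if i = j then 1 else 0) else 0)"
      unfolding mat_trace_def by (intro sum.cong) (auto simp: elem_mat_def)
    finally have "x * of_nat d = of_nat (card (carrier G)) * (if i = j then 1 else 0)"
      using ij by simp
    then show ?thesis using d ij unfolding x by (auto simp: field_simps)
  qed
  have "(\<Sum>g\<in>carrier G. character \<rho> g * character \<rho> (inv g)) =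
      (\<Sum>i<d. \<Sum>j<d. if i = j then of_nat (card (carrier G)) / of_nat d else 0)"
    unfolding character_def
    using sum_mult_mat_trace[of "carrier G" \<rho> d "\<lambda>g. \<rho> (inv g)" d] c M by (simp del: index_msum)
  also have "\<dots> = of_nat (card (carrier G))" using d by simp
  finally show ?thesis .
qed

lemma schur_orthogonality_irreducible:
  fixes G :: "('a, 'b) monoid_scheme" (structure) and \<rho> :: "'a \<Rightarrow> 'k::{alg_closed_field, field_char_0} mat"
  assumes G: "group G" and \<rho>: "irreducible_rep G d \<rho>"
  shows "(\<Sum>g\<in>carrier G. character \<rho> g * character \<rho> (inv g)) = of_nat (card (carrier G))"
  using irreducible_repD(1,2)[OF \<rho>]
  by (rule schur_orthogonality_scalar_commutant[OF G]) (metis schur_scalar[OF \<rho>])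

text \<open>
  For a decomposition into irreducible summands, the norm of the character is the order of
  the group times the number of pairs of equivalent summands, and the diagonal pairs alone
  contribute the number of summands.
\<close>

lemma irreducible_of_character_norm:
  fixes G :: "('a, 'b) monoid_scheme" (structure) and \<rho> :: "'a \<Rightarrow> 'k::{alg_closed_field, field_char_0} mat"
  assumes G: "group G" "finite (carrier G)" and \<rho>: "mat_rep G d \<rho>"
    and norm: "(\<Sum>g\<in>carrier G. character \<rho> g * character \<rho> (inv g)) = of_nat (card (carrier G))"
  shows "irreducible_rep G d \<rho>"
proof -
  interpret group G by (rule G)
  obtain Rs where Rs: "irreducible_decomposition G d \<rho> Rs"
    using irreducible_decomposition_exists[OF group_semisimple[OF G] \<rho>] by blast
  have irr: "irreducible_rep G (fst (Rs ! i)) (snd (Rs ! i))" if "i < length Rs" for i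
    using Rs nth_mem[OF that] by (auto simp: irreducible_decomposition_def split_def)
  let ?\<chi> = "\<lambda>i. character (snd (Rs ! i))"
  let ?m = "\<lambda>i j. if rep_equiv G (fst (Rs ! i)) (snd (Rs ! i)) (fst (Rs ! j)) (snd (Rs ! j)) then 1 else 0 :: nat"
  let ?N = "of_nat (card (carrier G)) :: 'k"
  have N: "?N \<noteq> 0" using G(2) carrier_not_empty by simp
  have \<chi>: "character \<rho> g = (\<Sum>i<length Rs. ?\<chi> i g)" if "g \<in> carrier G" for g
    using character_decomposition[OF \<rho> Rs that]
    by (simp add: sum_list_sum_nth split_def atLeast0LessThan)
  have inner: "(\<Sum>g\<in>carrier G. ?\<chi> i g * ?\<chi> j (inv g)) = ?N * of_nat (?m i j)"
    if "i < length Rs" "j < length Rs" for i j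
  proof (cases "?m i j = 1")
    case True
    then have eq: "rep_equiv G (fst (Rs ! i)) (snd (Rs ! i)) (fst (Rs ! j)) (snd (Rs ! j))"
      by (auto split: if_splits)
    have "?\<chi> j (inv g) = ?\<chi> i (inv g)" if "g \<in> carrier G" for g
      using character_rep_equiv[OF eq irreducible_repD(1)[OF irr] irreducible_repD(1)[OF irr]] that
        \<open>i < length Rs\<close> \<open>j < length Rs\<close> by simp
    then show ?thesis using schur_orthogonality_irreducible[OF G(1) irr[OF that(1)]] True by simp
  next
    case False
    then show ?thesis using schur_orthogonality_inequivalent[OF G(1) irr[OF that(1)] irr[OF that(2)]]
      by (auto split: if_splits)
  qed
  have "?N * of_nat (\<Sum>i<length Rs. \<Sum>j<length Rs. ?m i j) =
      (\<Sum>i<length Rs. \<Sum>j<length Rs. \<Sum>g\<in>carrier G. ?\<chi> i g * ?\<chi> j (inv g))"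
    unfolding of_nat_sum sum_distrib_left by (rule sum.cong[OF refl], rule sum.cong[OF refl], rule inner[symmetric]) simp_all
  also have "\<dots> = (\<Sum>i<length Rs. \<Sum>g\<in>carrier G. \<Sum>j<length Rs. ?\<chi> i g * ?\<chi> j (inv g))"
    by (intro sum.cong refl, rule sum.swap)
  also have "\<dots> = (\<Sum>g\<in>carrier G. \<Sum>i<length Rs. \<Sum>j<length Rs. ?\<chi> i g * ?\<chi> j (inv g))"
    by (rule sum.swap)
  also have "\<dots> = (\<Sum>g\<in>carrier G. character \<rho> g * character \<rho> (inv g))"
    by (rule sum.cong[OF refl]) (simp only: \<chi> inv_closed sum_product)
  finally have "of_nat (\<Sum>i<length Rs. \<Sum>j<length Rs. ?m i j) = (1 :: 'k)"
    using norm N by simp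
  then have one: "(\<Sum>i<length Rs. \<Sum>j<length Rs. ?m i j) = 1"
    unfolding of_nat_eq_1_iff .
  have "length Rs \<le> (\<Sum>i<length Rs. \<Sum>j<length Rs. ?m i j)"
  proof -
    have "(\<Sum>i<length Rs. 1 :: nat) \<le> (\<Sum>i<length Rs. \<Sum>j<length Rs. ?m i j)"
    proof (rule sum_mono)
      fix i assume i: "i \<in> {..<length Rs}"
      then have "?m i i = 1" using rep_equiv_refl[OF irreducible_repD(1)[OF irr]] by auto
      then show "1 \<le> (\<Sum>j<length Rs. ?m i j)" using i member_le_sum[of i "{..<length Rs}" "?m i"] by simp
    qed
    then show ?thesis by simp
  qed
  then have "length Rs \<le> 1" using one by simp
  moreover have "length Rs \<noteq> 0"
  proof
    assume "length Rs = 0"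
    then show False using one by simp
  qed
  ultimately have "length Rs = 1" by linarith
  then obtain d' \<sigma> where R: "Rs = [(d', \<sigma>)]" by (cases Rs) auto
  have "direct_sum [(d', \<sigma>)] = \<sigma>" by (rule ext) (simp add: direct_sum_def del: diag_block_mat.simps)
  then have "rep_equiv G d \<rho> d' \<sigma>" "irreducible_rep G d' \<sigma>"
    using Rs by (auto simp: irreducible_decomposition_def R)
  then show ?thesis using irreducible_rep_equiv[OF _ \<rho>] by blast
qed

section \<open>Partial permutations and the groupoid basis\<close>

text \<open>
  The subsets with and without the point \<open>x\<close> cancel in pairs.
\<close>

lemma sum_Pow_alternating_cancel:
  fixes f :: "'a set \<Rightarrow> 'k::comm_ring_1"
  assumes "finite D" "x \<in> D" and f: "\<And>Z. Z \<subseteq> D - {x} \<Longrightarrow> f (insert x Z) = f Z"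
  shows "(\<Sum>Z\<in>Pow D. (-1) ^ card (D - Z) * f Z) = 0"
proof -
  let ?E = "D - {x}"
  have D: "D = insert x ?E" using assms(2) by auto
  have split: "Pow D = Pow ?E \<union> insert x ` Pow ?E" using Pow_insert[of x ?E] D by simp
  have "(\<Sum>Z\<in>Pow D. (-1) ^ card (D - Z) * f Z) =
      (\<Sum>Z\<in>Pow ?E. (-1) ^ card (D - Z) * f Z) + (\<Sum>Z\<in>insert x ` Pow ?E. (-1) ^ card (D - Z) * f Z)"
    unfolding split by (rule sum.union_disjoint) (use assms(1) in auto)
  also have "(\<Sum>Z\<in>insert x ` Pow ?E. (-1) ^ card (D - Z) * f Z) =
      (\<Sum>Z\<in>Pow ?E. (-1) ^ card (D - insert x Z) * f (insert x Z))"
    by (rule sum.reindex_cong[of "insert x"]) (auto simp: inj_on_def)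
  also have "\<dots> = (\<Sum>Z\<in>Pow ?E. - ((-1) ^ card (D - Z) * f Z))"
  proof (rule sum.cong[OF refl])
    fix Z assume Z: "Z \<in> Pow ?E"
    then have "D - Z = insert x (D - insert x Z)" using assms(2) by auto
    then have "card (D - Z) = Suc (card (D - insert x Z))"
      using assms(1) by (metis card_insert_disjoint finite_Diff insertI1 Diff_iff)
    then show "(-1) ^ card (D - insert x Z) * f (insert x Z) = - ((-1) ^ card (D - Z) * f Z)"
      using f Z by simp
  qed
  also have "(\<Sum>Z\<in>Pow ?E. (-1) ^ card (D - Z) * f Z) + \<dots> = 0"
    by (simp add: sum_negf)
  finally show ?thesis .
qed

lemma sum_interval_alternating:
  assumes "finite X" "Y \<subseteq> X"
  shows "(\<Sum>Z\<in>{Z. Y \<subseteq> Z \<and> Z \<subseteq> X}. (-1) ^ card (Z - Y)) = (if Y = X then 1 else 0 :: 'k::comm_ring_1)"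
proof -
  let ?D = "X - Y"
  have "(\<Sum>Z\<in>{Z. Y \<subseteq> Z \<and> Z \<subseteq> X}. (-1) ^ card (Z - Y)) = (\<Sum>W\<in>Pow ?D. (-1) ^ card (?D - W) * (1 :: 'k))"
    by (rule sum.reindex_bij_witness[of _ "\<lambda>W. X - W" "\<lambda>Z. X - Z"])
      (use assms(2) in \<open>auto intro!: arg_cong[of _ _ card] arg_cong[of _ _ "\<lambda>k. (-1) ^ k"]\<close>)
  also have "\<dots> = (if Y = X then 1 else 0)"
  proof (cases "Y = X")
    case False
    then obtain x where "x \<in> ?D" using assms(2) by auto
    then show ?thesis using sum_Pow_alternating_cancel[of ?D x "\<lambda>_. 1"] assms(1) False by simp
  qed simp
  finally show ?thesis .
qed

lemma Id_on_comp: "Id_on Y O Id_on Z = Id_on (Y \<inter> Z)" by auto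

lemma Id_on_eq_iff [simp]: "Id_on Y = Id_on Z \<longleftrightarrow> Y = Z" by (auto simp: Id_on_def)

lemma Id_on_subset_iff [simp]: "Id_on Y \<subseteq> Id_on Z \<longleftrightarrow> Y \<subseteq> Z" by (auto simp: Id_on_def)

lemma Id_on_O: "Domain s \<subseteq> Z \<Longrightarrow> Id_on Z O s = s" by auto

lemma O_Id_on: "Range s \<subseteq> Z \<Longrightarrow> s O Id_on Z = s" by auto

lemma pperms_comp_converse: "s \<in> pperms n \<Longrightarrow> s O s\<inverse> = Id_on (Domain s)"
  unfolding pperms_def single_valued_def by (auto simp: Id_on_iff)

lemma pperms_converse_comp: "s \<in> pperms n \<Longrightarrow> s\<inverse> O s = Id_on (Range s)"
  unfolding pperms_def single_valued_def by (auto simp: Id_on_iff)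

lemma pperms_Id_on: "Z \<subseteq> {1..n} \<Longrightarrow> Id_on Z \<in> pperms n"
  by (auto simp: pperms_def single_valued_def)

lemma idems_pperms: "idems (pperms n) = Id_on ` Pow {1..n}"
proof
  show "idems (pperms n) \<subseteq> Id_on ` Pow {1..n}"
  proof
    fix e assume e: "e \<in> idems (pperms n)"
    then have p: "e \<in> pperms n" and ee: "e O e = e" by (auto simp: idems_def)
    have "x = y" if "(x, y) \<in> e" for x y
    proof -
      from that ee have "(x, y) \<in> e O e" by simp
      then obtain z where "(x, z) \<in> e" "(z, y) \<in> e" by blast
      moreover from this that p have "z = y" unfolding pperms_def single_valued_def by blast
      ultimately show ?thesis using that p unfolding pperms_def single_valued_def by blast
    qed
    then have "e = Id_on (Domain e)" by auto
    moreover have "Domain e \<subseteq> {1..n}" using p by (auto simp: pperms_def)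
    ultimately show "e \<in> Id_on ` Pow {1..n}" by blast
  qed
  show "Id_on ` Pow {1..n} \<subseteq> idems (pperms n)"
    using pperms_Id_on by (auto simp: idems_def)
qed

lemma idem_dom_pperms: "s \<in> pperms n \<Longrightarrow> idem_dom s = Id_on (Domain s)"
  and idem_ran_pperms: "s \<in> pperms n \<Longrightarrow> idem_ran s = Id_on (Range s)"
  by (simp_all add: idem_dom_def idem_ran_def pperms_comp_converse pperms_converse_comp)

lemma rel_monoid_simps [simp]:
  "carrier (rel_monoid S e) = S" "\<one>\<^bsub>rel_monoid S e\<^esub> = e" "s \<otimes>\<^bsub>rel_monoid S e\<^esub> t = s O t"
  by (simp_all add: rel_monoid_def)

locale full_inverse_monoid =
  fixes n :: nat and S :: "nat rel set"
  assumes inverse_subsemigroup: "inverse_subsemigroup n S"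
    and idems_eq: "idems S = idems (pperms n)"
begin

abbreviation M :: "nat rel monoid" where "M \<equiv> rel_monoid S (Id_on {1..n})"

lemma S_pperms: "s \<in> S \<Longrightarrow> s \<in> pperms n"
  and S_comp: "s \<in> S \<Longrightarrow> t \<in> S \<Longrightarrow> s O t \<in> S"
  and S_converse: "s \<in> S \<Longrightarrow> s\<inverse> \<in> S"
  using inverse_subsemigroup by (auto simp: inverse_subsemigroup_def)

lemma S_Id_on: "Z \<subseteq> {1..n} \<Longrightarrow> Id_on Z \<in> S"
  using idems_eq idems_pperms[of n] by (auto simp: idems_def)

lemma Domain_S: "s \<in> S \<Longrightarrow> Domain s \<subseteq> {1..n}" and Range_S: "s \<in> S \<Longrightarrow> Range s \<subseteq> {1..n}"
  using S_pperms by (auto simp: pperms_def)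

lemma finite_Domain_S: "s \<in> S \<Longrightarrow> finite (Domain s)"
  using Domain_S finite_subset by blast

lemma finite_S: "finite S"
proof (rule finite_subset)
  show "S \<subseteq> Pow ({1..n} \<times> {1..n})" using S_pperms by (auto simp: pperms_def)
qed simp

lemma S_inj: "s \<in> S \<Longrightarrow> (x, y) \<in> s \<Longrightarrow> (x, z) \<in> s \<Longrightarrow> y = z"
  and S_inj': "s \<in> S \<Longrightarrow> (x, z) \<in> s \<Longrightarrow> (y, z) \<in> s \<Longrightarrow> x = y"
  using S_pperms by (auto simp: pperms_def single_valued_def)

lemma comp_converse: "s \<in> S \<Longrightarrow> s O s\<inverse> = Id_on (Domain s)"
  and converse_comp: "s \<in> S \<Longrightarrow> s\<inverse> O s = Id_on (Range s)"
  using S_pperms pperms_comp_converse pperms_converse_comp by blast+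

lemma rep_M:
  assumes "mat_rep M d \<sigma>"
  shows "s \<in> S \<Longrightarrow> \<sigma> s \<in> carrier_mat d d" "s \<in> S \<Longrightarrow> t \<in> S \<Longrightarrow> \<sigma> (s O t) = \<sigma> s * \<sigma> t"
    "\<sigma> (Id_on {1..n}) = 1\<^sub>m d"
  using assms by (auto simp: mat_rep_iff)

text \<open>
  The matrix of the element \<open>\<Sum>\<^sub>t \<mu>(t, s) t\<close> of the semigroup algebra, where \<open>t\<close> runs over the
  restrictions of \<open>s\<close>. These elements form the groupoid basis of the algebra.
\<close>

definition bracket :: "nat \<Rightarrow> (nat rel \<Rightarrow> 'k::field mat) \<Rightarrow> nat rel \<Rightarrow> 'k mat" where
  "bracket d \<sigma> s = msum d d (\<lambda>Z. (-1) ^ card (Domain s - Z) \<cdot>\<^sub>m \<sigma> (Id_on Z O s)) (Pow (Domain s))"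

lemma bracket_carrier [simp]: "bracket d \<sigma> s \<in> carrier_mat d d"
  and dim_bracket [simp]: "dim_row (bracket d \<sigma> s) = d" "dim_col (bracket d \<sigma> s) = d"
  by (simp_all add: bracket_def)

lemma S_restrict: "s \<in> S \<Longrightarrow> Z \<subseteq> Domain s \<Longrightarrow> Id_on Z O s \<in> S"
  using S_comp S_Id_on Domain_S by (meson order_trans)

lemma bracket_term_carrier:
  "mat_rep M d \<sigma> \<Longrightarrow> s \<in> S \<Longrightarrow> Z \<in> Pow (Domain s) \<Longrightarrow> c \<cdot>\<^sub>m \<sigma> (Id_on Z O s) \<in> carrier_mat d d"
  using rep_M(1)[of d \<sigma>] S_restrict by auto

lemma index_bracket:
  assumes "mat_rep M d \<sigma>" "s \<in> S" "a < d" "b < d"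
  shows "bracket d \<sigma> s $$ (a, b) = (\<Sum>Z\<in>Pow (Domain s). (-1) ^ card (Domain s - Z) * \<sigma> (Id_on Z O s) $$ (a, b))"
proof -
  have "((-1) ^ card (Domain s - Z) \<cdot>\<^sub>m \<sigma> (Id_on Z O s)) $$ (a, b) =
      (-1) ^ card (Domain s - Z) * \<sigma> (Id_on Z O s) $$ (a, b)" if "Z \<in> Pow (Domain s)" for Z
    using rep_M(1)[OF assms(1) S_restrict[OF assms(2)], of Z] that assms(3,4) by auto
  then show ?thesis using assms(3,4) by (simp add: bracket_def)
qed

text \<open>
  If \<open>s\<close> maps a point outside of the domain of \<open>t\<close>, then adding that point to a restriction does
  not change the product with \<open>t\<close>, and the terms cancel in pairs.
\<close>

lemma bracket_mult_rep:
  fixes \<sigma> :: "nat rel \<Rightarrow> 'k::field mat"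
  assumes \<sigma>: "mat_rep M d \<sigma>" and s: "s \<in> S" and t: "t \<in> S"
  shows "bracket d \<sigma> s * \<sigma> t = (if Range s \<subseteq> Domain t then bracket d \<sigma> (s O t) else 0\<^sub>m d d)"
proof (rule eq_matI)
  let ?R = "if Range s \<subseteq> Domain t then bracket d \<sigma> (s O t) else 0\<^sub>m d d"
  fix a b assume "a < dim_row ?R" "b < dim_col ?R"
  then have ab: "a < d" "b < d" by (auto split: if_splits)
  have "bracket d \<sigma> s * \<sigma> t =
    msum d d (\<lambda>Z. ((-1) ^ card (Domain s - Z) \<cdot>\<^sub>m \<sigma> (Id_on Z O s)) * \<sigma> t) (Pow (Domain s))"
    unfolding bracket_def by (rule msum_mult[OF rep_M(1)[OF \<sigma> t] bracket_term_carrier[OF \<sigma> s]])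
  then have "(bracket d \<sigma> s * \<sigma> t) $$ (a, b) =
      (\<Sum>Z\<in>Pow (Domain s). (((-1) ^ card (Domain s - Z) \<cdot>\<^sub>m \<sigma> (Id_on Z O s)) * \<sigma> t) $$ (a, b))"
    using ab by simp
  also have "\<dots> = (\<Sum>Z\<in>Pow (Domain s). (-1) ^ card (Domain s - Z) * \<sigma> (Id_on Z O s O t) $$ (a, b))"
  proof (rule sum.cong[OF refl])
    fix Z assume Z: "Z \<in> Pow (Domain s)"
    have r: "Id_on Z O s \<in> S" using S_restrict[OF s] Z by simp
    have "\<sigma> (Id_on Z O s O t) = \<sigma> (Id_on Z O s) * \<sigma> t"
      using rep_M(2)[OF \<sigma> r t] by (simp add: O_assoc)
    then show "(((-1) ^ card (Domain s - Z) \<cdot>\<^sub>m \<sigma> (Id_on Z O s)) * \<sigma> t) $$ (a, b) =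
      (-1) ^ card (Domain s - Z) * \<sigma> (Id_on Z O s O t) $$ (a, b)"
      using mult_smult_assoc_mat[OF rep_M(1)[OF \<sigma> r] rep_M(1)[OF \<sigma> t]] rep_M(1)[OF \<sigma> r] rep_M(1)[OF \<sigma> t] ab
      by simp
  qed
  also have "\<dots> = ?R $$ (a, b)"
  proof (cases "Range s \<subseteq> Domain t")
    case True
    then have "Domain (s O t) = Domain s" by blast
    then show ?thesis using True index_bracket[OF \<sigma> S_comp[OF s t] ab] by simp
  next
    case False
    then obtain x y where x: "(x, y) \<in> s" "y \<notin> Domain t" by auto
    have "(\<Sum>Z\<in>Pow (Domain s). (-1) ^ card (Domain s - Z) * \<sigma> (Id_on Z O s O t) $$ (a, b)) = 0"
    proof (rule sum_Pow_alternating_cancel[OF finite_Domain_S[OF s]])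
      show "x \<in> Domain s" using x by auto
      fix Z
      have "Id_on (insert x Z) O s O t = Id_on Z O s O t"
      proof
        show "Id_on (insert x Z) O s O t \<subseteq> Id_on Z O s O t" using x S_inj[OF s x(1)] by blast
        show "Id_on Z O s O t \<subseteq> Id_on (insert x Z) O s O t" by blast
      qed
      then show "\<sigma> (Id_on (insert x Z) O s O t) $$ (a, b) = \<sigma> (Id_on Z O s O t) $$ (a, b)" by simp
    qed
    then show ?thesis using False ab by simp
  qed
  finally show "(bracket d \<sigma> s * \<sigma> t) $$ (a, b) = ?R $$ (a, b)" .
qed (use rep_M(1)[OF \<sigma> t] in \<open>auto split: if_splits\<close>)

text \<open>
  If the domain of \<open>s\<close> lies in the range of \<open>t\<close>, then pulling back along \<open>t\<close> matches the
  restrictions of \<open>s\<close> with those of \<open>t O s\<close>; otherwise the terms cancel in pairs.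
\<close>

lemma rep_mult_bracket:
  fixes \<sigma> :: "nat rel \<Rightarrow> 'k::field mat"
  assumes \<sigma>: "mat_rep M d \<sigma>" and s: "s \<in> S" and t: "t \<in> S"
  shows "\<sigma> t * bracket d \<sigma> s = (if Domain s \<subseteq> Range t then bracket d \<sigma> (t O s) else 0\<^sub>m d d)"
proof (rule eq_matI)
  let ?R = "if Domain s \<subseteq> Range t then bracket d \<sigma> (t O s) else 0\<^sub>m d d"
  fix a b assume "a < dim_row ?R" "b < dim_col ?R"
  then have ab: "a < d" "b < d" by (auto split: if_splits)
  have "\<sigma> t * bracket d \<sigma> s =
    msum d d (\<lambda>Z. \<sigma> t * ((-1) ^ card (Domain s - Z) \<cdot>\<^sub>m \<sigma> (Id_on Z O s))) (Pow (Domain s))"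
    unfolding bracket_def by (rule mult_msum[OF rep_M(1)[OF \<sigma> t] bracket_term_carrier[OF \<sigma> s]])
  then have "(\<sigma> t * bracket d \<sigma> s) $$ (a, b) =
      (\<Sum>Z\<in>Pow (Domain s). (\<sigma> t * ((-1) ^ card (Domain s - Z) \<cdot>\<^sub>m \<sigma> (Id_on Z O s))) $$ (a, b))"
    using ab by simp
  also have "\<dots> = (\<Sum>Z\<in>Pow (Domain s). (-1) ^ card (Domain s - Z) * \<sigma> (t O Id_on Z O s) $$ (a, b))"
  proof (rule sum.cong[OF refl])
    fix Z assume Z: "Z \<in> Pow (Domain s)"
    have r: "Id_on Z O s \<in> S" using S_restrict[OF s] Z by simp
    have "\<sigma> (t O Id_on Z O s) = \<sigma> t * \<sigma> (Id_on Z O s)"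
      using rep_M(2)[OF \<sigma> t r] by simp
    then show "(\<sigma> t * ((-1) ^ card (Domain s - Z) \<cdot>\<^sub>m \<sigma> (Id_on Z O s))) $$ (a, b) =
      (-1) ^ card (Domain s - Z) * \<sigma> (t O Id_on Z O s) $$ (a, b)"
      using mult_smult_distrib[OF rep_M(1)[OF \<sigma> t] rep_M(1)[OF \<sigma> r]] rep_M(1)[OF \<sigma> r] rep_M(1)[OF \<sigma> t] ab
      by simp
  qed
  also have "\<dots> = ?R $$ (a, b)"
  proof (cases "Domain s \<subseteq> Range t")
    case True
    have inj: "inj_on (\<lambda>x. THE y. (y, x) \<in> t) (Range t)"
    proof (rule inj_onI)
      have the: "((THE y. (y, x) \<in> t), x) \<in> t" if "x \<in> Range t" for x
        using that S_inj'[OF t] by (auto intro: theI2)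
      fix x x' assume "x \<in> Range t" "x' \<in> Range t" "(THE y. (y, x) \<in> t) = (THE y. (y, x') \<in> t)"
      then show "x = x'" using the[of x] the[of x'] S_inj[OF t] by metis
    qed
    have img: "t\<inverse> `` Z = (\<lambda>x. THE y. (y, x) \<in> t) ` Z" if "Z \<subseteq> Range t" for Z
    proof -
      have the: "(THE y. (y, x) \<in> t) = y" if "(y, x) \<in> t" for x y
        using that S_inj'[OF t] by blast
      show ?thesis using that by (force simp: the)
    qed
    have card_img: "card (t\<inverse> `` Z) = card Z" if "Z \<subseteq> Range t" for Z
      unfolding img[OF that] by (rule card_image[OF inj_on_subset[OF inj that]])
    have bij: "bij_betw (\<lambda>Z. t\<inverse> `` Z) (Pow (Domain s)) (Pow (Domain (t O s)))"
    proof (rule bij_betwI[of _ _ _ "\<lambda>Y. t `` Y"])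
      show "(\<lambda>Y. t `` Y) \<in> Pow (Domain (t O s)) \<rightarrow> Pow (Domain s)"
        using S_inj[OF t] by (auto, blast)
      show "(\<lambda>Z. t\<inverse> `` Z) \<in> Pow (Domain s) \<rightarrow> Pow (Domain (t O s))" by (rule funcsetI) blast
      show "t `` (t\<inverse> `` Z) = Z" if "Z \<in> Pow (Domain s)" for Z
      proof
        show "t `` (t\<inverse> `` Z) \<subseteq> Z" using S_inj[OF t] by blast
        show "Z \<subseteq> t `` (t\<inverse> `` Z)" using that True by blast
      qed
      show "t\<inverse> `` (t `` Y) = Y" if "Y \<in> Pow (Domain (t O s))" for Y
      proof
        show "t\<inverse> `` (t `` Y) \<subseteq> Y" using S_inj'[OF t] by blast
        show "Y \<subseteq> t\<inverse> `` (t `` Y)" using that by blast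
      qed
    qed
    have "bracket d \<sigma> (t O s) $$ (a, b) = (\<Sum>Y\<in>Pow (Domain (t O s)).
        (-1) ^ card (Domain (t O s) - Y) * \<sigma> (Id_on Y O t O s) $$ (a, b))"
      by (rule index_bracket[OF \<sigma> S_comp[OF t s] ab])
    also have "\<dots> = (\<Sum>Z\<in>Pow (Domain s).
        (-1) ^ card (Domain (t O s) - t\<inverse> `` Z) * \<sigma> (Id_on (t\<inverse> `` Z) O t O s) $$ (a, b))"
      by (rule sum.reindex_bij_betw[OF bij, symmetric])
    also have "\<dots> = (\<Sum>Z\<in>Pow (Domain s). (-1) ^ card (Domain s - Z) * \<sigma> (t O Id_on Z O s) $$ (a, b))"
    proof (rule sum.cong[OF refl])
      fix Z assume Z: "Z \<in> Pow (Domain s)"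
      have "Id_on (t\<inverse> `` Z) O t = t O Id_on Z"
      proof
        show "Id_on (t\<inverse> `` Z) O t \<subseteq> t O Id_on Z" using S_inj[OF t] by blast
        show "t O Id_on Z \<subseteq> Id_on (t\<inverse> `` Z) O t" by blast
      qed
      then have "Id_on (t\<inverse> `` Z) O t O s = t O Id_on Z O s"
        by (simp only: O_assoc[symmetric])
      moreover have "Domain (t O s) - t\<inverse> `` Z = t\<inverse> `` (Domain s - Z)"
      proof
        show "Domain (t O s) - t\<inverse> `` Z \<subseteq> t\<inverse> `` (Domain s - Z)" by blast
        show "t\<inverse> `` (Domain s - Z) \<subseteq> Domain (t O s) - t\<inverse> `` Z" using S_inj[OF t] by blast
      qed
      moreover have "card (t\<inverse> `` (Domain s - Z)) = card (Domain s - Z)"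
        by (rule card_img) (use True in auto)
      ultimately show "(-1) ^ card (Domain (t O s) - t\<inverse> `` Z) * \<sigma> (Id_on (t\<inverse> `` Z) O t O s) $$ (a, b) =
          (-1) ^ card (Domain s - Z) * \<sigma> (t O Id_on Z O s) $$ (a, b)" by simp
    qed
    finally show ?thesis using True by simp
  next
    case False
    then obtain x where x: "x \<in> Domain s" "x \<notin> Range t" by auto
    have "(\<Sum>Z\<in>Pow (Domain s). (-1) ^ card (Domain s - Z) * \<sigma> (t O Id_on Z O s) $$ (a, b)) = 0"
    proof (rule sum_Pow_alternating_cancel[OF finite_Domain_S[OF s] x(1)])
      fix Z
      have "t O Id_on (insert x Z) O s = t O Id_on Z O s" using x by auto
      then show "\<sigma> (t O Id_on (insert x Z) O s) $$ (a, b) = \<sigma> (t O Id_on Z O s) $$ (a, b)" by simp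
    qed
    then show ?thesis using False ab by simp
  qed
  finally show "(\<sigma> t * bracket d \<sigma> s) $$ (a, b) = ?R $$ (a, b)" .
qed (use rep_M(1)[OF \<sigma> t] in \<open>auto split: if_splits\<close>)

text \<open>
  Moebius inversion at the identity element.
\<close>

lemma sum_bracket_idems:
  assumes \<sigma>: "mat_rep M d \<sigma>"
  shows "msum d d (\<lambda>Z. bracket d \<sigma> (Id_on Z)) (Pow {1..n}) = 1\<^sub>m d"
proof (rule eq_matI)
  fix a b assume "a < dim_row (1\<^sub>m d :: 'a mat)" "b < dim_col (1\<^sub>m d :: 'a mat)"
  then have ab: "a < d" "b < d" by auto
  have "msum d d (\<lambda>Z. bracket d \<sigma> (Id_on Z)) (Pow {1..n}) $$ (a, b) =
    (\<Sum>Z\<in>Pow {1..n}. \<Sum>Y\<in>{Y\<in>Pow {1..n}. Y \<subseteq> Z}. (-1) ^ card (Z - Y) * \<sigma> (Id_on Y) $$ (a, b))"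
    using ab by (auto simp: index_bracket[OF \<sigma> S_Id_on] Id_on_comp intro!: sum.cong arg_cong[of _ _ \<sigma>]
       arg_cong[of _ _ "\<lambda>A. A $$ (a, b)"])
  also have "\<dots> = (\<Sum>Y\<in>Pow {1..n}. \<Sum>Z\<in>{Z\<in>Pow {1..n}. Y \<subseteq> Z}. (-1) ^ card (Z - Y) * \<sigma> (Id_on Y) $$ (a, b))"
    by (rule sum.swap_restrict) auto
  also have "\<dots> = (\<Sum>Y\<in>Pow {1..n}. if Y = {1..n} then \<sigma> (Id_on Y) $$ (a, b) else 0)"
  proof (rule sum.cong[OF refl])
    fix Y assume "Y \<in> Pow {1..n}"
    moreover have "{Z\<in>Pow {1..n}. Y \<subseteq> Z} = {Z. Y \<subseteq> Z \<and> Z \<subseteq> {1..n}}" by auto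
    ultimately show "(\<Sum>Z\<in>{Z\<in>Pow {1..n}. Y \<subseteq> Z}. (-1) ^ card (Z - Y) * \<sigma> (Id_on Y) $$ (a, b)) =
       (if Y = {1..n} then \<sigma> (Id_on Y) $$ (a, b) else 0)"
      by (simp add: sum_distrib_right[symmetric] sum_interval_alternating)
  qed
  also have "\<dots> = 1\<^sub>m d $$ (a, b)" by (simp add: rep_M(3)[OF \<sigma>] del: One_nat_def)
  finally show "msum d d (\<lambda>Z. bracket d \<sigma> (Id_on Z)) (Pow {1..n}) $$ (a, b) = 1\<^sub>m d $$ (a, b)" .
qed auto

text \<open>
  In the expansion of the second factor only the full restriction survives.
\<close>

lemma bracket_mult_bracket_converse:
  assumes \<sigma>: "mat_rep M d \<sigma>" and s: "s \<in> S"
  shows "bracket d \<sigma> s * bracket d \<sigma> (s\<inverse>) = bracket d \<sigma> (Id_on (Domain s))"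
proof -
  let ?f = "\<lambda>Z. bracket d \<sigma> s * ((-1) ^ card (Domain (s\<inverse>) - Z) \<cdot>\<^sub>m \<sigma> (Id_on Z O s\<inverse>))"
  have s': "s\<inverse> \<in> S" by (rule S_converse[OF s])
  have f: "?f Z = (-1) ^ card (Range s - Z) \<cdot>\<^sub>m
      (if Range s \<subseteq> Z then bracket d \<sigma> (s O Id_on Z O s\<inverse>) else 0\<^sub>m d d)" if "Z \<in> Pow (Range s)" for Z
  proof -
    have r: "Id_on Z O s\<inverse> \<in> S" using S_restrict[OF s'] that by simp
    have "Domain (Id_on Z O s\<inverse>) = Z" using that by blast
    then show ?thesis using mult_smult_distrib[OF bracket_carrier rep_M(1)[OF \<sigma> r]] bracket_mult_rep[OF \<sigma> s r] by simp
  qed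
  have "bracket d \<sigma> s * bracket d \<sigma> (s\<inverse>) = msum d d ?f (Pow (Domain (s\<inverse>)))"
    unfolding bracket_def[of d \<sigma> "s\<inverse>"]
    by (rule mult_msum[OF bracket_carrier bracket_term_carrier[OF \<sigma> s']])
  also have "\<dots> = msum d d ?f {Range s}"
  proof (rule msum_mono_neutral[symmetric])
    fix Z assume "Z \<in> Pow (Domain (s\<inverse>)) - {Range s}"
    then have Z: "Z \<in> Pow (Range s)" "\<not> Range s \<subseteq> Z" by auto
    show "?f Z = 0\<^sub>m d d" using Z(2) by (subst f[OF Z(1)]) auto
  qed (use finite_Domain_S[OF s'] in auto)
  also have "\<dots> = ?f (Range s)" by (intro eq_matI) (use rep_M(1)[OF \<sigma> s'] in \<open>auto simp: f Id_on_O\<close>)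
  also have "\<dots> = bracket d \<sigma> (s O Id_on (Range s) O s\<inverse>)" by (subst f) (auto intro!: eq_matI)
  also have "s O Id_on (Range s) O s\<inverse> = Id_on (Domain s)"
    using comp_converse[OF s] by (simp add: Id_on_O)
  finally show ?thesis .
qed

end

section \<open>Semisimplicity of inverse monoids of partial permutations\<close>

context full_inverse_monoid begin

lemma bij_betw_left_translation:
  assumes t: "t \<in> S"
  shows "bij_betw (\<lambda>s. t O s) {s \<in> S. Domain s \<subseteq> Range t} {s \<in> S. Domain s \<subseteq> Domain t}"
proof (rule bij_betwI[of _ _ _ "\<lambda>s. t\<inverse> O s"])
  show "(\<lambda>s. t O s) \<in> {s \<in> S. Domain s \<subseteq> Range t} \<rightarrow> {s \<in> S. Domain s \<subseteq> Domain t}"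
    using S_comp[OF t] by auto
  show "(\<lambda>s. t\<inverse> O s) \<in> {s \<in> S. Domain s \<subseteq> Domain t} \<rightarrow> {s \<in> S. Domain s \<subseteq> Range t}"
    using S_comp[OF S_converse[OF t]] by auto
  show "t\<inverse> O (t O s) = s" if "s \<in> {s \<in> S. Domain s \<subseteq> Range t}" for s
    using that Id_on_O[of s "Range t"] converse_comp[OF t] by (simp flip: O_assoc)
  show "t O (t\<inverse> O s) = s" if "s \<in> {s \<in> S. Domain s \<subseteq> Domain t}" for s
    using that Id_on_O[of s "Domain t"] comp_converse[OF t] by (simp flip: O_assoc)
qed

text \<open>
  The weights in the average over the groupoid are invariant under left translation.
\<close>

lemma card_domain_class:
  assumes t: "t \<in> S" and s: "s \<in> S" "Domain s \<subseteq> Range t"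
  shows "card {u \<in> S. Domain u = Domain (t O s)} = card {u \<in> S. Domain u = Domain s}"
proof -
  have "bij_betw (\<lambda>u. t O u) {u \<in> S. Domain u = Domain s} {u \<in> S. Domain u = Domain (t O s)}"
  proof (rule bij_betw_subset[OF bij_betw_left_translation[OF t]])
    show "(\<lambda>u. t O u) ` {u \<in> S. Domain u = Domain s} = {u \<in> S. Domain u = Domain (t O s)}"
    proof
      show "(\<lambda>u. t O u) ` {u \<in> S. Domain u = Domain s} \<subseteq> {u \<in> S. Domain u = Domain (t O s)}"
        using S_comp[OF t] by blast
      show "{u \<in> S. Domain u = Domain (t O s)} \<subseteq> (\<lambda>u. t O u) ` {u \<in> S. Domain u = Domain s}"
      proof
        fix u assume u: "u \<in> {u \<in> S. Domain u = Domain (t O s)}"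
        then have "Domain u \<subseteq> Domain t" by blast
        then have "u = t O (t\<inverse> O u)"
          using Id_on_O[of u "Domain t"] comp_converse[OF t] by (simp flip: O_assoc)
        moreover have "Domain (t\<inverse> O u) = Domain s"
        proof
          show "Domain (t\<inverse> O u) \<subseteq> Domain s" using u S_inj[OF t] by blast
          show "Domain s \<subseteq> Domain (t\<inverse> O u)" using u s(2) by blast
        qed
        moreover have "t\<inverse> O u \<in> S" using S_comp[OF S_converse[OF t]] u by simp
        ultimately show "u \<in> (\<lambda>u. t O u) ` {u \<in> S. Domain u = Domain s}" by blast
      qed
    qed
    show "{u \<in> S. Domain u = Domain s} \<subseteq> {u \<in> S. Domain u \<subseteq> Range t}"
      using s(2) by (intro Collect_mono) simp
  qed
  then show ?thesis by (rule bij_betw_same_card[symmetric])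
qed

lemma bracket_invariant:
  assumes \<sigma>: "mat_rep M d \<sigma>" and W: "subspace_vec d W" "invariant M \<sigma> W" and s: "s \<in> S" and w: "w \<in> W"
  shows "bracket d \<sigma> s *\<^sub>v w \<in> W"
proof -
  have wc: "w \<in> carrier_vec d" using W w by (auto simp: subspace_vec_def)
  show ?thesis
    unfolding bracket_def
  proof (rule msum_mult_vec_mem[OF W(1) _ bracket_term_carrier[OF \<sigma> s] wc])
    fix Z assume "Z \<in> Pow (Domain s)"
    then have r: "Id_on Z O s \<in> S" using S_restrict[OF s] by simp
    let ?c = "(-1) ^ card (Domain s - Z) :: 'a"
    have "(?c \<cdot>\<^sub>m \<sigma> (Id_on Z O s)) *\<^sub>v w = ?c \<cdot>\<^sub>v (\<sigma> (Id_on Z O s) *\<^sub>v w)"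
      using rep_M(1)[OF \<sigma> r] wc by (intro eq_vecI) auto
    then show "(?c \<cdot>\<^sub>m \<sigma> (Id_on Z O s)) *\<^sub>v w \<in> W"
      using W r w by (auto simp: subspace_vec_def invariant_def)
  qed (use finite_Domain_S[OF s] in auto)
qed

text \<open>
  Maschke's theorem for the groupoid of \<open>S\<close>. The arrow \<open>s\<close> is weighted by the inverse of the
  number of arrows with the same domain, so that the products \<open>a s * b s\<close> sum to the sum of all
  idempotent arrows, which is \<open>1\<close>. Multiplication by \<open>t\<close> annihilates the arrows that do not match and
  translates the others bijectively.
\<close>

lemma monoid_semisimple: "semisimple_reps M TYPE('k::field_char_0)"
proof (rule semisimple_by_averaging)
  fix d and \<sigma> :: "nat rel \<Rightarrow> 'k mat" assume \<sigma>: "mat_rep M d \<sigma>"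
  define w where "w (s :: nat rel) = (1 / of_nat (card {u \<in> S. Domain u = Domain s}) :: 'k)" for s
  let ?a = "\<lambda>s. w s \<cdot>\<^sub>m bracket d \<sigma> s" and ?b = "\<lambda>s. bracket d \<sigma> (s\<inverse>)"
  have one: "msum d d (\<lambda>s. ?a s * ?b s) S = 1\<^sub>m d"
  proof -
    have "msum d d (\<lambda>s. ?a s * ?b s) S = msum d d (\<lambda>Z. bracket d \<sigma> (Id_on Z)) (Pow {1..n})"
    proof (rule eq_matI)
      fix a b assume "a < dim_row (msum d d (\<lambda>Z. bracket d \<sigma> (Id_on Z)) (Pow {1..n}))"
        "b < dim_col (msum d d (\<lambda>Z. bracket d \<sigma> (Id_on Z)) (Pow {1..n}))"
      then have ab: "a < d" "b < d" by auto
      have "msum d d (\<lambda>s. ?a s * ?b s) S $$ (a, b) = (\<Sum>s\<in>S. (?a s * ?b s) $$ (a, b))" using ab by simp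
      also have "\<dots> = (\<Sum>s\<in>S. w s * bracket d \<sigma> (Id_on (Domain s)) $$ (a, b))"
      proof (rule sum.cong[OF refl])
        fix s assume s: "s \<in> S"
        have "?a s * ?b s = w s \<cdot>\<^sub>m (bracket d \<sigma> s * bracket d \<sigma> (s\<inverse>))"
          by (rule mult_smult_assoc_mat) (rule bracket_carrier)+
        then show "(?a s * ?b s) $$ (a, b) = w s * bracket d \<sigma> (Id_on (Domain s)) $$ (a, b)"
          using ab by (simp add: bracket_mult_bracket_converse[OF \<sigma> s])
      qed
      also have "\<dots> = (\<Sum>Z\<in>Pow {1..n}. \<Sum>s\<in>{s \<in> S. Domain s = Z}. w s * bracket d \<sigma> (Id_on (Domain s)) $$ (a, b))"
        by (rule sum.group[symmetric]) (use finite_S Domain_S in auto)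
      also have "\<dots> = (\<Sum>Z\<in>Pow {1..n}. bracket d \<sigma> (Id_on Z) $$ (a, b))"
      proof (rule sum.cong[OF refl])
        fix Z assume Z: "Z \<in> Pow {1..n}"
        then have "Id_on Z \<in> {s \<in> S. Domain s = Z}" using S_Id_on[of Z] by simp
        then have ne: "card {s \<in> S. Domain s = Z} \<noteq> 0" using finite_S by auto
        have "(\<Sum>s\<in>{s \<in> S. Domain s = Z}. w s * bracket d \<sigma> (Id_on (Domain s)) $$ (a, b)) =
          (\<Sum>s\<in>{s \<in> S. Domain s = Z}. 1 / of_nat (card {s \<in> S. Domain s = Z}) * bracket d \<sigma> (Id_on Z) $$ (a, b))"
          by (rule sum.cong) (auto simp: w_def)
        also have "\<dots> = bracket d \<sigma> (Id_on Z) $$ (a, b)"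
          using ne by simp
        finally show "(\<Sum>s\<in>{s \<in> S. Domain s = Z}. w s * bracket d \<sigma> (Id_on (Domain s)) $$ (a, b)) =
          bracket d \<sigma> (Id_on Z) $$ (a, b)" .
      qed
      also have "\<dots> = msum d d (\<lambda>Z. bracket d \<sigma> (Id_on Z)) (Pow {1..n}) $$ (a, b)" using ab by simp
      finally show "msum d d (\<lambda>s. ?a s * ?b s) S $$ (a, b) =
        msum d d (\<lambda>Z. bracket d \<sigma> (Id_on Z)) (Pow {1..n}) $$ (a, b)" .
    qed auto
    then show ?thesis using sum_bracket_idems[OF \<sigma>] by simp
  qed
  have comm: "msum d d (\<lambda>s. ?a s * P * ?b s) S * \<sigma> t = \<sigma> t * msum d d (\<lambda>s. ?a s * P * ?b s) S"
    if P: "P \<in> carrier_mat d d" and t: "t \<in> S" for P t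
  proof -
    note ct = rep_M(1)[OF \<sigma> t]
    have c: "?a s * P * ?b s \<in> carrier_mat d d" for s
      using P by (intro mult3_carrier[of _ d d _ d]) auto
    have z: "w s \<cdot>\<^sub>m 0\<^sub>m d d * P * Q = 0\<^sub>m d d" if "Q \<in> carrier_mat d d" for s Q
      using P that by simp
    have "\<sigma> t * msum d d (\<lambda>s. ?a s * P * ?b s) S = msum d d (\<lambda>s. \<sigma> t * (?a s * P * ?b s)) S"
      by (rule mult_msum[OF ct c])
    also have "\<dots> = msum d d (\<lambda>s. w s \<cdot>\<^sub>m (\<sigma> t * bracket d \<sigma> s) * P * ?b s) S"
    proof (rule msum_cong)
      fix s
      have "\<sigma> t * (?a s * P * ?b s) = (\<sigma> t * ?a s) * P * ?b s"
        using ct P by (simp add: mat_assoc)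
      also have "\<sigma> t * ?a s = w s \<cdot>\<^sub>m (\<sigma> t * bracket d \<sigma> s)"
        by (rule mult_smult_distrib[OF ct bracket_carrier])
      finally show "\<sigma> t * (?a s * P * ?b s) = w s \<cdot>\<^sub>m (\<sigma> t * bracket d \<sigma> s) * P * ?b s" .
    qed
    also have "\<dots> = msum d d (\<lambda>s. w s \<cdot>\<^sub>m (\<sigma> t * bracket d \<sigma> s) * P * ?b s) {s \<in> S. Domain s \<subseteq> Range t}"
    proof (rule msum_mono_neutral[symmetric])
      fix s assume "s \<in> S - {s \<in> S. Domain s \<subseteq> Range t}"
      then have "\<sigma> t * bracket d \<sigma> s = 0\<^sub>m d d" using rep_mult_bracket[OF \<sigma> _ t] by auto
      then show "w s \<cdot>\<^sub>m (\<sigma> t * bracket d \<sigma> s) * P * ?b s = 0\<^sub>m d d" using z by simp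
    qed (use finite_S in auto)
    also have "\<dots> = msum d d (\<lambda>s. w (t O s) \<cdot>\<^sub>m bracket d \<sigma> (t O s) * P * (bracket d \<sigma> ((t O s)\<inverse>) * \<sigma> t))
        {s \<in> S. Domain s \<subseteq> Range t}"
    proof (rule msum_cong)
      fix s assume "s \<in> {s \<in> S. Domain s \<subseteq> Range t}"
      then have s: "s \<in> S" "Domain s \<subseteq> Range t" by auto
      have ts: "t O s \<in> S" by (rule S_comp[OF t s(1)])
      have "Range ((t O s)\<inverse>) \<subseteq> Domain t" by blast
      then have "bracket d \<sigma> ((t O s)\<inverse>) * \<sigma> t = bracket d \<sigma> ((t O s)\<inverse> O t)"
        using bracket_mult_rep[OF \<sigma> S_converse[OF ts] t] by simp
      also have "(t O s)\<inverse> O t = s\<inverse>"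
        using converse_comp[OF t] O_Id_on[of "s\<inverse>" "Range t"] s(2) by (simp add: converse_relcomp O_assoc)
      finally show "w s \<cdot>\<^sub>m (\<sigma> t * bracket d \<sigma> s) * P * ?b s =
          w (t O s) \<cdot>\<^sub>m bracket d \<sigma> (t O s) * P * (bracket d \<sigma> ((t O s)\<inverse>) * \<sigma> t)"
        using rep_mult_bracket[OF \<sigma> s(1) t] s(2) card_domain_class[OF t s] by (simp add: w_def)
    qed
    also have "\<dots> = msum d d (\<lambda>s. ?a s * P * (?b s * \<sigma> t)) {s \<in> S. Domain s \<subseteq> Domain t}"
      by (rule msum_reindex[OF bij_betw_left_translation[OF t], symmetric])
    also have "\<dots> = msum d d (\<lambda>s. ?a s * P * (?b s * \<sigma> t)) S"
    proof (rule msum_mono_neutral)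
      fix s assume "s \<in> S - {s \<in> S. Domain s \<subseteq> Domain t}"
      then have s: "s \<in> S" "\<not> Range (s\<inverse>) \<subseteq> Domain t" by auto
      then have "?b s * \<sigma> t = 0\<^sub>m d d" using bracket_mult_rep[OF \<sigma> S_converse[OF s(1)] t] by auto
      moreover have "?a s * P \<in> carrier_mat d d" using P by (auto intro!: mult_carrier_mat[of _ d d])
      ultimately show "?a s * P * (?b s * \<sigma> t) = 0\<^sub>m d d" by (simp add: right_mult_zero_mat[of _ d d d])
    qed (use finite_S in auto)
    also have "\<dots> = msum d d (\<lambda>s. ?a s * P * ?b s * \<sigma> t) S"
      by (rule msum_cong) (use P ct in \<open>simp add: mat_assoc\<close>)
    also have "\<dots> = msum d d (\<lambda>s. ?a s * P * ?b s) S * \<sigma> t"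
      by (rule msum_mult[OF ct c, symmetric])
    finally show ?thesis ..
  qed
  have inv: "?a s *\<^sub>v v \<in> W \<and> ?b s *\<^sub>v v \<in> W"
    if W: "subspace_vec d W \<and> invariant M \<sigma> W" and s: "s \<in> S" and v: "v \<in> W" for W s v
  proof -
    have "v \<in> carrier_vec d" using W v by (auto simp: subspace_vec_def)
    then have "?a s *\<^sub>v v = w s \<cdot>\<^sub>v (bracket d \<sigma> s *\<^sub>v v)" by (intro eq_vecI) auto
    moreover have "bracket d \<sigma> s *\<^sub>v v \<in> W" "?b s *\<^sub>v v \<in> W"
      using bracket_invariant[OF \<sigma>] W s v S_converse by blast+
    ultimately show ?thesis using W by (auto simp: subspace_vec_def)
  qed
  show "\<exists>(I :: nat rel set) a b. finite I \<and> (\<forall>i\<in>I. a i \<in> carrier_mat d d \<and> b i \<in> carrier_mat d d) \<and>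
      (\<forall>W. subspace_vec d W \<and> invariant M \<sigma> W \<longrightarrow> (\<forall>i\<in>I. \<forall>w\<in>W. a i *\<^sub>v w \<in> W \<and> b i *\<^sub>v w \<in> W)) \<and>
      msum d d (\<lambda>i. a i * b i) I = 1\<^sub>m d \<and>
      (\<forall>P\<in>carrier_mat d d. \<forall>s\<in>carrier M.
         msum d d (\<lambda>i. a i * P * b i) I * \<sigma> s = \<sigma> s * msum d d (\<lambda>i. a i * P * b i) I)"
    by (rule exI[of _ S], rule exI[of _ ?a], rule exI[of _ ?b], intro conjI ballI allI impI)
      (use finite_S one comm inv in \<open>auto simp del: One_nat_def\<close>)
qed

end

section \<open>Maximal subgroups and induced representations\<close>

locale maximal_subgroup = full_inverse_monoid +
  fixes X :: "nat set"
  assumes X: "X \<subseteq> {1..n}"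
begin

abbreviation H :: "nat rel set" where "H \<equiv> max_subgroup S (Id_on X)"
abbreviation G :: "nat rel monoid" where "G \<equiv> rel_monoid H (Id_on X)"

lemma idem_dom_S: "s \<in> S \<Longrightarrow> idem_dom s = Id_on (Domain s)"
  and idem_ran_S: "s \<in> S \<Longrightarrow> idem_ran s = Id_on (Range s)"
  using S_pperms idem_dom_pperms idem_ran_pperms by blast+

lemma H_iff: "s \<in> H \<longleftrightarrow> s \<in> S \<and> Domain s = X \<and> Range s = X"
  unfolding max_subgroup_def by (simp cong: conj_cong add: idem_dom_S idem_ran_S)

lemma H_S: "s \<in> H \<Longrightarrow> s \<in> S" by (simp add: H_iff)

lemma finite_H: "finite H" by (rule finite_subset[OF _ finite_S]) (auto simp: H_iff)

lemma H_comp: "s \<in> H \<Longrightarrow> t \<in> H \<Longrightarrow> s O t \<in> H"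
proof -
  assume "s \<in> H" "t \<in> H"
  moreover from this have "Domain (s O t) = X" "Range (s O t) = X" unfolding H_iff by blast+
  ultimately show "s O t \<in> H" using S_comp by (simp add: H_iff)
qed

lemma H_converse: "s \<in> H \<Longrightarrow> s\<inverse> \<in> H"
  using S_converse by (simp add: H_iff)

lemma H_Id_on: "Id_on X \<in> H" using S_Id_on[OF X] by (simp add: H_iff)

lemma H_inverse: "s \<in> H \<Longrightarrow> s O s\<inverse> = Id_on X" "s \<in> H \<Longrightarrow> s\<inverse> O s = Id_on X"
  using comp_converse converse_comp by (auto simp: H_iff)

lemma group_G: "group G"
proof (rule groupI)
  show "\<exists>y\<in>carrier G. y \<otimes>\<^bsub>G\<^esub> x = \<one>\<^bsub>G\<^esub>" if "x \<in> carrier G" for x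
    using that H_converse H_inverse(2) by (intro bexI[of _ "x\<inverse>"]) auto
qed (use H_comp H_Id_on in \<open>auto simp: O_assoc Id_on_O H_iff\<close>)

lemma inv_G: "g \<in> H \<Longrightarrow> inv\<^bsub>G\<^esub> g = g\<inverse>"
  using group.inv_equality[OF group_G, of "g\<inverse>" g] H_converse H_inverse(2) by simp

lemma rep_G:
  assumes "mat_rep G d \<phi>"
  shows "s \<in> H \<Longrightarrow> \<phi> s \<in> carrier_mat d d" "s \<in> H \<Longrightarrow> t \<in> H \<Longrightarrow> \<phi> (s O t) = \<phi> s * \<phi> t"
    "\<phi> (Id_on X) = 1\<^sub>m d"
  using assms by (auto simp: mat_rep_iff)

lemma d_class_idems_eq:
  "d_class_idems S (Id_on X) = {Id_on (Range s) | s. s \<in> S \<and> Domain s = X}"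
proof -
  have "Id_on (Range s) \<in> idems S" if "s \<in> S" for s
    unfolding idems_eq idems_pperms using Range_S[OF that] by blast
  moreover have "d_class_idems S (Id_on X) = {f \<in> idems S. \<exists>s\<in>S. Domain s = X \<and> Id_on (Range s) = f}"
    unfolding d_class_idems_def
    by (rule Collect_cong, rule conj_cong[OF refl], rule bex_cong[OF refl]) (simp only: idem_dom_S idem_ran_S Id_on_eq_iff)
  ultimately show ?thesis by auto
qed

end

lemma block_index_less: "k < L \<Longrightarrow> i < d \<Longrightarrow> k * d + i < L * (d :: nat)"
  by (metis add.commute add_strict_left_mono mult.commute mult_Suc_right mult_le_mono1 order.strict_trans2 Suc_leI)

lemma sum_div_mod:
  fixes F :: "nat \<Rightarrow> nat \<Rightarrow> 'a::comm_monoid_add"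
  shows "(\<Sum>a<L * d. F (a div d) (a mod d)) = (\<Sum>k<L. \<Sum>i<d. F k i)"
proof (cases "d = 0")
  case False
  have "(\<Sum>k<L. \<Sum>i<d. F k i) = (\<Sum>(k, i)\<in>{..<L} \<times> {..<d}. F k i)" by (rule sum.cartesian_product)
  also have "\<dots> = (\<Sum>a<L * d. F (a div d) (a mod d))"
    by (rule sum.reindex_bij_witness[of _ "\<lambda>a. (a div d, a mod d)" "\<lambda>(k, i). k * d + i"])
      (use False in \<open>auto simp: less_mult_imp_div_less block_index_less\<close>)
  finally show ?thesis ..
qed simp

lemma div_mod_less: "a < L * d \<Longrightarrow> a div d < L \<and> a mod d < (d :: nat)"
  by (cases "d = 0") (auto simp: less_mult_imp_div_less)

locale induced = maximal_subgroup +
  fixes d :: nat and \<phi> :: "nat rel \<Rightarrow> 'k::{alg_closed_field, field_char_0} mat"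
    and fs :: "nat rel list" and pf :: "nat rel \<Rightarrow> nat rel"
  assumes \<phi>: "irreducible_rep G d \<phi>" and transversal: "transversal S (Id_on X) fs pf"
begin

text \<open>
  The block with index \<open>k\<close> belongs to the idempotent \<open>Id_on (Z k)\<close>, and \<open>p k\<close> is the chosen element
  leading there from \<open>Id_on X\<close>. The block \<open>(k, l)\<close> of the matrix of \<open>s\<close> is nonzero when \<open>s\<close> links
  \<open>k\<close> to \<open>l\<close>, that is, when it maps \<open>Z k\<close> onto \<open>Z l\<close>.
\<close>

definition p :: "nat \<Rightarrow> nat rel" where "p k = pf (fs ! k)"
definition Z :: "nat \<Rightarrow> nat set" where "Z k = Range (p k)"
abbreviation L :: nat where "L \<equiv> length fs"
abbreviation \<psi> :: "nat rel \<Rightarrow> 'k mat" where "\<psi> \<equiv> induced_rep d \<phi> fs pf"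
definition linked :: "nat rel \<Rightarrow> nat \<Rightarrow> nat \<Rightarrow> bool" where
  "linked s k l \<longleftrightarrow> Z k \<subseteq> Domain s \<and> s `` Z k = Z l"

lemma d_pos: "d > 0" and rep_\<phi>: "mat_rep G d \<phi>" using \<phi> by (auto simp: irreducible_rep_iff)

lemma fs_d_class: "k < L \<Longrightarrow> fs ! k \<in> d_class_idems S (Id_on X)"
  using transversal by (auto simp: transversal_def)

lemma p_S: "k < L \<Longrightarrow> p k \<in> S" and Domain_p: "k < L \<Longrightarrow> Domain (p k) = X"
  and fs_nth: "k < L \<Longrightarrow> fs ! k = Id_on (Z k)"
proof -
  assume k: "k < L"
  then have *: "pf (fs ! k) \<in> S" "idem_dom (pf (fs ! k)) = Id_on X" "idem_ran (pf (fs ! k)) = fs ! k"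
    using transversal fs_d_class[OF k] by (auto simp: transversal_def)
  show "p k \<in> S" using * by (simp add: p_def)
  show "Domain (p k) = X" using * idem_dom_pperms[OF S_pperms[OF *(1)]] by (simp add: p_def)
  show "fs ! k = Id_on (Z k)" using * idem_ran_pperms[OF S_pperms[OF *(1)]] by (simp add: p_def Z_def)
qed

lemma Z_eq_iff: "k < L \<Longrightarrow> l < L \<Longrightarrow> Z k = Z l \<longleftrightarrow> k = l"
  using transversal nth_eq_iff_index_eq[of fs k l] by (auto simp: transversal_def fs_nth)

lemma ex_Z:
  assumes "s \<in> S" "Domain s = X"
  obtains k where "k < L" "Range s = Z k"
proof -
  have "Id_on (Range s) \<in> set fs"
    using assms transversal by (auto simp: transversal_def d_class_idems_eq)
  then obtain k where "k < L" "fs ! k = Id_on (Range s)" by (auto simp: in_set_conv_nth)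
  then show thesis using that[of k] fs_nth[of k] by simp
qed

lemma p_comp_converse: "k < L \<Longrightarrow> p k O (p k)\<inverse> = Id_on X"
  and p_converse_comp: "k < L \<Longrightarrow> (p k)\<inverse> O p k = Id_on (Z k)"
  using comp_converse[OF p_S] converse_comp[OF p_S] Domain_p by (auto simp: Z_def)

lemma card_Z: "k < L \<Longrightarrow> card (Z k) = card X"
proof -
  assume k: "k < L"
  have "bij_betw (\<lambda>x. THE y. (x, y) \<in> p k) X (Z k)"
    unfolding bij_betw_def
  proof
    have the: "(THE y. (x, y) \<in> p k) = y" if "(x, y) \<in> p k" for x y
      using that S_inj[OF p_S[OF k]] by blast
    show "inj_on (\<lambda>x. THE y. (x, y) \<in> p k) X"
    proof (rule inj_onI)
      fix x x' assume "x \<in> X" "x' \<in> X" and eq: "(THE y. (x, y) \<in> p k) = (THE y. (x', y) \<in> p k)"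
      then obtain y y' where "(x, y) \<in> p k" "(x', y') \<in> p k" using Domain_p[OF k] by blast
      then show "x = x'" using the eq S_inj'[OF p_S[OF k]] by metis
    qed
    show "(\<lambda>x. THE y. (x, y) \<in> p k) ` X = Z k"
      unfolding Z_def Domain_p[OF k, symmetric] by (force simp: the)
  qed
  then show ?thesis by (rule bij_betw_same_card[symmetric])
qed

lemma linked_condition:
  assumes "k < L" "l < L" "s \<in> S"
  shows "(fs ! k \<subseteq> s O s\<inverse> \<and> s\<inverse> O fs ! k O s = fs ! l) \<longleftrightarrow> linked s k l"
proof -
  have "s\<inverse> O Id_on (Z k) O s = Id_on (s `` Z k)"
  proof
    show "s\<inverse> O Id_on (Z k) O s \<subseteq> Id_on (s `` Z k)" using S_inj[OF assms(3)] by blast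
    show "Id_on (s `` Z k) \<subseteq> s\<inverse> O Id_on (Z k) O s" by blast
  qed
  then show ?thesis using assms by (simp add: fs_nth comp_converse linked_def)
qed

lemma linked_group:
  assumes "k < L" "l < L" "s \<in> S" "linked s k l"
  shows "p k O s O (p l)\<inverse> \<in> H"
proof -
  have "Domain (p k O s O (p l)\<inverse>) = X"
  proof
    show "Domain (p k O s O (p l)\<inverse>) \<subseteq> X" using Domain_p[OF assms(1)] by blast
    show "X \<subseteq> Domain (p k O s O (p l)\<inverse>)"
    proof
      fix x assume "x \<in> X"
      then obtain y where y: "(x, y) \<in> p k" using Domain_p[OF assms(1)] by blast
      then obtain z where z: "(y, z) \<in> s" using assms(4) unfolding linked_def Z_def by blast
      then have "z \<in> Range (p l)" using y assms(4) unfolding linked_def Z_def by blast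
      then show "x \<in> Domain (p k O s O (p l)\<inverse>)" using y z by blast
    qed
  qed
  moreover have "Range (p k O s O (p l)\<inverse>) = X"
  proof
    show "Range (p k O s O (p l)\<inverse>) \<subseteq> X" using Domain_p[OF assms(2)] by blast
    show "X \<subseteq> Range (p k O s O (p l)\<inverse>)"
    proof
      fix x assume "x \<in> X"
      then obtain z where z: "(x, z) \<in> p l" using Domain_p[OF assms(2)] by blast
      then have "z \<in> s `` Z k" using assms(4) unfolding linked_def Z_def by blast
      then show "x \<in> Range (p k O s O (p l)\<inverse>)" using z unfolding Z_def by blast
    qed
  qed
  moreover have "p k O s O (p l)\<inverse> \<in> S"
    using S_comp S_converse p_S assms by blast
  ultimately show ?thesis by (simp add: H_iff)
qed

lemma induced_carrier [simp]: "\<psi> s \<in> carrier_mat (L * d) (L * d)"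
  by (simp add: induced_rep_def)

lemma index_induced:
  assumes "s \<in> S" "a < L * d" "b < L * d"
  shows "\<psi> s $$ (a, b) = (if linked s (a div d) (b div d)
    then \<phi> (p (a div d) O s O (p (b div d))\<inverse>) $$ (a mod d, b mod d) else 0)"
  using assms div_mod_less[of a L d] div_mod_less[of b L d] linked_condition[of "a div d" "b div d" s]
  by (auto simp: induced_rep_def Let_def p_def)

lemma linked_unique: "k < L \<Longrightarrow> l < L \<Longrightarrow> l' < L \<Longrightarrow> linked s k l \<Longrightarrow> linked s k l' \<Longrightarrow> l = l'"
  by (auto simp: linked_def Z_eq_iff)

lemma linked_compE:
  assumes "k < L" "l < L" "s \<in> S" "t \<in> S" "linked (s O t) k l"
  obtains m where "m < L" "linked s k m" "linked t m l"
proof -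
  have kD: "Z k \<subseteq> Domain s" using assms(5) unfolding linked_def by blast
  have "Domain (p k O s) = X"
    using Domain_p[OF assms(1)] kD unfolding Z_def by blast
  then obtain m where m: "m < L" "Range (p k O s) = Z m"
    using ex_Z[OF S_comp[OF p_S[OF assms(1)] assms(3)]] by blast
  have "Range (p k O s) = s `` Z k" unfolding Z_def by blast
  then have sm: "s `` Z k = Z m" using m by simp
  have "linked s k m" using kD sm by (simp add: linked_def)
  moreover have "linked t m l"
  proof -
    have "t `` Z m = (s O t) `` Z k" unfolding sm[symmetric] by blast
    moreover have "Z m \<subseteq> Domain t"
    proof
      fix z assume "z \<in> Z m"
      then obtain y where y: "y \<in> Z k" "(y, z) \<in> s" unfolding sm[symmetric] by blast
      then obtain w where "(y, w) \<in> s O t" using assms(5) unfolding linked_def by blast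
      then obtain z' where "(y, z') \<in> s" "(z', w) \<in> t" by blast
      then show "z \<in> Domain t" using S_inj[OF assms(3) y(2)] by blast
    qed
    ultimately show ?thesis using assms(5) by (simp add: linked_def)
  qed
  ultimately show thesis using m that by blast
qed

lemma linked_comp: "linked s k m \<Longrightarrow> linked t m l \<Longrightarrow> linked (s O t) k l"
proof -
  assume 1: "linked s k m" "linked t m l"
  have "Z k \<subseteq> Domain (s O t)"
  proof
    fix y assume y: "y \<in> Z k"
    then obtain z where z: "(y, z) \<in> s" using 1 unfolding linked_def by blast
    then have "z \<in> Z m" using 1 y unfolding linked_def by blast
    then show "y \<in> Domain (s O t)" using z 1 unfolding linked_def by blast
  qed
  moreover have "(s O t) `` Z k = t `` (s `` Z k)" by blast
  ultimately show "linked (s O t) k l" using 1 by (simp add: linked_def)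
qed

text \<open>
  Only the block of the image of \<open>Z k\<close> under \<open>s\<close> contributes as intermediate block \<open>m\<close>, and there
  the factor \<open>(p m)\<inverse> O p m\<close> cancels.
\<close>

lemma induced_mult:
  assumes s: "s \<in> S" and t: "t \<in> S"
  shows "\<psi> (s O t) = \<psi> s * \<psi> t"
proof (rule eq_matI)
  fix a b assume "a < dim_row (\<psi> s * \<psi> t)" "b < dim_col (\<psi> s * \<psi> t)"
  then have ab: "a < L * d" "b < L * d" by (auto simp: induced_rep_def)
  let ?k = "a div d" and ?l = "b div d" and ?i = "a mod d" and ?j = "b mod d"
  have kl: "?k < L" "?l < L" "?i < d" "?j < d" using div_mod_less ab by auto
  let ?F = "\<lambda>m q. (if linked s ?k m then \<phi> (p ?k O s O (p m)\<inverse>) $$ (?i, q) else 0) *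
      (if linked t m ?l then \<phi> (p m O t O (p ?l)\<inverse>) $$ (q, ?j) else 0)"
  have "(\<psi> s * \<psi> t) $$ (a, b) = (\<Sum>c<L * d. \<psi> s $$ (a, c) * \<psi> t $$ (c, b))"
    using ab by (subst index_mult_mat_sum) (auto simp: induced_rep_def)
  also have "\<dots> = (\<Sum>c<L * d. ?F (c div d) (c mod d))"
    using ab s t by (intro sum.cong) (auto simp: index_induced)
  also have "\<dots> = (\<Sum>m<L. \<Sum>q<d. ?F m q)" by (rule sum_div_mod)
  also have "\<dots> = \<psi> (s O t) $$ (a, b)"
  proof (cases "linked (s O t) ?k ?l")
    case True
    then obtain m where m: "m < L" "linked s ?k m" "linked t m ?l"
      using linked_compE[OF kl(1,2) s t] by blast
    have g1: "p ?k O s O (p m)\<inverse> \<in> H" by (rule linked_group[OF kl(1) m(1) s m(2)])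
    have g2: "p m O t O (p ?l)\<inverse> \<in> H" by (rule linked_group[OF m(1) kl(2) t m(3)])
    have "(\<Sum>m<L. \<Sum>q<d. ?F m q) = (\<Sum>m'\<in>{m}. \<Sum>q<d. ?F m' q)"
    proof (rule sum.mono_neutral_right)
      show "\<forall>m'\<in>{..<L} - {m}. (\<Sum>q<d. ?F m' q) = 0"
      proof
        fix m' assume "m' \<in> {..<L} - {m}"
        then have "\<not> linked s ?k m'" using linked_unique[OF kl(1) m(1) _ m(2), of m'] by auto
        then show "(\<Sum>q<d. ?F m' q) = 0" by simp
      qed
    qed (use m in auto)
    also have "\<dots> = (\<phi> (p ?k O s O (p m)\<inverse>) * \<phi> (p m O t O (p ?l)\<inverse>)) $$ (?i, ?j)"
      using m kl rep_G(1)[OF rep_\<phi> g1] rep_G(1)[OF rep_\<phi> g2] by (subst index_mult_mat_sum) auto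
    also have "\<phi> (p ?k O s O (p m)\<inverse>) * \<phi> (p m O t O (p ?l)\<inverse>) =
      \<phi> ((p ?k O s O (p m)\<inverse>) O (p m O t O (p ?l)\<inverse>))"
      by (rule rep_G(2)[OF rep_\<phi> g1 g2, symmetric])
    also have "(p ?k O s O (p m)\<inverse>) O (p m O t O (p ?l)\<inverse>) = (p ?k O s) O ((p m)\<inverse> O p m) O t O (p ?l)\<inverse>"
      by (simp only: O_assoc)
    also have "\<dots> = ((p ?k O s) O Id_on (Z m)) O t O (p ?l)\<inverse>"
      by (simp only: p_converse_comp[OF m(1)] O_assoc)
    also have "(p ?k O s) O Id_on (Z m) = p ?k O s"
      by (rule O_Id_on) (use m(2) in \<open>unfold linked_def Z_def, blast\<close>)
    finally show ?thesis using True index_induced[OF S_comp[OF s t] ab] by (simp add: O_assoc)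
  next
    case False
    then have "(\<Sum>m<L. \<Sum>q<d. ?F m q) = 0" using linked_comp by (intro sum.neutral ballI) auto
    then show ?thesis using False index_induced[OF S_comp[OF s t] ab] by simp
  qed
  finally show "\<psi> (s O t) $$ (a, b) = (\<psi> s * \<psi> t) $$ (a, b)" ..
qed (auto simp: induced_rep_def)

lemma induced_one: "\<psi> (Id_on {1..n}) = 1\<^sub>m (L * d)"
proof (rule eq_matI)
  fix a b assume "a < dim_row (1\<^sub>m (L * d) :: 'k mat)" "b < dim_col (1\<^sub>m (L * d) :: 'k mat)"
  then have ab: "a < L * d" "b < L * d" by auto
  let ?k = "a div d" and ?l = "b div d" and ?i = "a mod d" and ?j = "b mod d"
  have kl: "?k < L" "?l < L" "?i < d" "?j < d" using div_mod_less ab by auto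
  have Zn: "Z k \<subseteq> {1..n}" if "k < L" for k using Range_S[OF p_S[OF that]] by (simp add: Z_def)
  have "linked (Id_on {1..n}) ?k ?l \<longleftrightarrow> ?k = ?l"
  proof -
    have "Id_on {1..n} `` Z ?k = Z ?k" using Zn[OF kl(1)] by blast
    then show ?thesis using kl Zn[OF kl(1)] by (simp add: linked_def Z_eq_iff)
  qed
  moreover have "p ?k O Id_on {1..n} O (p ?k)\<inverse> = Id_on X"
    using Range_S[OF p_S[OF kl(1)]] p_comp_converse[OF kl(1)] by (simp add: Id_on_O)
  moreover have "a = b" if "?k = ?l" "?i = ?j" using that by (metis div_mult_mod_eq)
  ultimately show "\<psi> (Id_on {1..n}) $$ (a, b) = 1\<^sub>m (L * d) $$ (a, b)"
    using index_induced[OF S_Id_on[OF order_refl] ab] rep_G(3)[OF rep_\<phi>] ab kl by auto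
qed (auto simp: induced_rep_def)

lemma rep_induced: "mat_rep M (L * d) \<psi>"
  unfolding mat_rep_iff using induced_mult induced_one by simp

end

section \<open>Irreducibility of induced representations\<close>

context induced begin

text \<open>The index of the block of \<open>Id_on X\<close> itself.\<close>

definition base :: nat where "base = (SOME k. k < L \<and> Z k = X)"

lemma base: "base < L" "Z base = X"
proof -
  have "\<exists>k. k < L \<and> Z k = X"
    using ex_Z[OF S_Id_on[OF X]] by (metis Domain_Id_on Range_Id_on)
  then have "base < L \<and> Z base = X" unfolding base_def by (rule someI_ex)
  then show "base < L" "Z base = X" by auto
qed

lemma p_base_H: "p base \<in> H"
  using p_S[OF base(1)] Domain_p[OF base(1)] base(2) by (simp add: H_iff Z_def)

lemma finite_Z: "k < L \<Longrightarrow> finite (Z k)"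
  using Range_S[OF p_S] finite_subset unfolding Z_def by blast

lemma Z_subset_iff: "k < L \<Longrightarrow> l < L \<Longrightarrow> Z k \<subseteq> Z l \<longleftrightarrow> k = l"
  using card_subset_eq[OF finite_Z, of l "Z k"] card_Z Z_eq_iff by auto

lemma Z_subset_X_iff: "k < L \<Longrightarrow> Z k \<subseteq> X \<longleftrightarrow> k = base"
  using Z_subset_iff[of k base] base by simp

definition embed :: "nat \<Rightarrow> 'k vec \<Rightarrow> 'k vec" where
  "embed k v = vec (L * d) (\<lambda>a. if a div d = k then v $ (a mod d) else 0)"

definition component :: "nat \<Rightarrow> 'k vec \<Rightarrow> 'k vec" where
  "component k w = vec d (\<lambda>i. w $ (k * d + i))"

lemma embed_carrier [simp]: "embed k v \<in> carrier_vec (L * d)" by (simp add: embed_def)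
lemma component_carrier [simp]: "component k w \<in> carrier_vec d" by (simp add: component_def)

lemma component_embed: "k < L \<Longrightarrow> v \<in> carrier_vec d \<Longrightarrow> component k (embed k v) = v"
  using d_pos by (intro eq_vecI) (auto simp: component_def embed_def block_index_less)

lemma induced_single_block:
  assumes s: "s \<in> S" and k1: "k1 < L" and l1: "l1 < L"
    and linked: "\<And>k l. k < L \<Longrightarrow> l < L \<Longrightarrow> linked s k l \<longleftrightarrow> k = k1 \<and> l = l1"
    and w: "w \<in> carrier_vec (L * d)"
  shows "\<psi> s *\<^sub>v w = embed k1 (\<phi> (p k1 O s O (p l1)\<inverse>) *\<^sub>v component l1 w)"
proof (rule eq_vecI)
  have g: "p k1 O s O (p l1)\<inverse> \<in> H" by (rule linked_group[OF k1 l1 s]) (use linked k1 l1 in auto)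
  note cg = rep_G(1)[OF rep_\<phi> g]
  fix a assume "a < dim_vec (embed k1 (\<phi> (p k1 O s O (p l1)\<inverse>) *\<^sub>v component l1 w))"
  then have a: "a < L * d" by (simp add: embed_def)
  note am = div_mod_less[OF a]
  let ?F = "\<lambda>l j. (if linked s (a div d) l then \<phi> (p (a div d) O s O (p l)\<inverse>) $$ (a mod d, j) * w $ (l * d + j) else 0)"
  have "(\<psi> s *\<^sub>v w) $ a = (\<Sum>b<L * d. \<psi> s $$ (a, b) * w $ b)"
    using a w by (subst index_mult_vec_sum) (auto simp: induced_rep_def)
  also have "\<dots> = (\<Sum>b<L * d. ?F (b div d) (b mod d))"
    using a s by (intro sum.cong) (auto simp: index_induced)
  also have "\<dots> = (\<Sum>l<L. \<Sum>j<d. ?F l j)" by (rule sum_div_mod)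
  also have "\<dots> = (\<Sum>l<L. if l = l1 then \<Sum>j<d. ?F l1 j else 0)"
    using am by (intro sum.cong) (auto simp: linked)
  also have "\<dots> = (\<Sum>j<d. ?F l1 j)" using l1 by simp
  also have "\<dots> = embed k1 (\<phi> (p k1 O s O (p l1)\<inverse>) *\<^sub>v component l1 w) $ a"
  proof (cases "a div d = k1")
    case True
    have "(\<phi> (p k1 O s O (p l1)\<inverse>) *\<^sub>v component l1 w) $ (a mod d) =
        (\<Sum>j<d. \<phi> (p k1 O s O (p l1)\<inverse>) $$ (a mod d, j) * w $ (l1 * d + j))"
      using am cg by (subst index_mult_vec_sum) (auto simp: component_def)
    then show ?thesis using True a am l1 by (simp add: embed_def linked)
  next
    case False
    then show ?thesis using a am l1 by (simp add: embed_def linked)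
  qed
  finally show "(\<psi> s *\<^sub>v w) $ a = embed k1 (\<phi> (p k1 O s O (p l1)\<inverse>) *\<^sub>v component l1 w) $ a" .
qed (auto simp: induced_rep_def embed_def)

lemma linked_p: "m < L \<Longrightarrow> k < L \<Longrightarrow> l < L \<Longrightarrow> linked (p m) k l \<longleftrightarrow> k = base \<and> l = m"
proof -
  assume m: "m < L" "k < L" "l < L"
  have "p m `` X = Z m" using Domain_p[OF m(1)] unfolding Z_def by blast
  then show "linked (p m) k l \<longleftrightarrow> k = base \<and> l = m"
    unfolding linked_def Domain_p[OF m(1)] Z_subset_X_iff[OF m(2)]
    using Z_eq_iff[OF m(1,3)] base(2) by (metis (no_types))
qed

lemma linked_p_converse: "m < L \<Longrightarrow> k < L \<Longrightarrow> l < L \<Longrightarrow> linked ((p m)\<inverse>) k l \<longleftrightarrow> k = m \<and> l = base"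
proof -
  assume m: "m < L" "k < L" "l < L"
  have "(p m)\<inverse> `` Z m = X" using Domain_p[OF m(1)] unfolding Z_def by blast
  moreover have "Domain ((p m)\<inverse>) = Z m" by (simp add: Z_def)
  moreover have "X = Z l \<longleftrightarrow> l = base" using m base Z_eq_iff[of base l] by auto
  ultimately show "linked ((p m)\<inverse>) k l \<longleftrightarrow> k = m \<and> l = base"
    unfolding linked_def using Z_subset_iff[OF m(2,1)] by (metis (no_types))
qed

lemma linked_H: "g \<in> H \<Longrightarrow> k < L \<Longrightarrow> l < L \<Longrightarrow> linked g k l \<longleftrightarrow> k = base \<and> l = base"
proof -
  assume m: "g \<in> H" "k < L" "l < L"
  then have gX: "Domain g = X" "g `` X = X" unfolding H_iff by blast+
  have "X = Z l \<longleftrightarrow> l = base" using m base Z_eq_iff[of base l] by auto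
  then show "linked g k l \<longleftrightarrow> k = base \<and> l = base"
    unfolding linked_def gX(1) Z_subset_X_iff[OF m(2)] using gX(2) base(2) by (metis (no_types))
qed

lemma \<phi>_p_base_inverse: "v \<in> carrier_vec d \<Longrightarrow> \<phi> ((p base)\<inverse>) *\<^sub>v (\<phi> (p base) *\<^sub>v v) = v"
proof -
  assume v: "v \<in> carrier_vec d"
  have "\<phi> ((p base)\<inverse>) * \<phi> (p base) = 1\<^sub>m d"
    using rep_G(2)[OF rep_\<phi> H_converse[OF p_base_H] p_base_H] H_inverse(2)[OF p_base_H] rep_G(3)[OF rep_\<phi>] by simp
  then show ?thesis
    using mat_vec_assoc[of "\<phi> ((p base)\<inverse>)" "\<phi> (p base)" v] v
      rep_G(1)[OF rep_\<phi> p_base_H] rep_G(1)[OF rep_\<phi> H_converse[OF p_base_H]] by auto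
qed

lemma act_p: "k < L \<Longrightarrow> w \<in> carrier_vec (L * d) \<Longrightarrow> \<psi> (p k) *\<^sub>v w = embed base (\<phi> (p base) *\<^sub>v component k w)"
proof -
  assume k: "k < L" and w: "w \<in> carrier_vec (L * d)"
  have "p base O p k O (p k)\<inverse> = p base"
    using p_comp_converse[OF k] O_Id_on[of "p base" X] p_base_H by (simp add: H_iff)
  then show ?thesis using induced_single_block[OF p_S[OF k] base(1) k linked_p[OF k] w] by simp
qed

lemma act_p_converse:
  "k < L \<Longrightarrow> v \<in> carrier_vec d \<Longrightarrow> \<psi> ((p k)\<inverse>) *\<^sub>v embed base v = embed k (\<phi> ((p base)\<inverse>) *\<^sub>v v)"
proof -
  assume k: "k < L" and v: "v \<in> carrier_vec d"
  have "p k O (p k)\<inverse> O (p base)\<inverse> = (p base)\<inverse>"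
    using p_comp_converse[OF k] Id_on_O[of "(p base)\<inverse>" X] p_base_H by (simp add: H_iff flip: O_assoc)
  then show ?thesis
    using induced_single_block[OF S_converse[OF p_S[OF k]] k base(1) linked_p_converse[OF k] embed_carrier, of base v]
    by (simp add: component_embed[OF base(1) v])
qed

lemma act_H:
  "g \<in> H \<Longrightarrow> v \<in> carrier_vec d \<Longrightarrow> \<psi> ((p base)\<inverse> O g O p base) *\<^sub>v embed base v = embed base (\<phi> g *\<^sub>v v)"
proof -
  assume g: "g \<in> H" and v: "v \<in> carrier_vec d"
  have g': "(p base)\<inverse> O g O p base \<in> H" by (intro H_comp H_converse g p_base_H)
  have "p base O ((p base)\<inverse> O g O p base) O (p base)\<inverse> = (p base O (p base)\<inverse>) O g O (p base O (p base)\<inverse>)"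
    by (simp only: O_assoc)
  also have "\<dots> = g" using g by (simp add: p_comp_converse[OF base(1)] Id_on_O O_Id_on H_iff)
  finally show ?thesis
    using induced_single_block[OF H_S[OF g'] base(1) base(1) linked_H[OF g'] embed_carrier, of base v]
    by (simp add: component_embed[OF base(1) v])
qed

text \<open>
  Every component of a vector can be moved to the block of \<open>Id_on X\<close> and, from there, to every
  other block. On the vectors concentrated in the block of \<open>Id_on X\<close> the maximal subgroup acts
  irreducibly.
\<close>

lemma induced_irreducible: "irreducible_rep M (L * d) \<psi>"
  unfolding irreducible_rep_iff
proof (intro conjI allI impI)
  show "mat_rep M (L * d) \<psi>" by (rule rep_induced)
  have "0 < L" using base(1) by linarith
  then show "0 < L * d" using d_pos by simp
  fix W assume W: "subspace_vec (L * d) W \<and> invariant M \<psi> W"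
  then have Wc: "W \<subseteq> carrier_vec (L * d)" and W0: "0\<^sub>v (L * d) \<in> W"
    and Wadd: "\<And>x y. x \<in> W \<Longrightarrow> y \<in> W \<Longrightarrow> x + y \<in> W" and Wsm: "\<And>c x. x \<in> W \<Longrightarrow> c \<cdot>\<^sub>v x \<in> W"
    and Winv: "\<And>s w. s \<in> S \<Longrightarrow> w \<in> W \<Longrightarrow> \<psi> s *\<^sub>v w \<in> W"
    by (auto simp: subspace_vec_def invariant_def)
  show "W = {0\<^sub>v (L * d)} \<or> W = carrier_vec (L * d)"
  proof (rule disjCI)
    assume "W \<noteq> carrier_vec (L * d)"
    define U where "U = {v \<in> carrier_vec d. embed base v \<in> W}"
    have "embed base (0\<^sub>v d) = 0\<^sub>v (L * d)" using d_pos by (intro eq_vecI) (auto simp: embed_def)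
    moreover have "embed base (x + y) = embed base x + embed base y" if "x \<in> carrier_vec d" "y \<in> carrier_vec d" for x y
      using that d_pos by (intro eq_vecI) (auto simp: embed_def)
    moreover have "embed base (c \<cdot>\<^sub>v x) = c \<cdot>\<^sub>v embed base x" if "x \<in> carrier_vec d" for c x
      using that d_pos by (intro eq_vecI) (auto simp: embed_def)
    ultimately have "subspace_vec d U"
      using W0 Wadd Wsm by (auto simp: U_def subspace_vec_def)
    moreover have "invariant G \<phi> U"
      unfolding invariant_def
    proof (intro ballI)
      fix g v assume "g \<in> carrier G" and v: "v \<in> U"
      then have g: "g \<in> H" by simp
      have vc: "v \<in> carrier_vec d" using v by (simp add: U_def)
      \<comment> \<open>The element chosen for \<open>Id_on X\<close> itself need not be the identity; conjugating by it undoes its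
        effect on the block.\<close>
      have "(p base)\<inverse> O g O p base \<in> S" by (intro H_S H_comp H_converse g p_base_H)
      from Winv[OF this, of "embed base v"] have "embed base (\<phi> g *\<^sub>v v) \<in> W"
        using v unfolding act_H[OF g vc] by (simp add: U_def)
      then show "\<phi> g *\<^sub>v v \<in> U" using rep_G(1)[OF rep_\<phi> g] vc by (simp add: U_def)
    qed
    ultimately have U: "U = {0\<^sub>v d} \<or> U = carrier_vec d" by (rule irreducible_repD(3)[OF \<phi>])
    have "U \<noteq> carrier_vec d"
    proof
      assume U: "U = carrier_vec d"
      have block: "embed k v \<in> W" if k: "k < L" and v: "v \<in> carrier_vec d" for k v
      proof -
        have v': "\<phi> (p base) *\<^sub>v v \<in> carrier_vec d" using rep_G(1)[OF rep_\<phi> p_base_H] v by simp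
        then have "embed base (\<phi> (p base) *\<^sub>v v) \<in> W" using U by (auto simp: U_def)
        then have "\<psi> ((p k)\<inverse>) *\<^sub>v embed base (\<phi> (p base) *\<^sub>v v) \<in> W"
          by (rule Winv[OF S_converse[OF p_S[OF k]]])
        then show ?thesis by (simp add: act_p_converse[OF k v'] \<phi>_p_base_inverse[OF v])
      qed
      have "carrier_vec (L * d) \<subseteq> W"
      proof
        fix w :: "'k vec" assume w: "w \<in> carrier_vec (L * d)"
        have "vec (L * d) (\<lambda>a. if a div d < m then w $ a else 0) \<in> W" if "m \<le> L" for m
          using that
        proof (induction m)
          case 0
          have "vec (L * d) (\<lambda>a. if a div d < 0 then w $ a else 0) = 0\<^sub>v (L * d)" by auto
          then show ?case using W0 by simp
        next
          case (Suc m)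
          have "vec (L * d) (\<lambda>a. if a div d < Suc m then w $ a else 0) =
            vec (L * d) (\<lambda>a. if a div d < m then w $ a else 0) + embed m (component m w)"
            using d_pos by (intro eq_vecI) (auto simp: embed_def component_def less_Suc_eq)
          then show ?case using Suc Wadd block[of m "component m w"] by simp
        qed
        from this[OF order_refl]
        have "vec (L * d) (\<lambda>a. if a div d < L then w $ a else 0) \<in> W" .
        moreover have "vec (L * d) (\<lambda>a. if a div d < L then w $ a else 0) = w"
          using w div_mod_less by (intro eq_vecI) auto
        ultimately show "w \<in> W" by simp
      qed
      then show False using \<open>W \<noteq> carrier_vec (L * d)\<close> Wc by blast
    qed
    with U have U0: "U = {0\<^sub>v d}" by blast
    have "w = 0\<^sub>v (L * d)" if w: "w \<in> W" for w
    proof (rule eq_vecI)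
      fix a assume "a < dim_vec (0\<^sub>v (L * d) :: 'k vec)"
      then have a: "a < L * d" by simp
      let ?k = "a div d"
      have k: "?k < L" "a mod d < d" using div_mod_less[OF a] by auto
      have wc: "w \<in> carrier_vec (L * d)" using w Wc by auto
      have "embed base (\<phi> (p base) *\<^sub>v component ?k w) \<in> W"
        using Winv[OF p_S[OF k(1)] w] act_p[OF k(1) wc] by simp
      then have "\<phi> (p base) *\<^sub>v component ?k w \<in> U" using rep_G(1)[OF rep_\<phi> p_base_H] by (auto simp: U_def)
      then have "\<phi> (p base) *\<^sub>v component ?k w = 0\<^sub>v d" using U0 by simp
      then have "component ?k w = \<phi> ((p base)\<inverse>) *\<^sub>v 0\<^sub>v d" using \<phi>_p_base_inverse[OF component_carrier, of ?k w] by simp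
      also have "\<dots> = 0\<^sub>v d" using rep_G(1)[OF rep_\<phi> H_converse[OF p_base_H]] by (intro eq_vecI) auto
      finally have "component ?k w $ (a mod d) = 0" using k by simp
      then show "w $ a = 0\<^sub>v (L * d) $ a" using a k by (simp add: component_def)
    qed (use w Wc in auto)
    then show "W = {0\<^sub>v (L * d)}" using W0 by blast
  qed
qed

lemma mat_trace_induced:
  assumes s: "s \<in> S"
  shows "mat_trace (\<psi> s) = (\<Sum>k<L. if linked s k k then mat_trace (\<phi> (p k O s O (p k)\<inverse>)) else 0)"
proof -
  have "mat_trace (\<psi> s) = (\<Sum>a<L * d. if linked s (a div d) (a div d)
      then \<phi> (p (a div d) O s O (p (a div d))\<inverse>) $$ (a mod d, a mod d) else 0)"
    unfolding mat_trace_def carrier_matD(1)[OF induced_carrier]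
    using s by (intro sum.cong) (auto simp: index_induced)
  also have "\<dots> = (\<Sum>k<L. \<Sum>i<d. if linked s k k then \<phi> (p k O s O (p k)\<inverse>) $$ (i, i) else 0)"
    by (rule sum_div_mod)
  also have "\<dots> = (\<Sum>k<L. if linked s k k then mat_trace (\<phi> (p k O s O (p k)\<inverse>)) else 0)"
  proof (rule sum.cong[OF refl])
    fix k assume "k \<in> {..<L}"
    then have "dim_row (\<phi> (p k O s O (p k)\<inverse>)) = d" if "linked s k k"
      using rep_G(1)[OF rep_\<phi> linked_group[OF _ _ s that]] by auto
    then show "(\<Sum>i<d. if linked s k k then \<phi> (p k O s O (p k)\<inverse>) $$ (i, i) else 0) =
        (if linked s k k then mat_trace (\<phi> (p k O s O (p k)\<inverse>)) else 0)"
      by (simp add: mat_trace_def)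
  qed
  finally show ?thesis .
qed

lemma mat_trace_conj_H:
  assumes g: "g \<in> H"
  shows "mat_trace (\<phi> (p base O g O (p base)\<inverse>)) = mat_trace (\<phi> g)"
proof -
  note h = p_base_H and h' = H_converse[OF p_base_H]
  have "\<phi> (p base O g O (p base)\<inverse>) = \<phi> (p base) * \<phi> (g O (p base)\<inverse>)"
    by (rule rep_G(2)[OF rep_\<phi> h H_comp[OF g h']])
  then have "mat_trace (\<phi> (p base O g O (p base)\<inverse>)) = mat_trace (\<phi> (g O (p base)\<inverse>) * \<phi> (p base))"
    using mat_trace_comm rep_G(1)[OF rep_\<phi> h] rep_G(1)[OF rep_\<phi> H_comp[OF g h']] by metis
  also have "\<phi> (g O (p base)\<inverse>) * \<phi> (p base) = \<phi> ((g O (p base)\<inverse>) O p base)"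
    by (rule rep_G(2)[OF rep_\<phi> H_comp[OF g h'] h, symmetric])
  also have "(g O (p base)\<inverse>) O p base = g"
    using H_inverse(2)[OF h] g by (simp add: O_assoc O_Id_on H_iff)
  finally show ?thesis .
qed

text \<open>
  A proper restriction of \<open>g\<close> is defined on fewer than \<open>card X\<close> points, so it has no nonzero
  diagonal block. This leaves \<open>g\<close> itself, which has the block of \<open>Id_on X\<close> only.
\<close>

lemma mat_trace_bracket_induced:
  assumes g: "g \<in> H"
  shows "mat_trace (bracket (L * d) \<psi> g) = mat_trace (\<phi> g)"
proof -
  have gS: "g \<in> S" and Dg: "Domain g = X" using g by (auto simp: H_iff)
  have fX: "finite X" using X finite_subset by blast
  have "mat_trace (bracket (L * d) \<psi> g) =
    (\<Sum>Y\<in>Pow X. mat_trace ((-1) ^ card (X - Y) \<cdot>\<^sub>m \<psi> (Id_on Y O g)))"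
    unfolding bracket_def Dg by (rule mat_trace_msum) simp
  also have "\<dots> = (\<Sum>Y\<in>Pow X. (-1) ^ card (X - Y) * mat_trace (\<psi> (Id_on Y O g)))"
    by (simp add: mat_trace_smult[OF induced_carrier])
  also have "\<dots> = (\<Sum>Y\<in>{X}. (-1) ^ card (X - Y) * mat_trace (\<psi> (Id_on Y O g)))"
  proof (rule sum.mono_neutral_right)
    show "\<forall>Y\<in>Pow X - {X}. (-1) ^ card (X - Y) * mat_trace (\<psi> (Id_on Y O g)) = 0"
    proof
      fix Y assume Y: "Y \<in> Pow X - {X}"
      have "\<not> linked (Id_on Y O g) k k" if k: "k < L" for k
      proof
        assume "linked (Id_on Y O g) k k"
        then have "Z k \<subseteq> Y" unfolding linked_def by blast
        moreover have "card Y < card X" using Y fX by (intro psubset_card_mono) auto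
        moreover have "finite Y" using Y fX finite_subset by auto
        ultimately show False using card_mono[of Y "Z k"] card_Z[OF k] by auto
      qed
      moreover have "Id_on Y O g \<in> S" using S_restrict[OF gS] Y Dg by simp
      ultimately have "mat_trace (\<psi> (Id_on Y O g)) = 0" by (simp add: mat_trace_induced)
      then show "(-1) ^ card (X - Y) * mat_trace (\<psi> (Id_on Y O g)) = 0" by simp
    qed
  qed (use fX in auto)
  also have "\<dots> = mat_trace (\<psi> g)" using Dg by (simp add: Id_on_O)
  also have "\<dots> = (\<Sum>k<L. if k = base then mat_trace (\<phi> (p base O g O (p base)\<inverse>)) else 0)"
    unfolding mat_trace_induced[OF gS] by (intro sum.cong) (auto simp: linked_H[OF g])
  also have "\<dots> = mat_trace (\<phi> g)" using base(1) mat_trace_conj_H[OF g] by simp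
  finally show ?thesis .
qed

end

section \<open>The pairing counts multiplicities\<close>

text \<open>
  The partial identities below \<open>Id_on X\<close> form a Boolean lattice.
\<close>

lemma moebius_Id_on:
  assumes "finite X" "Y \<subseteq> X" and P: "finite P" "\<And>Z. Z \<subseteq> X \<Longrightarrow> Id_on Z \<in> P"
    and P': "\<And>f. f \<in> P \<Longrightarrow> \<exists>Z. f = Id_on Z"
  shows "moebius P (Id_on Y) (Id_on X) = (-1) ^ card (X - Y)"
  using assms(1,2) P(2)
proof (induction X rule: finite_psubset_induct)
  case (psubset X)
  show ?case
  proof (cases "Y = X")
    case True
    then show ?thesis by (simp add: moebius.simps)
  next
    case False
    then have less: "Id_on Y < Id_on X" using psubset.prems by (auto simp: less_le)
    let ?I = "{Z. Y \<subseteq> Z \<and> Z \<subseteq> X}"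
    have fin: "finite ?I" by (rule finite_subset[of _ "Pow X"]) (use psubset.hyps in auto)
    have "{z \<in> P. Id_on Y \<le> z \<and> z < Id_on X} = Id_on ` (?I - {X})"
    proof
      show "{z \<in> P. Id_on Y \<le> z \<and> z < Id_on X} \<subseteq> Id_on ` (?I - {X})"
      proof
        fix z assume z: "z \<in> {z \<in> P. Id_on Y \<le> z \<and> z < Id_on X}"
        then obtain Z where "z = Id_on Z" using P' by blast
        then show "z \<in> Id_on ` (?I - {X})" using z by (simp add: less_le image_iff)
      qed
      show "Id_on ` (?I - {X}) \<subseteq> {z \<in> P. Id_on Y \<le> z \<and> z < Id_on X}"
        using psubset.prems(2) by (auto simp: less_le)
    qed
    then have "moebius P (Id_on Y) (Id_on X) = - (\<Sum>z\<in>Id_on ` (?I - {X}). moebius P (Id_on Y) z)"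
      using less P(1) False by (subst moebius.simps) simp
    also have "(\<Sum>z\<in>Id_on ` (?I - {X}). moebius P (Id_on Y) z) = (\<Sum>Z\<in>?I - {X}. moebius P (Id_on Y) (Id_on Z))"
      by (rule sum.reindex_cong[of Id_on]) (auto simp: inj_on_def)
    also have "\<dots> = (\<Sum>Z\<in>?I - {X}. (-1) ^ card (Z - Y))"
      by (rule sum.cong[OF refl], rule psubset.IH) (use psubset.prems in auto)
    also have "\<dots> = (\<Sum>Z\<in>?I. (-1) ^ card (Z - Y)) - (-1) ^ card (X - Y)"
      using fin psubset.prems(1) by (subst sum_diff) auto
    also have "(\<Sum>Z\<in>?I. (-1) ^ card (Z - Y)) = (0 :: int)"
      using sum_interval_alternating[OF psubset.hyps psubset.prems(1), where 'k = int] False by simp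
    finally show ?thesis by simp
  qed
qed

context maximal_subgroup begin

lemma finite_X: "finite X" using X finite_subset by blast

lemma pairing_eq:
  "pairing S (Id_on X) \<chi> \<theta> = 1 / of_nat (card H) * (\<Sum>g\<in>H. \<chi> (g\<inverse>) *
    (\<Sum>Y\<in>Pow X. (-1) ^ card (X - Y) * \<theta> (Id_on Y O g)))" for \<chi> \<theta> :: "nat rel \<Rightarrow> 'k::field"
proof -
  have fs: "{f \<in> idems S. f \<subseteq> Id_on X} = Id_on ` Pow X"
    using X unfolding idems_eq idems_pperms by auto
  have m: "moebius (idems S) (Id_on Y) (Id_on X) = (-1) ^ card (X - Y)" if "Y \<in> Pow X" for Y
    by (rule moebius_Id_on) (use that X finite_X in \<open>auto simp: idems_eq idems_pperms\<close>)
  have "pairing S (Id_on X) \<chi> \<theta> =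
    (\<Sum>Y\<in>Pow X. 1 / of_nat (card H) * (\<Sum>g\<in>H. \<chi> (g\<inverse>) * \<theta> (Id_on Y O g)) *
      of_int (moebius (idems S) (Id_on Y) (Id_on X)))"
    unfolding pairing_def fs by (rule sum.reindex_cong[of Id_on]) (auto simp: inj_on_def)
  also have "\<dots> = 1 / of_nat (card H) * (\<Sum>Y\<in>Pow X. \<Sum>g\<in>H. \<chi> (g\<inverse>) * ((-1) ^ card (X - Y) * \<theta> (Id_on Y O g)))"
    unfolding sum_distrib_left[of "1 / of_nat (card H)"]
    by (intro sum.cong refl) (simp add: m sum_distrib_right sum_distrib_left mult_ac)
  also have "(\<Sum>Y\<in>Pow X. \<Sum>g\<in>H. \<chi> (g\<inverse>) * ((-1) ^ card (X - Y) * \<theta> (Id_on Y O g))) =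
      (\<Sum>g\<in>H. \<Sum>Y\<in>Pow X. \<chi> (g\<inverse>) * ((-1) ^ card (X - Y) * \<theta> (Id_on Y O g)))" by (rule sum.swap)
  finally show ?thesis by (simp add: sum_distrib_left)
qed

lemma pairing_cong:
  assumes "\<And>s. s \<in> S \<Longrightarrow> \<theta> s = \<theta>' s"
  shows "pairing S (Id_on X) \<chi> \<theta> = pairing S (Id_on X) \<chi> (\<theta>' :: nat rel \<Rightarrow> 'k::field)"
proof -
  have "Id_on Y O g \<in> S" if "g \<in> H" "Y \<in> Pow X" for g Y
    using that S_restrict[of g Y] by (simp add: H_iff)
  then show ?thesis unfolding pairing_eq by (simp add: assms)
qed

lemma pairing_sum_list:
  "pairing S (Id_on X) \<chi> (\<lambda>s. \<Sum>x\<leftarrow>xs. \<theta> x s) = (\<Sum>x\<leftarrow>xs. pairing S (Id_on X) \<chi> (\<theta> x))"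
  for \<chi> :: "nat rel \<Rightarrow> 'k::field"
proof (induction xs)
  case (Cons x xs)
  have "pairing S (Id_on X) \<chi> (\<lambda>s. \<theta> s + \<theta>' s) = pairing S (Id_on X) \<chi> \<theta> + pairing S (Id_on X) \<chi> \<theta>'" for \<theta> \<theta>'
    unfolding pairing_eq by (simp add: sum.distrib distrib_left)
  then show ?case using Cons by simp
qed (simp add: pairing_eq)

lemma pairing_character:
  assumes \<sigma>: "mat_rep M N \<sigma>"
  shows "pairing S (Id_on X) \<chi> (character \<sigma>) =
    1 / of_nat (card H) * (\<Sum>g\<in>H. \<chi> (g\<inverse>) * mat_trace (bracket N \<sigma> g))"
proof -
  have "mat_trace (bracket N \<sigma> g) = (\<Sum>Y\<in>Pow X. (-1) ^ card (X - Y) * character \<sigma> (Id_on Y O g))"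
    if g: "g \<in> H" for g
  proof -
    have gS: "g \<in> S" and Dg: "Domain g = X" using g by (auto simp: H_iff)
    have "mat_trace (bracket N \<sigma> g) = (\<Sum>Y\<in>Pow X. mat_trace ((-1) ^ card (X - Y) \<cdot>\<^sub>m \<sigma> (Id_on Y O g)))"
      unfolding bracket_def Dg by (rule mat_trace_msum) (use bracket_term_carrier[OF \<sigma> gS] Dg in auto)
    also have "\<dots> = (\<Sum>Y\<in>Pow X. (-1) ^ card (X - Y) * character \<sigma> (Id_on Y O g))"
      by (intro sum.cong refl, unfold character_def, rule mat_trace_smult, rule rep_M(1)[OF \<sigma>], rule S_restrict[OF gS])
        (simp add: Dg)
    finally show ?thesis .
  qed
  then show ?thesis unfolding pairing_eq by simp
qed

end

context induced begin

text \<open>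
  Frobenius reciprocity. A map that intertwines the maximal subgroup, and on which all elements
  vanish whose range does not contain \<open>X\<close>, extends to the induced representation: the block \<open>k\<close> is
  mapped by moving it to \<open>Id_on X\<close> first.
\<close>

lemma intertwiner:
  assumes \<sigma>: "mat_rep M N \<sigma>" and T: "T \<in> carrier_mat N d"
    and TH: "\<And>g. g \<in> H \<Longrightarrow> \<sigma> g * T = T * \<phi> g"
    and T0: "\<And>s. s \<in> S \<Longrightarrow> \<not> X \<subseteq> Range s \<Longrightarrow> \<sigma> s * T = 0\<^sub>m N d"
    and s: "s \<in> S"
  defines "T' \<equiv> mat N (L * d) (\<lambda>(a, b). (\<sigma> ((p (b div d))\<inverse>) * T) $$ (a, b mod d))"
  shows "\<sigma> s * T' = T' * \<psi> s"
proof (rule eq_matI)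
  have T'c: "T' \<in> carrier_mat N (L * d)" by (simp add: T'_def)
  fix a b assume "a < dim_row (T' * \<psi> s)" "b < dim_col (T' * \<psi> s)"
  then have a: "a < N" and b: "b < L * d" using T'c by (auto simp: induced_rep_def)
  let ?l = "b div d" and ?j = "b mod d"
  have l: "?l < L" and j: "?j < d" using div_mod_less[OF b] by auto
  note c = rep_M(1)[OF \<sigma>]
  have pS: "(p k)\<inverse> \<in> S" if "k < L" for k using S_converse[OF p_S[OF that]] .
  have \<sigma>T: "\<sigma> t * T \<in> carrier_mat N d" if "t \<in> S" for t using c[OF that] T by auto
  have "(\<sigma> s * T') $$ (a, b) = (\<Sum>i<N. \<sigma> s $$ (a, i) * (\<sigma> ((p ?l)\<inverse>) * T) $$ (i, ?j))"
    using a b c[OF s] by (subst index_mult_mat_sum) (auto simp: T'_def)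
  also have "\<dots> = (\<sigma> s * (\<sigma> ((p ?l)\<inverse>) * T)) $$ (a, ?j)"
    using a j c[OF s] \<sigma>T[OF pS[OF l]] by (subst index_mult_mat_sum) auto
  also have "\<sigma> s * (\<sigma> ((p ?l)\<inverse>) * T) = \<sigma> (s O (p ?l)\<inverse>) * T"
    using rep_M(2)[OF \<sigma> s pS[OF l]] mat_assoc[of "\<sigma> s" "\<sigma> ((p ?l)\<inverse>)" T] c[OF s] c[OF pS[OF l]] T by auto
  finally have left: "(\<sigma> s * T') $$ (a, b) = (\<sigma> (s O (p ?l)\<inverse>) * T) $$ (a, ?j)" .
  have "(T' * \<psi> s) $$ (a, b) = (\<Sum>x<L * d. T' $$ (a, x) * \<psi> s $$ (x, b))"
    using a b by (subst index_mult_mat_sum) (auto simp: T'_def induced_rep_def)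
  also have "\<dots> = (\<Sum>x<L * d. (\<lambda>k i. if linked s k ?l
      then (\<sigma> ((p k)\<inverse>) * T) $$ (a, i) * \<phi> (p k O s O (p ?l)\<inverse>) $$ (i, ?j) else 0) (x div d) (x mod d))"
    using a b s by (intro sum.cong) (auto simp: T'_def index_induced)
  also have "\<dots> = (\<Sum>k<L. \<Sum>i<d. if linked s k ?l
      then (\<sigma> ((p k)\<inverse>) * T) $$ (a, i) * \<phi> (p k O s O (p ?l)\<inverse>) $$ (i, ?j) else 0)"
    by (rule sum_div_mod)
  also have "\<dots> = (\<Sum>k<L. if linked s k ?l then (\<sigma> (s O (p ?l)\<inverse>) * T) $$ (a, ?j) else 0)"
  proof (rule sum.cong[OF refl])
    fix k assume "k \<in> {..<L}"
    then have k: "k < L" by simp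
    show "(\<Sum>i<d. if linked s k ?l
      then (\<sigma> ((p k)\<inverse>) * T) $$ (a, i) * \<phi> (p k O s O (p ?l)\<inverse>) $$ (i, ?j) else 0) =
      (if linked s k ?l then (\<sigma> (s O (p ?l)\<inverse>) * T) $$ (a, ?j) else 0)"
    proof (cases "linked s k ?l")
      case True
      let ?g = "p k O s O (p ?l)\<inverse>"
      have g: "?g \<in> H" by (rule linked_group[OF k l s True])
      have "(\<Sum>i<d. (\<sigma> ((p k)\<inverse>) * T) $$ (a, i) * \<phi> ?g $$ (i, ?j)) = ((\<sigma> ((p k)\<inverse>) * T) * \<phi> ?g) $$ (a, ?j)"
        using a j \<sigma>T[OF pS[OF k]] rep_G(1)[OF rep_\<phi> g] by (subst index_mult_mat_sum) auto
      also have "(\<sigma> ((p k)\<inverse>) * T) * \<phi> ?g = \<sigma> ((p k)\<inverse>) * (T * \<phi> ?g)"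
        by (rule mat_assoc) (use c[OF pS[OF k]] T rep_G(1)[OF rep_\<phi> g] in auto)
      also have "\<dots> = \<sigma> ((p k)\<inverse>) * (\<sigma> ?g * T)" by (simp only: TH[OF g])
      also have "\<dots> = \<sigma> ((p k)\<inverse>) * \<sigma> ?g * T"
        by (rule mat_assoc[symmetric]) (use c[OF pS[OF k]] c[OF H_S[OF g]] T in auto)
      also have "\<sigma> ((p k)\<inverse>) * \<sigma> ?g = \<sigma> ((p k)\<inverse> O ?g)" by (rule rep_M(2)[OF \<sigma> pS[OF k] H_S[OF g], symmetric])
      also have "(p k)\<inverse> O ?g = Id_on (Z k) O (s O (p ?l)\<inverse>)"
        by (simp only: p_converse_comp[OF k, symmetric] O_assoc)
      also have "\<dots> = s O (p ?l)\<inverse>"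
      proof (rule Id_on_O)
        show "Domain (s O (p ?l)\<inverse>) \<subseteq> Z k"
        proof
          fix x assume "x \<in> Domain (s O (p ?l)\<inverse>)"
          then obtain y where y: "(x, y) \<in> s" "y \<in> Z ?l" unfolding Z_def by blast
          then obtain x' where "x' \<in> Z k" "(x', y) \<in> s" using True unfolding linked_def by blast
          then show "x \<in> Z k" using S_inj'[OF s y(1)] by blast
        qed
      qed
      finally show ?thesis using True by simp
    qed simp
  qed
  \<comment> \<open>Only the block of the preimage of \<open>Z ?l\<close> under \<open>s\<close> is linked to \<open>?l\<close>. There is no such block if
    \<open>Z ?l\<close> is not contained in the range of \<open>s\<close>, and then the right side vanishes as well.\<close>
  also have "\<dots> = (\<sigma> (s O (p ?l)\<inverse>) * T) $$ (a, ?j)"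
  proof (cases "Z ?l \<subseteq> Range s")
    case True
    let ?t = "p ?l O s\<inverse>"
    have "?t \<in> S" by (rule S_comp[OF p_S[OF l] S_converse[OF s]])
    moreover have "Domain ?t = X"
      using Domain_p[OF l] True unfolding Z_def by blast
    ultimately obtain k where k: "k < L" "Range ?t = Z k" by (rule ex_Z)
    have "Range ?t = s\<inverse> `` Z ?l" unfolding Z_def by blast
    then have Zk: "Z k = s\<inverse> `` Z ?l" using k by simp
    have "s `` (s\<inverse> `` Z ?l) = Z ?l"
    proof
      show "s `` (s\<inverse> `` Z ?l) \<subseteq> Z ?l" using S_inj[OF s] by blast
      show "Z ?l \<subseteq> s `` (s\<inverse> `` Z ?l)" using True by blast
    qed
    moreover have "s\<inverse> `` Z ?l \<subseteq> Domain s" by blast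
    ultimately have ck: "linked s k ?l" unfolding linked_def Zk by simp
    have uniq: "k' = k" if "k' < L" "linked s k' ?l" for k'
    proof -
      have "Z k' \<subseteq> Z k" using that(2) unfolding linked_def Zk by blast
      then show ?thesis using Z_subset_iff[OF that(1) k(1)] by simp
    qed
    have "(\<Sum>k<L. if linked s k ?l then (\<sigma> (s O (p ?l)\<inverse>) * T) $$ (a, ?j) else 0) =
      (\<Sum>k'<L. if k' = k then (\<sigma> (s O (p ?l)\<inverse>) * T) $$ (a, ?j) else 0)"
    proof (rule sum.cong[OF refl])
      fix k' assume "k' \<in> {..<L}"
      then have "linked s k' ?l \<longleftrightarrow> k' = k" using uniq[of k'] ck by blast
      then show "(if linked s k' ?l then (\<sigma> (s O (p ?l)\<inverse>) * T) $$ (a, ?j) else 0) =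
        (if k' = k then (\<sigma> (s O (p ?l)\<inverse>) * T) $$ (a, ?j) else 0)" by simp
    qed
    then show ?thesis using k by simp
  next
    case False
    have "\<not> X \<subseteq> Range (s O (p ?l)\<inverse>)"
    proof
      assume sub: "X \<subseteq> Range (s O (p ?l)\<inverse>)"
      have "Z ?l \<subseteq> Range s"
      proof
        fix y assume "y \<in> Z ?l"
        then obtain x where x: "(x, y) \<in> p ?l" unfolding Z_def by blast
        then have "x \<in> X" using Domain_p[OF l] by blast
        then obtain w y' where "(w, y') \<in> s" "(x, y') \<in> p ?l" using sub by blast
        then show "y \<in> Range s" using S_inj[OF p_S[OF l] x] by blast
      qed
      then show False using False by simp
    qed
    then have "(\<sigma> (s O (p ?l)\<inverse>) * T) $$ (a, ?j) = 0"
      using T0[OF S_comp[OF s pS[OF l]]] a j by simp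
    moreover have "\<not> linked s k ?l" for k
    proof
      assume "linked s k ?l"
      then have "Z ?l \<subseteq> Range s" unfolding linked_def by blast
      then show False using False by simp
    qed
    ultimately show ?thesis by simp
  qed
  finally show "(\<sigma> s * T') $$ (a, b) = (T' * \<psi> s) $$ (a, b)" using left by simp
qed (use rep_M(1)[OF \<sigma> s] in \<open>auto simp: T'_def induced_rep_def\<close>)

text \<open>
  The extension of a nonzero \<open>T\<close> would be a nonzero intertwiner between inequivalent irreducible
  representations.
\<close>

lemma intertwiner_zero:
  assumes \<sigma>: "irreducible_rep M N \<sigma>" and ne: "\<not> rep_equiv M N \<sigma> (L * d) \<psi>"
    and T: "T \<in> carrier_mat N d"
    and TH: "\<And>g. g \<in> H \<Longrightarrow> \<sigma> g * T = T * \<phi> g"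
    and T0: "\<And>s. s \<in> S \<Longrightarrow> \<not> X \<subseteq> Range s \<Longrightarrow> \<sigma> s * T = 0\<^sub>m N d"
  shows "T = 0\<^sub>m N d"
proof -
  note rep = irreducible_repD(1)[OF \<sigma>]
  note h' = H_converse[OF p_base_H]
  define T' where "T' = mat N (L * d) (\<lambda>(a, b). (\<sigma> ((p (b div d))\<inverse>) * T) $$ (a, b mod d))"
  have T'c: "T' \<in> carrier_mat N (L * d)" by (simp add: T'_def)
  have "T' = 0\<^sub>m N (L * d)"
  proof (rule ccontr)
    assume nz: "T' \<noteq> 0\<^sub>m N (L * d)"
    have "rep_equiv M N \<sigma> (L * d) \<psi>"
    proof (rule schur_equiv[OF \<sigma> induced_irreducible T'c nz])
      fix s assume "s \<in> carrier M"
      then have s: "s \<in> S" by simp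
      show "\<sigma> s * T' = T' * \<psi> s" unfolding T'_def by (rule intertwiner[OF rep T TH T0 s])
    qed
    then show False using ne by simp
  qed
  have z: "\<sigma> ((p base)\<inverse>) * T = 0\<^sub>m N d"
  proof (rule eq_matI)
    fix a j assume "a < dim_row (0\<^sub>m N d :: 'k mat)" "j < dim_col (0\<^sub>m N d :: 'k mat)"
    then have aj: "a < N" "j < d" by auto
    have "T' $$ (a, base * d + j) = (\<sigma> ((p base)\<inverse>) * T) $$ (a, j)"
      using aj block_index_less[OF base(1) aj(2)] by (simp add: T'_def)
    then show "(\<sigma> ((p base)\<inverse>) * T) $$ (a, j) = 0\<^sub>m N d $$ (a, j)"
      using \<open>T' = 0\<^sub>m N (L * d)\<close> aj block_index_less[OF base(1) aj(2)] by simp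
  qed (use T rep_M(1)[OF rep H_S[OF h']] in auto)
  have "T = T * \<phi> (Id_on X)" using rep_G(3)[OF rep_\<phi>] T by simp
  also have "\<dots> = \<sigma> (Id_on X) * T" by (simp only: TH[OF H_Id_on])
  also have "\<sigma> (Id_on X) = \<sigma> (p base) * \<sigma> ((p base)\<inverse>)"
    using rep_M(2)[OF rep H_S[OF p_base_H] H_S[OF h']] H_inverse(1)[OF p_base_H] by simp
  also have "\<dots> * T = \<sigma> (p base) * (\<sigma> ((p base)\<inverse>) * T)"
    by (rule mat_assoc) (use T rep_M(1)[OF rep H_S[OF h']] rep_M(1)[OF rep H_S[OF p_base_H]] in auto)
  also have "\<dots> = 0\<^sub>m N d" unfolding z by (rule right_mult_zero_mat[OF rep_M(1)[OF rep H_S[OF p_base_H]]])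
  finally show ?thesis .
qed

text \<open>
  An average over the arrows of the maximal subgroup satisfies both conditions for extending it
  to an intertwiner.
\<close>

lemma average_zero:
  assumes \<sigma>: "irreducible_rep M N \<sigma>" and ne: "\<not> rep_equiv M N \<sigma> (L * d) \<psi>"
    and T: "T \<in> carrier_mat N d"
  shows "msum N d (\<lambda>g. bracket N \<sigma> g * T * \<phi> (g\<inverse>)) H = 0\<^sub>m N d"
proof (rule intertwiner_zero[OF \<sigma> ne msum_carrier])
  note rep = irreducible_repD(1)[OF \<sigma>]
  have \<phi>c: "\<phi> (g\<inverse>) \<in> carrier_mat d d" if "g \<in> H" for g using rep_G(1)[OF rep_\<phi> H_converse[OF that]] .
  have c: "bracket N \<sigma> g * T * \<phi> (g\<inverse>) \<in> carrier_mat N d" if "g \<in> H" for g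
    by (rule mult3_carrier[OF bracket_carrier T \<phi>c[OF that]])
  have mult: "\<sigma> s * (bracket N \<sigma> g * T * \<phi> (g\<inverse>)) = (\<sigma> s * bracket N \<sigma> g) * T * \<phi> (g\<inverse>)"
    if "s \<in> S" "g \<in> H" for s g
    using rep_M(1)[OF rep that(1)] \<phi>c[OF that(2)] T by (simp add: mat_assoc)
  fix h assume h: "h \<in> H"
  have bij: "bij_betw (\<lambda>g. h O g) H H"
    using group_bij_mult_left[OF group_G] h by simp
  have "\<sigma> h * msum N d (\<lambda>g. bracket N \<sigma> g * T * \<phi> (g\<inverse>)) H =
      msum N d (\<lambda>g. \<sigma> h * (bracket N \<sigma> g * T * \<phi> (g\<inverse>))) H"
    by (rule mult_msum[OF rep_M(1)[OF rep H_S[OF h]] c])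
  also have "\<dots> = msum N d (\<lambda>g. bracket N \<sigma> (h O g) * T * \<phi> ((h O g)\<inverse>) * \<phi> h) H"
  proof (rule msum_cong)
    fix g assume g: "g \<in> H"
    have "\<sigma> h * bracket N \<sigma> g = bracket N \<sigma> (h O g)"
      using rep_mult_bracket[OF rep H_S[OF g] H_S[OF h]] g h by (simp add: H_iff)
    moreover have "\<phi> (g\<inverse>) = \<phi> ((h O g)\<inverse>) * \<phi> h"
    proof -
      have "\<phi> ((h O g)\<inverse>) * \<phi> h = \<phi> ((h O g)\<inverse> O h)"
        by (rule rep_G(2)[OF rep_\<phi> H_converse[OF H_comp[OF h g]] h, symmetric])
      also have "(h O g)\<inverse> O h = g\<inverse>"
        using H_inverse(2)[OF h] O_Id_on[of "g\<inverse>" X] g by (simp add: converse_relcomp O_assoc H_iff)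
      finally show ?thesis ..
    qed
    ultimately have "\<sigma> h * (bracket N \<sigma> g * T * \<phi> (g\<inverse>)) = bracket N \<sigma> (h O g) * T * (\<phi> ((h O g)\<inverse>) * \<phi> h)"
      using mult[OF H_S[OF h] g] by simp
    also have "\<dots> = bracket N \<sigma> (h O g) * T * \<phi> ((h O g)\<inverse>) * \<phi> h"
      by (rule mat_assoc[symmetric]) (use T \<phi>c[OF H_comp[OF h g]] rep_G(1)[OF rep_\<phi> h] in auto)
    finally show "\<sigma> h * (bracket N \<sigma> g * T * \<phi> (g\<inverse>)) = bracket N \<sigma> (h O g) * T * \<phi> ((h O g)\<inverse>) * \<phi> h" .
  qed
  also have "\<dots> = msum N d (\<lambda>g. bracket N \<sigma> g * T * \<phi> (g\<inverse>) * \<phi> h) H"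
    by (rule msum_reindex[OF bij, symmetric])
  also have "\<dots> = msum N d (\<lambda>g. bracket N \<sigma> g * T * \<phi> (g\<inverse>)) H * \<phi> h"
    by (rule msum_mult[OF rep_G(1)[OF rep_\<phi> h] c, symmetric])
  finally show "\<sigma> h * msum N d (\<lambda>g. bracket N \<sigma> g * T * \<phi> (g\<inverse>)) H =
    msum N d (\<lambda>g. bracket N \<sigma> g * T * \<phi> (g\<inverse>)) H * \<phi> h" .
next
  note rep = irreducible_repD(1)[OF \<sigma>]
  have \<phi>c: "\<phi> (g\<inverse>) \<in> carrier_mat d d" if "g \<in> H" for g using rep_G(1)[OF rep_\<phi> H_converse[OF that]] .
  fix s assume s: "s \<in> S" "\<not> X \<subseteq> Range s"
  have "\<sigma> s * msum N d (\<lambda>g. bracket N \<sigma> g * T * \<phi> (g\<inverse>)) H =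
      msum N d (\<lambda>g. \<sigma> s * (bracket N \<sigma> g * T * \<phi> (g\<inverse>))) H"
    by (rule mult_msum[OF rep_M(1)[OF rep s(1)] mult3_carrier[OF bracket_carrier T \<phi>c]])
  also have "\<dots> = 0\<^sub>m N d"
  proof (rule msum_zero)
    fix g assume g: "g \<in> H"
    have "\<sigma> s * (bracket N \<sigma> g * T * \<phi> (g\<inverse>)) = (\<sigma> s * bracket N \<sigma> g) * T * \<phi> (g\<inverse>)"
      using rep_M(1)[OF rep s(1)] \<phi>c[OF g] T by (simp add: mat_assoc)
    also have "\<sigma> s * bracket N \<sigma> g = 0\<^sub>m N N"
      using rep_mult_bracket[OF rep H_S[OF g] s(1)] s(2) g by (simp add: H_iff)
    finally show "\<sigma> s * (bracket N \<sigma> g * T * \<phi> (g\<inverse>)) = 0\<^sub>m N d"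
      using T \<phi>c[OF g] by simp
  qed
  finally show "\<sigma> s * msum N d (\<lambda>g. bracket N \<sigma> g * T * \<phi> (g\<inverse>)) H = 0\<^sub>m N d" .
qed

lemma bracket_intertwine:
  assumes \<sigma>: "mat_rep M N \<sigma>" and eq: "rep_equiv M N \<sigma> (L * d) \<psi>" and g: "g \<in> H"
  shows "mat_trace (bracket N \<sigma> g) = mat_trace (bracket (L * d) \<psi> g)"
proof -
  have gS: "g \<in> S" by (rule H_S[OF g])
  have "mat_trace (bracket N \<sigma> g) = (\<Sum>Y\<in>Pow (Domain g). (-1) ^ card (Domain g - Y) * mat_trace (\<sigma> (Id_on Y O g)))"
    unfolding bracket_def
    by (subst mat_trace_msum[OF bracket_term_carrier[OF \<sigma> gS]], assumption, intro sum.cong refl mat_trace_smult,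
        rule rep_M(1)[OF \<sigma>], rule S_restrict[OF gS]) simp
  also have "\<dots> = (\<Sum>Y\<in>Pow (Domain g). (-1) ^ card (Domain g - Y) * mat_trace (\<psi> (Id_on Y O g)))"
  proof (rule sum.cong[OF refl])
    fix Y assume "Y \<in> Pow (Domain g)"
    then have "Id_on Y O g \<in> carrier M" using S_restrict[OF gS] by simp
    then show "(-1) ^ card (Domain g - Y) * mat_trace (\<sigma> (Id_on Y O g)) =
        (-1) ^ card (Domain g - Y) * mat_trace (\<psi> (Id_on Y O g))"
      using character_rep_equiv[OF eq \<sigma> rep_induced] by (simp add: character_def)
  qed
  also have "\<dots> = mat_trace (bracket (L * d) \<psi> g)"
    unfolding bracket_def
    by (subst mat_trace_msum[OF bracket_term_carrier[OF rep_induced gS]], assumption,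
        intro sum.cong refl mat_trace_smult[symmetric], rule induced_carrier)
  finally show ?thesis .
qed

text \<open>
  If \<open>\<sigma>\<close> is equivalent to the induced representation, the traces of the arrows \<open>g\<close> are the
  values of the character of \<open>\<phi>\<close>, and its norm is known; otherwise all averages are zero.
\<close>

lemma pairing_irreducible:
  assumes \<sigma>: "irreducible_rep M N \<sigma>"
  shows "pairing S (Id_on X) (character \<phi>) (character \<sigma>) = (if rep_equiv M N \<sigma> (L * d) \<psi> then 1 else 0)"
proof -
  note rep = irreducible_repD(1)[OF \<sigma>]
  have pair: "pairing S (Id_on X) (character \<phi>) (character \<sigma>) =
    1 / of_nat (card H) * (\<Sum>g\<in>H. mat_trace (bracket N \<sigma> g) * mat_trace (\<phi> (g\<inverse>)))"
    unfolding pairing_character[OF rep] by (simp add: character_def mult.commute)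
  show ?thesis
  proof (cases "rep_equiv M N \<sigma> (L * d) \<psi>")
    case True
    have "(\<Sum>g\<in>H. mat_trace (bracket N \<sigma> g) * mat_trace (\<phi> (g\<inverse>))) =
        (\<Sum>g\<in>carrier G. character \<phi> g * character \<phi> (inv\<^bsub>G\<^esub> g))"
      by (intro sum.cong) (auto simp: bracket_intertwine[OF rep True] mat_trace_bracket_induced inv_G character_def)
    also have "\<dots> = of_nat (card H)" using schur_orthogonality_irreducible[OF group_G \<phi>] by simp
    finally show ?thesis using True pair finite_H H_Id_on by (auto simp: card_eq_0_iff)
  next
    case False
    have "(\<Sum>g\<in>H. mat_trace (bracket N \<sigma> g) * mat_trace (\<phi> (g\<inverse>))) =
       (\<Sum>i<N. \<Sum>j<d. msum N d (\<lambda>g. bracket N \<sigma> g * elem_mat N d i j * \<phi> (g\<inverse>)) H $$ (i, j))"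
      by (rule sum_mult_mat_trace[OF bracket_carrier rep_G(1)[OF rep_\<phi> H_converse]])
    also have "\<dots> = 0" by (simp add: average_zero[OF \<sigma> False] del: index_msum)
    finally show ?thesis using False pair by simp
  qed
qed

text \<open>
  By additivity the pairing counts the summands equivalent to the induced representation, whichever
  decomposition is chosen.
\<close>

theorem has_multiplicity_pairing:
  assumes \<rho>: "mat_rep M N \<rho>"
  shows "\<exists>m. has_multiplicity M (L * d) \<psi> N \<rho> m \<and> of_nat m = pairing S (Id_on X) (character \<phi>) (character \<rho>)"
proof -
  have count: "of_nat (length (filter (\<lambda>(d', \<sigma>). rep_equiv M d' \<sigma> (L * d) \<psi>) Rs)) =
      pairing S (Id_on X) (character \<phi>) (character \<rho>)"
    if Rs: "irreducible_decomposition M N \<rho> Rs" for Rs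
  proof -
    have "pairing S (Id_on X) (character \<phi>) (character \<rho>) =
        pairing S (Id_on X) (character \<phi>) (\<lambda>s. \<Sum>R\<leftarrow>Rs. character (snd R) s)"
      by (rule pairing_cong) (use character_decomposition[OF \<rho> Rs] in \<open>simp add: split_def\<close>)
    also have "\<dots> = (\<Sum>R\<leftarrow>Rs. pairing S (Id_on X) (character \<phi>) (character (snd R)))"
      by (rule pairing_sum_list)
    also have "\<dots> = (\<Sum>R\<leftarrow>Rs. if rep_equiv M (fst R) (snd R) (L * d) \<psi> then 1 else 0)"
      by (rule arg_cong[of _ _ sum_list], rule map_cong[OF refl])
        (use Rs pairing_irreducible in \<open>auto simp: irreducible_decomposition_def\<close>)
    also have "\<dots> = of_nat (length (filter (\<lambda>(d', \<sigma>). rep_equiv M d' \<sigma> (L * d) \<psi>) Rs))"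
      by (induction Rs) (auto simp: split_def)
    finally show ?thesis ..
  qed
  obtain Rs where Rs: "irreducible_decomposition M N \<rho> Rs"
    using irreducible_decomposition_exists[OF monoid_semisimple \<rho>] by blast
  let ?m = "length (filter (\<lambda>(d', \<sigma>). rep_equiv M d' \<sigma> (L * d) \<psi>) Rs)"
  have "length (filter (\<lambda>(d', \<sigma>). rep_equiv M d' \<sigma> (L * d) \<psi>) Ts) = ?m"
    if "irreducible_decomposition M N \<rho> Ts" for Ts
    using trans[OF count[OF that] count[OF Rs, symmetric]] unfolding of_nat_eq_iff .
  then have "has_multiplicity M (L * d) \<psi> N \<rho> ?m" 
    unfolding has_multiplicity_def by (intro conjI exI[of _ Rs] Rs allI impI)
  then show ?thesis using count[OF Rs] by blast
qed

end

section \<open>Tensor powers of rook matrices\<close>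

lemma kronecker_carrier [simp]:
  "A \<in> carrier_mat a b \<Longrightarrow> B \<in> carrier_mat c e \<Longrightarrow> kronecker A B \<in> carrier_mat (a * c) (b * e)"
  by (auto simp: kronecker_def)

lemma kronecker_mult:
  assumes A: "A \<in> carrier_mat a b" and B: "B \<in> carrier_mat a' b'" and C: "C \<in> carrier_mat b c" and D: "D \<in> carrier_mat b' c'"
  shows "kronecker (A * C) (B * D) = kronecker A B * kronecker C D"
proof (rule eq_matI)
  fix i j assume "i < dim_row (kronecker A B * kronecker C D)" "j < dim_col (kronecker A B * kronecker C D)"
  then have ij: "i < a * a'" "j < c * c'" using A B C D by (auto simp: kronecker_def)
  note im = div_mod_less[OF ij(1)] and jm = div_mod_less[OF ij(2)]
  have "(kronecker A B * kronecker C D) $$ (i, j) =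
      (\<Sum>k<b * b'. (\<lambda>x y. A $$ (i div a', x) * B $$ (i mod a', y) * (C $$ (x, j div c') * D $$ (y, j mod c')))
        (k div b') (k mod b'))"
    using ij A B C D by (subst index_mult_mat_sum) (simp_all add: kronecker_def)
  also have "\<dots> = (\<Sum>x<b. \<Sum>y<b'. A $$ (i div a', x) * B $$ (i mod a', y) * (C $$ (x, j div c') * D $$ (y, j mod c')))"
    by (rule sum_div_mod)
  also have "\<dots> = (\<Sum>x<b. A $$ (i div a', x) * C $$ (x, j div c')) * (\<Sum>y<b'. B $$ (i mod a', y) * D $$ (y, j mod c'))"
    unfolding sum_product by (intro sum.cong refl) (simp add: mult_ac)
  also have "(\<Sum>x<b. A $$ (i div a', x) * C $$ (x, j div c')) = (A * C) $$ (i div a', j div c')"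
    using im jm A C by (subst index_mult_mat_sum) auto
  also have "(\<Sum>y<b'. B $$ (i mod a', y) * D $$ (y, j mod c')) = (B * D) $$ (i mod a', j mod c')"
    using im jm B D by (subst index_mult_mat_sum) auto
  also have "(A * C) $$ (i div a', j div c') * (B * D) $$ (i mod a', j mod c') = kronecker (A * C) (B * D) $$ (i, j)"
    using ij A B C D by (simp add: kronecker_def del: index_mult_mat(1))
  finally show "kronecker (A * C) (B * D) $$ (i, j) = (kronecker A B * kronecker C D) $$ (i, j)" ..
qed (use A B C D in \<open>auto simp: kronecker_def\<close>)

lemma kronecker_one: "kronecker (1\<^sub>m a) (1\<^sub>m b) = (1\<^sub>m (a * b) :: 'k::field mat)"
proof (rule eq_matI)
  fix i j assume "i < dim_row (1\<^sub>m (a * b) :: 'k mat)" "j < dim_col (1\<^sub>m (a * b) :: 'k mat)"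
  then have ij: "i < a * b" "j < a * b" by auto
  have "i = j" if "i div b = j div b" "i mod b = j mod b" using that by (metis div_mult_mod_eq)
  then show "kronecker (1\<^sub>m a) (1\<^sub>m b) $$ (i, j) = (1\<^sub>m (a * b) :: 'k mat) $$ (i, j)"
    using ij div_mod_less[OF ij(1)] div_mod_less[OF ij(2)] by (auto simp: kronecker_def)
qed (auto simp: kronecker_def)

lemma mat_trace_kronecker:
  assumes "A \<in> carrier_mat a a" "B \<in> carrier_mat b b"
  shows "mat_trace (kronecker A B) = mat_trace A * mat_trace (B :: 'k::field mat)"
proof -
  have "mat_trace (kronecker A B) = (\<Sum>i<a * b. (\<lambda>x y. A $$ (x, x) * B $$ (y, y)) (i div b) (i mod b))"
    unfolding mat_trace_def using assms by (intro sum.cong) (auto simp: kronecker_def)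
  also have "\<dots> = (\<Sum>x<a. \<Sum>y<b. A $$ (x, x) * B $$ (y, y))" by (rule sum_div_mod)
  finally show ?thesis using assms by (simp add: mat_trace_def sum_product)
qed

lemma kronecker_power_carrier: "A \<in> carrier_mat a a \<Longrightarrow> kronecker_power p A \<in> carrier_mat (a ^ p) (a ^ p)"
  by (induction p) auto

lemma kronecker_power_mult:
  "A \<in> carrier_mat a a \<Longrightarrow> B \<in> carrier_mat a a \<Longrightarrow>
   kronecker_power p (A * B) = kronecker_power p A * kronecker_power p (B :: 'k::field mat)"
  by (induction p) (auto simp: kronecker_mult[OF _ kronecker_power_carrier _ kronecker_power_carrier])

lemma kronecker_power_one: "kronecker_power p (1\<^sub>m a) = (1\<^sub>m (a ^ p) :: 'k::field mat)"
  by (induction p) (auto simp: kronecker_one)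

lemma mat_trace_kronecker_power:
  "A \<in> carrier_mat a a \<Longrightarrow> mat_trace (kronecker_power p A) = mat_trace (A :: 'k::field mat) ^ p"
  by (induction p) (auto simp: mat_trace_kronecker[OF _ kronecker_power_carrier])

lemma tensor_power_rep:
  assumes "mat_rep G d \<rho>"
  shows "mat_rep G (d ^ p) (tensor_power p \<rho>)"
  using assms unfolding mat_rep_iff tensor_power_def
  by (simp add: kronecker_power_carrier kronecker_power_mult[of _ d] kronecker_power_one)

lemma rook_rep_carrier: "rook_rep n s \<in> carrier_mat n n" by (simp add: rook_rep_def)

lemma mat_trace_rook_rep:
  "mat_trace (rook_rep n s :: 'k::field mat) = of_nat (card {x \<in> {1..n}. (x, x) \<in> s})"
proof -
  have "mat_trace (rook_rep n s :: 'k mat) = (\<Sum>i<n. if (Suc i, Suc i) \<in> s then 1 else 0)"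
    by (simp add: mat_trace_def rook_rep_def)
  also have "\<dots> = (\<Sum>x\<in>{1..n}. if (x, x) \<in> s then 1 else 0)"
    by (rule sum.reindex_bij_witness[of _ "\<lambda>x. x - 1" Suc]) auto
  also have "\<dots> = of_nat (card {x \<in> {1..n}. (x, x) \<in> s})"
    by (simp add: sum.If_cases Int_def)
  finally show ?thesis .
qed

context full_inverse_monoid begin

lemma rook_rep: "mat_rep M n (rook_rep n :: nat rel \<Rightarrow> 'k::field mat)"
  unfolding mat_rep_iff
proof (intro conjI ballI)
  fix s t assume "s \<in> carrier M" "t \<in> carrier M"
  then have s: "s \<in> S" and t: "t \<in> S" by auto
  show "rook_rep n (s \<otimes>\<^bsub>M\<^esub> t) = rook_rep n s * (rook_rep n t :: 'k mat)"
  proof (rule eq_matI)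
    fix i j assume "i < dim_row (rook_rep n s * (rook_rep n t :: 'k mat))" "j < dim_col (rook_rep n s * (rook_rep n t :: 'k mat))"
    then have ij: "i < n" "j < n" by (auto simp: rook_rep_def)
    have "(rook_rep n s * (rook_rep n t :: 'k mat)) $$ (i, j) =
        (\<Sum>k<n. (if (Suc i, Suc k) \<in> s then 1 else 0) * (if (Suc k, Suc j) \<in> t then 1 else 0))"
      using ij by (subst index_mult_mat_sum) (auto simp: rook_rep_def)
    also have "\<dots> = (if (Suc i, Suc j) \<in> s O t then 1 else 0)"
    proof (cases "(Suc i, Suc j) \<in> s O t")
      case True
      then obtain x where x: "(Suc i, x) \<in> s" "(x, Suc j) \<in> t" by blast
      then have "x \<in> {1..n}" using Range_S[OF s] by blast
      then obtain k where k: "x = Suc k" "k < n" by (cases x) auto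
      have "(\<Sum>k<n. (if (Suc i, Suc k) \<in> s then 1 else 0) * (if (Suc k, Suc j) \<in> t then 1 else 0)) =
        (\<Sum>k'<n. if k' = k then 1 else (0 :: 'k))"
        using x k S_inj[OF s x(1)] by (intro sum.cong) auto
      then show ?thesis using True k by simp
    next
      case False
      then have "(\<Sum>k<n. (if (Suc i, Suc k) \<in> s then 1 else 0) * (if (Suc k, Suc j) \<in> t then 1 else (0 :: 'k))) = 0"
        by (intro sum.neutral) auto
      then show ?thesis using False by simp
    qed
    finally show "rook_rep n (s \<otimes>\<^bsub>M\<^esub> t) $$ (i, j) = (rook_rep n s * (rook_rep n t :: 'k mat)) $$ (i, j)"
      using ij by (simp add: rook_rep_def)
  qed (auto simp: rook_rep_def)
next
  show "rook_rep n \<one>\<^bsub>M\<^esub> = (1\<^sub>m n :: 'k mat)"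
    by (intro eq_matI) (auto simp: rook_rep_def)
qed (simp add: rook_rep_def)

end

lemma sum_Pow_card:
  assumes "finite X"
  shows "(\<Sum>Y\<in>Pow X. f (card Y)) = (\<Sum>k\<le>card X. of_nat (card X choose k) * (f k :: 'k::comm_ring_1))"
proof -
  have "(\<Sum>Y\<in>Pow X. f (card Y)) = (\<Sum>k\<le>card X. \<Sum>Y\<in>{Y \<in> Pow X. card Y = k}. f (card Y))"
    by (rule sum.group[symmetric]) (use assms card_mono in auto)
  also have "\<dots> = (\<Sum>k\<le>card X. of_nat (card X choose k) * f k)"
  proof (rule sum.cong[OF refl])
    fix k
    have "{Y \<in> Pow X. card Y = k} = {Y. Y \<subseteq> X \<and> card Y = k}" by auto
    then show "(\<Sum>Y\<in>{Y \<in> Pow X. card Y = k}. f (card Y)) = of_nat (card X choose k) * f k"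
      using n_subsets[OF assms, of k] by simp
  qed
  finally show ?thesis .
qed

text \<open>
  Inclusion and exclusion over the images of maps from a set with \<open>p\<close> elements to \<open>X\<close>.
\<close>

lemma surjection_count:
  assumes "finite X"
  shows "(\<Sum>Y\<in>Pow X. (-1) ^ card (X - Y) * of_nat (card Y) ^ p) =
    (fact (card X) * of_nat (Stirling p (card X)) :: 'k::field_char_0)"
proof -
  have "(\<Sum>Y\<in>Pow X. (-1) ^ card (X - Y) * of_nat (card Y) ^ p) =
      (\<Sum>Y\<in>Pow X. (-1) ^ (card X - card Y) * (of_nat (card Y) ^ p :: 'k))"
    by (intro sum.cong refl) (use assms in \<open>auto simp: card_Diff_subset finite_subset\<close>)
  also have "\<dots> = (\<Sum>k\<le>card X. of_nat (card X choose k) * ((-1) ^ (card X - k) * of_nat k ^ p))"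
    by (rule sum_Pow_card[OF assms])
  also have "\<dots> = of_nat (fact (card X) * Stirling p (card X))"
    unfolding Stirling_explicit_fact by (simp add: mult_ac)
  finally show ?thesis by simp
qed

text \<open>
  If \<open>g\<close> moves a point of \<open>X\<close>, that point is never a fixed point of a restriction of \<open>g\<close>, and the
  alternating sum cancels. So only the identity contributes.
\<close>

lemma (in maximal_subgroup) pairing_tensor_power:
  assumes \<phi>: "mat_rep G d (\<phi> :: nat rel \<Rightarrow> 'k::field_char_0 mat)"
  shows "pairing S (Id_on X) (character \<phi>) (character (tensor_power p (rook_rep n))) =
    1 / of_nat (card H) * of_nat d * fact (card X) * of_nat (Stirling p (card X))"
proof -
  let ?\<theta> = "character (tensor_power p (rook_rep n)) :: nat rel \<Rightarrow> 'k"
  have \<theta>: "?\<theta> s = of_nat (card {x \<in> {1..n}. (x, x) \<in> s}) ^ p" for s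
    by (simp add: character_def tensor_power_def mat_trace_kronecker_power[OF rook_rep_carrier] mat_trace_rook_rep)
  have inner: "(\<Sum>Y\<in>Pow X. (-1) ^ card (X - Y) * ?\<theta> (Id_on Y O g)) =
      (if g = Id_on X then fact (card X) * of_nat (Stirling p (card X)) else 0)" if g: "g \<in> H" for g
  proof (cases "g = Id_on X")
    case True
    have "{x \<in> {1..n}. (x, x) \<in> Id_on Y O g} = Y" if "Y \<in> Pow X" for Y
      using that X True by auto
    then show ?thesis using True surjection_count[OF finite_X, of p, where 'k = 'k] by (simp add: \<theta>)
  next
    case False
    have "\<exists>x\<in>X. (x, x) \<notin> g"
    proof (rule ccontr)
      assume "\<not> (\<exists>x\<in>X. (x, x) \<notin> g)"
      then have diag: "(x, x) \<in> g" if "x \<in> X" for x using that by blast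
      have gS: "g \<in> S" and Dg: "Domain g = X" using g by (auto simp: H_iff)
      have "g = Id_on X"
      proof
        show "Id_on X \<subseteq> g" using diag by blast
        show "g \<subseteq> Id_on X"
        proof
          fix z assume z: "z \<in> g"
          obtain a b where ab: "z = (a, b)" by (cases z)
          then have "a \<in> X" using z Dg by blast
          moreover from this have "a = b" using S_inj[OF gS diag] z ab by blast
          ultimately show "z \<in> Id_on X" using ab by blast
        qed
      qed
      then show False using False by simp
    qed
    then obtain x where x: "x \<in> X" "(x, x) \<notin> g" by blast
    have "(\<Sum>Y\<in>Pow X. (-1) ^ card (X - Y) * ?\<theta> (Id_on Y O g)) = 0"
    proof (rule sum_Pow_alternating_cancel[OF finite_X x(1)])
      fix Y
      have "{y \<in> {1..n}. (y, y) \<in> Id_on (insert x Y) O g} = {y \<in> {1..n}. (y, y) \<in> Id_on Y O g}"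
        using x(2) by auto
      then show "?\<theta> (Id_on (insert x Y) O g) = ?\<theta> (Id_on Y O g)" by (simp only: \<theta>)
    qed
    then show ?thesis using False by simp
  qed
  have "pairing S (Id_on X) (character \<phi>) ?\<theta> = 1 / of_nat (card H) *
      (\<Sum>g\<in>H. if g = Id_on X then character \<phi> ((Id_on X)\<inverse>) * (fact (card X) * of_nat (Stirling p (card X))) else 0)"
    unfolding pairing_eq by (intro arg_cong2[of _ _ _ _ "(*)"] refl sum.cong) (simp add: inner)
  also have "\<dots> = 1 / of_nat (card H) * (of_nat d * (fact (card X) * of_nat (Stirling p (card X))))"
    using finite_H H_Id_on rep_G(3)[OF \<phi>] by (simp add: character_def)
  finally show ?thesis by (simp add: mult.assoc)
qed

theorem (in induced) multiplicity_tensor_power: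
  "\<exists>m. has_multiplicity M (L * d) \<psi> (n ^ q) (tensor_power q (rook_rep n)) m \<and>
     of_nat m = pairing S (Id_on X) (character \<phi>) (character (tensor_power q (rook_rep n)))"
  by (rule has_multiplicity_pairing[OF tensor_power_rep[OF rook_rep]])

section \<open>Group actions on spaces of functions\<close>

lemma sum_fun_apply: "(\<Sum>i\<in>I. f i) x = (\<Sum>i\<in>I. f i x :: 'b::comm_monoid_add)"
  by (induction I rule: infinite_finite_induct) auto

lemma fun_scale_apply: "fun_scale c v x = c * v x" by (simp add: fun_scale_def)

definition coords :: "('x \<Rightarrow> 'k::field) list \<Rightarrow> ('x \<Rightarrow> 'k) \<Rightarrow> 'k vec" where
  "coords bs w = vec (length bs) (\<lambda>i. fun_space.representation (set bs) w (bs ! i))"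

definition combination :: "('x \<Rightarrow> 'k::field) list \<Rightarrow> 'k vec \<Rightarrow> 'x \<Rightarrow> 'k" where
  "combination bs x = (\<Sum>i<length bs. fun_scale (x $ i) (bs ! i))"

definition op_mat :: "('x \<Rightarrow> 'k::field) list \<Rightarrow> (('x \<Rightarrow> 'k) \<Rightarrow> 'x \<Rightarrow> 'k) \<Rightarrow> 'k mat" where
  "op_mat bs L = mat (length bs) (length bs) (\<lambda>(i, j). fun_space.representation (set bs) (L (bs ! j)) (bs ! i))"

definition fun_linear :: "(('x \<Rightarrow> 'k::field) \<Rightarrow> 'x \<Rightarrow> 'k) \<Rightarrow> bool" where
  "fun_linear L \<longleftrightarrow> (\<forall>x y. L (x + y) = L x + L y) \<and> (\<forall>c x. L (fun_scale c x) = fun_scale c (L x))"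

lemma fun_linear_sum:
  assumes "fun_linear L"
  shows "L (\<Sum>i\<in>I. fun_scale (c i) (f i)) = (\<Sum>i\<in>I. fun_scale (c i) (L (f i)))"
proof -
  have "L 0 = 0"
    using assms[unfolded fun_linear_def, THEN conjunct2, rule_format, of 0 0] by (simp add: fun_scale_def zero_fun_def)
  then show ?thesis
    using assms by (induction I rule: infinite_finite_induct) (auto simp: fun_linear_def)
qed

lemma coords_carrier [simp]: "coords bs w \<in> carrier_vec (length bs)" by (simp add: coords_def)

lemma op_mat_carrier [simp]: "op_mat bs L \<in> carrier_mat (length bs) (length bs)" by (simp add: op_mat_def)

context
  fixes bs :: "('x \<Rightarrow> 'k::field) list"
  assumes distinct: "distinct bs" and indep: "fun_space.independent (set bs)"
begin

lemma combination_coords: "w \<in> fun_space.span (set bs) \<Longrightarrow> combination bs (coords bs w) = w"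
proof -
  assume w: "w \<in> fun_space.span (set bs)"
  have "w = (\<Sum>b\<in>set bs. fun_scale (fun_space.representation (set bs) w b) b)"
    using fun_space.sum_representation_eq[OF indep w, of "set bs"] by simp
  also have "\<dots> = (\<Sum>i<length bs. fun_scale (fun_space.representation (set bs) w (bs ! i)) (bs ! i))"
    by (rule sum.reindex_bij_betw[symmetric]) (rule bij_betw_nth[OF distinct]; simp)
  finally show ?thesis by (simp add: combination_def coords_def)
qed

lemma combination_span: "combination bs x \<in> fun_space.span (set bs)"
  unfolding combination_def
  by (intro fun_space.span_sum fun_space.span_scale fun_space.span_base) auto

lemma coords_sum:
  assumes "\<And>i. i \<in> I \<Longrightarrow> f i \<in> fun_space.span (set bs)" and "a < length bs"
  shows "coords bs (\<Sum>i\<in>I. fun_scale (c i) (f i)) $ a = (\<Sum>i\<in>I. c i * coords bs (f i) $ a)"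
proof -
  have "fun_space.representation (set bs) (\<Sum>i\<in>I. fun_scale (c i) (f i)) (bs ! a) =
      (\<Sum>i\<in>I. c i * fun_space.representation (set bs) (f i) (bs ! a))"
    using assms(1)
  proof (induction I rule: infinite_finite_induct)
    case (insert i I)
    then have 1: "f i \<in> fun_space.span (set bs)" "fun_scale (c i) (f i) \<in> fun_space.span (set bs)"
      "(\<Sum>i\<in>I. fun_scale (c i) (f i)) \<in> fun_space.span (set bs)"
      by (auto intro!: fun_space.span_scale fun_space.span_sum)
    have 2: "fun_space.representation (set bs) (\<Sum>i\<in>I. fun_scale (c i) (f i)) (bs ! a) =
      (\<Sum>i\<in>I. c i * fun_space.representation (set bs) (f i) (bs ! a))"
      by (rule insert.IH) (use insert.prems in auto)
    show ?case
      unfolding sum.insert[OF insert.hyps] fun_space.representation_add[OF indep 1(3,2)]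
        fun_space.representation_scale[OF indep 1(1)] 2 ..
  qed (simp_all add: fun_space.representation_zero)
  then show ?thesis using assms(2) by (simp add: coords_def)
qed

lemma coords_basis: "j < length bs \<Longrightarrow> coords bs (bs ! j) = unit_vec (length bs) j"
  using distinct by (intro eq_vecI) (auto simp: coords_def fun_space.representation_basis[OF indep] nth_eq_iff_index_eq)

lemma coords_combination:
  assumes "x \<in> carrier_vec (length bs)"
  shows "coords bs (combination bs x) = x"
proof (rule eq_vecI)
  fix a assume "a < dim_vec x"
  then have a: "a < length bs" using assms by simp
  have "coords bs (combination bs x) $ a = (\<Sum>i<length bs. x $ i * coords bs (bs ! i) $ a)"
    unfolding combination_def by (rule coords_sum[OF _ a]) (auto intro: fun_space.span_base)
  also have "\<dots> = (\<Sum>i<length bs. if i = a then x $ i else 0)"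
    using a by (intro sum.cong) (auto simp: coords_basis)
  finally show "coords bs (combination bs x) $ a = x $ a" using a by simp
qed (use assms in \<open>simp add: coords_def\<close>)

lemma op_mat_coords:
  assumes L: "fun_linear L" and LW: "\<And>w. w \<in> fun_space.span (set bs) \<Longrightarrow> L w \<in> fun_space.span (set bs)"
    and w: "w \<in> fun_space.span (set bs)"
  shows "coords bs (L w) = op_mat bs L *\<^sub>v coords bs w"
proof (rule eq_vecI)
  fix a assume "a < dim_vec (op_mat bs L *\<^sub>v coords bs w)"
  then have a: "a < length bs" by (simp add: op_mat_def)
  have "L w = (\<Sum>i<length bs. fun_scale (coords bs w $ i) (L (bs ! i)))"
    by (subst combination_coords[OF w, symmetric]) (simp add: combination_def fun_linear_sum[OF L])
  then have "coords bs (L w) $ a = (\<Sum>i<length bs. coords bs w $ i * coords bs (L (bs ! i)) $ a)"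
    by (simp only:, intro coords_sum[OF LW a] fun_space.span_base) auto
  also have "\<dots> = (op_mat bs L *\<^sub>v coords bs w) $ a"
    using a by (subst index_mult_vec_sum) (auto simp: op_mat_def coords_def mult.commute)
  finally show "coords bs (L w) $ a = (op_mat bs L *\<^sub>v coords bs w) $ a" .
qed (simp add: coords_def op_mat_def)

lemma op_mat_eqI:
  assumes A: "A \<in> carrier_mat (length bs) (length bs)" and B: "B \<in> carrier_mat (length bs) (length bs)"
    and "\<And>w. w \<in> fun_space.span (set bs) \<Longrightarrow> A *\<^sub>v coords bs w = B *\<^sub>v coords bs w"
  shows "A = B"
proof (rule mat_eqI_vec[OF A B])
  fix v :: "'k vec" assume v: "v \<in> carrier_vec (length bs)"
  show "A *\<^sub>v v = B *\<^sub>v v"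
    using assms(3)[OF combination_span, of v] coords_combination[OF v] by simp
qed

end

text \<open>
  With respect to the basis \<open>bs\<close> the action becomes a matrix representation, and a matrix in
  its commutant becomes an operator \<open>E\<close> on the span that commutes with the action. Such an operator is
  linear on the span only; the stated forms of linearity are those needed to evaluate it on
  polytabloids.
\<close>

lemma trace_orthogonality_scalar_commutant:
  fixes G :: "('a, 'b) monoid_scheme" (structure) and bs :: "('x \<Rightarrow> 'k::field_char_0) list"
    and L :: "'a \<Rightarrow> ('x \<Rightarrow> 'k) \<Rightarrow> 'x \<Rightarrow> 'k"
  assumes G: "group G" and bs: "distinct bs" "fun_space.independent (set bs)" "bs \<noteq> []"
  defines "W \<equiv> fun_space.span (set bs)"
  assumes L: "\<And>g. g \<in> carrier G \<Longrightarrow> fun_linear (L g)" "\<And>g w. g \<in> carrier G \<Longrightarrow> w \<in> W \<Longrightarrow> L g w \<in> W"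
    and hom: "\<And>g h w. g \<in> carrier G \<Longrightarrow> h \<in> carrier G \<Longrightarrow> w \<in> W \<Longrightarrow> L (g \<otimes> h) w = L g (L h w)" "\<And>w. w \<in> W \<Longrightarrow> L \<one> w = w"
    and scalar: "\<And>E. (\<And>w. w \<in> W \<Longrightarrow> E w \<in> W) \<Longrightarrow>
       (\<And>I c (f :: 'a \<Rightarrow> 'x \<Rightarrow> 'k). (\<And>i. i \<in> I \<Longrightarrow> f i \<in> W) \<Longrightarrow> E (\<Sum>i\<in>I. fun_scale (c i) (f i)) = (\<Sum>i\<in>I. fun_scale (c i) (E (f i)))) \<Longrightarrow>
       (\<And>c w. w \<in> W \<Longrightarrow> E (fun_scale c w) = fun_scale c (E w)) \<Longrightarrow>
       (\<And>x y. x \<in> W \<Longrightarrow> y \<in> W \<Longrightarrow> E (x + y) = E x + E y) \<Longrightarrow>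
       (\<And>g w. g \<in> carrier G \<Longrightarrow> w \<in> W \<Longrightarrow> E (L g w) = L g (E w)) \<Longrightarrow> \<exists>c. \<forall>w\<in>W. E w = fun_scale c w"
  defines "\<chi> \<equiv> \<lambda>g. \<Sum>b\<in>set bs. fun_space.representation (set bs) (L g b) b"
  shows "(\<Sum>g\<in>carrier G. \<chi> g * \<chi> (inv g)) = of_nat (card (carrier G))"
proof -
  interpret group G by (rule G)
  let ?\<rho> = "\<lambda>g. op_mat bs (L g)" and ?d = "length bs"
  note W_def' = W_def[symmetric]
  have opc: "coords bs (L g w) = ?\<rho> g *\<^sub>v coords bs w" if "g \<in> carrier G" "w \<in> W" for g w
    using op_mat_coords[OF bs(1,2) L(1)[OF that(1)], of w] L(2)[OF that(1)] that(2) unfolding W_def by blast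
  note eqI = op_mat_eqI[OF bs(1,2), unfolded W_def']
  have \<chi>: "character ?\<rho> g = \<chi> g" for g
  proof -
    have "character ?\<rho> g = (\<Sum>i<?d. fun_space.representation (set bs) (L g (bs ! i)) (bs ! i))"
      by (simp add: character_def mat_trace_def op_mat_def)
    also have "\<dots> = \<chi> g"
      unfolding \<chi>_def by (rule sum.reindex_bij_betw) (rule bij_betw_nth[OF bs(1)]; simp)
    finally show ?thesis .
  qed
  have rep: "mat_rep G ?d ?\<rho>"
    unfolding mat_rep_iff
  proof (intro conjI ballI)
    fix g h assume g: "g \<in> carrier G" and h: "h \<in> carrier G"
    show "?\<rho> (g \<otimes> h) = ?\<rho> g * ?\<rho> h"
    proof (rule eqI)
      fix w assume w: "w \<in> W"
      have "?\<rho> (g \<otimes> h) *\<^sub>v coords bs w = coords bs (L g (L h w))"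
        by (simp only: opc[OF m_closed[OF g h] w, symmetric] hom(1)[OF g h w])
      also have "\<dots> = ?\<rho> g *\<^sub>v (?\<rho> h *\<^sub>v coords bs w)"
        by (simp only: opc[OF g L(2)[OF h w]] opc[OF h w])
      also have "\<dots> = ?\<rho> g * ?\<rho> h *\<^sub>v coords bs w"
        by (rule mat_vec_assoc[symmetric]) (simp_all add: op_mat_def coords_def)
      finally show "?\<rho> (g \<otimes> h) *\<^sub>v coords bs w = ?\<rho> g * ?\<rho> h *\<^sub>v coords bs w" .
    qed (rule op_mat_carrier mult_carrier_mat[OF op_mat_carrier op_mat_carrier])+
  next
    show "?\<rho> \<one> = 1\<^sub>m ?d"
    proof (rule eqI)
      fix w assume w: "w \<in> W"
      show "?\<rho> \<one> *\<^sub>v coords bs w = 1\<^sub>m ?d *\<^sub>v coords bs w"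
        by (simp only: opc[OF one_closed w, symmetric] hom(2)[OF w] one_mult_mat_vec[OF coords_carrier])
    qed auto
  qed simp
  have "(\<Sum>g\<in>carrier G. character ?\<rho> g * character ?\<rho> (inv g)) = of_nat (card (carrier G))"
  proof (rule schur_orthogonality_scalar_commutant[OF G rep])
    show "0 < ?d" using bs(3) by simp
    fix T :: "'k mat" assume T: "T \<in> carrier_mat ?d ?d" and comm: "\<And>g. g \<in> carrier G \<Longrightarrow> ?\<rho> g * T = T * ?\<rho> g"
    define E where "E w = combination bs (T *\<^sub>v coords bs w)" for w
    have E: "E w \<in> W" for w unfolding E_def W_def by (rule combination_span[OF bs(1,2)])
    have cE: "coords bs (E w) = T *\<^sub>v coords bs w" for w
      unfolding E_def by (rule coords_combination[OF bs(1,2)]) (use T in simp)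
    have inj: "x = y" if "x \<in> W" "y \<in> W" "coords bs x = coords bs y" for x y
      using trans[OF combination_coords[OF bs(1,2) that(1)[unfolded W_def], symmetric, unfolded that(3)]
          combination_coords[OF bs(1,2) that(2)[unfolded W_def]]] .
    have Esum: "E (\<Sum>i\<in>I. fun_scale (c i) (f i)) = (\<Sum>i\<in>I. fun_scale (c i) (E (f i)))"
      if f: "\<And>i. i \<in> I \<Longrightarrow> f i \<in> W" for I :: "'i set" and c and f :: "'i \<Rightarrow> 'x \<Rightarrow> 'k"
    proof (rule inj[OF E])
      show "(\<Sum>i\<in>I. fun_scale (c i) (E (f i))) \<in> W"
        unfolding W_def by (intro fun_space.span_sum fun_space.span_scale E[unfolded W_def])
      show "coords bs (E (\<Sum>i\<in>I. fun_scale (c i) (f i))) = coords bs (\<Sum>i\<in>I. fun_scale (c i) (E (f i)))"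
      proof (rule eq_vecI)
        fix a assume "a < dim_vec (coords bs (\<Sum>i\<in>I. fun_scale (c i) (E (f i))))"
        then have a: "a < ?d" by (simp add: coords_def)
        have "coords bs (E (\<Sum>i\<in>I. fun_scale (c i) (f i))) $ a =
            (\<Sum>j<?d. T $$ (a, j) * coords bs (\<Sum>i\<in>I. fun_scale (c i) (f i)) $ j)"
          unfolding cE using a T by (subst index_mult_vec_sum) (auto simp: coords_def)
        also have "\<dots> = (\<Sum>j<?d. \<Sum>i\<in>I. T $$ (a, j) * (c i * coords bs (f i) $ j))"
          using f unfolding W_def by (intro sum.cong refl) (simp add: coords_sum[OF bs(1,2)] sum_distrib_left)
        also have "\<dots> = (\<Sum>i\<in>I. \<Sum>j<?d. T $$ (a, j) * (c i * coords bs (f i) $ j))" by (rule sum.swap)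
        also have "\<dots> = (\<Sum>i\<in>I. c i * coords bs (E (f i)) $ a)"
          unfolding cE using a T
          by (intro sum.cong refl, subst index_mult_vec_sum) (auto simp: coords_def sum_distrib_left mult_ac)
        also have "\<dots> = coords bs (\<Sum>i\<in>I. fun_scale (c i) (E (f i))) $ a"
          by (rule coords_sum[OF bs(1,2) E[unfolded W_def] a, symmetric])
        finally show "coords bs (E (\<Sum>i\<in>I. fun_scale (c i) (f i))) $ a =
          coords bs (\<Sum>i\<in>I. fun_scale (c i) (E (f i))) $ a" .
      qed (simp add: coords_def)
    qed
    have "\<exists>c. \<forall>w\<in>W. E w = fun_scale c w"
    proof (rule scalar)
      show "E w \<in> W" for w by (rule E)
      show "E (\<Sum>i\<in>I. fun_scale (c i) (f i)) = (\<Sum>i\<in>I. fun_scale (c i) (E (f i)))"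
        if "\<And>i. i \<in> I \<Longrightarrow> f i \<in> W" for I :: "'a set" and c f by (rule Esum[OF that])
      show "E (fun_scale c w) = fun_scale c (E w)" if "w \<in> W" for c w
        using Esum[of "{()}" "\<lambda>_. w" "\<lambda>_. c"] that by simp
      show "E (x + y) = E x + E y" if "x \<in> W" "y \<in> W" for x y
        using Esum[of UNIV "\<lambda>b. if b then x else y" "\<lambda>_. 1"] that by (simp add: UNIV_bool add.commute)
      show "E (L g w) = L g (E w)" if g: "g \<in> carrier G" and w: "w \<in> W" for g w
      proof (rule inj[OF E L(2)[OF g E]])
        have "coords bs (E (L g w)) = T * ?\<rho> g *\<^sub>v coords bs w"
          unfolding cE opc[OF g w] by (rule mat_vec_assoc[symmetric]) (use T in \<open>simp_all add: op_mat_def coords_def\<close>)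
        also have "\<dots> = ?\<rho> g * T *\<^sub>v coords bs w" by (simp only: comm[OF g])
        also have "\<dots> = coords bs (L g (E w))"
          unfolding cE opc[OF g E] by (rule mat_vec_assoc) (use T in \<open>simp_all add: op_mat_def coords_def\<close>)
        finally show "coords bs (E (L g w)) = coords bs (L g (E w))" .
      qed
    qed
    then obtain c where c: "\<And>w. w \<in> W \<Longrightarrow> E w = fun_scale c w" by blast
    have "T = c \<cdot>\<^sub>m 1\<^sub>m ?d"
    proof (rule eqI[OF T])
      fix w assume w: "w \<in> W"
      have "T *\<^sub>v coords bs w = coords bs (fun_scale c w)" using cE[of w] c[OF w] by simp
      also have "\<dots> = (c \<cdot>\<^sub>m 1\<^sub>m ?d) *\<^sub>v coords bs w"
      proof (rule eq_vecI)
        fix a assume "a < dim_vec ((c \<cdot>\<^sub>m 1\<^sub>m ?d) *\<^sub>v coords bs w)"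
        then have a: "a < ?d" by simp
        then show "coords bs (fun_scale c w) $ a = ((c \<cdot>\<^sub>m 1\<^sub>m ?d) *\<^sub>v coords bs w) $ a"
          using coords_sum[OF bs(1,2), of "{()}" "\<lambda>_. w" a "\<lambda>_. c"] w
          by (simp add: W_def coords_def)
      qed (simp add: coords_def)
      finally show "T *\<^sub>v coords bs w = (c \<cdot>\<^sub>m 1\<^sub>m ?d) *\<^sub>v coords bs w" .
    qed simp
    then show "\<exists>c. T = c \<cdot>\<^sub>m 1\<^sub>m ?d" by blast
  qed
  then show ?thesis by (simp add: \<chi>)
qed

section \<open>Antisymmetrisers and polytabloids\<close>

unbundle no m_inv_syntax

definition delta :: "'x \<Rightarrow> 'x \<Rightarrow> 'k::field" where "delta T = (\<lambda>T'. if T = T' then 1 else 0)"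

lemma perm_action_linear: "fun_linear (perm_action \<pi> :: ((nat \<Rightarrow> nat set) \<Rightarrow> 'k::field) \<Rightarrow> _)"
  by (auto simp: fun_linear_def perm_action_def fun_scale_def fun_eq_iff)

lemma perm_action_scale: "perm_action \<pi> (fun_scale c v) = fun_scale c (perm_action \<pi> v)"
  and perm_action_add: "perm_action \<pi> (v + w) = perm_action \<pi> v + perm_action \<pi> w"
  for v w :: "(nat \<Rightarrow> nat set) \<Rightarrow> 'k::field"
  using perm_action_linear[of \<pi>, where 'k = 'k] unfolding fun_linear_def by blast+

lemma perm_action_comp: "perm_action (\<pi> \<circ> \<sigma>) v = perm_action \<pi> (perm_action \<sigma> v)"
  by (simp add: perm_action_def vimage_comp)

lemma perm_action_id: "perm_action id v = v"
  by (simp add: perm_action_def)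

lemma perm_action_delta:
  assumes "bij \<pi>"
  shows "perm_action \<pi> (delta T :: (nat \<Rightarrow> nat set) \<Rightarrow> 'k::field) = delta (\<lambda>i. \<pi> ` T i)"
proof
  fix T'
  have "T = (\<lambda>i. \<pi> -` T' i) \<longleftrightarrow> (\<lambda>i. \<pi> ` T i) = T'"
  proof
    assume "T = (\<lambda>i. \<pi> -` T' i)"
    then show "(\<lambda>i. \<pi> ` T i) = T'" using bij_is_surj[OF assms] by (simp add: surj_image_vimage_eq)
  next
    assume "(\<lambda>i. \<pi> ` T i) = T'"
    then show "T = (\<lambda>i. \<pi> -` T' i)" using bij_is_inj[OF assms] by (auto simp: inj_vimage_image_eq)
  qed
  then show "perm_action \<pi> (delta T) T' = (delta (\<lambda>i. \<pi> ` T i) T' :: 'k)"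
    by (simp add: perm_action_def delta_def)
qed

lemma tabloid_comp: "tabloid shp (\<pi> \<circ> t) = (\<lambda>i. \<pi> ` tabloid shp t i)"
  by (simp add: tabloid_def image_comp)

lemma perm_action_delta_tabloid:
  "bij \<pi> \<Longrightarrow> perm_action \<pi> (delta (tabloid shp t)) = (delta (tabloid shp (\<pi> \<circ> t)) :: _ \<Rightarrow> 'k::field)"
  by (simp add: perm_action_delta tabloid_comp)

definition perm_subgroup :: "nat \<Rightarrow> (nat \<Rightarrow> nat) set \<Rightarrow> bool" where
  "perm_subgroup r A \<longleftrightarrow> (\<forall>\<pi>\<in>A. \<pi> permutes {1..r}) \<and> id \<in> A \<and>
     (\<forall>\<pi>\<in>A. \<forall>\<sigma>\<in>A. \<pi> \<circ> \<sigma> \<in> A) \<and> (\<forall>\<pi>\<in>A. inv \<pi> \<in> A)"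

lemma perm_subgroupD:
  assumes "perm_subgroup r A"
  shows "\<pi> \<in> A \<Longrightarrow> \<pi> permutes {1..r}" "id \<in> A" "\<pi> \<in> A \<Longrightarrow> \<sigma> \<in> A \<Longrightarrow> \<pi> \<circ> \<sigma> \<in> A" "\<pi> \<in> A \<Longrightarrow> inv \<pi> \<in> A"
    and "\<pi> \<in> A \<Longrightarrow> permutation \<pi>" "\<pi> \<in> A \<Longrightarrow> bij \<pi>" "finite A"
proof -
  show 1: "\<pi> \<in> A \<Longrightarrow> \<pi> permutes {1..r}" "id \<in> A" "\<pi> \<in> A \<Longrightarrow> \<sigma> \<in> A \<Longrightarrow> \<pi> \<circ> \<sigma> \<in> A" "\<pi> \<in> A \<Longrightarrow> inv \<pi> \<in> A" for \<pi> \<sigma>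
    using assms by (auto simp: perm_subgroup_def)
  show "\<pi> \<in> A \<Longrightarrow> permutation \<pi>" "\<pi> \<in> A \<Longrightarrow> bij \<pi>"
    using 1(1) permutes_imp_permutation[of "{1..r}"] permutes_bij by auto
  show "finite A" by (rule finite_subset[OF _ finite_permutations[of "{1..r}"]]) (use 1(1) in auto)
qed

lemma perm_subgroup_bij_right:
  assumes "perm_subgroup r A" "\<sigma> \<in> A"
  shows "bij_betw (\<lambda>\<pi>. \<pi> \<circ> \<sigma>) A A"
proof (rule bij_betwI[of _ _ _ "\<lambda>\<pi>. \<pi> \<circ> inv \<sigma>"])
  note A = perm_subgroupD[OF assms(1)]
  note i = permutes_inv_o[OF A(1)[OF assms(2)]]
  show "(\<lambda>\<pi>. \<pi> \<circ> \<sigma>) \<in> A \<rightarrow> A" "(\<lambda>\<pi>. \<pi> \<circ> inv \<sigma>) \<in> A \<rightarrow> A" using A(3,4) assms(2) by auto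
  show "\<pi> \<circ> \<sigma> \<circ> inv \<sigma> = \<pi>" "\<pi> \<circ> inv \<sigma> \<circ> \<sigma> = \<pi>" for \<pi> :: "nat \<Rightarrow> nat"
    using i by (simp_all add: comp_assoc)
qed

lemma perm_subgroup_bij_left:
  assumes "perm_subgroup r A" "\<sigma> \<in> A"
  shows "bij_betw (\<lambda>\<pi>. \<sigma> \<circ> \<pi>) A A"
proof (rule bij_betwI[of _ _ _ "\<lambda>\<pi>. inv \<sigma> \<circ> \<pi>"])
  note A = perm_subgroupD[OF assms(1)]
  note i = permutes_inv_o[OF A(1)[OF assms(2)]]
  show "(\<lambda>\<pi>. \<sigma> \<circ> \<pi>) \<in> A \<rightarrow> A" "(\<lambda>\<pi>. inv \<sigma> \<circ> \<pi>) \<in> A \<rightarrow> A" using A(3,4) assms(2) by auto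
  show "inv \<sigma> \<circ> (\<sigma> \<circ> \<pi>) = \<pi>" "\<sigma> \<circ> (inv \<sigma> \<circ> \<pi>) = \<pi>" for \<pi> :: "nat \<Rightarrow> nat"
    using i by (simp_all add: comp_assoc[symmetric])
qed

text \<open>
  For a column group this yields polytabloids, and for the symmetric group of a subset of the
  entries it yields the Garnir relations.
\<close>

definition antisym :: "(nat \<Rightarrow> nat) set \<Rightarrow> ((nat \<Rightarrow> nat set) \<Rightarrow> 'k::field) \<Rightarrow> (nat \<Rightarrow> nat set) \<Rightarrow> 'k" where
  "antisym A v = (\<Sum>\<pi>\<in>A. fun_scale (of_int (sign \<pi>)) (perm_action \<pi> v))"

lemma fun_scale_sum: "fun_scale c (\<Sum>i\<in>I. f i) = (\<Sum>i\<in>I. fun_scale c (f i))"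
  by (simp add: fun_space.scale_sum_right)

lemma fun_scale_scale: "fun_scale c (fun_scale d v) = fun_scale (c * d) v"
  by (simp add: fun_space.scale_scale)

lemma of_int_sign_square: "of_int (sign \<pi>) * of_int (sign \<pi>) = (1 :: 'k::field)"
  unfolding of_int_mult[symmetric] by simp

lemma antisym_linear: "fun_linear (antisym A :: ((nat \<Rightarrow> nat set) \<Rightarrow> 'k::field) \<Rightarrow> _)"
  unfolding fun_linear_def antisym_def
  by (simp add: perm_action_add perm_action_scale fun_space.scale_right_distrib sum.distrib
      fun_space.scale_sum_right fun_space.scale_scale mult.commute)

lemma antisym_perm_action:
  assumes A: "perm_subgroup r A" and \<sigma>: "\<sigma> \<in> A"
  shows "antisym A (perm_action \<sigma> v) = fun_scale (of_int (sign \<sigma>)) (antisym A (v :: _ \<Rightarrow> 'k::field))"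
proof -
  note D = perm_subgroupD[OF A]
  have "fun_scale (of_int (sign \<sigma>)) (antisym A v) =
      (\<Sum>\<pi>\<in>A. fun_scale (of_int (sign \<sigma>) * of_int (sign \<pi>)) (perm_action \<pi> v))"
    unfolding antisym_def fun_scale_sum fun_scale_scale ..
  also have "\<dots> = (\<Sum>\<pi>\<in>A. fun_scale (of_int (sign \<sigma>) * of_int (sign (\<pi> \<circ> \<sigma>))) (perm_action (\<pi> \<circ> \<sigma>) v))"
    by (rule sum.reindex_bij_betw[OF perm_subgroup_bij_right[OF A \<sigma>], symmetric])
  also have "\<dots> = (\<Sum>\<pi>\<in>A. fun_scale (of_int (sign \<pi>)) (perm_action \<pi> (perm_action \<sigma> v)))"
  proof (rule sum.cong[OF refl])
    fix \<pi> assume "\<pi> \<in> A"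
    then have s: "sign (\<pi> \<circ> \<sigma>) = sign \<pi> * sign \<sigma>" using D(5) \<sigma> sign_compose by blast
    have "of_int (sign \<sigma>) * of_int (sign (\<pi> \<circ> \<sigma>)) = (of_int (sign \<pi>) :: 'k)"
      unfolding s using of_int_sign_square[of \<sigma>, where 'k = 'k] by (simp add: mult_ac)
    then show "fun_scale (of_int (sign \<sigma>) * of_int (sign (\<pi> \<circ> \<sigma>))) (perm_action (\<pi> \<circ> \<sigma>) v) =
        fun_scale (of_int (sign \<pi>)) (perm_action \<pi> (perm_action \<sigma> v))" by (simp add: perm_action_comp)
  qed
  finally show ?thesis by (simp add: antisym_def)
qed

lemma perm_action_antisym:
  assumes A: "perm_subgroup r A" and \<sigma>: "\<sigma> \<in> A"
  shows "perm_action \<sigma> (antisym A v) = fun_scale (of_int (sign \<sigma>)) (antisym A (v :: _ \<Rightarrow> 'k::field))"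
proof -
  note D = perm_subgroupD[OF A]
  have "fun_scale (of_int (sign \<sigma>)) (antisym A v) =
      (\<Sum>\<pi>\<in>A. fun_scale (of_int (sign \<sigma>) * of_int (sign \<pi>)) (perm_action \<pi> v))"
    unfolding antisym_def fun_scale_sum fun_scale_scale ..
  also have "\<dots> = (\<Sum>\<pi>\<in>A. fun_scale (of_int (sign \<sigma>) * of_int (sign (\<sigma> \<circ> \<pi>))) (perm_action (\<sigma> \<circ> \<pi>) v))"
    by (rule sum.reindex_bij_betw[OF perm_subgroup_bij_left[OF A \<sigma>], symmetric])
  also have "\<dots> = (\<Sum>\<pi>\<in>A. fun_scale (of_int (sign \<pi>)) (perm_action \<sigma> (perm_action \<pi> v)))"
  proof (rule sum.cong[OF refl])
    fix \<pi> assume "\<pi> \<in> A"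
    then have s: "sign (\<sigma> \<circ> \<pi>) = sign \<sigma> * sign \<pi>" using D(5) \<sigma> sign_compose by blast
    have "of_int (sign \<sigma>) * of_int (sign (\<sigma> \<circ> \<pi>)) = (of_int (sign \<pi>) :: 'k)"
      unfolding s using of_int_sign_square[of \<sigma>, where 'k = 'k] by (simp add: mult.assoc[symmetric])
    then show "fun_scale (of_int (sign \<sigma>) * of_int (sign (\<sigma> \<circ> \<pi>))) (perm_action (\<sigma> \<circ> \<pi>) v) =
        fun_scale (of_int (sign \<pi>)) (perm_action \<sigma> (perm_action \<pi> v))" by (simp add: perm_action_comp)
  qed
  also have "\<dots> = perm_action \<sigma> (antisym A v)"
    unfolding antisym_def by (rule fun_linear_sum[OF perm_action_linear, symmetric])
  finally show ?thesis ..
qed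

text \<open>
  Applying the transposition first fixes \<open>v\<close> and changes the sign of the result.
\<close>

lemma antisym_eq_0:
  fixes v :: "(nat \<Rightarrow> nat set) \<Rightarrow> 'k::field_char_0"
  assumes A: "perm_subgroup r A" and ab: "transpose a b \<in> A" "a \<noteq> b" and v: "perm_action (transpose a b) v = v"
  shows "antisym A v = 0"
proof -
  have neg: "antisym A v = fun_scale (- 1) (antisym A v)"
    using antisym_perm_action[OF A ab(1), of v] ab(2) v by (simp add: sign_swap_id)
  have "antisym A v x = 0" for x
  proof -
    have "antisym A v x = - antisym A v x"
      using fun_cong[OF neg, of x] unfolding fun_scale_apply mult_minus1 .
    then have "2 * antisym A v x = 0" unfolding eq_neg_iff_add_eq_0 mult_2 .
    then show ?thesis by simp
  qed
  then show ?thesis by (simp add: fun_eq_iff)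
qed

lemma antisym_antisym:
  assumes A: "perm_subgroup r A"
  shows "antisym A (antisym A v) = fun_scale (of_nat (card A)) (antisym A (v :: _ \<Rightarrow> 'k::field))"
proof -
  have "antisym A (antisym A v) = (\<Sum>\<pi>\<in>A. antisym A v)"
    unfolding antisym_def[of A "antisym A v"]
    by (rule sum.cong[OF refl]) (simp add: perm_action_antisym[OF A] fun_scale_scale of_int_sign_square)
  then show ?thesis by (auto simp: fun_eq_iff sum_fun_apply fun_scale_apply)
qed

locale young_diagram =
  fixes shp :: "nat list"
  assumes shp_sorted: "sorted_wrt (\<ge>) shp"
begin

abbreviation r :: nat where "r \<equiv> sum_list shp"
abbreviation C :: "(nat \<times> nat) set" where "C \<equiv> cells shp"

lemma shp_mono: "i \<le> i' \<Longrightarrow> i' < length shp \<Longrightarrow> shp ! i' \<le> shp ! i"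
  using sorted_wrt_nth_less[OF shp_sorted, of i i'] by (cases "i = i'") auto

lemma C_Sigma: "C = Sigma {..<length shp} (\<lambda>i. {..<shp ! i})"
  by (auto simp: cells_def)

lemma finite_C: "finite C" unfolding C_Sigma by auto

lemma card_C: "card C = r"
  unfolding C_Sigma by (simp add: sum_list_sum_nth atLeast0LessThan)

text \<open>
  Fillings are tableaux without a convention on their values outside of the diagram, so that
  permutations act on them by composition.
\<close>

definition filling :: "(nat \<times> nat \<Rightarrow> nat) \<Rightarrow> bool" where
  "filling t \<longleftrightarrow> bij_betw t C {1..r}"

lemma filling_inj: "filling t \<Longrightarrow> c \<in> C \<Longrightarrow> c' \<in> C \<Longrightarrow> t c = t c' \<longleftrightarrow> c = c'"
  by (auto simp: filling_def bij_betw_def inj_on_def)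

lemma filling_range: "filling t \<Longrightarrow> c \<in> C \<Longrightarrow> t c \<in> {1..r}"
  by (auto simp: filling_def bij_betw_def)

lemma filling_surj: "filling t \<Longrightarrow> x \<in> {1..r} \<Longrightarrow> \<exists>c\<in>C. x = t c"
  by (auto simp: filling_def bij_betw_def)

lemma ex_filling: "\<exists>t. filling t"
  unfolding filling_def using finite_same_card_bij[OF finite_C, of "{1..r}"] card_C by simp

lemma filling_comp: "filling t \<Longrightarrow> \<pi> permutes {1..r} \<Longrightarrow> filling (\<pi> \<circ> t)"
  unfolding filling_def using bij_betw_trans permutes_imp_bij by blast

lemma filling_transitive:
  assumes "filling s" "filling t"
  obtains \<pi> where "\<pi> permutes {1..r}" "\<And>c. c \<in> C \<Longrightarrow> s c = \<pi> (t c)"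
proof -
  define \<pi> where "\<pi> x = (if x \<in> {1..r} then s (inv_into C t x) else x)" for x
  have "bij_betw (s \<circ> inv_into C t) {1..r} {1..r}"
    using assms bij_betw_trans[OF bij_betw_inv_into] unfolding filling_def by blast
  then have "bij_betw \<pi> {1..r} {1..r}"
    by (rule bij_betw_cong[THEN iffD1, rotated]) (simp add: \<pi>_def)
  then have "\<pi> permutes {1..r}" by (rule bij_imp_permutes) (auto simp: \<pi>_def)
  moreover have "s c = \<pi> (t c)" if "c \<in> C" for c
    using filling_range[OF assms(2) that] bij_betw_inv_into_left[of t C "{1..r}" c] assms(2) that
    by (simp add: \<pi>_def filling_def)
  ultimately show thesis by (rule that)
qed

lemma tabloid_cong: "(\<And>c. c \<in> C \<Longrightarrow> s c = t c) \<Longrightarrow> tabloid shp s = tabloid shp t"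
  by (auto simp: tabloid_def fun_eq_iff intro!: image_cong)

lemma column_group_cong: "(\<And>c. c \<in> C \<Longrightarrow> s c = t c) \<Longrightarrow> column_group shp s = column_group shp t"
proof -
  assume eq: "\<And>c. c \<in> C \<Longrightarrow> s c = t c"
  have "s ` {c \<in> C. snd c = j} = t ` {c \<in> C. snd c = j}" for j
    by (rule image_cong) (auto simp: eq)
  then show ?thesis by (simp add: column_group_def)
qed

lemma perm_subgroup_column_group: "perm_subgroup r (column_group shp t)"
proof -
  have "inv \<pi> ` B = B" if "\<pi> permutes {1..r}" "\<pi> ` B = B" for \<pi> :: "nat \<Rightarrow> nat" and B
    using image_inv_f_f[OF permutes_inj[OF that(1)], of B] that(2) by simp
  moreover have "(\<pi> \<circ> \<sigma>) ` B = B" if "\<pi> ` B = B" "\<sigma> ` B = B" for \<pi> \<sigma> :: "nat \<Rightarrow> nat" and B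
    by (simp only: image_comp[symmetric] that)
  ultimately show ?thesis
    unfolding perm_subgroup_def column_group_def
    by (intro conjI ballI CollectI allI)
      (simp_all only: mem_Collect_eq permutes_compose permutes_inv permutes_id image_id id_apply)
qed

definition \<e> :: "(nat \<times> nat \<Rightarrow> nat) \<Rightarrow> (nat \<Rightarrow> nat set) \<Rightarrow> 'k::field" where
  "\<e> t = antisym (column_group shp t) (delta (tabloid shp t))"

lemma polytabloid_eq: "polytabloid shp t = (\<e> t :: _ \<Rightarrow> 'k::field)"
proof
  fix T
  have "\<e> t T = (\<Sum>\<pi>\<in>column_group shp t. of_int (sign \<pi>) * (delta (tabloid shp (\<pi> \<circ> t)) T :: 'k))"
    unfolding \<e>_def antisym_def sum_fun_apply fun_scale_apply
    by (rule sum.cong[OF refl])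
      (simp add: perm_action_delta_tabloid[OF perm_subgroupD(6)[OF perm_subgroup_column_group]])
  then show "polytabloid shp t T = (\<e> t T :: 'k)"
    by (auto simp: polytabloid_def delta_def intro!: sum.cong)
qed

lemma polytabloid_cong: "(\<And>c. c \<in> C \<Longrightarrow> s c = t c) \<Longrightarrow> \<e> s = (\<e> t :: _ \<Rightarrow> 'k::field)"
  using column_group_cong[of s t] tabloid_cong[of s t] by (simp add: \<e>_def)

lemma column_group_conj:
  assumes \<sigma>: "\<sigma> permutes {1..r}"
  shows "bij_betw (\<lambda>\<pi>. \<sigma> \<circ> \<pi> \<circ> inv \<sigma>) (column_group shp t) (column_group shp (\<sigma> \<circ> t))"
proof (rule bij_betwI[of _ _ _ "\<lambda>\<pi>. inv \<sigma> \<circ> \<pi> \<circ> \<sigma>"])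
  note i = permutes_inv_o[OF \<sigma>]
  have img: "inv \<sigma> ` \<sigma> ` B = B" "\<sigma> ` inv \<sigma> ` B = B" for B using i by (simp_all add: image_comp)
  have fwd: "(\<sigma> \<circ> \<pi> \<circ> inv \<sigma>) ` (\<sigma> \<circ> t) ` B = (\<sigma> \<circ> t) ` B" if "\<pi> ` t ` B = t ` B" for \<pi> B
    by (simp only: image_comp[symmetric] img that)
  show "(\<lambda>\<pi>. \<sigma> \<circ> \<pi> \<circ> inv \<sigma>) \<in> column_group shp t \<rightarrow> column_group shp (\<sigma> \<circ> t)"
    unfolding column_group_def
    by (intro funcsetI CollectI conjI allI permutes_compose permutes_inv[OF \<sigma>] \<sigma> fwd; simp)
  have bwd: "(inv \<sigma> \<circ> \<pi> \<circ> \<sigma>) ` t ` B = t ` B" if "\<pi> ` (\<sigma> \<circ> t) ` B = (\<sigma> \<circ> t) ` B" for \<pi> B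
    using that by (simp only: image_comp[symmetric] img)
  show "(\<lambda>\<pi>. inv \<sigma> \<circ> \<pi> \<circ> \<sigma>) \<in> column_group shp (\<sigma> \<circ> t) \<rightarrow> column_group shp t"
    unfolding column_group_def
    by (intro funcsetI CollectI conjI allI permutes_compose permutes_inv[OF \<sigma>] \<sigma> bwd; simp)
  show "inv \<sigma> \<circ> (\<sigma> \<circ> \<pi> \<circ> inv \<sigma>) \<circ> \<sigma> = \<pi>" "\<sigma> \<circ> (inv \<sigma> \<circ> \<pi> \<circ> \<sigma>) \<circ> inv \<sigma> = \<pi>" for \<pi> :: "nat \<Rightarrow> nat"
    using i by (simp_all add: fun_eq_iff)
qed

lemma perm_action_polytabloid:
  assumes \<sigma>: "\<sigma> permutes {1..r}"
  shows "perm_action \<sigma> (\<e> t) = (\<e> (\<sigma> \<circ> t) :: _ \<Rightarrow> 'k::field)"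
proof -
  note D = perm_subgroupD[OF perm_subgroup_column_group]
  have p: "permutation \<sigma>" "permutation (inv \<sigma>)"
    using \<sigma> permutes_imp_permutation[of "{1..r}"] permutes_inv[OF \<sigma>] by auto
  have "\<e> (\<sigma> \<circ> t) = (\<Sum>\<pi>\<in>column_group shp (\<sigma> \<circ> t). fun_scale (of_int (sign \<pi>)) (delta (tabloid shp (\<pi> \<circ> (\<sigma> \<circ> t)))) :: _ \<Rightarrow> 'k)"
    unfolding \<e>_def antisym_def
    by (rule sum.cong[OF refl]) (simp add: perm_action_delta_tabloid[OF D(6)])
  also have "\<dots> = (\<Sum>\<pi>\<in>column_group shp t. fun_scale (of_int (sign (\<sigma> \<circ> \<pi> \<circ> inv \<sigma>)))
      (delta (tabloid shp (\<sigma> \<circ> \<pi> \<circ> inv \<sigma> \<circ> (\<sigma> \<circ> t)))))"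
    by (rule sum.reindex_bij_betw[OF column_group_conj[OF \<sigma>], symmetric])
  also have "\<dots> = (\<Sum>\<pi>\<in>column_group shp t. fun_scale (of_int (sign \<pi>)) (perm_action \<sigma> (perm_action \<pi> (delta (tabloid shp t)))))"
  proof (rule sum.cong[OF refl])
    fix \<pi> assume \<pi>: "\<pi> \<in> column_group shp t"
    have "sign (\<sigma> \<circ> \<pi> \<circ> inv \<sigma>) = sign \<sigma> * sign \<pi> * sign (inv \<sigma>)"
      using p D(5)[OF \<pi>] by (simp add: sign_compose permutation_compose)
    also have "\<dots> = sign \<pi>" using sign_inverse[OF p(1)] by (simp add: mult_ac flip: mult.assoc)
    finally have s: "sign (\<sigma> \<circ> \<pi> \<circ> inv \<sigma>) = sign \<pi>" .
    have "\<sigma> \<circ> \<pi> \<circ> inv \<sigma> \<circ> (\<sigma> \<circ> t) = \<sigma> \<circ> (\<pi> \<circ> t)" using permutes_inv_o[OF \<sigma>] by (simp add: fun_eq_iff)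
    then show "fun_scale (of_int (sign (\<sigma> \<circ> \<pi> \<circ> inv \<sigma>))) (delta (tabloid shp (\<sigma> \<circ> \<pi> \<circ> inv \<sigma> \<circ> (\<sigma> \<circ> t)))) =
       (fun_scale (of_int (sign \<pi>)) (perm_action \<sigma> (perm_action \<pi> (delta (tabloid shp t)))) :: _ \<Rightarrow> 'k)"
      unfolding s by (simp add: perm_action_delta_tabloid[OF D(6)[OF \<pi>]] perm_action_delta_tabloid[OF permutes_bij[OF \<sigma>]])
  qed
  also have "\<dots> = perm_action \<sigma> (\<e> t)"
    unfolding \<e>_def antisym_def by (rule fun_linear_sum[OF perm_action_linear, symmetric])
  finally show ?thesis ..
qed

lemma transpose_column_group:
  assumes t: "filling t" and c: "c \<in> C" "c' \<in> C" "snd c = snd c'"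
  shows "transpose (t c) (t c') \<in> column_group shp t"
  unfolding column_group_def
proof (intro CollectI conjI allI)
  show "transpose (t c) (t c') permutes {1..sum_list shp}"
    using filling_range[OF t] c by (intro permutes_swap_id) auto
  fix j
  show "transpose (t c) (t c') ` t ` {c \<in> C. snd c = j} = t ` {c \<in> C. snd c = j}"
  proof (cases "snd c = j")
    case True
    then show ?thesis using c by (intro transpose_image_eq) auto
  next
    case False
    have notin: "t b \<notin> t ` {c \<in> C. snd c = j}" if b: "b \<in> C" "snd b \<noteq> j" for b
    proof
      assume "t b \<in> t ` {c \<in> C. snd c = j}"
      then obtain b' where "b' \<in> C" "snd b' = j" "t b = t b'" by blast
      then show False using filling_inj[OF t b(1)] b(2) by simp
    qed
    have "t c \<notin> t ` {c \<in> C. snd c = j}" "t c' \<notin> t ` {c \<in> C. snd c = j}"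
      using notin[OF c(1)] notin[OF c(2)] False c(3) by simp_all
    then show ?thesis by (intro transpose_image_eq) auto
  qed
qed

end

section \<open>The commutant of a Specht module\<close>

context young_diagram begin

definition cell :: "(nat \<times> nat \<Rightarrow> nat) \<Rightarrow> nat \<Rightarrow> nat \<times> nat" where "cell t x = inv_into C t x"
definition row :: "(nat \<times> nat \<Rightarrow> nat) \<Rightarrow> nat \<Rightarrow> nat" where "row t x = fst (cell t x)"
definition column :: "(nat \<times> nat \<Rightarrow> nat) \<Rightarrow> nat \<Rightarrow> nat" where "column t x = snd (cell t x)"

lemma cell_C: "filling t \<Longrightarrow> x \<in> {1..r} \<Longrightarrow> cell t x \<in> C"
  and filling_cell: "filling t \<Longrightarrow> x \<in> {1..r} \<Longrightarrow> t (cell t x) = x"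
  and cell_filling: "filling t \<Longrightarrow> c \<in> C \<Longrightarrow> cell t (t c) = c"
  unfolding cell_def filling_def bij_betw_def
  by (auto intro: inv_into_into f_inv_into_f inv_into_f_f simp del: One_nat_def)

lemma row_filling: "filling t \<Longrightarrow> c \<in> C \<Longrightarrow> row t (t c) = fst c"
  and column_filling: "filling t \<Longrightarrow> c \<in> C \<Longrightarrow> column t (t c) = snd c"
  by (simp_all add: row_def column_def cell_filling)

lemma mem_tabloid_iff: "filling t \<Longrightarrow> x \<in> tabloid shp t i \<longleftrightarrow> x \<in> {1..r} \<and> row t x = i"
proof -
  assume t: "filling t"
  show ?thesis
  proof
    assume "x \<in> tabloid shp t i"
    then show "x \<in> {1..r} \<and> row t x = i"
      using t filling_range[OF t] row_filling[OF t] by (auto simp: tabloid_def simp del: One_nat_def)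
  next
    assume x: "x \<in> {1..r} \<and> row t x = i"
    then have "x = t (cell t x)" "cell t x \<in> C" "fst (cell t x) = i"
      using cell_C[OF t] filling_cell[OF t] by (auto simp: row_def)
    then show "x \<in> tabloid shp t i" unfolding tabloid_def by blast
  qed
qed

lemma mem_column_iff: "filling t \<Longrightarrow> x \<in> t ` {c \<in> C. snd c = j} \<longleftrightarrow> x \<in> {1..r} \<and> column t x = j"
proof -
  assume t: "filling t"
  show ?thesis
  proof
    assume "x \<in> t ` {c \<in> C. snd c = j}"
    then show "x \<in> {1..r} \<and> column t x = j"
      using t filling_range[OF t] column_filling[OF t] by (auto simp del: One_nat_def)
  next
    assume x: "x \<in> {1..r} \<and> column t x = j"
    then have "x = t (cell t x)" "cell t x \<in> C" "snd (cell t x) = j"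
      using cell_C[OF t] filling_cell[OF t] by (auto simp: column_def)
    then show "x \<in> t ` {c \<in> C. snd c = j}" by blast
  qed
qed

lemma row_column_inj:
  assumes "filling t" "x \<in> {1..r}" "y \<in> {1..r}" "row t x = row t y" "column t x = column t y"
  shows "x = y"
proof -
  have "cell t x = cell t y" using assms(4,5) by (simp add: row_def column_def prod_eq_iff)
  from arg_cong[OF this, of t] show ?thesis
    unfolding filling_cell[OF assms(1,2)] filling_cell[OF assms(1,3)] .
qed

lemma column_group_column:
  assumes t: "filling t" and \<pi>: "\<pi> \<in> column_group shp t" and x: "x \<in> {1..r}"
  shows "column t (\<pi> x) = column t x"
proof -
  have "\<pi> x \<in> \<pi> ` t ` {c \<in> C. snd c = column t x}" using mem_column_iff[OF t, of x] x by blast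
  then have "\<pi> x \<in> t ` {c \<in> C. snd c = column t x}" using \<pi> by (simp add: column_group_def)
  then show ?thesis using mem_column_iff[OF t] by blast
qed

lemma column_group_row_trivial:
  assumes t: "filling t" and \<pi>: "\<pi> \<in> column_group shp t" and eq: "tabloid shp (\<pi> \<circ> t) = tabloid shp t"
  shows "\<pi> = id"
proof -
  have p: "\<pi> permutes {1..r}" using \<pi> by (simp add: column_group_def)
  have "\<pi> x = x" for x
  proof (cases "x \<in> {1..r}")
    case True
    have "\<pi> x \<in> \<pi> ` tabloid shp t (row t x)" using mem_tabloid_iff[OF t, of x] True by blast
    then have "\<pi> x \<in> tabloid shp t (row t x)" using fun_cong[OF eq, of "row t x"] by (simp add: tabloid_comp)
    then have "row t (\<pi> x) = row t x" "\<pi> x \<in> {1..r}" using mem_tabloid_iff[OF t] by blast+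
    then show ?thesis using row_column_inj[OF t _ True] column_group_column[OF t \<pi> True] by blast
  next
    case False
    then show ?thesis using permutes_not_in[OF p] by blast
  qed
  then show ?thesis by auto
qed

lemma polytabloid_at_tabloid:
  assumes t: "filling t"
  shows "\<e> t (tabloid shp t) = (1 :: 'k::field)"
proof -
  have "\<e> t (tabloid shp t) = polytabloid shp t (tabloid shp t)" by (simp add: polytabloid_eq)
  also have "\<dots> = (\<Sum>\<pi>\<in>column_group shp t. if \<pi> = id then 1 else (0 :: 'k))"
    unfolding polytabloid_def
    using column_group_row_trivial[OF t] by (intro sum.cong) auto
  also have "\<dots> = 1"
    using perm_subgroupD(2,7)[OF perm_subgroup_column_group[of t]] by simp
  finally show ?thesis .
qed

lemma perm_action_transpose_row:
  assumes s: "filling s" and x: "x \<in> {1..r}" "y \<in> {1..r}" and eq: "row s x = row s y"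
  shows "perm_action (transpose x y) (delta (tabloid shp s)) = (delta (tabloid shp s) :: _ \<Rightarrow> 'k::field)"
proof -
  have "transpose x y ` tabloid shp s i = tabloid shp s i" for i
  proof (rule transpose_image_eq)
    show "x \<in> tabloid shp s i \<longleftrightarrow> y \<in> tabloid shp s i"
      using mem_tabloid_iff[OF s] x eq by metis
  qed
  then show ?thesis by (subst perm_action_delta) auto
qed

lemma antisym_row_column_collision:
  assumes s: "filling s" and t: "filling t" and x: "x \<in> {1..r}" "y \<in> {1..r}" "x \<noteq> y"
    and "row s x = row s y" "column t x = column t y"
  shows "antisym (column_group shp t) (delta (tabloid shp s)) = (0 :: _ \<Rightarrow> 'k::field_char_0)"
proof (rule antisym_eq_0[OF perm_subgroup_column_group _ x(3)])
  have "transpose (t (cell t x)) (t (cell t y)) \<in> column_group shp t"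
    by (rule transpose_column_group[OF t cell_C[OF t x(1)] cell_C[OF t x(2)]]) (use assms(7) in \<open>simp add: column_def\<close>)
  then show "transpose x y \<in> column_group shp t" by (simp only: filling_cell[OF t x(1)] filling_cell[OF t x(2)])
  show "perm_action (transpose x y) (delta (tabloid shp s)) = (delta (tabloid shp s) :: _ \<Rightarrow> 'k)"
    by (rule perm_action_transpose_row[OF s x(1,2) assms(6)])
qed

lemma card_row:
  assumes s: "filling s" and i: "i < length shp"
  shows "card {x \<in> {1..r}. row s x = i} = shp ! i"
proof -
  have "{x \<in> {1..r}. row s x = i} = tabloid shp s i" using mem_tabloid_iff[OF s] by blast
  also have "\<dots> = s ` ({i} \<times> {..<shp ! i})"
    unfolding tabloid_def by (rule arg_cong[of _ _ "image s"]) (use i in \<open>auto simp: cells_def\<close>)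
  also have "card \<dots> = card ({i} \<times> {..<shp ! i})"
    by (rule card_image) (use i filling_inj[OF s] in \<open>auto simp: inj_on_def cells_def\<close>)
  finally show ?thesis by (simp add: card_cartesian_product)
qed

lemma card_column:
  assumes t: "filling t"
  shows "card {x \<in> {1..r}. column t x = j} = card {i. i < length shp \<and> j < shp ! i}"
proof -
  have "{x \<in> {1..r}. column t x = j} = t ` {c \<in> C. snd c = j}" using mem_column_iff[OF t] by blast
  also have "\<dots> = t ` ({i. i < length shp \<and> j < shp ! i} \<times> {j})"
    by (rule arg_cong[of _ _ "image t"]) (auto simp: cells_def)
  also have "card \<dots> = card ({i. i < length shp \<and> j < shp ! i} \<times> {j})"
    by (rule card_image) (use filling_inj[OF t] in \<open>auto simp: inj_on_def cells_def\<close>)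
  finally show ?thesis by (simp add: card_cartesian_product)
qed

text \<open>
  If the entries of each row of \<open>s\<close> lie in different columns of \<open>t\<close>, then the rows of \<open>s\<close> above row
  \<open>i\<close> already contain all entries of the columns of \<open>t\<close> of length at most \<open>i\<close>. This leaves the first
  \<open>shp ! i\<close> columns for row \<open>i\<close>.
\<close>

lemma column_image_row:
  assumes s: "filling s" and t: "filling t"
    and distinct: "\<And>x y. x \<in> {1..r} \<Longrightarrow> y \<in> {1..r} \<Longrightarrow> row s x = row s y \<Longrightarrow> column t x = column t y \<Longrightarrow> x = y"
    and i: "i < length shp"
  shows "column t ` {x \<in> {1..r}. row s x = i} = {..<shp ! i}"
  using i
proof (induction i rule: less_induct)
  case (less i)
  let ?R = "\<lambda>i. {x \<in> {1..r}. row s x = i}"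
  have sub: "column t ` ?R i \<subseteq> {..<shp ! i}"
  proof
    fix j assume "j \<in> column t ` ?R i"
    then obtain x where x: "x \<in> {1..r}" "row s x = i" "column t x = j" by blast
    show "j \<in> {..<shp ! i}"
    proof (rule ccontr)
      assume "j \<notin> {..<shp ! i}"
      then have j: "shp ! i \<le> j" by simp
      define K where "K = {x \<in> {1..r}. column t x = j}"
      define I where "I = {i. i < length shp \<and> j < shp ! i}"
      have finK: "finite K" and finI: "finite I" by (auto simp: K_def I_def)
      have "insert i I \<subseteq> row s ` K"
      proof
        fix i' assume "i' \<in> insert i I"
        then consider "i' = i" | "i' \<in> I" by blast
        then show "i' \<in> row s ` K"
        proof cases
          case 1
          then show ?thesis using x unfolding K_def by blast
        next
          case 2
          then have i': "i' < length shp" "j < shp ! i'" by (auto simp: I_def)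
          have "i' < i"
          proof (rule ccontr)
            assume "\<not> i' < i"
            then have "shp ! i' \<le> shp ! i" using shp_mono[of i i'] i' by simp
            then show False using i' j by simp
          qed
          then have "column t ` ?R i' = {..<shp ! i'}" using less.IH i' by blast
          then have "j \<in> column t ` ?R i'" using i' by simp
          then show ?thesis unfolding K_def by blast
        qed
      qed
      then have "card (insert i I) \<le> card (row s ` K)" using finK by (intro card_mono) auto
      also have "\<dots> \<le> card K" by (rule card_image_le[OF finK])
      also have "\<dots> = card I" unfolding K_def I_def by (rule card_column[OF t])
      finally show False using finI j by (auto simp: I_def)
    qed
  qed
  have "inj_on (column t) (?R i)"
  proof (rule inj_onI)
    fix x y assume "x \<in> ?R i" "y \<in> ?R i" and eq: "column t x = column t y"
    then have "x \<in> {1..r}" "y \<in> {1..r}" "row s x = row s y" by (simp_all del: One_nat_def)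
    then show "x = y" using eq by (rule distinct)
  qed
  then have "card (column t ` ?R i) = card {..<shp ! i}"
    using card_row[OF s less.prems] by (simp add: card_image)
  then show ?case using sub by (intro card_subset_eq) auto
qed

text \<open>
  Permuting each column of \<open>t\<close> moves every entry to its row in \<open>s\<close>.
\<close>

lemma column_group_matching:
  assumes s: "filling s" and t: "filling t"
    and distinct: "\<And>x y. x \<in> {1..r} \<Longrightarrow> y \<in> {1..r} \<Longrightarrow> row s x = row s y \<Longrightarrow> column t x = column t y \<Longrightarrow> x = y"
  obtains \<pi> where "\<pi> \<in> column_group shp t" "tabloid shp (\<pi> \<circ> t) = tabloid shp s"
proof -
  have image_row: "column t ` {x \<in> {1..r}. row s x = i} = {..<shp ! i}" if "i < length shp" for i
    by (rule column_image_row[OF s t _ that]) (rule distinct)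
  have "\<exists>y. y \<in> {1..r} \<and> row s y = fst c \<and> column t y = snd c" if "c \<in> C" for c
  proof -
    have "fst c < length shp" "snd c < shp ! fst c" using that by (auto simp: cells_def)
    then have "snd c \<in> column t ` {x \<in> {1..r}. row s x = fst c}"
      using image_row[of "fst c"] by simp
    then obtain y where "snd c = column t y" "y \<in> {x \<in> {1..r}. row s x = fst c}" by (rule imageE)
    then show ?thesis by (intro exI[of _ y]) simp
  qed
  then obtain t' where t': "\<And>c. c \<in> C \<Longrightarrow> t' c \<in> {1..r} \<and> row s (t' c) = fst c \<and> column t (t' c) = snd c"
    by metis
  have inj: "inj_on t' C"
  proof (rule inj_onI)
    fix c c' assume "c \<in> C" "c' \<in> C" "t' c = t' c'"
    then show "c = c'" using t'[of c] t'[of c'] by (simp add: prod_eq_iff)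
  qed
  have "t' ` C = {1..r}"
  proof (rule card_subset_eq)
    show "card (t' ` C) = card {1..r}" using card_image[OF inj] card_C by simp
  qed (use t' in auto)
  with inj have fill: "filling t'" by (simp add: filling_def bij_betw_def)
  obtain \<pi> where \<pi>: "\<pi> permutes {1..r}" "\<And>c. c \<in> C \<Longrightarrow> t' c = \<pi> (t c)"
    by (rule filling_transitive[OF fill t]) (rule that; simp)
  have "\<pi> \<in> column_group shp t"
    unfolding column_group_def
  proof (intro CollectI conjI allI \<pi>(1))
    fix j
    have "\<pi> ` t ` {c \<in> C. snd c = j} = t' ` {c \<in> C. snd c = j}"
      unfolding image_image by (rule image_cong) (auto simp: \<pi>(2))
    also have "\<dots> = t ` {c \<in> C. snd c = j}"
    proof (intro equalityI subsetI)
      fix x assume "x \<in> t' ` {c \<in> C. snd c = j}"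
      then obtain c where "c \<in> C" "snd c = j" "x = t' c" by blast
      then show "x \<in> t ` {c \<in> C. snd c = j}" using t'[of c] unfolding mem_column_iff[OF t] by simp
    next
      fix x assume "x \<in> t ` {c \<in> C. snd c = j}"
      then have x: "x \<in> {1..r}" "column t x = j" unfolding mem_column_iff[OF t] by auto
      obtain c where "c \<in> C" "x = t' c" using filling_surj[OF fill x(1)] by blast
      moreover from this have "snd c = j" using t'[of c] x(2) by simp
      ultimately show "x \<in> t' ` {c \<in> C. snd c = j}" by blast
    qed
    finally show "\<pi> ` t ` {c \<in> C. snd c = j} = t ` {c \<in> C. snd c = j}" .
  qed
  moreover have "tabloid shp (\<pi> \<circ> t) = tabloid shp t'" by (rule tabloid_cong) (simp add: \<pi>(2))
  moreover have "tabloid shp t' = tabloid shp s"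
  proof
    fix i
    show "tabloid shp t' i = tabloid shp s i"
    proof (intro equalityI subsetI)
      fix x assume "x \<in> tabloid shp t' i"
      then obtain c where "c \<in> C" "fst c = i" "x = t' c" unfolding tabloid_def by blast
      then show "x \<in> tabloid shp s i" using t'[of c] unfolding mem_tabloid_iff[OF s] by simp
    next
      fix x assume "x \<in> tabloid shp s i"
      then have x: "x \<in> {1..r}" "row s x = i" unfolding mem_tabloid_iff[OF s] by auto
      obtain c where "c \<in> C" "x = t' c" using filling_surj[OF fill x(1)] by blast
      moreover from this have "fst c = i" using t'[of c] x(2) by simp
      ultimately show "x \<in> tabloid shp t' i" unfolding tabloid_def by blast
    qed
  qed
  ultimately show thesis using that by simp
qed

text \<open>
  Either two entries share a row of \<open>s\<close> and a column of \<open>t\<close>, and their transposition makes the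
  result zero, or the tabloid of \<open>s\<close> is a column permutation of that of \<open>t\<close>.
\<close>

lemma antisym_tabloid:
  assumes s: "filling s" and t: "filling t"
  shows "\<exists>c. antisym (column_group shp t) (delta (tabloid shp s)) = fun_scale c (\<e> t :: _ \<Rightarrow> 'k::field_char_0)"
proof (cases "\<exists>x y. x \<in> {1..r} \<and> y \<in> {1..r} \<and> row s x = row s y \<and> column t x = column t y \<and> x \<noteq> y")
  case True
  then show ?thesis using antisym_row_column_collision[where 'k = 'k, OF s t]
    by (intro exI[of _ 0]) (auto simp: fun_eq_iff fun_scale_apply)
next
  case False
  then obtain \<pi> where \<pi>: "\<pi> \<in> column_group shp t" "tabloid shp (\<pi> \<circ> t) = tabloid shp s"
    by (rule_tac column_group_matching[OF s t]) blast+
  note A = perm_subgroup_column_group[of t]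
  have "delta (tabloid shp s) = (perm_action \<pi> (delta (tabloid shp t)) :: _ \<Rightarrow> 'k)"
    unfolding perm_action_delta_tabloid[OF perm_subgroupD(6)[OF A \<pi>(1)]] \<pi>(2) ..
  then show ?thesis using antisym_perm_action[where 'k = 'k, OF A \<pi>(1), of "delta (tabloid shp t)"]
    unfolding \<e>_def by auto
qed

abbreviation W :: "((nat \<Rightarrow> nat set) \<Rightarrow> 'k::field) set" where "W \<equiv> specht shp"

lemma restrict_tableau: "filling t \<Longrightarrow> restrict t C \<in> tableaux shp"
  unfolding tableaux_def filling_def by (auto cong: bij_betw_cong)

lemma tableau_filling: "t \<in> tableaux shp \<Longrightarrow> filling t"
  by (simp add: tableaux_def filling_def)

lemma specht_eq: "W = fun_space.span (\<e> ` {t. filling t} :: ((nat \<Rightarrow> nat set) \<Rightarrow> 'k::field) set)"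
proof -
  have "(polytabloid shp ` tableaux shp :: ((nat \<Rightarrow> nat set) \<Rightarrow> 'k) set) = \<e> ` {t. filling t}"
  proof
    show "(polytabloid shp ` tableaux shp :: ((nat \<Rightarrow> nat set) \<Rightarrow> 'k) set) \<subseteq> \<e> ` {t. filling t}"
      using tableau_filling by (auto simp: polytabloid_eq)
    show "\<e> ` {t. filling t} \<subseteq> (polytabloid shp ` tableaux shp :: ((nat \<Rightarrow> nat set) \<Rightarrow> 'k) set)"
    proof
      fix v :: "(nat \<Rightarrow> nat set) \<Rightarrow> 'k" assume "v \<in> \<e> ` {t. filling t}"
      then obtain t where t: "filling t" "v = \<e> t" by blast
      have "\<e> (restrict t C) = (\<e> t :: _ \<Rightarrow> 'k)" by (rule polytabloid_cong) simp
      then show "v \<in> polytabloid shp ` tableaux shp"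
        using t restrict_tableau[OF t(1)] polytabloid_eq[of "restrict t C", where 'k = 'k] by (metis image_eqI)
    qed
  qed
  then show ?thesis by (simp add: specht_def)
qed

lemma polytabloid_specht: "filling t \<Longrightarrow> \<e> t \<in> (W :: ((nat \<Rightarrow> nat set) \<Rightarrow> 'k::field) set)"
  unfolding specht_eq by (intro fun_space.span_base) auto

lemma specht_induct [consumes 1, case_names zero scale add polytabloid]:
  assumes w: "w \<in> (W :: ((nat \<Rightarrow> nat set) \<Rightarrow> 'k::field) set)"
    and "P 0" "\<And>c v. v \<in> W \<Longrightarrow> P v \<Longrightarrow> P (fun_scale c v)"
      "\<And>u v. u \<in> W \<Longrightarrow> v \<in> W \<Longrightarrow> P u \<Longrightarrow> P v \<Longrightarrow> P (u + v)" "\<And>t. filling t \<Longrightarrow> P (\<e> t)"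
  shows "P w"
proof -
  have "w \<in> W \<and> P w"
  proof (rule fun_space.span_induct[OF w[unfolded specht_eq]])
    show "fun_space.subspace (Collect (\<lambda>w. w \<in> (W :: ((nat \<Rightarrow> nat set) \<Rightarrow> 'k) set) \<and> P w))"
      using assms(2-4) unfolding fun_space.subspace_def specht_eq
      by (auto intro: fun_space.span_zero fun_space.span_add fun_space.span_scale)
    show "x \<in> W \<and> P x" if "x \<in> \<e> ` {t. filling t}" for x
      using that assms(5) polytabloid_specht by auto
  qed
  then show ?thesis by simp
qed

lemma perm_action_0: "perm_action \<pi> 0 = 0"
  by (auto simp: perm_action_def)

lemma perm_action_specht:
  assumes "\<pi> permutes {1..r}" and w: "w \<in> (W :: ((nat \<Rightarrow> nat set) \<Rightarrow> 'k::field) set)"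
  shows "perm_action \<pi> w \<in> W"
  using w
proof (induction rule: specht_induct)
  case zero then show ?case unfolding perm_action_0 specht_eq by (rule fun_space.span_zero)
next
  case (scale c v) then show ?case unfolding perm_action_scale specht_eq by (intro fun_space.span_scale)
next
  case (add u v) then show ?case unfolding perm_action_add specht_eq by (intro fun_space.span_add)
next
  case (polytabloid t) then show ?case
    unfolding perm_action_polytabloid[OF assms(1)] by (intro polytabloid_specht filling_comp assms(1))
qed

lemma antisym_specht:
  assumes t: "filling t" and w: "w \<in> (W :: ((nat \<Rightarrow> nat set) \<Rightarrow> 'k::field_char_0) set)"
  shows "\<exists>c. antisym (column_group shp t) w = fun_scale c (\<e> t)"
  using w
proof (induction rule: specht_induct)
  case zero
  have "antisym (column_group shp t) (0 :: _ \<Rightarrow> 'k) = fun_scale 0 (\<e> t)"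
    unfolding antisym_def perm_action_0 by (auto simp: fun_eq_iff fun_scale_apply sum_fun_apply)
  then show ?case ..
next
  case (scale c v)
  then obtain d where "antisym (column_group shp t) v = fun_scale d (\<e> t)" by blast
  then have "antisym (column_group shp t) (fun_scale c v) = fun_scale (c * d) (\<e> t)"
    using antisym_linear[of "column_group shp t", where 'k = 'k] unfolding fun_linear_def by (simp add: fun_scale_scale)
  then show ?case by blast
next
  case (add u v)
  then obtain c d where "antisym (column_group shp t) u = fun_scale c (\<e> t)" "antisym (column_group shp t) v = fun_scale d (\<e> t)" by blast
  then have "antisym (column_group shp t) (u + v) = fun_scale (c + d) (\<e> t)"
    using antisym_linear[of "column_group shp t", where 'k = 'k] unfolding fun_linear_def
    by (simp only: fun_space.scale_left_distrib)
  then show ?case by blast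
next
  case (polytabloid s)
  note D = perm_subgroupD[OF perm_subgroup_column_group]
  have "\<exists>c. antisym (column_group shp t) (delta (tabloid shp (\<pi> \<circ> s))) = fun_scale c (\<e> t :: _ \<Rightarrow> 'k)"
    if "\<pi> \<in> column_group shp s" for \<pi>
    by (rule antisym_tabloid[OF filling_comp[OF polytabloid D(1)[OF that]] t])
  then obtain c where c: "\<And>\<pi>. \<pi> \<in> column_group shp s \<Longrightarrow>
      antisym (column_group shp t) (delta (tabloid shp (\<pi> \<circ> s))) = fun_scale (c \<pi>) (\<e> t :: _ \<Rightarrow> 'k)"
    by metis
  have "antisym (column_group shp t) (\<e> s) = (\<Sum>\<pi>\<in>column_group shp s. fun_scale (of_int (sign \<pi>))
      (antisym (column_group shp t) (perm_action \<pi> (delta (tabloid shp s)))) :: _ \<Rightarrow> 'k)"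
    unfolding \<e>_def antisym_def[of "column_group shp s"] by (rule fun_linear_sum[OF antisym_linear])
  also have "\<dots> = (\<Sum>\<pi>\<in>column_group shp s. fun_scale (of_int (sign \<pi>) * c \<pi>) (\<e> t))"
    by (rule sum.cong[OF refl]) (simp only: perm_action_delta_tabloid[OF D(6)] c fun_scale_scale)
  also have "\<dots> = fun_scale (\<Sum>\<pi>\<in>column_group shp s. of_int (sign \<pi>) * c \<pi>) (\<e> t)"
    by (rule fun_space.scale_sum_left[symmetric])
  finally show ?case by blast
qed

lemma finite_tableaux: "finite (tableaux shp)"
proof (rule finite_subset)
  show "tableaux shp \<subseteq> C \<rightarrow>\<^sub>E {1..r}"
    by (auto simp: tableaux_def PiE_def bij_betw_def)
  show "finite (C \<rightarrow>\<^sub>E {1..r})" by (intro finite_PiE finite_C) auto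
qed

lemma specht_basis:
  fixes B :: "((nat \<Rightarrow> nat set) \<Rightarrow> 'k::field) set"
  defines "B \<equiv> (SOME B. fun_space.independent B \<and> fun_space.span B = W)"
  shows "fun_space.independent B" "fun_space.span B = W" "finite B"
proof -
  obtain B' :: "((nat \<Rightarrow> nat set) \<Rightarrow> 'k) set" where B': "B' \<subseteq> W" "fun_space.independent B'" "W \<subseteq> fun_space.span B'"
    by (rule fun_space.basis_exists)
  have "fun_space.span B' \<subseteq> W" unfolding specht_def
    by (rule fun_space.span_minimal) (use B'(1) in \<open>auto simp: specht_def fun_space.subspace_span\<close>)
  then have "fun_space.independent B' \<and> fun_space.span B' = W" using B' by blast
  then have B: "fun_space.independent B \<and> fun_space.span B = W" unfolding B_def by (rule someI)
  then show "fun_space.independent B" "fun_space.span B = W" by auto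
  have "B \<subseteq> fun_space.span (polytabloid shp ` tableaux shp)"
    using B fun_space.span_superset[of B] by (auto simp: specht_def)
  then show "finite B" using fun_space.independent_span_bound[OF finite_imageI[OF finite_tableaux]] B by blast
qed

text \<open>
  A polytabloid is, up to a nonzero factor, its own column antisymmetrisation, and the
  antisymmetriser commutes with \<open>E\<close> and maps the Specht module to multiples of the polytabloid. So the
  polytabloid is an eigenvector of \<open>E\<close>; the eigenvalue is the same for all of them as the symmetric
  group permutes them transitively.
\<close>

lemma specht_commutant_scalar:
  fixes E :: "((nat \<Rightarrow> nat set) \<Rightarrow> 'k::field_char_0) \<Rightarrow> (nat \<Rightarrow> nat set) \<Rightarrow> 'k"
  assumes EW: "\<And>w. w \<in> W \<Longrightarrow> E w \<in> W"
    and Esum: "\<And>(I :: (nat \<Rightarrow> nat) set) c f. (\<And>i. i \<in> I \<Longrightarrow> f i \<in> W) \<Longrightarrow>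
       E (\<Sum>i\<in>I. fun_scale (c i) (f i)) = (\<Sum>i\<in>I. fun_scale (c i) (E (f i)))"
    and Escale: "\<And>c w. w \<in> W \<Longrightarrow> E (fun_scale c w) = fun_scale c (E w)"
    and Eadd: "\<And>x y. x \<in> W \<Longrightarrow> y \<in> W \<Longrightarrow> E (x + y) = E x + E y"
    and comm: "\<And>\<pi> w. \<pi> permutes {1..r} \<Longrightarrow> w \<in> W \<Longrightarrow> E (perm_action \<pi> w) = perm_action \<pi> (E w)"
  shows "\<exists>c. \<forall>w\<in>W. E w = fun_scale c w"
proof -
  obtain t where t: "filling t" using ex_filling by blast
  let ?A = "column_group shp t"
  note A = perm_subgroup_column_group[of t]
  note D = perm_subgroupD[OF A]
  have eW: "\<e> t \<in> (W :: (_ \<Rightarrow> 'k) set)" by (rule polytabloid_specht[OF t])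
  let ?N = "of_nat (card ?A) :: 'k"
  have N: "?N \<noteq> 0" using D(2,7) by auto
  obtain c where c: "antisym ?A (E (\<e> t)) = fun_scale c (\<e> t)" using antisym_specht[OF t EW[OF eW]] by blast
  have "fun_scale ?N (E (\<e> t)) = E (fun_scale ?N (\<e> t))" by (rule Escale[OF eW, symmetric])
  also have "fun_scale ?N (\<e> t) = antisym ?A (\<e> t)"
    unfolding \<e>_def by (rule antisym_antisym[OF A, symmetric])
  also have "E (antisym ?A (\<e> t)) = (\<Sum>\<pi>\<in>?A. fun_scale (of_int (sign \<pi>)) (E (perm_action \<pi> (\<e> t))))"
    unfolding antisym_def by (rule Esum) (rule perm_action_specht[OF D(1) eW])
  also have "\<dots> = antisym ?A (E (\<e> t))"
    unfolding antisym_def by (rule sum.cong[OF refl]) (simp only: comm[OF D(1) eW])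
  finally have "fun_scale ?N (E (\<e> t)) = fun_scale c (\<e> t)" using c by simp
  then have "fun_scale (1 / ?N) (fun_scale ?N (E (\<e> t))) = fun_scale (1 / ?N) (fun_scale c (\<e> t))" by simp
  then have Et: "E (\<e> t) = fun_scale (c / ?N) (\<e> t)" using N by (simp add: fun_scale_scale)
  have "E w = fun_scale (c / ?N) w" if "w \<in> W" for w
    using that
  proof (induction rule: specht_induct)
    case zero
    have "E (fun_scale 0 0) = fun_scale 0 (E 0)"
      by (rule Escale) (simp only: specht_eq fun_space.span_zero)
    then show ?case by (simp only: fun_space.scale_zero_left fun_space.scale_zero_right)
  next
    case (scale d v)
    then show ?case by (simp add: Escale fun_scale_scale mult.commute)
  next
    case (add u v)
    then show ?case by (simp only: Eadd fun_space.scale_right_distrib)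
  next
    case (polytabloid s)
    obtain \<pi> where \<pi>: "\<pi> permutes {1..r}" "\<And>c. c \<in> C \<Longrightarrow> s c = \<pi> (t c)"
      by (rule filling_transitive[OF polytabloid t]) (rule that; simp)
    have s: "\<e> s = (perm_action \<pi> (\<e> t) :: _ \<Rightarrow> 'k)"
      unfolding perm_action_polytabloid[OF \<pi>(1)] by (rule polytabloid_cong) (simp add: \<pi>(2))
    show ?case unfolding s comm[OF \<pi>(1) eW] Et perm_action_scale ..
  qed
  then show ?thesis by blast
qed

theorem specht_orthogonality:
  "(\<Sum>\<pi>\<in>{\<pi>. \<pi> permutes {1..r}}. specht_character shp \<pi> * specht_character shp (inv \<pi>)) = (fact r :: 'k::field_char_0)"
proof -
  define B where "B = (SOME B. fun_space.independent B \<and> fun_space.span B = (W :: ((nat \<Rightarrow> nat set) \<Rightarrow> 'k) set))"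
  note B = specht_basis[where 'k = 'k, folded B_def]
  obtain bs where bs: "set bs = B" "distinct bs" using finite_distinct_list[OF B(3)] by blast
  have \<chi>: "specht_character shp \<pi> = (\<Sum>b\<in>set bs. fun_space.representation (set bs) (perm_action \<pi> b) b :: 'k)" for \<pi>
    unfolding specht_character_def trace_on_def bs(1) B_def[symmetric] by simp
  have "bs \<noteq> []"
  proof
    assume "bs = []"
    then have W0: "(W :: ((nat \<Rightarrow> nat set) \<Rightarrow> 'k) set) = {0}" using B(2) bs(1) by (simp add: fun_space.span_empty)
    obtain t where t: "filling t" using ex_filling by blast
    have "(\<e> t :: _ \<Rightarrow> 'k) = 0" using polytabloid_specht[where 'k = 'k, OF t] W0 by simp
    then show False using polytabloid_at_tabloid[where 'k = 'k, OF t] by simp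
  qed
  let ?G = "sym_group r"
  have W: "fun_space.span (set bs) = W" using B(2) bs(1) by simp
  have carr: "carrier ?G = {\<pi>. \<pi> permutes {1..r}}" by (simp add: sym_group_def)
  have inv: "m_inv ?G \<pi> = inv \<pi>" if "\<pi> permutes {1..r}" for \<pi>
    by (rule group.inv_equality[OF sym_group_is_group])
      (use that permutes_inv permutes_inv_o[OF that] in \<open>auto simp: sym_group_def\<close>)
  have "(\<Sum>\<pi>\<in>carrier ?G. (\<Sum>b\<in>set bs. fun_space.representation (set bs) (perm_action \<pi> b) b) *
      (\<Sum>b\<in>set bs. fun_space.representation (set bs) (perm_action (m_inv ?G \<pi>) b) b)) = (of_nat (card (carrier ?G)) :: 'k)"
  proof (rule trace_orthogonality_scalar_commutant[OF sym_group_is_group bs(2) _ \<open>bs \<noteq> []\<close>, unfolded W])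
    show "fun_space.independent (set bs)" using B(1) bs(1) by simp
    show "fun_linear (perm_action \<pi> :: ((nat \<Rightarrow> nat set) \<Rightarrow> 'k) \<Rightarrow> _)" for \<pi> by (rule perm_action_linear)
    show "perm_action \<pi> w \<in> W" if "\<pi> \<in> carrier ?G" "w \<in> (W :: (_ \<Rightarrow> 'k) set)" for \<pi> w
      using that perm_action_specht by (simp add: carr)
    show "perm_action (\<pi> \<otimes>\<^bsub>?G\<^esub> \<sigma>) w = perm_action \<pi> (perm_action \<sigma> w)" for \<pi> \<sigma> and w :: "_ \<Rightarrow> 'k"
      by (simp add: sym_group_def perm_action_comp)
    show "perm_action \<one>\<^bsub>?G\<^esub> w = w" for w :: "_ \<Rightarrow> 'k" by (simp add: sym_group_def perm_action_id)
  next
    fix E :: "((nat \<Rightarrow> nat set) \<Rightarrow> 'k) \<Rightarrow> (nat \<Rightarrow> nat set) \<Rightarrow> 'k"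
    assume "\<And>w. w \<in> W \<Longrightarrow> E w \<in> W"
      "\<And>(I :: (nat \<Rightarrow> nat) set) c f. (\<And>i. i \<in> I \<Longrightarrow> f i \<in> W) \<Longrightarrow>
         E (\<Sum>i\<in>I. fun_scale (c i) (f i)) = (\<Sum>i\<in>I. fun_scale (c i) (E (f i)))"
      "\<And>c w. w \<in> W \<Longrightarrow> E (fun_scale c w) = fun_scale c (E w)"
      "\<And>x y. x \<in> W \<Longrightarrow> y \<in> W \<Longrightarrow> E (x + y) = E x + E y"
      "\<And>\<pi> w. \<pi> \<in> carrier ?G \<Longrightarrow> w \<in> W \<Longrightarrow> E (perm_action \<pi> w) = perm_action \<pi> (E w)"
    then show "\<exists>c. \<forall>w\<in>W. E w = fun_scale c w" unfolding carr mem_Collect_eq by (rule specht_commutant_scalar)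
  qed
  moreover have "card (carrier ?G) = fact r" unfolding carr by (rule card_permutations) auto
  ultimately show ?thesis
    unfolding \<chi> carr using inv by simp
qed

lemma specht_character_id: "specht_character shp id = (of_nat (fun_space.dim (W :: ((nat \<Rightarrow> nat set) \<Rightarrow> 'k) set)) :: 'k::field_char_0)"
proof -
  define B where "B = (SOME B. fun_space.independent B \<and> fun_space.span B = (W :: ((nat \<Rightarrow> nat set) \<Rightarrow> 'k) set))"
  note B = specht_basis[where 'k = 'k, folded B_def]
  have "specht_character shp id = (\<Sum>b\<in>B. fun_space.representation B b b :: 'k)"
    unfolding specht_character_def trace_on_def B_def[symmetric] by (simp add: perm_action_id)
  also have "\<dots> = (\<Sum>b\<in>B. 1)"
    by (rule sum.cong[OF refl]) (simp add: fun_space.representation_basis[OF B(1)])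
  also have "\<dots> = of_nat (fun_space.dim (W :: ((nat \<Rightarrow> nat set) \<Rightarrow> 'k) set))"
    using fun_space.dim_span_eq_card_independent[OF B(1)] B(2) by simp
  finally show ?thesis .
qed

end

section \<open>Independence of the standard polytabloids\<close>

lemma digits_less_power:
  fixes f :: "nat \<Rightarrow> nat"
  assumes "\<And>y. f y < b"
  shows "(\<Sum>y<x. f y * b ^ y) < b ^ x"
proof (induction x)
  case (Suc x)
  have "(\<Sum>y<Suc x. f y * b ^ y) < b ^ x + f x * b ^ x" using Suc by simp
  also have "\<dots> = Suc (f x) * b ^ x" by simp
  also have "\<dots> \<le> b * b ^ x" by (rule mult_le_mono1) (use assms in \<open>simp add: Suc_leI\<close>)
  finally show ?case by simp
qed simp

text \<open>
  Numbers in base \<open>b\<close> are compared at the most significant digit where they differ.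
\<close>

lemma digits_less:
  fixes f g :: "nat \<Rightarrow> nat"
  assumes f: "\<And>y. f y < b" and x: "x < n" "f x < g x" and eq: "\<And>y. x < y \<Longrightarrow> y < n \<Longrightarrow> f y = g y"
  shows "(\<Sum>y<n. f y * b ^ y) < (\<Sum>y<n. g y * b ^ y)"
proof -
  have split: "(\<Sum>y<n. h y) = (\<Sum>y<x. h y) + h x + (\<Sum>y\<in>{x<..<n}. h y)" for h :: "nat \<Rightarrow> nat"
  proof -
    have "{..<n} = insert x ({..<x} \<union> {x<..<n})" using x(1) by auto
    moreover have "(\<Sum>y\<in>{..<x} \<union> {x<..<n}. h y) = (\<Sum>y<x. h y) + (\<Sum>y\<in>{x<..<n}. h y)"
      by (rule sum.union_disjoint) auto
    ultimately show ?thesis by simp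
  qed
  have "(\<Sum>y<x. f y * b ^ y) + f x * b ^ x < b ^ x + f x * b ^ x"
    using digits_less_power[of f b x] f by simp
  also have "\<dots> = Suc (f x) * b ^ x" by simp
  also have "\<dots> \<le> g x * b ^ x" by (rule mult_le_mono1) (use x(2) in simp)
  also have "\<dots> \<le> (\<Sum>y<x. g y * b ^ y) + g x * b ^ x" by simp
  finally have "(\<Sum>y<x. f y * b ^ y) + f x * b ^ x < (\<Sum>y<x. g y * b ^ y) + g x * b ^ x" .
  moreover have "(\<Sum>y\<in>{x<..<n}. f y * b ^ y) = (\<Sum>y\<in>{x<..<n}. g y * b ^ y)"
    by (rule sum.cong[OF refl]) (simp add: eq)
  ultimately show ?thesis unfolding split[of "\<lambda>y. f y * b ^ y"] split[of "\<lambda>y. g y * b ^ y"] by simp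
qed

text \<open>
  The elements that leave \<open>B\<close> are replaced by equally many elements of \<open>A\<close>, which are larger.
\<close>

lemma sum_exchange_less:
  fixes \<sigma> :: "nat \<Rightarrow> nat"
  assumes A: "finite A" and B: "finite B" and less: "\<And>a b. a \<in> A \<Longrightarrow> b \<in> B \<Longrightarrow> b < a"
    and \<sigma>: "\<sigma> permutes A \<union> B" and ne: "\<sigma> ` B \<noteq> B"
  shows "(\<Sum>x\<in>B. x) < (\<Sum>x\<in>B. \<sigma> x)"
proof -
  let ?B = "\<sigma> ` B"
  have inj: "inj_on \<sigma> B" using permutes_inj[OF \<sigma>] by (rule inj_on_subset) simp
  have card: "card ?B = card B" by (rule card_image[OF inj])
  have fin: "finite ?B" using B by simp
  have split: "(\<Sum>x\<in>?B. x) = (\<Sum>x\<in>?B \<inter> B. x) + (\<Sum>x\<in>?B - B. x)" "(\<Sum>x\<in>B. x) = (\<Sum>x\<in>?B \<inter> B. x) + (\<Sum>x\<in>B - ?B. x)"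
    using sum.Int_Diff[OF fin, of "\<lambda>x. x" B] sum.Int_Diff[OF B, of "\<lambda>x. x" ?B] by (simp_all add: Int_commute)
  have cards: "card (?B - B) = card (B - ?B)"
    using card_Int_Diff[OF fin, of B] card_Int_Diff[OF B, of ?B] card by (simp add: Int_commute)
  have nonempty: "B - ?B \<noteq> {}"
  proof
    assume "B - ?B = {}"
    then have "B = ?B" using card fin by (intro card_subset_eq) auto
    then show False using ne by simp
  qed
  let ?m = "Max (B - ?B)"
  have m: "?m \<in> B" using Max_in[of "B - ?B"] nonempty B by blast
  have "(\<Sum>x\<in>B - ?B. x) \<le> card (B - ?B) * ?m"
    using sum_bounded_above[of "B - ?B" "\<lambda>x. x" ?m] B by simp
  also have "\<dots> < card (?B - B) * Suc ?m"
    unfolding cards using nonempty B by (simp add: card_gt_0_iff)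
  also have "\<dots> \<le> (\<Sum>x\<in>?B - B. x)"
  proof -
    have "Suc ?m \<le> y" if "y \<in> ?B - B" for y
    proof -
      have "y \<in> A \<union> B" using that permutes_in_image[OF \<sigma>] by blast
      then show ?thesis using that less[OF _ m, of y] by auto
    qed
    then show ?thesis using sum_bounded_below[of "?B - B" "Suc ?m" "\<lambda>x. x"] by simp
  qed
  finally have "(\<Sum>x\<in>B. x) < (\<Sum>x\<in>?B. x)" unfolding split by simp
  then show ?thesis by (simp add: sum.reindex[OF inj])
qed

context young_diagram begin

text \<open>
  The row numbers are read as digits, the largest entry being the most significant, so that the
  numerical order is a lexicographic order on tabloids. In this order a column strict filling is
  the largest among its column permutations.
\<close>

definition weight :: "(nat \<times> nat \<Rightarrow> nat) \<Rightarrow> nat" where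
  "weight t = (\<Sum>x<Suc r. (if x \<in> {1..r} then row t x else 0) * Suc (length shp) ^ x)"

definition column_strict :: "(nat \<times> nat \<Rightarrow> nat) \<Rightarrow> bool" where
  "column_strict t \<longleftrightarrow> (\<forall>i i' j. (i, j) \<in> C \<and> (i', j) \<in> C \<and> i < i' \<longrightarrow> t (i, j) < t (i', j))"

definition row_strict :: "(nat \<times> nat \<Rightarrow> nat) \<Rightarrow> bool" where
  "row_strict t \<longleftrightarrow> (\<forall>i j j'. (i, j) \<in> C \<and> (i, j') \<in> C \<and> j < j' \<longrightarrow> t (i, j) < t (i, j'))"

lemma standard_iff: "t \<in> standard_tableaux shp \<longleftrightarrow> t \<in> tableaux shp \<and> row_strict t \<and> column_strict t"
  by (auto simp: standard_tableaux_def row_strict_def column_strict_def)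

lemma row_less: "filling t \<Longrightarrow> x \<in> {1..r} \<Longrightarrow> row t x < length shp"
  using cell_C[of t x] by (auto simp: row_def cells_def)

lemma weight_less:
  assumes s: "filling s" and x: "x \<in> {1..r}" "row s x < row t x"
    and eq: "\<And>y. x < y \<Longrightarrow> y \<in> {1..r} \<Longrightarrow> row s y = row t y"
  shows "weight s < weight t"
  unfolding weight_def
  by (rule digits_less[of _ _ x]) (use row_less[OF s] x eq in \<open>auto simp: less_Suc_eq\<close>)

lemma row_comp:
  assumes t: "filling t" and \<pi>: "\<pi> permutes {1..r}" and x: "x \<in> {1..r}"
  shows "row (\<pi> \<circ> t) (\<pi> x) = row t x"
proof -
  have "row (\<pi> \<circ> t) ((\<pi> \<circ> t) (cell t x)) = fst (cell t x)"
    by (rule row_filling[OF filling_comp[OF t \<pi>] cell_C[OF t x]])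
  then show ?thesis by (simp add: filling_cell[OF t x] row_def[of t] del: One_nat_def)
qed

lemma weight_tabloid:
  assumes "filling s" "filling t" "tabloid shp s = tabloid shp t"
  shows "weight s = weight t"
proof -
  have "row s x = row t x" if "x \<in> {1..r}" for x
    using mem_tabloid_iff[OF assms(1), of x "row s x"] mem_tabloid_iff[OF assms(2), of x "row s x"] assms(3) that by simp
  then show ?thesis unfolding weight_def by (intro sum.cong) auto
qed

lemma column_strict_row_less:
  assumes t: "filling t" "column_strict t" and x: "x \<in> {1..r}" "y \<in> {1..r}" "column t x = column t y" "x < y"
  shows "row t x < row t y"
proof (rule ccontr)
  assume "\<not> row t x < row t y"
  moreover have "row t x \<noteq> row t y" using row_column_inj[OF t(1) x(1,2) _ x(3)] x(4) by auto
  ultimately have less: "row t y < row t x" by simp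
  have c: "(row t x, column t x) = cell t x" "(row t y, column t x) = cell t y"
    using x(3) by (simp_all add: row_def column_def prod_eq_iff)
  then have "(row t x, column t x) \<in> C" "(row t y, column t x) \<in> C"
    using cell_C[OF t(1) x(1)] cell_C[OF t(1) x(2)] by simp_all
  then have "t (row t y, column t x) < t (row t x, column t x)"
    using t(2) less unfolding column_strict_def by blast
  then have "y < x" by (simp only: c filling_cell[OF t(1) x(1)] filling_cell[OF t(1) x(2)])
  then show False using x(4) by simp
qed

text \<open>
  The largest entry that \<open>\<pi>\<close> moves takes the place of a smaller entry of its column, which is
  further up.
\<close>

lemma weight_column_group_less:
  assumes t: "filling t" "column_strict t" and \<pi>: "\<pi> \<in> column_group shp t" "\<pi> \<noteq> id"
  shows "weight (\<pi> \<circ> t) < weight t"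
proof -
  have p: "\<pi> permutes {1..r}" using \<pi> by (simp add: column_group_def)
  define D where "D = {x \<in> {1..r}. \<pi> x \<noteq> x}"
  have "D \<noteq> {}"
  proof
    assume "D = {}"
    then have "\<pi> x = x" for x using permutes_not_in[OF p, of x] by (cases "x \<in> {1..r}") (auto simp: D_def)
    then show False using \<pi>(2) by auto
  qed
  moreover have finD: "finite D" by (simp add: D_def)
  ultimately have "Max D \<in> D" by simp
  define x where "x = Max D"
  have x: "x \<in> {1..r}" "\<pi> x \<noteq> x" using \<open>Max D \<in> D\<close> unfolding x_def D_def by auto
  have fixed: "\<pi> z = z" if "x < z" for z
  proof (rule ccontr)
    assume z: "\<pi> z \<noteq> z"
    then have "z \<in> {1..r}" using permutes_not_in[OF p] by blast
    then have "z \<in> D" using z by (simp add: D_def)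
    then show False using Max_ge[OF finD, of z] that unfolding x_def by simp
  qed
  define y where "y = inv \<pi> x"
  have \<pi>y: "\<pi> y = x" unfolding y_def by (rule permutes_inverses(1)[OF p])
  have y: "y \<in> {1..r}" using permutes_in_image[OF p, of y] \<pi>y x(1) by simp
  have "y \<noteq> x" using \<pi>y x(2) by auto
  moreover have "\<not> x < y" using fixed[of y] \<pi>y by auto
  ultimately have "y < x" by simp
  have "column t y = column t x" using column_group_column[OF t(1) \<pi>(1) y] \<pi>y by simp
  then have less: "row t y < row t x" using column_strict_row_less[OF t y x(1) _ \<open>y < x\<close>] by simp
  show ?thesis
  proof (rule weight_less[OF filling_comp[OF t(1) p] x(1)])
    show "row (\<pi> \<circ> t) x < row t x" using row_comp[OF t(1) p y] \<pi>y less by simp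
    show "row (\<pi> \<circ> t) z = row t z" if "x < z" "z \<in> {1..r}" for z
      using row_comp[OF t(1) p that(2)] fixed[OF that(1)] by simp
  qed
qed

text \<open>
  A filling with increasing rows can therefore be recovered from its tabloid.
\<close>

lemma row_strict_column:
  assumes t: "filling t" "row_strict t" and x: "x \<in> {1..r}"
  shows "column t x = card {y \<in> tabloid shp t (row t x). y < x}"
proof -
  have cx: "(row t x, column t x) = cell t x" by (simp add: row_def column_def)
  then have C: "(row t x, column t x) \<in> C" using cell_C[OF t(1) x] by simp
  have Cj: "(row t x, j) \<in> C" if "j < column t x" for j using C that by (auto simp: cells_def)
  have tx: "t (row t x, column t x) = x" by (simp only: cx filling_cell[OF t(1) x])
  have "{y \<in> tabloid shp t (row t x). y < x} = (\<lambda>j. t (row t x, j)) ` {..<column t x}"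
  proof (intro equalityI subsetI)
    fix y assume "y \<in> {y \<in> tabloid shp t (row t x). y < x}"
    then obtain j where j: "(row t x, j) \<in> C" "y = t (row t x, j)" "y < x" by (auto simp: tabloid_def)
    have "j < column t x"
    proof (rule ccontr)
      assume "\<not> j < column t x"
      then consider "j = column t x" | "column t x < j" by linarith
      then show False
      proof cases
        case 1 then show False using j tx by simp
      next
        case 2
        then have "t (row t x, column t x) < t (row t x, j)"
          using t(2) C j(1) unfolding row_strict_def by blast
        then show False using j tx by simp
      qed
    qed
    then show "y \<in> (\<lambda>j. t (row t x, j)) ` {..<column t x}" using j by blast
  next
    fix y assume "y \<in> (\<lambda>j. t (row t x, j)) ` {..<column t x}"
    then obtain j where j: "j < column t x" "y = t (row t x, j)" by blast
    have "t (row t x, j) < t (row t x, column t x)"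
      using t(2) C Cj[OF j(1)] j(1) unfolding row_strict_def by blast
    moreover have "y \<in> tabloid shp t (row t x)"
      unfolding tabloid_def j(2) by (intro imageI) (simp add: Cj[OF j(1)])
    ultimately show "y \<in> {y \<in> tabloid shp t (row t x). y < x}" using j tx by simp
  qed
  also have "card \<dots> = card {..<column t x}"
    by (rule card_image) (use filling_inj[OF t(1)] Cj in \<open>auto simp: inj_on_def\<close>)
  finally show ?thesis by simp
qed

lemma standard_tabloid_inj:
  assumes s: "s \<in> standard_tableaux shp" and t: "t \<in> standard_tableaux shp"
    and eq: "tabloid shp s = tabloid shp t"
  shows "s = t"
proof -
  have s': "filling s" "row_strict s" "s \<in> extensional C" and t': "filling t" "row_strict t" "t \<in> extensional C"
    using s t by (auto simp: standard_iff tableau_filling tableaux_def filling_def)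
  have "s c = t c" if c: "c \<in> C" for c
  proof -
    have x: "s c \<in> {1..r}" by (rule filling_range[OF s'(1) c])
    have row: "row s (s c) = row t (s c)"
      using mem_tabloid_iff[OF s'(1), of "s c" "row s (s c)"] mem_tabloid_iff[OF t'(1), of "s c" "row s (s c)"] eq x by simp
    then have "column s (s c) = column t (s c)"
      using row_strict_column[OF s'(1,2) x] row_strict_column[OF t'(1,2) x] eq by simp
    then have "cell t (s c) = cell s (s c)" using row by (simp add: row_def column_def prod_eq_iff)
    also have "\<dots> = c" by (rule cell_filling[OF s'(1) c])
    finally show ?thesis using filling_cell[OF t'(1) x] by simp
  qed
  then show ?thesis using extensionalityI[OF s'(3) t'(3)] by blast
qed

abbreviation ST :: "(nat \<times> nat \<Rightarrow> nat) set" where "ST \<equiv> standard_tableaux shp"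

lemma finite_ST: "finite ST"
  by (rule finite_subset[OF _ finite_tableaux]) (auto simp: standard_iff)

text \<open>
  Evaluating at the tabloid of largest weight among those with nonzero coefficient isolates a single
  coefficient.
\<close>

lemma standard_independent:
  fixes c :: "(nat \<times> nat \<Rightarrow> nat) \<Rightarrow> 'k::field"
  assumes zero: "(\<Sum>t\<in>ST. fun_scale (c t) (\<e> t)) = 0" and t: "t \<in> ST"
  shows "c t = 0"
proof (rule ccontr)
  assume "c t \<noteq> 0"
  define D where "D = {t \<in> ST. c t \<noteq> 0}"
  have D: "finite D" "D \<noteq> {}" using finite_ST t \<open>c t \<noteq> 0\<close> by (auto simp: D_def)
  then have "Max (weight ` D) \<in> weight ` D" by simp
  then obtain u where "u \<in> D" "Max (weight ` D) = weight u" by (rule imageE)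
  then have u: "u \<in> D" "\<And>s. s \<in> D \<Longrightarrow> weight s \<le> weight u"
    using Max_ge[of "weight ` D"] D(1) by auto
  have uST: "u \<in> ST" and cu: "c u \<noteq> 0" using u(1) by (auto simp: D_def)
  have fu: "filling u" using uST tableau_filling by (simp add: standard_iff)
  have "(\<Sum>s\<in>ST. c s * \<e> s (tabloid shp u)) = (0 :: 'k)"
    using fun_cong[OF zero, of "tabloid shp u"] by (simp add: sum_fun_apply fun_scale_apply)
  moreover have "c s * \<e> s (tabloid shp u) = (if s = u then c u else 0)" if s: "s \<in> ST" for s
  proof (cases "s = u")
    case True
    then show ?thesis using polytabloid_at_tabloid[where 'k = 'k, OF fu] by simp
  next
    case False
    have fs: "filling s" "column_strict s" using s tableau_filling by (auto simp: standard_iff)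
    have "\<e> s (tabloid shp u) = (0 :: 'k)" if "c s \<noteq> 0"
    proof -
      have sD: "s \<in> D" using s that by (simp add: D_def)
      have "tabloid shp (\<pi> \<circ> s) \<noteq> tabloid shp u" if \<pi>: "\<pi> \<in> column_group shp s" for \<pi>
      proof
        assume eq: "tabloid shp (\<pi> \<circ> s) = tabloid shp u"
        have p: "\<pi> permutes {1..r}" using \<pi> by (simp add: column_group_def)
        have w: "weight (\<pi> \<circ> s) = weight u" by (rule weight_tabloid[OF filling_comp[OF fs(1) p] fu eq])
        have "\<pi> = id"
        proof (rule ccontr)
          assume "\<pi> \<noteq> id"
          then have "weight (\<pi> \<circ> s) < weight s" by (rule weight_column_group_less[OF fs \<pi>])
          then show False using w u(2)[OF sD] by simp
        qed
        then show False using standard_tabloid_inj[OF s uST] eq False by simp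
      qed
      then show ?thesis unfolding polytabloid_eq[symmetric] polytabloid_def by (intro sum.neutral) auto
    qed
    then show ?thesis using False by auto
  qed
  ultimately have "(\<Sum>s\<in>ST. if s = u then c u else 0) = 0" by simp
  then show False using finite_ST uST cu by simp
qed

lemma standard_inj: "inj_on (\<e> :: _ \<Rightarrow> _ \<Rightarrow> 'k::field) ST"
proof (rule inj_onI, rule ccontr)
  fix s t assume st: "s \<in> ST" "t \<in> ST" "\<e> s = (\<e> t :: _ \<Rightarrow> 'k)" "s \<noteq> t"
  let ?c = "\<lambda>u. if u = s then 1 else if u = t then - 1 else 0 :: 'k"
  have "(\<Sum>u\<in>ST. fun_scale (?c u) (\<e> u)) = (\<Sum>u\<in>{s, t}. fun_scale (?c u) (\<e> u))"
    by (rule sum.mono_neutral_right) (use finite_ST st in \<open>auto simp: fun_scale_def zero_fun_def\<close>)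
  also have "\<dots> = 0" using st by (auto simp: fun_eq_iff fun_scale_apply)
  finally show False using standard_independent[OF _ st(1)] by fastforce
qed

lemma standard_independent_set: "fun_space.independent (\<e> ` ST :: ((nat \<Rightarrow> nat set) \<Rightarrow> 'k::field) set)"
proof (rule fun_space.independent_if_scalars_zero)
  show "finite (\<e> ` ST)" using finite_ST by simp
  fix f :: "((nat \<Rightarrow> nat set) \<Rightarrow> 'k) \<Rightarrow> 'k" and v :: "(nat \<Rightarrow> nat set) \<Rightarrow> 'k"
  assume "(\<Sum>x\<in>\<e> ` ST. fun_scale (f x) x) = 0" and v: "v \<in> \<e> ` ST"
  then have "(\<Sum>t\<in>ST. fun_scale (f (\<e> t)) (\<e> t)) = 0" by (simp add: sum.reindex[OF standard_inj])
  then show "f v = 0" using standard_independent[of "\<lambda>t. f (\<e> t)"] v by blast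
qed

end

section \<open>Garnir relations\<close>

context young_diagram begin

text \<open>
  The measure for straightening: it increases when larger entries move to the right.
\<close>

definition moment :: "(nat \<times> nat \<Rightarrow> nat) \<Rightarrow> nat" where
  "moment t = (\<Sum>c\<in>C. snd c * t c)"

lemma moment_le: "filling t \<Longrightarrow> moment t \<le> (\<Sum>c\<in>C. snd c * r)"
  unfolding moment_def by (intro sum_mono mult_le_mono2) (use filling_range[of t] in auto)

lemma moment_comp:
  assumes t: "filling t"
  shows "moment (\<sigma> \<circ> t) = (\<Sum>x\<in>{1..r}. column t x * \<sigma> x)"
proof -
  have "(\<Sum>x\<in>{1..r}. column t x * \<sigma> x) = (\<Sum>c\<in>C. column t (t c) * \<sigma> (t c))"
    by (rule sum.reindex_bij_betw[symmetric]) (use t in \<open>simp add: filling_def\<close>)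
  also have "\<dots> = (\<Sum>c\<in>C. snd c * \<sigma> (t c))"
    by (rule sum.cong[OF refl]) (simp add: column_filling[OF t])
  finally show ?thesis by (simp add: moment_def)
qed

lemma moment_eq: "filling t \<Longrightarrow> moment t = (\<Sum>x\<in>{1..r}. column t x * x)"
  using moment_comp[of t id] by (simp add: comp_def)

lemma column_comp:
  assumes t: "filling t" and \<pi>: "\<pi> permutes {1..r}" and x: "x \<in> {1..r}"
  shows "column (\<pi> \<circ> t) (\<pi> x) = column t x"
proof -
  have "column (\<pi> \<circ> t) ((\<pi> \<circ> t) (cell t x)) = snd (cell t x)"
    by (rule column_filling[OF filling_comp[OF t \<pi>] cell_C[OF t x]])
  then show ?thesis by (simp add: filling_cell[OF t x] column_def[of t] del: One_nat_def)
qed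

lemma column_comp_column_group:
  assumes t: "filling t" and \<pi>: "\<pi> \<in> column_group shp t" and x: "x \<in> {1..r}"
  shows "column (\<pi> \<circ> t) x = column t x"
proof -
  have p: "\<pi> permutes {1..r}" using \<pi> by (simp add: column_group_def)
  define y where "y = inv \<pi> x"
  have \<pi>y: "\<pi> y = x" unfolding y_def by (rule permutes_inverses(1)[OF p])
  have y: "y \<in> {1..r}" using permutes_in_image[OF p, of y] \<pi>y x by simp
  show ?thesis using column_comp[OF t p y] column_group_column[OF t \<pi> y] unfolding \<pi>y by simp
qed

lemma moment_column_group:
  assumes t: "filling t" and \<pi>: "\<pi> \<in> column_group shp t"
  shows "moment (\<pi> \<circ> t) = moment t"
proof -
  have p: "\<pi> permutes {1..r}" using \<pi> by (simp add: column_group_def)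
  have "moment (\<pi> \<circ> t) = (\<Sum>x\<in>{1..r}. column (\<pi> \<circ> t) x * x)" by (rule moment_eq[OF filling_comp[OF t p]])
  also have "\<dots> = (\<Sum>x\<in>{1..r}. column t x * x)"
    by (rule sum.cong[OF refl]) (simp only: column_comp_column_group[OF t \<pi>])
  finally show ?thesis by (simp add: moment_eq[OF t])
qed

lemma column_group_comp:
  "\<pi> \<in> column_group shp t \<Longrightarrow> column_group shp (\<pi> \<circ> t) = column_group shp t"
  unfolding column_group_def by (simp only: image_comp[symmetric] mem_Collect_eq)

lemma column_groupI:
  assumes t: "filling t" and \<sigma>: "\<sigma> permutes {1..r}"
    and col: "\<And>x. x \<in> {1..r} \<Longrightarrow> column t (\<sigma> x) = column t x"
  shows "\<sigma> \<in> column_group shp t"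
  unfolding column_group_def
proof (intro CollectI conjI allI \<sigma>)
  fix j
  let ?K = "t ` {c \<in> C. snd c = j}"
  show "\<sigma> ` ?K = ?K"
  proof (rule card_subset_eq)
    show "finite ?K" using finite_C by simp
    show "\<sigma> ` ?K \<subseteq> ?K"
    proof
      fix y assume "y \<in> \<sigma> ` ?K"
      then obtain x where x: "x \<in> ?K" "y = \<sigma> x" by blast
      then have "x \<in> {1..r}" "column t x = j" unfolding mem_column_iff[OF t] by blast+
      then show "y \<in> ?K" unfolding mem_column_iff[OF t] x(2) using col permutes_in_image[OF \<sigma>] by simp
    qed
    show "card (\<sigma> ` ?K) = card ?K" by (rule card_image) (rule inj_on_subset[OF permutes_inj[OF \<sigma>] subset_UNIV])
  qed
qed

lemma polytabloid_column_group:
  assumes "\<pi> \<in> column_group shp t"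
  shows "\<e> (\<pi> \<circ> t) = fun_scale (of_int (sign \<pi>)) (\<e> t :: _ \<Rightarrow> 'k::field)"
proof -
  have "\<pi> permutes {1..r}" using assms by (simp add: column_group_def)
  then have "\<e> (\<pi> \<circ> t) = (perm_action \<pi> (\<e> t) :: _ \<Rightarrow> 'k)" by (rule perm_action_polytabloid[symmetric])
  also have "\<dots> = fun_scale (of_int (sign \<pi>)) (\<e> t)"
    unfolding \<e>_def by (rule perm_action_antisym[OF perm_subgroup_column_group assms])
  finally show ?thesis .
qed

text \<open>
  A column permutation of largest weight works: exchanging two entries of a column that are
  in the wrong order would increase the weight.
\<close>

lemma column_sort:
  assumes t: "filling t"
  obtains \<pi> where "\<pi> \<in> column_group shp t" "column_strict (\<pi> \<circ> t)"
proof -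
  let ?A = "column_group shp t"
  note D = perm_subgroupD[OF perm_subgroup_column_group[of t]]
  let ?W = "(\<lambda>\<pi>. weight (\<pi> \<circ> t)) ` ?A"
  have "finite ?W" "?W \<noteq> {}" using D(2,7) by auto
  then have "Max ?W \<in> ?W" by (rule Max_in)
  then obtain \<pi> where \<pi>: "\<pi> \<in> ?A" "Max ?W = weight (\<pi> \<circ> t)" by (rule imageE)
  have max: "weight (\<sigma> \<circ> t) \<le> weight (\<pi> \<circ> t)" if "\<sigma> \<in> ?A" for \<sigma>
    unfolding \<pi>(2)[symmetric] using \<open>finite ?W\<close> that by simp
  let ?s = "\<pi> \<circ> t"
  have s: "filling ?s" by (rule filling_comp[OF t D(1)[OF \<pi>(1)]])
  have "column_strict ?s"
    unfolding column_strict_def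
  proof (intro allI impI, rule ccontr)
    fix i i' j assume c: "(i, j) \<in> C \<and> (i', j) \<in> C \<and> i < i'" and nless: "\<not> ?s (i, j) < ?s (i', j)"
    then have C: "(i, j) \<in> C" "(i', j) \<in> C" "i < i'" by auto
    define x where "x = ?s (i, j)"
    define y where "y = ?s (i', j)"
    have x: "x \<in> {1..r}" and y: "y \<in> {1..r}" unfolding x_def y_def by (rule filling_range[OF s C(1)], rule filling_range[OF s C(2)])
    have "x \<noteq> y" unfolding x_def y_def filling_inj[OF s C(1,2)] using C(3) by simp
    then have yx: "y < x" using nless unfolding x_def y_def by simp
    let ?\<tau> = "transpose x y"
    have "?\<tau> \<in> column_group shp ?s" unfolding x_def y_def by (rule transpose_column_group[OF s C(1,2)]) simp
    then have \<tau>: "?\<tau> \<in> ?A" by (simp only: column_group_comp[OF \<pi>(1)])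
    have p: "?\<tau> permutes {1..r}" by (rule D(1)[OF \<tau>])
    have "weight ?s < weight (?\<tau> \<circ> ?s)"
    proof (rule weight_less[OF s x])
      have "row (?\<tau> \<circ> ?s) x = row ?s y" using row_comp[OF s p y] by simp
      then show "row ?s x < row (?\<tau> \<circ> ?s) x"
        unfolding x_def y_def row_filling[OF s C(1)] row_filling[OF s C(2)] using C(3) by simp
      show "row ?s z = row (?\<tau> \<circ> ?s) z" if "x < z" "z \<in> {1..r}" for z
      proof -
        have "?\<tau> z = z" using that yx by (intro transpose_apply_other) auto
        then show ?thesis using row_comp[OF s p that(2)] by simp
      qed
    qed
    moreover have "weight (?\<tau> \<circ> ?s) \<le> weight ?s"
      using max[OF D(3)[OF \<tau> \<pi>(1)]] by (simp add: comp_assoc)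
    ultimately show False by simp
  qed
  with \<pi>(1) show thesis by (rule that)
qed

text \<open>
  Let \<open>A\<close> be the entries of column \<open>j\<close> from row \<open>i\<close> downwards and \<open>B\<close> those of column \<open>Suc j\<close> up
  to row \<open>i\<close>. Together they outnumber the rows of column \<open>j\<close>, so in every tabloid of the polytabloid two
  of them share a row, and antisymmetrising over all permutations of \<open>A \<union> B\<close> gives zero. The permutations
  that preserve \<open>B\<close> contribute multiples of the polytabloid itself. All others replace elements of \<open>B\<close>
  by elements of \<open>A\<close>, which are larger, and so increase the moment.
\<close>

lemma garnir:
  assumes t: "filling t" "column_strict t" and c: "(i, Suc j) \<in> C" "t (i, Suc j) < t (i, j)"
  shows "\<e> t \<in> fun_space.span (\<e> ` {s. filling s \<and> moment t < moment s} :: ((nat \<Rightarrow> nat set) \<Rightarrow> 'k::field_char_0) set)"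
proof -
  have i: "i < length shp" "Suc j < shp ! i" using c(1) by (auto simp: cells_def)
  define K where "K = {k. (k, j) \<in> C}"
  have K_le: "k \<in> K" if "k \<le> i" for k
    using that i shp_mono[OF that i(1)] by (auto simp: K_def cells_def)
  have finK: "finite K" by (rule finite_subset[of _ "{..<length shp}"]) (auto simp: K_def cells_def)
  define CA where "CA = {k \<in> K. i \<le> k} \<times> {j}"
  define CB where "CB = {..i} \<times> {Suc j}"
  have CA: "CA \<subseteq> C" by (auto simp: CA_def K_def)
  have CB: "CB \<subseteq> C"
  proof
    fix c assume "c \<in> CB"
    then obtain k where k: "c = (k, Suc j)" "k \<le> i" by (auto simp: CB_def)
    then show "c \<in> C" using shp_mono[OF k(2) i(1)] i by (auto simp: cells_def)
  qed
  define A where "A = t ` CA"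
  define B where "B = t ` CB"
  have range: "A \<subseteq> {1..r}" "B \<subseteq> {1..r}"
    using CA CB filling_range[OF t(1)] unfolding A_def B_def by blast+
  have fin: "finite A" "finite B" using finK by (auto simp: A_def B_def CA_def CB_def)
  have colA: "column t x = j" if x: "x \<in> A" for x
  proof -
    obtain c where "c \<in> CA" "x = t c" using x unfolding A_def by blast
    then show ?thesis using column_filling[OF t(1), of c] CA by (auto simp: CA_def)
  qed
  have colB: "column t x = Suc j" if x: "x \<in> B" for x
  proof -
    obtain c where "c \<in> CB" "x = t c" using x unfolding B_def by blast
    then show ?thesis using column_filling[OF t(1), of c] CB by (auto simp: CB_def)
  qed
  have disj: "A \<inter> B = {}" 
  proof (rule equals0I)
    fix x assume "x \<in> A \<inter> B"
    then have "column t x = j" "column t x = Suc j" using colA[of x] colB[of x] by simp_all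
    then show False by simp
  qed
  have less: "b < a" if ab: "a \<in> A" "b \<in> B" for a b
  proof -
    obtain k where k: "k \<in> K" "i \<le> k" "a = t (k, j)" using ab(1) by (auto simp: A_def CA_def)
    obtain l where l: "l \<le> i" "b = t (l, Suc j)" using ab(2) by (auto simp: B_def CB_def)
    have "t (i, j) \<le> a"
    proof (cases "k = i")
      case False
      then have "t (i, j) < t (k, j)"
        using t(2) k K_le[of i] unfolding column_strict_def K_def by auto
      then show ?thesis using k by simp
    qed (use k in simp)
    moreover have "b \<le> t (i, Suc j)"
    proof (cases "l = i")
      case False
      have "(l, Suc j) \<in> CB" using l(1) by (simp add: CB_def)
      then have "(l, Suc j) \<in> C" using CB by blast
      then have "t (l, Suc j) < t (i, Suc j)"
        using t(2) c(1) l(1) False unfolding column_strict_def by auto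
      then show ?thesis using l by simp
    qed (use l in simp)
    ultimately show ?thesis using c(2) by simp
  qed
  define Y where "Y = A \<union> B"
  have Y: "Y \<subseteq> {1..r}" "finite Y" using range fin by (auto simp: Y_def)
  have injt: "inj_on t C" using t(1) by (simp add: filling_def bij_betw_def)
  have "card A = card {k \<in> K. i \<le> k}"
    unfolding A_def by (subst card_image[OF inj_on_subset[OF injt CA]]) (simp add: CA_def card_cartesian_product)
  moreover have "card B = Suc i"
    unfolding B_def by (subst card_image[OF inj_on_subset[OF injt CB]]) (simp add: CB_def card_cartesian_product)
  moreover have "card K = i + card {k \<in> K. i \<le> k}"
  proof -
    have "K = {..<i} \<union> {k \<in> K. i \<le> k}" using K_le by force
    then have "card K = card ({..<i} \<union> {k \<in> K. i \<le> k})" by simp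
    also have "\<dots> = card {..<i} + card {k \<in> K. i \<le> k}" by (rule card_Un_disjoint) (use finK in auto)
    finally show ?thesis by simp
  qed
  ultimately have cardY: "card Y = Suc (card K)"
    unfolding Y_def using card_Un_disjoint[OF fin disj] by simp
  define S where "S = {\<sigma>. \<sigma> permutes Y}"
  have SP: "\<sigma> permutes {1..r}" if "\<sigma> \<in> S" for \<sigma>
    using that permutes_subset[OF _ Y(1)] by (simp add: S_def)
  have S: "perm_subgroup r S"
    unfolding perm_subgroup_def using SP
    by (auto simp: S_def permutes_id intro: permutes_compose permutes_inv)
  have vanish: "antisym S (\<e> t) = (0 :: _ \<Rightarrow> 'k)"
  proof -
    note D = perm_subgroupD[OF perm_subgroup_column_group[of t]]
    have "antisym S (delta (tabloid shp (\<pi> \<circ> t))) = (0 :: _ \<Rightarrow> 'k)" if \<pi>: "\<pi> \<in> column_group shp t" for \<pi>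
    proof -
      have f: "filling (\<pi> \<circ> t)" by (rule filling_comp[OF t(1) D(1)[OF \<pi>]])
      have "row (\<pi> \<circ> t) ` Y \<subseteq> K"
      proof
        fix k assume "k \<in> row (\<pi> \<circ> t) ` Y"
        then obtain y where y: "y \<in> Y" "k = row (\<pi> \<circ> t) y" by blast
        have yr: "y \<in> {1..r}" using y(1) Y(1) by (rule rev_subsetD)
        have "cell (\<pi> \<circ> t) y = (k, column t y)"
          using y(2) column_comp_column_group[OF t(1) \<pi> yr] by (simp add: row_def column_def prod_eq_iff)
        then have "(k, column t y) \<in> C" using cell_C[OF f yr] by simp
        moreover have "column t y = j \<or> column t y = Suc j"
          using y(1) colA[of y] colB[of y] unfolding Y_def by blast
        ultimately show "k \<in> K" by (auto simp: K_def cells_def)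
      qed
      from card_mono[OF finK this] have "card (row (\<pi> \<circ> t) ` Y) < card Y" unfolding cardY by simp
      then have "\<not> inj_on (row (\<pi> \<circ> t)) Y" by (rule pigeonhole)
      then obtain x y where xy: "x \<in> Y" "y \<in> Y" "row (\<pi> \<circ> t) x = row (\<pi> \<circ> t) y" "x \<noteq> y"
        unfolding inj_on_def by blast
      show ?thesis
      proof (rule antisym_eq_0[OF S _ xy(4)])
        show "transpose x y \<in> S" using xy by (simp add: S_def permutes_swap_id)
        show "perm_action (transpose x y) (delta (tabloid shp (\<pi> \<circ> t))) = (delta (tabloid shp (\<pi> \<circ> t)) :: _ \<Rightarrow> 'k)"
          by (rule perm_action_transpose_row[OF f _ _ xy(3)]) (use xy Y in blast)+
      qed
    qed
    moreover have "\<e> t = (\<Sum>\<pi>\<in>column_group shp t. fun_scale (of_int (sign \<pi>)) (delta (tabloid shp (\<pi> \<circ> t))) :: _ \<Rightarrow> 'k)"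
      unfolding \<e>_def antisym_def by (rule sum.cong[OF refl]) (simp only: perm_action_delta_tabloid[OF D(6)])
    ultimately show ?thesis
      by (simp add: fun_linear_sum[OF antisym_linear] fun_space.scale_zero_right del: One_nat_def)
  qed
  let ?N = "{\<sigma> \<in> S. \<sigma> ` B = B}"
  let ?V = "fun_space.span (\<e> ` {s. filling s \<and> moment t < moment s}) :: ((nat \<Rightarrow> nat set) \<Rightarrow> 'k) set"
  have finS: "finite S" by (rule perm_subgroupD(7)[OF S])
  have stab: "fun_scale (of_int (sign \<sigma>)) (\<e> (\<sigma> \<circ> t)) = (\<e> t :: _ \<Rightarrow> 'k)" if "\<sigma> \<in> ?N" for \<sigma>
  proof -
    have \<sigma>: "\<sigma> permutes Y" "\<sigma> \<in> S" "\<sigma> ` B = B" using that by (auto simp: S_def)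
    have "\<sigma> \<in> column_group shp t"
    proof (rule column_groupI[OF t(1) SP[OF \<sigma>(2)]])
      fix x assume "x \<in> {1..r}"
      consider "x \<in> B" | "x \<in> A" "x \<notin> B" | "x \<notin> Y" unfolding Y_def by blast
      then show "column t (\<sigma> x) = column t x"
      proof cases
        case 1
        then have "\<sigma> x \<in> B" using \<sigma>(3) by blast
        then show ?thesis using colB 1 by simp
      next
        case 2
        then have "\<sigma> x \<in> Y" using permutes_in_image[OF \<sigma>(1)] by (simp add: Y_def)
        moreover have "\<sigma> x \<notin> B"
        proof
          assume "\<sigma> x \<in> B"
          then have "\<sigma> x \<in> \<sigma> ` B" using \<sigma>(3) by simp
          then show False using 2 inj_image_mem_iff[OF permutes_inj[OF \<sigma>(1)]] by blast
        qed
        ultimately have "\<sigma> x \<in> A" by (simp add: Y_def)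
        then show ?thesis using colA 2 by simp
      next
        case 3
        then show ?thesis using permutes_not_in[OF \<sigma>(1)] by simp
      qed
    qed
    then have "\<e> (\<sigma> \<circ> t) = fun_scale (of_int (sign \<sigma>)) (\<e> t :: _ \<Rightarrow> 'k)" by (rule polytabloid_column_group)
    then show ?thesis by (simp only: fun_scale_scale of_int_sign_square fun_space.scale_one)
  qed
  have greater: "moment t < moment (\<sigma> \<circ> t)" if "\<sigma> \<in> S - ?N" for \<sigma>
  proof -
    have \<sigma>: "\<sigma> permutes Y" "\<sigma> ` B \<noteq> B" using that by (auto simp: S_def)
    \<comment> \<open>A permutation of \<open>Y\<close> preserves the sum over \<open>Y\<close> and the entries outside of \<open>Y\<close>, so the moment can
      only change by the sum over \<open>B\<close>.\<close>
    have split: "(\<Sum>x\<in>{1..r}. column t x * h x) =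
        (\<Sum>x\<in>{1..r} - Y. column t x * h x) + (j * (\<Sum>x\<in>Y. h x) + (\<Sum>x\<in>B. h x))" for h :: "nat \<Rightarrow> nat"
    proof -
      have "(\<Sum>x\<in>{1..r}. column t x * h x) = (\<Sum>x\<in>{1..r} - Y. column t x * h x) + (\<Sum>x\<in>Y. column t x * h x)"
        by (rule sum.subset_diff[OF Y(1)]) simp
      also have "(\<Sum>x\<in>Y. column t x * h x) = (\<Sum>x\<in>A. j * h x) + (\<Sum>x\<in>B. Suc j * h x)"
        unfolding Y_def using colA colB by (simp add: sum.union_disjoint[OF fin disj] del: mult_Suc)
      also have "\<dots> = j * (\<Sum>x\<in>Y. h x) + (\<Sum>x\<in>B. h x)"
        unfolding Y_def by (simp add: sum.union_disjoint[OF fin disj] sum_distrib_left sum.distrib distrib_left)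
      finally show ?thesis .
    qed
    have "(\<Sum>x\<in>Y. \<sigma> x) = (\<Sum>x\<in>Y. x)"
      using sum.reindex_bij_betw[OF permutes_imp_bij[OF \<sigma>(1)], of "\<lambda>x. x"] by simp
    moreover have "(\<Sum>x\<in>{1..r} - Y. column t x * \<sigma> x) = (\<Sum>x\<in>{1..r} - Y. column t x * x)"
      by (rule sum.cong[OF refl]) (simp add: permutes_not_in[OF \<sigma>(1)])
    moreover have "(\<Sum>x\<in>B. x) < (\<Sum>x\<in>B. \<sigma> x)"
      by (rule sum_exchange_less[OF fin less \<sigma>(1)[unfolded Y_def] \<sigma>(2)])
    ultimately show ?thesis
      unfolding moment_comp[OF t(1)] moment_eq[OF t(1)] split[of \<sigma>] split[of "\<lambda>x. x"] by simp
  qed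
  have "(\<Sum>\<sigma>\<in>S - ?N. fun_scale (of_int (sign \<sigma>)) (\<e> (\<sigma> \<circ> t))) \<in> ?V"
  proof (intro fun_space.span_sum fun_space.span_scale fun_space.span_base imageI CollectI conjI greater)
    show "filling (\<sigma> \<circ> t)" if "\<sigma> \<in> S - ?N" for \<sigma> using that by (intro filling_comp[OF t(1)] SP) simp
  qed
  moreover have "antisym S (\<e> t) = fun_scale (of_nat (card ?N)) (\<e> t) +
      (\<Sum>\<sigma>\<in>S - ?N. fun_scale (of_int (sign \<sigma>)) (\<e> (\<sigma> \<circ> t)) :: _ \<Rightarrow> 'k)"
  proof -
    have "antisym S (\<e> t) = (\<Sum>\<sigma>\<in>S. fun_scale (of_int (sign \<sigma>)) (\<e> (\<sigma> \<circ> t)) :: _ \<Rightarrow> 'k)"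
      unfolding antisym_def by (rule sum.cong[OF refl]) (simp only: perm_action_polytabloid[OF SP])
    also have "\<dots> = (\<Sum>\<sigma>\<in>S - ?N. fun_scale (of_int (sign \<sigma>)) (\<e> (\<sigma> \<circ> t))) +
        (\<Sum>\<sigma>\<in>?N. fun_scale (of_int (sign \<sigma>)) (\<e> (\<sigma> \<circ> t)))"
      by (rule sum.subset_diff) (use finS in auto)
    also have "(\<Sum>\<sigma>\<in>?N. fun_scale (of_int (sign \<sigma>)) (\<e> (\<sigma> \<circ> t)) :: _ \<Rightarrow> 'k) = (\<Sum>\<sigma>\<in>?N. \<e> t)"
      by (rule sum.cong[OF refl stab])
    also have "\<dots> = fun_scale (of_nat (card ?N)) (\<e> t)"
      by (auto simp: fun_eq_iff sum_fun_apply fun_scale_apply)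
    finally show ?thesis by (simp only: add.commute)
  qed
  ultimately have "fun_scale (of_nat (card ?N)) (\<e> t) \<in> ?V"
    using vanish fun_space.span_neg by (metis (no_types, lifting) eq_neg_iff_add_eq_0)
  then have "fun_scale (1 / of_nat (card ?N)) (fun_scale (of_nat (card ?N)) (\<e> t)) \<in> ?V"
    by (rule fun_space.span_scale)
  moreover have "of_nat (card ?N) \<noteq> (0 :: 'k)"
  proof -
    have "id \<in> ?N" using perm_subgroupD(2)[OF S] by simp
    then show ?thesis using finS by auto
  qed
  ultimately show ?thesis by (simp add: fun_scale_scale fun_space.scale_one)
qed

lemma row_strict_if_adjacent:
  assumes adj: "\<And>i j. (i, Suc j) \<in> C \<Longrightarrow> t (i, j) < t (i, Suc j)"
  shows "row_strict t"
  unfolding row_strict_def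
proof (intro allI impI)
  fix i j j' assume "(i, j) \<in> C \<and> (i, j') \<in> C \<and> j < j'"
  then have "j < j'" "(i, j') \<in> C" by auto
  then show "t (i, j) < t (i, j')"
  proof (induction j')
    case (Suc j')
    have "(i, j') \<in> C" using Suc.prems(2) by (auto simp: cells_def)
    then show ?case using Suc adj[OF Suc.prems(2)] by (cases "j = j'") auto
  qed simp
qed

text \<open>
  Sorting the columns changes the polytabloid by a sign only; if a descent in a row remains, the
  Garnir relation leads to fillings of larger moment, which is bounded.
\<close>

lemma standard_spanning:
  "filling t \<Longrightarrow> \<e> t \<in> fun_space.span (\<e> ` ST :: ((nat \<Rightarrow> nat set) \<Rightarrow> 'k::field_char_0) set)"
proof (induction "(\<Sum>c\<in>C. snd c * r) - moment t" arbitrary: t rule: less_induct)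
  case less
  note t = less.prems
  let ?V = "fun_space.span (\<e> ` ST) :: ((nat \<Rightarrow> nat set) \<Rightarrow> 'k) set"
  obtain \<pi> where \<pi>: "\<pi> \<in> column_group shp t" "column_strict (\<pi> \<circ> t)" by (rule column_sort[OF t])
  have p: "\<pi> permutes {1..r}" using \<pi>(1) by (simp add: column_group_def)
  let ?s = "\<pi> \<circ> t"
  have s: "filling ?s" by (rule filling_comp[OF t p])
  have "\<e> ?s = fun_scale (of_int (sign \<pi>)) (\<e> t :: _ \<Rightarrow> 'k)"
    by (rule polytabloid_column_group[OF \<pi>(1)])
  then have et: "\<e> t = fun_scale (of_int (sign \<pi>)) (\<e> ?s :: _ \<Rightarrow> 'k)"
    by (simp only: fun_scale_scale of_int_sign_square fun_space.scale_one)
  have "\<e> ?s \<in> ?V"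
  proof (cases "row_strict ?s")
    case True
    have "restrict ?s C \<in> ST"
      using restrict_tableau[OF s] True \<pi>(2) by (simp add: standard_iff row_strict_def column_strict_def)
    moreover have "\<e> ?s = (\<e> (restrict ?s C) :: _ \<Rightarrow> 'k)" by (rule polytabloid_cong) simp
    ultimately show ?thesis by (simp only:) (intro fun_space.span_base imageI)
  next
    case False
    then obtain i j where ij: "(i, Suc j) \<in> C" "\<not> ?s (i, j) < ?s (i, Suc j)"
      using row_strict_if_adjacent[of ?s] by blast
    have "(i, j) \<in> C" using ij(1) by (auto simp: cells_def)
    then have "?s (i, j) \<noteq> ?s (i, Suc j)" using filling_inj[OF s _ ij(1), of "(i, j)"] by simp
    then have "?s (i, Suc j) < ?s (i, j)" using ij(2) by simp
    from garnir[OF s \<pi>(2) ij(1) this]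
    have "\<e> ?s \<in> fun_space.span (\<e> ` {u. filling u \<and> moment ?s < moment u} :: ((nat \<Rightarrow> nat set) \<Rightarrow> 'k) set)" .
    moreover have "fun_space.span (\<e> ` {u. filling u \<and> moment ?s < moment u} :: ((nat \<Rightarrow> nat set) \<Rightarrow> 'k) set) \<subseteq> ?V"
    proof (rule fun_space.span_minimal[OF _ fun_space.subspace_span], rule image_subsetI)
      fix u assume "u \<in> {u. filling u \<and> moment ?s < moment u}"
      then have u: "filling u" "moment t < moment u" using moment_column_group[OF t \<pi>(1)] by auto
      show "\<e> u \<in> ?V" by (rule less.hyps[OF _ u(1)]) (use u(2) moment_le[OF u(1)] in linarith)
    qed
    ultimately show ?thesis by blast
  qed
  then show ?case unfolding et by (rule fun_space.span_scale)
qed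

theorem dim_specht: "fun_space.dim (W :: ((nat \<Rightarrow> nat set) \<Rightarrow> 'k::field_char_0) set) = card ST"
proof -
  have "fun_space.span (\<e> ` ST) = (W :: ((nat \<Rightarrow> nat set) \<Rightarrow> 'k) set)"
  proof
    show "fun_space.span (\<e> ` ST) \<subseteq> (W :: ((nat \<Rightarrow> nat set) \<Rightarrow> 'k) set)"
      unfolding specht_eq using tableau_filling
      by (intro fun_space.span_mono image_mono) (auto simp: standard_iff)
    show "(W :: ((nat \<Rightarrow> nat set) \<Rightarrow> 'k) set) \<subseteq> fun_space.span (\<e> ` ST)"
      unfolding specht_eq
      by (rule fun_space.span_minimal[OF _ fun_space.subspace_span]) (use standard_spanning in blast)
  qed
  then have "fun_space.dim (W :: ((nat \<Rightarrow> nat set) \<Rightarrow> 'k) set) = card (\<e> ` ST :: ((nat \<Rightarrow> nat set) \<Rightarrow> 'k) set)"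
    using fun_space.dim_span_eq_card_independent[OF standard_independent_set, where 'a = 'k] by simp
  also have "\<dots> = card ST" by (rule card_image[OF standard_inj])
  finally show ?thesis .
qed

end

section \<open>Multiplicities in tensor powers of rook matrices\<close>

lemma inverse_subsemigroup_pperms: "inverse_subsemigroup n (pperms n)"
  unfolding inverse_subsemigroup_def
proof (intro conjI ballI order_refl)
  fix s t assume s: "s \<in> pperms n" and t: "t \<in> pperms n"
  show "s\<inverse> \<in> pperms n" using s by (auto simp: pperms_def)
  have "s O t \<subseteq> {1..n} \<times> {1..n}" using s t unfolding pperms_def by blast
  moreover have "single_valued (s O t)" using s t by (simp add: pperms_def single_valued_relcomp)
  moreover have "single_valued ((s O t)\<inverse>)"
    using s t by (simp add: pperms_def converse_relcomp single_valued_relcomp)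
  ultimately show "s O t \<in> pperms n" by (simp add: pperms_def)
qed

lemma perm_graph_id: "perm_graph r id = Id_on {1..r}"
  by (auto simp: perm_graph_def)

lemma perm_graph_inverse:
  assumes "\<pi> permutes {1..r}"
  shows "perm_graph r (inv \<pi>) = (perm_graph r \<pi>)\<inverse>"
proof (intro equalityI subrelI)
  fix x y assume "(x, y) \<in> perm_graph r (inv \<pi>)"
  then have x: "x \<in> {1..r}" "y = inv \<pi> x" by (auto simp: perm_graph_def)
  then have "y \<in> {1..r}" "x = \<pi> y"
    using permutes_in_image[OF permutes_inv[OF assms]] permutes_inverses(1)[OF assms] by auto
  then show "(x, y) \<in> (perm_graph r \<pi>)\<inverse>" by (auto simp: perm_graph_def)
next
  fix x y assume "(x, y) \<in> (perm_graph r \<pi>)\<inverse>"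
  then have y: "y \<in> {1..r}" "x = \<pi> y" by (auto simp: perm_graph_def)
  then have "x \<in> {1..r}" "y = inv \<pi> x"
    using permutes_in_image[OF assms] permutes_inverses(2)[OF assms] by auto
  then show "(x, y) \<in> perm_graph r (inv \<pi>)" by (auto simp: perm_graph_def)
qed

lemma perm_graph_mem: "(x, y) \<in> perm_graph r \<pi> \<longleftrightarrow> x \<in> {1..r} \<and> y = \<pi> x"
  by (auto simp: perm_graph_def)

lemma perm_graph_bij:
  assumes "r \<le> n"
  shows "bij_betw (perm_graph r) {\<pi>. \<pi> permutes {1..r}} (max_subgroup (pperms n) (Id_on {1..r}))"
  unfolding bij_betw_def
proof
  have X: "{1..r} \<subseteq> {1..n}" using assms by auto
  interpret maximal_subgroup n "pperms n" "{1..r}"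
    by unfold_locales (use inverse_subsemigroup_pperms X in auto)
  show "inj_on (perm_graph r) {\<pi>. \<pi> permutes {1..r}}"
  proof (rule inj_onI)
    fix \<pi> \<sigma> assume p: "\<pi> \<in> {\<pi>. \<pi> permutes {1..r}}" "\<sigma> \<in> {\<pi>. \<pi> permutes {1..r}}"
      and eq: "perm_graph r \<pi> = perm_graph r \<sigma>"
    show "\<pi> = \<sigma>"
    proof
      fix x
      show "\<pi> x = \<sigma> x"
      proof (cases "x \<in> {1..r}")
        case True
        then have "(x, \<pi> x) \<in> perm_graph r \<sigma>" unfolding eq[symmetric] perm_graph_mem by simp
        then show ?thesis by (simp add: perm_graph_mem)
      next
        case False
        then show ?thesis using p permutes_not_in by (metis mem_Collect_eq)
      qed
    qed
  qed
  show "perm_graph r ` {\<pi>. \<pi> permutes {1..r}} = H"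
  proof (intro equalityI subsetI)
    fix s assume "s \<in> perm_graph r ` {\<pi>. \<pi> permutes {1..r}}"
    then obtain \<pi> where \<pi>: "\<pi> permutes {1..r}" "s = perm_graph r \<pi>" by blast
    note mem = perm_graph_mem[of _ _ r \<pi>, folded \<pi>(2)]
    have D: "Domain s = {1..r}" by (intro equalityI subsetI) (auto simp: mem Domain_iff simp del: atLeastAtMost_iff One_nat_def)
    have R: "Range s = {1..r}"
    proof -
      have "Range s = \<pi> ` {1..r}" by (intro equalityI subsetI) (auto simp: mem Range_iff simp del: atLeastAtMost_iff One_nat_def)
      then show ?thesis by (simp only: permutes_image[OF \<pi>(1)])
    qed
    have "s \<subseteq> Domain s \<times> Range s" by auto
    then have "s \<subseteq> {1..n} \<times> {1..n}" unfolding D R using Sigma_mono[OF X X] by (rule order_trans)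
    moreover have "single_valued s" unfolding single_valued_def mem by simp
    moreover have "single_valued (s\<inverse>)"
      unfolding single_valued_def converse_iff mem using permutes_inj[OF \<pi>(1)] by (auto dest: injD)
    ultimately have "s \<in> pperms n" unfolding pperms_def by blast
    then show "s \<in> H" using D R unfolding H_iff by blast
  next
    fix s assume s: "s \<in> H"
    then have sS: "s \<in> pperms n" and D: "Domain s = {1..r}" and R: "Range s = {1..r}"
      unfolding H_iff by blast+
    define \<pi> where "\<pi> x = (if x \<in> {1..r} then THE y. (x, y) \<in> s else x)" for x
    have \<pi>: "\<pi> x = y" if "(x, y) \<in> s" for x y
    proof -
      have "x \<in> {1..r}" using that D by blast
      moreover have "(THE y. (x, y) \<in> s) = y" using that S_inj[OF sS] by blast
      ultimately show ?thesis by (simp add: \<pi>_def)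
    qed
    have "s = perm_graph r \<pi>"
    proof (intro equalityI subrelI)
      fix x y assume "(x, y) \<in> s"
      then show "(x, y) \<in> perm_graph r \<pi>" unfolding perm_graph_mem using \<pi>[of x y] D by blast
    next
      fix x y assume "(x, y) \<in> perm_graph r \<pi>"
      then have x: "x \<in> {1..r}" "y = \<pi> x" unfolding perm_graph_mem by auto
      then obtain z where "(x, z) \<in> s" using D by blast
      then show "(x, y) \<in> s" using \<pi>[of x z] x(2) by simp
    qed
    moreover have "\<pi> permutes {1..r}"
    proof (rule bij_imp_permutes)
      show "bij_betw \<pi> {1..r} {1..r}"
        unfolding bij_betw_def
      proof
        show "inj_on \<pi> {1..r}"
        proof (rule inj_onI)
          fix x y assume xy: "x \<in> {1..r}" "y \<in> {1..r}" "\<pi> x = \<pi> y"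
          obtain a b where ab: "(x, a) \<in> s" "(y, b) \<in> s" using xy(1,2) unfolding D[symmetric] by blast
          then have "a = b" using \<pi>[OF ab(1)] \<pi>[OF ab(2)] xy(3) by simp
          then show "x = y" using S_inj'[OF sS ab(1)] ab(2) by simp
        qed
        show "\<pi> ` {1..r} = {1..r}"
        proof (intro equalityI subsetI)
          fix y assume "y \<in> \<pi> ` {1..r}"
          then obtain x where x: "x \<in> {1..r}" "y = \<pi> x" by blast
          obtain a where "(x, a) \<in> s" using x(1) unfolding D[symmetric] by blast
          then show "y \<in> {1..r}" using \<pi>[of x a] x(2) unfolding R[symmetric] by blast
        next
          fix y assume "y \<in> {1..r}"
          then obtain x where "(x, y) \<in> s" unfolding R[symmetric] by blast
          then show "y \<in> \<pi> ` {1..r}" using \<pi>[of x y] D by blast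
        qed
      qed
      show "\<pi> x = x" if "x \<notin> {1..r}" for x unfolding \<pi>_def by (rule if_not_P[OF that])
    qed
    ultimately show "s \<in> perm_graph r ` {\<pi>. \<pi> permutes {1..r}}" by blast
  qed
qed

text \<open>
  The map \<open>perm_graph r\<close> reverses products, but it preserves inverses, and the norm of a character only
  involves its values at an element and at its inverse.
\<close>

lemma specht_character_irreducible:
  fixes \<phi> :: "nat rel \<Rightarrow> 'k::{alg_closed_field, field_char_0} mat"
  assumes r: "r \<le> n" and shp: "partition_of r shp"
    and rep: "mat_rep (rel_monoid (max_subgroup (pperms n) (Id_on {1..r})) (Id_on {1..r})) d \<phi>"
    and char: "\<And>\<pi>. \<pi> permutes {1..r} \<Longrightarrow> character \<phi> (perm_graph r \<pi>) = specht_character shp \<pi>"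
  shows "irreducible_rep (rel_monoid (max_subgroup (pperms n) (Id_on {1..r})) (Id_on {1..r})) d \<phi>"
    and "d = card (standard_tableaux shp)"
    and "card (max_subgroup (pperms n) (Id_on {1..r})) = fact r"
proof -
  have X: "{1..r} \<subseteq> {1..n}" using r by auto
  interpret maximal_subgroup n "pperms n" "{1..r}"
    by unfold_locales (use inverse_subsemigroup_pperms X in auto)
  have sum_shp: "sum_list shp = r" using shp by (simp add: partition_of_def)
  interpret young_diagram shp by unfold_locales (use shp in \<open>simp add: partition_of_def\<close>)
  note bij = perm_graph_bij[OF r]
  have "card H = card {\<pi>. \<pi> permutes {1..r}}" by (rule bij_betw_same_card[OF bij, symmetric])
  also have "\<dots> = fact r" by (rule card_permutations) auto
  finally show cardH: "card H = fact r" .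
  have "(\<Sum>g\<in>carrier G. character \<phi> g * character \<phi> (m_inv G g)) = (\<Sum>g\<in>H. character \<phi> g * character \<phi> (g\<inverse>))"
    by (rule sum.cong) (simp_all add: inv_G del: One_nat_def)
  also have "\<dots> = (\<Sum>\<pi>\<in>{\<pi>. \<pi> permutes {1..r}}. character \<phi> (perm_graph r \<pi>) * character \<phi> ((perm_graph r \<pi>)\<inverse>))"
    by (rule sum.reindex_bij_betw[OF bij, symmetric])
  also have "\<dots> = (\<Sum>\<pi>\<in>{\<pi>. \<pi> permutes {1..r}}. specht_character shp \<pi> * specht_character shp (inv \<pi>))"
  proof (rule sum.cong[OF refl])
    fix \<pi> assume "\<pi> \<in> {\<pi>. \<pi> permutes {1..r}}"
    then have p: "\<pi> permutes {1..r}" by simp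
    show "character \<phi> (perm_graph r \<pi>) * character \<phi> ((perm_graph r \<pi>)\<inverse>) =
      specht_character shp \<pi> * specht_character shp (inv \<pi>)"
      unfolding perm_graph_inverse[OF p, symmetric] char[OF p] char[OF permutes_inv[OF p]] ..
  qed
  also have "\<dots> = of_nat (card (carrier G))"
    using specht_orthogonality[where 'k = 'k] cardH unfolding sum_shp by simp
  finally show "irreducible_rep G d \<phi>"
    by (intro irreducible_of_character_norm[OF group_G _ rep]) (simp_all add: finite_H del: One_nat_def)
  have "(of_nat d :: 'k) = character \<phi> (perm_graph r id)"
    using rep_G(3)[OF rep] by (simp add: perm_graph_id character_def del: One_nat_def)
  also have "\<dots> = of_nat (card (standard_tableaux shp))"
    unfolding char[OF permutes_id] specht_character_id dim_specht ..
  finally show "d = card (standard_tableaux shp)" unfolding of_nat_eq_iff .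
qed

theorem corollary6p5:
  fixes n p :: nat
  assumes "p \<ge> 1"
  shows
    "(\<forall>S X d (\<phi> :: nat rel \<Rightarrow> 'k::{alg_closed_field, field_char_0} mat) fs pf.
        inverse_subsemigroup n S \<and> idems S = idems (pperms n) \<and> X \<subseteq> {1..n} \<and>
        irreducible_rep (rel_monoid (max_subgroup S (Id_on X)) (Id_on X)) d \<phi> \<and>
        transversal S (Id_on X) fs pf \<longrightarrow>
        (\<exists>m. has_multiplicity (rel_monoid S (Id_on {1..n}))
               (length fs * d) (induced_rep d \<phi> fs pf)
               (n ^ p) (tensor_power p (rook_rep n)) m \<and>
             of_nat m = pairing S (Id_on X) (character \<phi>)
                          (character (tensor_power p (rook_rep n)))) \<and>
        pairing S (Id_on X) (character \<phi>) (character (tensor_power p (rook_rep n))) =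
          1 / of_nat (card (max_subgroup S (Id_on X))) *
            of_nat d * fact (card X) * of_nat (Stirling p (card X))) \<and>
     (\<forall>r shp d (\<phi> :: nat rel \<Rightarrow> 'k mat) fs pf.
        r \<le> n \<and> partition_of r shp \<and>
        mat_rep (rel_monoid (max_subgroup (pperms n) (Id_on {1..r})) (Id_on {1..r})) d \<phi> \<and>
        (\<forall>\<pi>. \<pi> permutes {1..r} \<longrightarrow> character \<phi> (perm_graph r \<pi>) = specht_character shp \<pi>) \<and>
        transversal (pperms n) (Id_on {1..r}) fs pf \<longrightarrow>
        has_multiplicity (rel_monoid (pperms n) (Id_on {1..n}))
          (length fs * d) (induced_rep d \<phi> fs pf)
          (n ^ p) (tensor_power p (rook_rep n))
          (card (standard_tableaux shp) * Stirling p r))"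
proof -
  have general: "(\<exists>m. has_multiplicity (rel_monoid S (Id_on {1..n}))
               (length fs * d) (induced_rep d \<phi> fs pf)
               (n ^ p) (tensor_power p (rook_rep n)) m \<and>
             of_nat m = pairing S (Id_on X) (character \<phi>)
                          (character (tensor_power p (rook_rep n)))) \<and>
        pairing S (Id_on X) (character \<phi>) (character (tensor_power p (rook_rep n))) =
          1 / of_nat (card (max_subgroup S (Id_on X))) *
            of_nat d * fact (card X) * of_nat (Stirling p (card X))"
    if "inverse_subsemigroup n S" "idems S = idems (pperms n)" "X \<subseteq> {1..n}"
      "irreducible_rep (rel_monoid (max_subgroup S (Id_on X)) (Id_on X)) d \<phi>" "transversal S (Id_on X) fs pf"
    for S X d fs pf and \<phi> :: "nat rel \<Rightarrow> 'k mat"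
  proof -
    interpret induced n S X d \<phi> fs pf by unfold_locales (use that in auto)
    show ?thesis using multiplicity_tensor_power[of p] pairing_tensor_power[OF rep_\<phi>, of p] by blast
  qed
  have special: "has_multiplicity (rel_monoid (pperms n) (Id_on {1..n}))
          (length fs * d) (induced_rep d \<phi> fs pf)
          (n ^ p) (tensor_power p (rook_rep n))
          (card (standard_tableaux shp) * Stirling p r)"
    if r: "r \<le> n" and shp: "partition_of r shp"
      and rep: "mat_rep (rel_monoid (max_subgroup (pperms n) (Id_on {1..r})) (Id_on {1..r})) d \<phi>"
      and char: "\<forall>\<pi>. \<pi> permutes {1..r} \<longrightarrow> character \<phi> (perm_graph r \<pi>) = specht_character shp \<pi>"
      and tr: "transversal (pperms n) (Id_on {1..r}) fs pf"
    for r shp d fs pf and \<phi> :: "nat rel \<Rightarrow> 'k mat"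
  proof -
    note \<phi> = specht_character_irreducible[OF r shp rep char[rule_format]]
    have X: "{1..r} \<subseteq> {1..n}" using r by auto
    note gen = general[OF inverse_subsemigroup_pperms refl X \<phi>(1) tr]
    then obtain m where m: "has_multiplicity (rel_monoid (pperms n) (Id_on {1..n}))
          (length fs * d) (induced_rep d \<phi> fs pf) (n ^ p) (tensor_power p (rook_rep n)) m"
        "of_nat m = pairing (pperms n) (Id_on {1..r}) (character \<phi>) (character (tensor_power p (rook_rep n)))"
      by blast
    have "(of_nat m :: 'k) = 1 / fact r * of_nat d * fact r * of_nat (Stirling p r)"
      using m(2) gen \<phi>(3) by simp
    then have "(of_nat m :: 'k) = of_nat (d * Stirling p r)" by simp
    then have "m = d * Stirling p r" unfolding of_nat_eq_iff .
    then have "m = card (standard_tableaux shp) * Stirling p r" using \<phi>(2) by simp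
    with m(1) show ?thesis by blast
  qed
  show ?thesis using general special by blast
qed

end
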